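(* Let $Q\in L(U)$ be a nonnegative and symmetric trace class operator with eigenvalues $\{\eta_j : j\in\mathcal J\}$, and let $(W_t)_{t\in[0,T]}$ be a $U$-valued $Q$-Wiener process. Let $\alpha\in(0,\infty)$, let $\Phi\in L(U,H)_{U_0}$ satisfy $\|\Phi Q^{-\alpha}\|_{L_{HS}(U_0,H)}<C$ for some $C>0$, and let $\Psi\in L(H,L(Q^{-\alpha}U,H)_{U_0})$. Then there is a constant $C_Q>0$ such that for all $h>0$ and $t$ with $t,t+h\in[0,T]$, all $D,K\in\mathbb N$, and all $\mathcal J_K\subset\mathcal J$ with $|\mathcal J_K|=K$, $$\bigg(\mathrm E\bigg[\Big\|\int_t^{t+h}\Psi\Big(\int_t^s\Phi\,\mathrm dW_r\Big)\mathrm dW_s-\sum_{i,j\in\mathcal J_K}\bar I^{Q,(D)}_{(i,j)}(h)\,\Psi\big(\Phi\tilde e_i,\tilde e_j\big)\Big\|_H^2\bigg]\bigg)^{1/2}\le C_Q\,h\Big(\sup_{j\in\mathcal J\setminus\mathcal J_K}\eta_j\Big)^{\alpha}+C_Q\frac{h}{\pi\sqrt D},$$ where $\bar I^{Q,(D)}_{(i,j)}(h)$ denotes the Algorithm 1 approximation (defined in the context) of the iterated integral $\int_t^{t+h}\int_t^s\langle\mathrm dW_r,\tilde e_i\rangle_U\langle\mathrm dW_s,\tilde e_j\rangle_U$.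
   Context: **Setting.** $H,U$ are separable real Hilbert spaces, $T>0$ is fixed, $(\Omega,\mathcal F,P,(\mathcal F_t)_{t\ge0})$ is a filtered probability space and $W$ is a $Q$-Wiener process with respect to $(\mathcal F_t)$. $Q$ has eigenvalues $\eta_j\ge0$ and eigenvectors $\tilde e_j$, $j\in\mathcal J$ ($\mathcal J$ countable), the $\tilde e_j$ forming an orthonormal basis of $U$; $W_t=\sum_{j\in\mathcal J}\sqrt{\eta_j}\,\beta^j_t\,\tilde e_j$ with independent real Brownian motions $\beta^j$. $U_0:=Q^{1/2}U$ (with its usual Hilbert structure), $L_{HS}(U_0,H)$ is the space of Hilbert-Schmidt operators, and $L(U,H)_{U_0}:=\{S|_{U_0}: S\in L(U,H)\}$. Negative powers $Q^{-\alpha}$ are pseudo-inverses of $Q^\alpha$; thus $\|\Phi Q^{-\alpha}\|^2_{L_{HS}(U_0,H)}=\sum_{j:\eta_j>0}\eta_j\|\Phi Q^{-\alpha}\tilde e_j\|_H^2$. The condition $\Psi\in L(H,L(Q^{-\alpha}U,H)_{U_0})$ means that $\Psi$ is a bounded linear map from $H$ into (restrictions to $U_0$ of) bounded linear operators from $Q^{-\alpha}U$ to $H$, where $Q^{-\alpha}U$ carries the norm $v\mapsto\|Q^{\alpha}v\|_U$; in particular $\|\Psi(x)Q^{-\alpha}u\|_H\le c\|x\|_H\|u\|_U$ for some $c$. Notation: $\Psi(x,u):=\Psi(x)u$. For finite $\mathcal J_K\subset\mathcal J$ with $|\mathcal J_K|=K$ it is assumed that $\eta_j\ne0$ for $j\in\mathcal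 J_K$ and, after relabelling, $\mathcal J_K=\{1,\dots,K\}$. The supremum over the empty set is $0$. The constant $C_Q$ may depend on $Q,\Phi,\Psi,\alpha,T$ but not on $h,t,D,K,\mathcal J_K$. **Algorithm 1.** Fix $t,h$. For $j\in\mathcal J_K$ and $s\in[0,h]$ let $w^j_s:=\langle W_{t+s}-W_t,\tilde e_j\rangle_U$, $\Delta w^j_h:=w^j_h$, and for $r\in\mathbb N$ $$a^j_r=\frac2h\int_0^h\Big(w^j_u-\frac uh w^j_h\Big)\cos\Big(\frac{2r\pi u}{h}\Big)\mathrm du,\qquad b^j_r=\frac2h\int_0^h\Big(w^j_u-\frac uh w^j_h\Big)\sin\Big(\frac{2r\pi u}{h}\Big)\mathrm du .$$ These are independent of each other and of the $\Delta w_h^j$, with $a^j_r,b^j_r\sim N(0,\eta_jh/(2\pi^2r^2))$. For $D\in\mathbb N$ the truncated Lévy area is $$A^{Q,(D)}_{(i,j)}(h)=\pi\sum_{r=1}^{D}r\Big(a^i_r\big(b^j_r-\tfrac1{\pi r}\Delta w^j_h\big)-\big(b^i_r-\tfrac1{\pi r}\Delta w^i_h\big)a^j_r\Big),$$ and the approximation is $$\bar I^{Q,(D)}_{(i,j)}(h)=\frac{\Delta w^i_h\,\Delta w^j_h-h\,\eta_i\,\delta_{ij}}{2}+A^{Q,(D)}_{(i,j)}(h),\qquad i,j\in\mathcal J_K .$$ *)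

theory Defs
  imports "HOL-Probability.Probability"
begin

section \<open>Operators on the Hilbert space \<open>U\<close>\<close>

definition symmetric_op :: "('u::real_inner \<Rightarrow>\<^sub>L 'u) \<Rightarrow> bool" where
  "symmetric_op Q \<longleftrightarrow> (\<forall>x y. blinfun_apply Q x \<bullet> y = x \<bullet> blinfun_apply Q y)"

definition nonneg_op :: "('u::real_inner \<Rightarrow>\<^sub>L 'u) \<Rightarrow> bool" where
  "nonneg_op Q \<longleftrightarrow> (\<forall>x. 0 \<le> blinfun_apply Q x \<bullet> x)"

text \<open>Trace class in the sense of nuclear operators; for operators on a Hilbert space the two
  notions coincide.\<close>

definition trace_class_op :: "('u::real_inner \<Rightarrow>\<^sub>L 'u) \<Rightarrow> bool" where
  "trace_class_op Q \<longleftrightarrow> (\<exists>a b :: nat \<Rightarrow> 'u. summable (\<lambda>n. norm (a n) * norm (b n)) \<and>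
     (\<forall>x. (\<lambda>n. (b n \<bullet> x) *\<^sub>R a n) sums blinfun_apply Q x))"

definition orthonormal_basis :: "'j set \<Rightarrow> ('j \<Rightarrow> 'u::real_inner) \<Rightarrow> bool" where
  "orthonormal_basis J e \<longleftrightarrow>
     (\<forall>i\<in>J. \<forall>j\<in>J. e i \<bullet> e j = (if i = j then 1 else 0)) \<and> closure (span (e ` J)) = UNIV"

definition eigenbasis ::
  "('u::real_inner \<Rightarrow>\<^sub>L 'u) \<Rightarrow> 'j set \<Rightarrow> ('j \<Rightarrow> real) \<Rightarrow> ('j \<Rightarrow> 'u) \<Rightarrow> bool" where
  "eigenbasis Q J \<eta> e \<longleftrightarrow>
     countable J \<and> orthonormal_basis J e \<and> (\<forall>j\<in>J. blinfun_apply Q (e j) = \<eta> j *\<^sub>R e j)"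

text \<open>\<open>Qpow J \<eta> e a\<close> is \<open>Q\<close> raised to the power \<open>a > 0\<close>, by the spectral representation of \<open>Q\<close>.
  Negative powers are \<open>Qneg\<close>, the pseudo-inverse, which is meaningful only on the range
  of the corresponding positive power.\<close>

definition Qpow ::
  "'j set \<Rightarrow> ('j \<Rightarrow> real) \<Rightarrow> ('j \<Rightarrow> 'u::real_inner) \<Rightarrow> real \<Rightarrow> 'u \<Rightarrow> 'u" where
  "Qpow J \<eta> e a u = (\<Sum>\<^sub>\<infinity>j\<in>J. (\<eta> j powr a * (u \<bullet> e j)) *\<^sub>R e j)"

definition pseudo_inverse :: "('u::real_inner \<Rightarrow> 'u) \<Rightarrow> 'u \<Rightarrow> 'u" where
  "pseudo_inverse A y = (THE x. A x = y \<and> (\<forall>z. A z = 0 \<longrightarrow> x \<bullet> z = 0))"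

definition Qneg ::
  "'j set \<Rightarrow> ('j \<Rightarrow> real) \<Rightarrow> ('j \<Rightarrow> 'u::real_inner) \<Rightarrow> real \<Rightarrow> 'u \<Rightarrow> 'u" where
  "Qneg J \<eta> e a = pseudo_inverse (Qpow J \<eta> e a)"

definition U0 :: "'j set \<Rightarrow> ('j \<Rightarrow> real) \<Rightarrow> ('j \<Rightarrow> 'u::real_inner) \<Rightarrow> 'u set" where
  "U0 J \<eta> e = range (Qpow J \<eta> e (1/2))"

definition U0_norm :: "'j set \<Rightarrow> ('j \<Rightarrow> real) \<Rightarrow> ('j \<Rightarrow> 'u::real_inner) \<Rightarrow> 'u \<Rightarrow> real" where
  "U0_norm J \<eta> e u = norm (Qneg J \<eta> e (1/2) u)"

definition linear_on_subspace :: "'u::real_vector set \<Rightarrow> ('u \<Rightarrow> 'h::real_vector) \<Rightarrow> bool" where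
  "linear_on_subspace V S \<longleftrightarrow>
     (\<forall>x\<in>V. \<forall>y\<in>V. S (x + y) = S x + S y) \<and> (\<forall>r. \<forall>x\<in>V. S (r *\<^sub>R x) = r *\<^sub>R S x)"

text \<open>Operators on \<open>U0\<close> are represented by functions on the whole type \<open>'u\<close> of which only the
  values on \<open>U0\<close> are relevant. The squared Hilbert-Schmidt norm is computed in the orthonormal
  basis of \<open>U0\<close> given by \<open>sqrt (\<eta> j) *\<^sub>R e j\<close>, \<open>\<eta> j > 0\<close>.\<close>

definition HS_norm_sq ::
  "'j set \<Rightarrow> ('j \<Rightarrow> real) \<Rightarrow> ('j \<Rightarrow> 'u::real_inner) \<Rightarrow> ('u \<Rightarrow> 'h::real_normed_vector) \<Rightarrow> ennreal" where
  "HS_norm_sq J \<eta> e A =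
     (\<Sum>\<^sub>\<infinity>j\<in>{j\<in>J. 0 < \<eta> j}. ennreal ((norm (A (sqrt (\<eta> j) *\<^sub>R e j)))\<^sup>2))"

definition HS_op ::
  "'j set \<Rightarrow> ('j \<Rightarrow> real) \<Rightarrow> ('j \<Rightarrow> 'u::real_inner) \<Rightarrow> ('u \<Rightarrow> 'h::real_normed_vector) \<Rightarrow> bool" where
  "HS_op J \<eta> e A \<longleftrightarrow> linear_on_subspace (U0 J \<eta> e) A \<and>
     (\<exists>c. \<forall>u\<in>U0 J \<eta> e. norm (A u) \<le> c * U0_norm J \<eta> e u) \<and> HS_norm_sq J \<eta> e A < \<infinity>"

text \<open>\<open>\<Phi> \<in> L(U,H)\<close>, restricted to \<open>U0\<close>.\<close>

definition L_UH_U0 ::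
  "'j set \<Rightarrow> ('j \<Rightarrow> real) \<Rightarrow> ('j \<Rightarrow> 'u::real_inner) \<Rightarrow> ('u \<Rightarrow> 'h::real_normed_vector) \<Rightarrow> bool" where
  "L_UH_U0 J \<eta> e \<Phi> \<longleftrightarrow> (\<exists>S :: 'u \<Rightarrow>\<^sub>L 'h. \<forall>u\<in>U0 J \<eta> e. \<Phi> u = blinfun_apply S u)"

text \<open>The image of the unbounded operator \<open>Qneg J \<eta> e a\<close> on its domain; it carries the norm
  \<open>\<lambda>v. norm (Qpow J \<eta> e a v)\<close>.\<close>

definition Qneg_space ::
  "'j set \<Rightarrow> ('j \<Rightarrow> real) \<Rightarrow> ('j \<Rightarrow> 'u::real_inner) \<Rightarrow> real \<Rightarrow> 'u set" where
  "Qneg_space J \<eta> e a = Qneg J \<eta> e a ` range (Qpow J \<eta> e a)"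

definition bounded_op_Qneg_space ::
  "'j set \<Rightarrow> ('j \<Rightarrow> real) \<Rightarrow> ('j \<Rightarrow> 'u::real_inner) \<Rightarrow> real \<Rightarrow> real
     \<Rightarrow> ('u \<Rightarrow> 'h::real_normed_vector) \<Rightarrow> bool" where
  "bounded_op_Qneg_space J \<eta> e a c S \<longleftrightarrow> linear_on_subspace (Qneg_space J \<eta> e a) S \<and>
     (\<forall>v\<in>Qneg_space J \<eta> e a. norm (S v) \<le> c * norm (Qpow J \<eta> e a v))"

text \<open>\<open>\<Psi>\<close> is a bounded linear map from \<open>H\<close> into the restrictions to \<open>U0\<close> of the bounded operators
  from \<open>Qneg_space J \<eta> e a\<close> to \<open>H\<close>.\<close>

definition L_H_L_Qneg_U0 ::
  "'j set \<Rightarrow> ('j \<Rightarrow> real) \<Rightarrow> ('j \<Rightarrow> 'u::real_inner) \<Rightarrow> real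
     \<Rightarrow> ('h::real_normed_vector \<Rightarrow> 'u \<Rightarrow> 'h) \<Rightarrow> bool" where
  "L_H_L_Qneg_U0 J \<eta> e a \<Psi> \<longleftrightarrow>
     (\<forall>u\<in>U0 J \<eta> e. linear (\<lambda>x. \<Psi> x u)) \<and>
     (\<exists>c. \<forall>x. \<exists>S. bounded_op_Qneg_space J \<eta> e a (c * norm x) S \<and>
        (\<forall>u\<in>U0 J \<eta> e. \<Psi> x u = S u))"


section \<open>\<open>Q\<close>-Wiener processes\<close>

definition filtered :: "'w measure \<Rightarrow> (real \<Rightarrow> 'w measure) \<Rightarrow> bool" where
  "filtered M F \<longleftrightarrow> (\<forall>t\<ge>0. subalgebra M (F t)) \<and>
     (\<forall>s t. 0 \<le> s \<longrightarrow> s \<le> t \<longrightarrow> sets (F s) \<subseteq> sets (F t))"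

definition normal_law :: "real \<Rightarrow> real \<Rightarrow> real measure" where
  "normal_law m v =
     (if v = 0 then return borel m else density lborel (\<lambda>x. ennreal (normal_density m (sqrt v) x)))"

definition Q_Wiener_process ::
  "'w measure \<Rightarrow> (real \<Rightarrow> 'w measure) \<Rightarrow> real \<Rightarrow>
     ('u::{real_inner, banach, second_countable_topology} \<Rightarrow>\<^sub>L 'u) \<Rightarrow> (real \<Rightarrow> 'w \<Rightarrow> 'u) \<Rightarrow> bool" where
  "Q_Wiener_process M F T Q W \<longleftrightarrow>
     (AE \<omega> in M. W 0 \<omega> = 0) \<and>
     (AE \<omega> in M. continuous_on {0..T} (\<lambda>t. W t \<omega>)) \<and>
     (\<forall>t\<in>{0..T}. W t \<in> borel_measurable (F t)) \<and>
     (\<forall>s t. 0 \<le> s \<longrightarrow> s \<le> t \<longrightarrow> t \<le> T \<longrightarrow>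
        prob_space.indep_set M (sets (F s))
          {(\<lambda>\<omega>. W t \<omega> - W s \<omega>) -` B \<inter> space M | B. B \<in> sets borel} \<and>
        (\<forall>u. distr M borel (\<lambda>\<omega>. (W t \<omega> - W s \<omega>) \<bullet> u)
               = normal_law 0 ((t - s) * (blinfun_apply Q u \<bullet> u))))"


section \<open>The Ito integral\<close>

text \<open>Taking values in \<open>[0,\<infinity>]\<close> this is meaningful without integrability assumptions, and it is
  invariant under almost sure equality even where no measurability is known.\<close>

definition mean_square :: "'w measure \<Rightarrow> ('w \<Rightarrow> 'h::real_normed_vector) \<Rightarrow> ennreal" where
  "mean_square M X = (\<integral>\<^sup>+\<omega>. ennreal ((norm (X \<omega>))\<^sup>2) \<partial>M)"

text \<open>\<open>\<tau> 0 \<le> \<dots> \<le> \<tau> k\<close> is a partition of \<open>[a,b]\<close>; on the \<open>m\<close>-th interval the elementary process takes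
  the value \<open>S m\<close>, which is known at time \<open>\<tau> m\<close> and takes finitely many values in \<open>L(U,H)\<close>.\<close>

definition elementary ::
  "(real \<Rightarrow> 'w measure) \<Rightarrow> real \<Rightarrow> real \<Rightarrow> (nat \<Rightarrow> real) \<Rightarrow> nat
     \<Rightarrow> (nat \<Rightarrow> 'w \<Rightarrow> ('u::real_normed_vector \<Rightarrow>\<^sub>L 'h::real_normed_vector)) \<Rightarrow> bool" where
  "elementary F a b \<tau> k S \<longleftrightarrow> \<tau> 0 = a \<and> \<tau> k = b \<and>
     (\<forall>m<k. \<tau> m \<le> \<tau> (Suc m)) \<and> (\<forall>m<k. simple_function (F (\<tau> m)) (S m))"

definition elementary_process ::
  "(nat \<Rightarrow> real) \<Rightarrow> nat \<Rightarrow> (nat \<Rightarrow> 'w \<Rightarrow> ('u::real_normed_vector \<Rightarrow>\<^sub>L 'h::real_normed_vector))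
     \<Rightarrow> real \<Rightarrow> 'w \<Rightarrow> 'u \<Rightarrow> 'h" where
  "elementary_process \<tau> k S s \<omega> u =
     (\<Sum>m<k. indicat_real {\<tau> m<..\<tau> (Suc m)} s *\<^sub>R blinfun_apply (S m \<omega>) u)"

definition elementary_integral ::
  "(real \<Rightarrow> 'w \<Rightarrow> 'u) \<Rightarrow> (nat \<Rightarrow> real) \<Rightarrow> nat
     \<Rightarrow> (nat \<Rightarrow> 'w \<Rightarrow> ('u::real_normed_vector \<Rightarrow>\<^sub>L 'h::real_normed_vector)) \<Rightarrow> 'w \<Rightarrow> 'h" where
  "elementary_integral W \<tau> k S \<omega> =
     (\<Sum>m<k. blinfun_apply (S m \<omega>) (W (\<tau> (Suc m)) \<omega> - W (\<tau> m) \<omega>))"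

definition predictable_algebra ::
  "'w measure \<Rightarrow> (real \<Rightarrow> 'w measure) \<Rightarrow> real \<Rightarrow> real \<Rightarrow> (real \<times> 'w) measure" where
  "predictable_algebra M F a b = sigma ({a..b} \<times> space M)
     ({{s<..t} \<times> A | s t A. a \<le> s \<and> s \<le> t \<and> t \<le> b \<and> A \<in> sets (F s)} \<union>
      {{a} \<times> A | A. A \<in> sets (F a)})"

definition predictable_HS_process ::
  "'w measure \<Rightarrow> (real \<Rightarrow> 'w measure) \<Rightarrow> 'j set \<Rightarrow> ('j \<Rightarrow> real) \<Rightarrow> ('j \<Rightarrow> 'u::real_inner)
     \<Rightarrow> real \<Rightarrow> real
     \<Rightarrow> (real \<Rightarrow> 'w \<Rightarrow> 'u \<Rightarrow> 'h::{real_normed_vector, second_countable_topology}) \<Rightarrow> bool" where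
  "predictable_HS_process M F J \<eta> e a b Y \<longleftrightarrow>
     (\<forall>s\<in>{a..b}. \<forall>\<omega>\<in>space M. HS_op J \<eta> e (Y s \<omega>)) \<and>
     (\<forall>u\<in>U0 J \<eta> e. (\<lambda>(s, \<omega>). Y s \<omega> u) \<in> borel_measurable (predictable_algebra M F a b))"

text \<open>\<open>I\<close> is (a version of) the integral of \<open>X\<close> over \<open>[a,b]\<close> against \<open>W\<close>: the mean square limit of
  the integrals of elementary processes that approximate \<open>X\<close>. The integrand \<open>X\<close> is only given
  up to modification (in a nested integral \<open>X s\<close> is itself determined only almost surely for
  each \<open>s\<close>), so the approximation is stated for a predictable modification \<open>Y\<close> of \<open>X\<close>.\<close>

definition is_ito_integral ::
  "'w measure \<Rightarrow> (real \<Rightarrow> 'w measure) \<Rightarrow> 'j set \<Rightarrow> ('j \<Rightarrow> real) \<Rightarrow> ('j \<Rightarrow> 'u)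
     \<Rightarrow> (real \<Rightarrow> 'w \<Rightarrow> 'u::real_inner) \<Rightarrow> real \<Rightarrow> real
     \<Rightarrow> (real \<Rightarrow> 'w \<Rightarrow> 'u \<Rightarrow> 'h::{real_normed_vector, second_countable_topology})
     \<Rightarrow> ('w \<Rightarrow> 'h) \<Rightarrow> bool" where
  "is_ito_integral M F J \<eta> e W a b X I \<longleftrightarrow> I \<in> borel_measurable M \<and>
     (\<exists>Y. predictable_HS_process M F J \<eta> e a b Y \<and>
        (\<forall>s\<in>{a..b}. AE \<omega> in M. \<forall>u\<in>U0 J \<eta> e. X s \<omega> u = Y s \<omega> u) \<and>
        (\<exists>\<tau> k S. (\<forall>n::nat. elementary F a b (\<tau> n) (k n) (S n)) \<and>
           (\<lambda>n. \<integral>\<^sup>+\<omega>. (\<integral>\<^sup>+s\<in>{a..b}.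
               HS_norm_sq J \<eta> e (\<lambda>u. Y s \<omega> u - elementary_process (\<tau> n) (k n) (S n) s \<omega> u)
               \<partial>lborel) \<partial>M) \<longlonglongrightarrow> 0 \<and>
           (\<lambda>n. mean_square M (\<lambda>\<omega>. I \<omega> - elementary_integral W (\<tau> n) (k n) (S n) \<omega>))
             \<longlonglongrightarrow> 0))"

definition ito_integral ::
  "'w measure \<Rightarrow> (real \<Rightarrow> 'w measure) \<Rightarrow> 'j set \<Rightarrow> ('j \<Rightarrow> real) \<Rightarrow> ('j \<Rightarrow> 'u)
     \<Rightarrow> (real \<Rightarrow> 'w \<Rightarrow> 'u::real_inner) \<Rightarrow> real \<Rightarrow> real
     \<Rightarrow> (real \<Rightarrow> 'w \<Rightarrow> 'u \<Rightarrow> 'h::{real_normed_vector, second_countable_topology})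
     \<Rightarrow> 'w \<Rightarrow> 'h" where
  "ito_integral M F J \<eta> e W a b X = (SOME I. is_ito_integral M F J \<eta> e W a b X I)"


section \<open>The truncated Fourier approximation of the iterated integrals\<close>

definition wincr ::
  "(real \<Rightarrow> 'w \<Rightarrow> 'u::real_inner) \<Rightarrow> ('j \<Rightarrow> 'u) \<Rightarrow> real \<Rightarrow> 'j \<Rightarrow> real \<Rightarrow> 'w \<Rightarrow> real" where
  "wincr W e t j s \<omega> = (W (t + s) \<omega> - W t \<omega>) \<bullet> e j"

definition coeff_a ::
  "(real \<Rightarrow> 'w \<Rightarrow> 'u::real_inner) \<Rightarrow> ('j \<Rightarrow> 'u) \<Rightarrow> real \<Rightarrow> real \<Rightarrow> 'j \<Rightarrow> nat \<Rightarrow> 'w \<Rightarrow> real" where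
  "coeff_a W e t h j r \<omega> = 2 / h * (LINT u:{0..h}|lborel.
     (wincr W e t j u \<omega> - u / h * wincr W e t j h \<omega>) * cos (2 * real r * pi * u / h))"

definition coeff_b ::
  "(real \<Rightarrow> 'w \<Rightarrow> 'u::real_inner) \<Rightarrow> ('j \<Rightarrow> 'u) \<Rightarrow> real \<Rightarrow> real \<Rightarrow> 'j \<Rightarrow> nat \<Rightarrow> 'w \<Rightarrow> real" where
  "coeff_b W e t h j r \<omega> = 2 / h * (LINT u:{0..h}|lborel.
     (wincr W e t j u \<omega> - u / h * wincr W e t j h \<omega>) * sin (2 * real r * pi * u / h))"

definition levy_area ::
  "(real \<Rightarrow> 'w \<Rightarrow> 'u::real_inner) \<Rightarrow> ('j \<Rightarrow> 'u) \<Rightarrow> real \<Rightarrow> real \<Rightarrow> nat \<Rightarrow> 'j \<Rightarrow> 'j \<Rightarrow> 'w \<Rightarrow> real" where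
  "levy_area W e t h D i j \<omega> = pi * (\<Sum>r=1..D. real r *
     (coeff_a W e t h i r \<omega> * (coeff_b W e t h j r \<omega> - 1 / (pi * real r) * wincr W e t j h \<omega>)
      - (coeff_b W e t h i r \<omega> - 1 / (pi * real r) * wincr W e t i h \<omega>) * coeff_a W e t h j r \<omega>))"

definition iter_int_approx ::
  "(real \<Rightarrow> 'w \<Rightarrow> 'u::real_inner) \<Rightarrow> ('j \<Rightarrow> real) \<Rightarrow> ('j \<Rightarrow> 'u) \<Rightarrow> real \<Rightarrow> real \<Rightarrow> nat
     \<Rightarrow> 'j \<Rightarrow> 'j \<Rightarrow> 'w \<Rightarrow> real" where
  "iter_int_approx W \<eta> e t h D i j \<omega> =
     (wincr W e t i h \<omega> * wincr W e t j h \<omega> - h * \<eta> i * (if i = j then 1 else 0)) / 2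
     + levy_area W e t h D i j \<omega>"

definition sup0 :: "('j \<Rightarrow> real) \<Rightarrow> 'j set \<Rightarrow> real" where
  "sup0 f A = (if A = {} then 0 else (SUP j\<in>A. f j))"

end

theory Submission
  imports Defs
begin

text \<open>
  In terms of the normalised coordinates \<open>\<beta>\<close> of \<open>W\<close>, stochastic integrals of step processes are finite sums of terms
  \<open>X * \<beta> j c d\<close> with \<open>X\<close> known at time \<open>c\<close>, and their Ito isometry is a computation of covariances. If such a sum belongs
  to a step process close to the integrand, it is close in mean square to every version of the Ito integral. Hence the
  integral is unique, and the double integral is the limit of the Riemann sums \<open>R n\<close> over the uniform grid with \<open>n\<close> cells.

  The Fourier coefficients are limits of sums of increments weighted with sines and cosines. The approximation is
  therefore the limit of quadratic forms in the increments over the same grid. The diagonal part of the latter is an error of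
  quadratic variation and vanishes in the limit. What remains of the difference from \<open>R n\<close> is a sum over pairs of distinct
  cells, of orthogonal terms, whose mean square is explicit. Pairs \<open>(i, j)\<close> outside of \<open>J\<^sub>K \<times> J\<^sub>K\<close> contribute at most a
  multiple of \<open>(h * sup \<eta> powr \<alpha>)\<^sup>2\<close> by the assumptions on \<open>\<Phi>\<close> and \<open>\<Psi>\<close>. Inside, the coefficients contain the remainder of
  the Fourier series of the sawtooth function, whose square has integral at most \<open>1 / (2 * pi\<^sup>2 * D)\<close>. Fatou's lemma
  transfers the bound to the limit.
\<close>

section \<open>Orthonormal bases\<close>

text \<open>The iterated integral is a \<open>SOME\<close> over mean square limits, and the inner
  integral is known only up to a null set for each time. Before existence is proved neither can be
  used, so the estimates are made for an arbitrary version, and a predictable modification has to be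
  constructed. A further obstacle: \<Psi> x acts only on \<open>U0\<close>, while elementary
  integrands have values in L(U,H); truncation to finitely many eigenvectors supplies rank-one
  operators there. The rate comes from a cancellation. For cells m' < m the double integral has
  coefficient 1 at (i, j); the approximation has 1/2 + K there and 1/2 - K at (j, i). Hence the
  difference carries the single factor 1/2 - K, a combination of three sawtooth remainders.
  Independence from the past, uncorrelated coordinates and moments up to order four replace the
  joint law of the Fourier coefficients. Outside \<open>J\<^sub>K\<close> the power \<alpha> is
  gained in two ways: for i from the square summability of \<Phi> Q^(-\<alpha>), for j from the norm
  of f j in Q^(-\<alpha>) U, which contains \<eta> j powr \<alpha>.\<close>

locale onb =
  fixes J :: "'j set" and e :: "'j \<Rightarrow> 'u::{real_inner, banach}"
  assumes basis: "orthonormal_basis J e"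
begin

lemma inner_basis: "i \<in> J \<Longrightarrow> j \<in> J \<Longrightarrow> e i \<bullet> e j = (if i = j then 1 else 0)"
  using basis by (auto simp: orthonormal_basis_def)

lemma inner_sum_basis:
  assumes "finite K" "K \<subseteq> J" "i \<in> J"
  shows "(\<Sum>j\<in>K. c j *\<^sub>R e j) \<bullet> e i = (if i \<in> K then c i else 0)"
proof -
  have "(\<Sum>j\<in>K. c j *\<^sub>R e j) \<bullet> e i = (\<Sum>j\<in>K. if j = i then c j else 0)"
    unfolding inner_sum_left using assms by (intro sum.cong) (auto simp: inner_basis)
  then show ?thesis using assms by simp
qed

lemma norm_sum_basis:
  assumes "finite K" "K \<subseteq> J"
  shows "(norm (\<Sum>j\<in>K. c j *\<^sub>R e j))\<^sup>2 = (\<Sum>j\<in>K. (c j)\<^sup>2)"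
proof -
  have "(norm (\<Sum>j\<in>K. c j *\<^sub>R e j))\<^sup>2 = (\<Sum>i\<in>K. (\<Sum>j\<in>K. c j *\<^sub>R e j) \<bullet> (c i *\<^sub>R e i))"
    unfolding power2_norm_eq_inner by (rule inner_sum_right)
  also have "\<dots> = (\<Sum>i\<in>K. (c i)\<^sup>2)"
  proof (rule sum.cong[OF refl])
    fix i assume "i \<in> K"
    then show "(\<Sum>j\<in>K. c j *\<^sub>R e j) \<bullet> (c i *\<^sub>R e i) = (c i)\<^sup>2"
      using inner_sum_basis[OF assms, of i c] assms(2) by (auto simp: power2_eq_square)
  qed
  finally show ?thesis .
qed

definition proj :: "'j set \<Rightarrow> 'u \<Rightarrow> 'u" where
  "proj K x = (\<Sum>j\<in>K. (x \<bullet> e j) *\<^sub>R e j)"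

lemma proj_orthogonal:
  assumes "finite K" "K \<subseteq> J" "j \<in> K"
  shows "(x - proj K x) \<bullet> e j = 0"
  using inner_sum_basis[OF assms(1,2), of j "\<lambda>j. x \<bullet> e j"] assms
  by (auto simp: proj_def inner_diff_left)

text \<open>The error \<open>x - proj K x\<close> is orthogonal to the whole span, so Pythagoras
  applies to its sum with \<open>proj K x - y\<close>.\<close>

lemma proj_best:
  assumes "finite K" "K \<subseteq> J" "y \<in> span (e ` K)"
  shows "norm (x - proj K x) \<le> norm (x - y)"
proof -
  have ort: "(x - proj K x) \<bullet> z = 0" if "z \<in> span (e ` K)" for z
    using that
  proof (induction rule: span_induct)
    case base then show ?case by (simp add: subspace_def inner_right_distrib)
  next
    case (step z) then show ?case using proj_orthogonal[OF assms(1,2)] by blast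
  qed
  have "proj K x - y \<in> span (e ` K)"
    unfolding proj_def by (intro span_diff span_sum span_scale span_base assms(3)) auto
  then have "(norm (x - y))\<^sup>2 = (norm (x - proj K x))\<^sup>2 + (norm (proj K x - y))\<^sup>2"
    using ort[of "proj K x - y"]
    by (simp add: power2_norm_eq_inner algebra_simps inner_commute)
  then have "(norm (x - proj K x))\<^sup>2 \<le> (norm (x - y))\<^sup>2" by simp
  then show ?thesis by (simp add: power2_le_iff_abs_le)
qed

lemma bessel:
  assumes "finite K" "K \<subseteq> J"
  shows "(\<Sum>j\<in>K. (x \<bullet> e j)\<^sup>2) \<le> (norm x)\<^sup>2"
proof -
  have "proj K x \<bullet> (x - proj K x) = 0"
    unfolding proj_def inner_sum_left
    using proj_orthogonal[OF assms] by (intro sum.neutral) (auto simp: inner_commute proj_def)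
  then have "(norm x)\<^sup>2 = (norm (x - proj K x))\<^sup>2 + (norm (proj K x))\<^sup>2"
    by (simp add: power2_norm_eq_inner algebra_simps inner_commute)
  moreover have "(norm (proj K x))\<^sup>2 = (\<Sum>j\<in>K. (x \<bullet> e j)\<^sup>2)"
    unfolding proj_def by (rule norm_sum_basis[OF assms])
  ultimately show ?thesis by (metis le_add_same_cancel2 zero_le_power2)
qed

text \<open>Density provides one nearby vector of the span and with it one finite set
  \<open>K\<close>. Since projections are best approximations, every larger finite set does at least
  as well, which is what convergence along finite sets asks for.\<close>

lemma proj_approx:
  assumes "0 < \<epsilon>"
  obtains K where "finite K" "K \<subseteq> J"
    "\<And>L. finite L \<Longrightarrow> K \<subseteq> L \<Longrightarrow> L \<subseteq> J \<Longrightarrow> norm (x - proj L x) < \<epsilon>"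
proof -
  have "x \<in> closure (span (e ` J))" using basis by (simp add: orthonormal_basis_def)
  then obtain y where y: "y \<in> span (e ` J)" "dist y x < \<epsilon>"
    using assms by (auto simp: closure_approachable)
  then obtain S r where S: "finite S" "S \<subseteq> e ` J" "y = (\<Sum>a\<in>S. r a *\<^sub>R a)"
    by (auto simp: span_explicit)
  then obtain K where K: "finite K" "K \<subseteq> J" "S = e ` K"
    by (meson finite_subset_image)
  have "norm (x - proj L x) < \<epsilon>" if L: "finite L" "K \<subseteq> L" "L \<subseteq> J" for L
  proof -
    have "y \<in> span (e ` L)" unfolding S(3) K(3)
      using L by (intro span_sum span_scale span_base) auto
    from proj_best[OF L(1,3) this, of x] y(2) show ?thesis
      by (simp add: dist_norm norm_minus_commute)
  qed
  with K show ?thesis using that by blast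
qed

lemma has_sum_basis: "((\<lambda>j. (x \<bullet> e j) *\<^sub>R e j) has_sum x) J"
  unfolding has_sum_def tendsto_iff eventually_finite_subsets_at_top
proof (intro allI impI)
  fix \<epsilon> :: real assume "0 < \<epsilon>"
  from proj_approx[OF this, of x] obtain K where "finite K" "K \<subseteq> J"
    "\<And>L. finite L \<Longrightarrow> K \<subseteq> L \<Longrightarrow> L \<subseteq> J \<Longrightarrow> norm (x - proj L x) < \<epsilon>" by blast
  then show "\<exists>X. finite X \<and> X \<subseteq> J \<and> (\<forall>Y. finite Y \<and> X \<subseteq> Y \<and> Y \<subseteq> J \<longrightarrow>
      dist (\<Sum>j\<in>Y. (x \<bullet> e j) *\<^sub>R e j) x < \<epsilon>)"
    by (intro exI[of _ K]) (auto simp: dist_norm norm_minus_commute proj_def)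
qed

text \<open>Reduces identities in the Hilbert space, such as those for \<open>Qpow\<close>, to
  scalar ones for each coefficient.\<close>

lemma eq_by_coeffs:
  assumes "\<And>j. j \<in> J \<Longrightarrow> x \<bullet> e j = y \<bullet> e j"
  shows "x = y"
proof -
  have "((\<lambda>j. (x \<bullet> e j) *\<^sub>R e j) has_sum y) J"
    using has_sum_basis[of y] by (rule has_sum_cong[THEN iffD1, rotated]) (simp add: assms)
  then show ?thesis using has_sum_basis[of x] has_sum_unique by blast
qed

text \<open>The series need not converge absolutely in norm, so the Cauchy criterion along finite
  sets is used: by Pythagoras, the part over \<open>L - K\<close> is at most \<open>B'\<close> times
  the corresponding part of the expansion of \<open>x\<close>.\<close>

lemma summable_multiplier:
  assumes a: "\<And>j. j \<in> J \<Longrightarrow> \<bar>a j\<bar> \<le> B"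
  shows "(\<lambda>j. (a j * (x \<bullet> e j)) *\<^sub>R e j) summable_on J"
proof -
  define f where "f = (\<lambda>j. (a j * (x \<bullet> e j)) *\<^sub>R e j)"
  define B' where "B' = \<bar>B\<bar> + 1"
  have B': "0 < B'" by (simp add: B'_def)
  have ab: "\<bar>a j\<bar> \<le> B'" if "j \<in> J" for j using a[OF that] by (simp add: B'_def)
  have "\<exists>P. eventually P (finite_subsets_at_top J) \<and> (\<forall>F1 F2. P F1 \<and> P F2 \<longrightarrow> dist (sum f F1) (sum f F2) < \<epsilon>)"
    if \<epsilon>: "0 < \<epsilon>" for \<epsilon> :: real
  proof -
    \<comment> \<open>Two projection errors below \<delta>, multiplied by \<open>B'\<close>, stay
      below \<epsilon>/4 for each of the two index sets to be compared.\<close>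
    define \<delta> where "\<delta> = \<epsilon> / (8 * B')"
    have \<delta>: "0 < \<delta>" using \<epsilon> B' by (simp add: \<delta>_def)
    from proj_approx[OF \<delta>, of x] obtain K where K: "finite K" "K \<subseteq> J"
      "\<And>L. finite L \<Longrightarrow> K \<subseteq> L \<Longrightarrow> L \<subseteq> J \<Longrightarrow> norm (x - proj L x) < \<delta>" by blast
    have *: "norm (sum f L - sum f K) < \<epsilon> / 2" if L: "finite L" "K \<subseteq> L" "L \<subseteq> J" for L
    proof -
      have fin: "finite (L - K)" "L - K \<subseteq> J" using L by auto
      have "(norm (sum f L - sum f K))\<^sup>2 = (norm (\<Sum>j\<in>L-K. (a j * (x \<bullet> e j)) *\<^sub>R e j))\<^sup>2"
        using sum_diff[OF L(1,2), of f] by (simp add: f_def)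
      also have "\<dots> = (\<Sum>j\<in>L-K. (a j * (x \<bullet> e j))\<^sup>2)" by (rule norm_sum_basis[OF fin])
      also have "\<dots> \<le> (\<Sum>j\<in>L-K. B'\<^sup>2 * (x \<bullet> e j)\<^sup>2)"
      proof (rule sum_mono)
        fix j assume "j \<in> L - K"
        then have "\<bar>a j\<bar> \<le> B'" using fin ab by auto
        then have "\<bar>a j\<bar>\<^sup>2 \<le> B'\<^sup>2" by (intro power_mono) auto
        then show "(a j * (x \<bullet> e j))\<^sup>2 \<le> B'\<^sup>2 * (x \<bullet> e j)\<^sup>2"
          by (simp add: power_mult_distrib mult_right_mono)
      qed
      also have "\<dots> = B'\<^sup>2 * (norm (\<Sum>j\<in>L-K. (x \<bullet> e j) *\<^sub>R e j))\<^sup>2"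
        by (simp add: norm_sum_basis[OF fin] sum_distrib_left)
      also have "(\<Sum>j\<in>L-K. (x \<bullet> e j) *\<^sub>R e j) = proj L x - proj K x"
        using sum_diff[OF L(1,2), of "\<lambda>j. (x \<bullet> e j) *\<^sub>R e j"] by (simp add: proj_def)
      finally have "(norm (sum f L - sum f K))\<^sup>2 \<le> (B' * norm (proj L x - proj K x))\<^sup>2"
        by (simp add: power_mult_distrib)
      then have "norm (sum f L - sum f K) \<le> B' * norm (proj L x - proj K x)"
        using B' by (auto intro: power2_le_imp_le)
      also have "norm (proj L x - proj K x) \<le> norm (x - proj K x) + norm (x - proj L x)"
        using norm_triangle_ineq4[of "x - proj K x" "x - proj L x"] by simp
      also have "\<dots> < 2 * \<delta>" using K(3)[OF L] K(3)[OF K(1) order_refl K(2)] by simp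
      finally have "norm (sum f L - sum f K) < \<epsilon> / 4"
        using B' by (simp add: \<delta>_def field_simps)
      then show ?thesis using \<epsilon> by linarith
    qed
    show ?thesis
    proof (intro exI conjI allI impI)
      show "\<forall>\<^sub>F L in finite_subsets_at_top J. finite L \<and> K \<subseteq> L \<and> L \<subseteq> J"
        unfolding eventually_finite_subsets_at_top using K by auto
      fix F1 F2 assume "(finite F1 \<and> K \<subseteq> F1 \<and> F1 \<subseteq> J) \<and> finite F2 \<and> K \<subseteq> F2 \<and> F2 \<subseteq> J"
      then have "norm (sum f F1 - sum f K) < \<epsilon> / 2" "norm (sum f F2 - sum f K) < \<epsilon> / 2"
        using * by auto
      then show "dist (sum f F1) (sum f F2) < \<epsilon>"
        using norm_triangle_ineq4[of "sum f F1 - sum f K" "sum f F2 - sum f K"]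
        by (simp add: dist_norm)
    qed
  qed
  then have "cauchy_filter (filtermap (sum f) (finite_subsets_at_top J))"
    by (simp add: cauchy_filter_metric_filtermap)
  moreover have "uniform_space_class.complete (UNIV::'u set)"
    by (meson Cauchy_convergent UNIV_I complete_def convergent_def)
  ultimately obtain L' where "(sum f \<longlongrightarrow> L') (finite_subsets_at_top J)"
    using complete_uniform[where S=UNIV] by (force simp add: filterlim_def)
  then show ?thesis unfolding summable_on_def has_sum_def f_def by blast
qed

lemma infsum_multiplier_inner:
  assumes a: "\<And>j. j \<in> J \<Longrightarrow> \<bar>a j\<bar> \<le> B" and k: "k \<in> J"
  shows "(\<Sum>\<^sub>\<infinity>j\<in>J. (a j * (x \<bullet> e j)) *\<^sub>R e j) \<bullet> e k = a k * (x \<bullet> e k)"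
proof -
  have "((\<lambda>j. (a j * (x \<bullet> e j)) *\<^sub>R e j) has_sum (\<Sum>\<^sub>\<infinity>j\<in>J. (a j * (x \<bullet> e j)) *\<^sub>R e j)) J"
    using summable_multiplier[of a B x] a by (intro has_sum_infsum) auto
  from has_sum_bounded_linear[OF bounded_linear_inner_left this, of "e k"]
  have 1: "((\<lambda>j. ((a j * (x \<bullet> e j)) *\<^sub>R e j) \<bullet> e k) has_sum ((\<Sum>\<^sub>\<infinity>j\<in>J. (a j * (x \<bullet> e j)) *\<^sub>R e j) \<bullet> e k)) J"
    by (simp add: o_def)
  have "((\<lambda>j. ((a j * (x \<bullet> e j)) *\<^sub>R e j) \<bullet> e k) has_sum (\<Sum>j\<in>{k}. ((a j * (x \<bullet> e j)) *\<^sub>R e j) \<bullet> e k)) J"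
    using k by (intro has_sum_finite_neutralI[where B="{k}"]) (auto simp: inner_basis)
  then have "((\<lambda>j. ((a j * (x \<bullet> e j)) *\<^sub>R e j) \<bullet> e k) has_sum a k * (x \<bullet> e k)) J"
    using k by (simp add: inner_basis)
  with 1 show ?thesis using has_sum_unique by blast
qed

text \<open>Bessel's inequality for \<open>y\<close> gives the bound for every finite partial sum of
  the expansion of \<open>x\<close>, and the norm is continuous.\<close>

lemma norm_le_by_coeffs:
  assumes c: "0 \<le> c" and le: "\<And>j. j \<in> J \<Longrightarrow> \<bar>x \<bullet> e j\<bar> \<le> c * \<bar>y \<bullet> e j\<bar>"
  shows "norm x \<le> c * norm y"
proof (rule tendsto_upperbound)
  show "((\<lambda>L. norm (\<Sum>j\<in>L. (x \<bullet> e j) *\<^sub>R e j)) \<longlongrightarrow> norm x) (finite_subsets_at_top J)"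
    using has_sum_basis[of x] unfolding has_sum_def by (rule tendsto_norm)
  show "\<forall>\<^sub>F L in finite_subsets_at_top J. norm (\<Sum>j\<in>L. (x \<bullet> e j) *\<^sub>R e j) \<le> c * norm y"
  proof (rule eventually_finite_subsets_at_top_weakI)
    fix L assume L: "finite L" "L \<subseteq> J"
    have "(norm (\<Sum>j\<in>L. (x \<bullet> e j) *\<^sub>R e j))\<^sup>2 = (\<Sum>j\<in>L. \<bar>x \<bullet> e j\<bar>\<^sup>2)"
      by (simp add: norm_sum_basis[OF L])
    also have "\<dots> \<le> (\<Sum>j\<in>L. (c * \<bar>y \<bullet> e j\<bar>)\<^sup>2)"
      using L by (intro sum_mono power_mono le) auto
    also have "\<dots> = c\<^sup>2 * (\<Sum>j\<in>L. (y \<bullet> e j)\<^sup>2)" by (simp add: power_mult_distrib sum_distrib_left)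
    also have "\<dots> \<le> c\<^sup>2 * (norm y)\<^sup>2" by (intro mult_left_mono bessel L) auto
    finally have "(norm (\<Sum>j\<in>L. (x \<bullet> e j) *\<^sub>R e j))\<^sup>2 \<le> (c * norm y)\<^sup>2"
      by (simp add: power_mult_distrib)
    then show "norm (\<Sum>j\<in>L. (x \<bullet> e j) *\<^sub>R e j) \<le> c * norm y"
      using c by (auto intro: power2_le_imp_le)
  qed
qed simp

lemma inner_zero_if_coeffs_disjoint:
  assumes "\<And>j. j \<in> J \<Longrightarrow> (x \<bullet> e j) * (y \<bullet> e j) = 0"
  shows "x \<bullet> y = 0"
proof -
  from has_sum_bounded_linear[OF bounded_linear_inner_left has_sum_basis, of x y]
  have "((\<lambda>j. ((x \<bullet> e j) *\<^sub>R e j) \<bullet> y) has_sum (x \<bullet> y)) J" by (simp add: o_def)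
  moreover have "((\<lambda>j. ((x \<bullet> e j) *\<^sub>R e j) \<bullet> y) has_sum 0) J"
    using assms by (intro has_sum_0) (simp add: inner_commute)
  ultimately show ?thesis using has_sum_unique by blast
qed

text \<open>The sequence need not exhaust \<open>J\<close>. The indices it never reaches have
  coefficient zero, so enlarging \<open>N n\<close> by a finite set \<open>K\<close> that is good
  enough for \<epsilon> does not change the projection once \<open>N n\<close> contains the
  reachable part of \<open>K\<close>.\<close>

lemma proj_tendsto:
  assumes fin: "\<And>n. finite (N n)" and sub: "\<And>n. N n \<subseteq> J" and inc: "incseq N"
    and zero: "\<And>j. j \<in> J \<Longrightarrow> j \<notin> (\<Union>n. N n) \<Longrightarrow> x \<bullet> e j = 0"
  shows "(\<lambda>n. proj (N n) x) \<longlonglongrightarrow> x"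
  unfolding LIMSEQ_iff
proof (intro allI impI)
  fix r :: real assume "0 < r"
  from proj_approx[OF this, of x] obtain K where K: "finite K" "K \<subseteq> J"
    "\<And>L. finite L \<Longrightarrow> K \<subseteq> L \<Longrightarrow> L \<subseteq> J \<Longrightarrow> norm (x - proj L x) < r" by blast
  have "\<exists>n. K \<inter> (\<Union>n. N n) \<subseteq> N n"
  proof -
    have "\<exists>n. A \<subseteq> N n" if "finite A" "A \<subseteq> (\<Union>n. N n)" for A
      using that
    proof (induction A rule: finite_induct)
      case (insert a A)
      then obtain n m where "A \<subseteq> N n" "a \<in> N m" by auto
      then have "insert a A \<subseteq> N (max n m)"
        using incseqD[OF inc, of n "max n m"] incseqD[OF inc, of m "max n m"] by auto
      then show ?case by blast
    qed auto
    then show ?thesis using K(1) by (meson finite_Int inf_le2)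
  qed
  then obtain n0 where n0: "K \<inter> (\<Union>n. N n) \<subseteq> N n0" by blast
  have "norm (proj (N n) x - x) < r" if "n0 \<le> n" for n
  proof -
    have "proj (N n \<union> K) x = proj (N n) x"
      unfolding proj_def
    proof (rule sum.mono_neutral_right)
      show "\<forall>i\<in>N n \<union> K - N n. (x \<bullet> e i) *\<^sub>R e i = 0"
      proof
        fix i assume i: "i \<in> N n \<union> K - N n"
        then have "i \<notin> (\<Union>n. N n)" using n0 incseqD[OF inc that] by blast
        then show "(x \<bullet> e i) *\<^sub>R e i = 0" using zero i K(2) by auto
      qed
    qed (use fin K in auto)
    moreover have "norm (x - proj (N n \<union> K) x) < r"
      by (rule K(3)) (use fin sub K in auto)
    ultimately show ?thesis by (simp add: norm_minus_commute)
  qed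
  then show "\<exists>no. \<forall>n\<ge>no. norm (proj (N n) x - x) < r" by blast
qed

end

section \<open>Powers of a nonnegative diagonal operator\<close>

text \<open>\<open>B\<close> bounds the single eigenvalues here; the same constant will also be a
  bound for the trace.\<close>

locale eigen = onb J e for J :: "'j set" and e :: "'j \<Rightarrow> 'u::{real_inner, banach}" +
  fixes \<eta> :: "'j \<Rightarrow> real" and B :: real
  assumes eta_nonneg: "j \<in> J \<Longrightarrow> 0 \<le> \<eta> j" and eta_le: "j \<in> J \<Longrightarrow> \<eta> j \<le> B" and B_pos: "0 < B"
begin

text \<open>The directions in which there is noise. They index the basis of \<open>U0\<close>; all
  sums over coordinates run over finite subsets of this set.\<close>

definition Jp :: "'j set" where "Jp = {j\<in>J. 0 < \<eta> j}"

lemma Jp_subset: "Jp \<subseteq> J" by (auto simp: Jp_def)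

lemma JpD: "j \<in> Jp \<Longrightarrow> j \<in> J" "j \<in> Jp \<Longrightarrow> 0 < \<eta> j" by (auto simp: Jp_def)

lemma eta_zero: "j \<in> J \<Longrightarrow> j \<notin> Jp \<Longrightarrow> \<eta> j = 0"
  using eta_nonneg by (force simp: Jp_def)

lemma eta_powr_le: "j \<in> J \<Longrightarrow> 0 < a \<Longrightarrow> \<bar>\<eta> j powr a\<bar> \<le> B powr a"
  using eta_nonneg eta_le by (auto intro: powr_mono2)

lemma Qpow_inner: "0 < a \<Longrightarrow> k \<in> J \<Longrightarrow> Qpow J \<eta> e a x \<bullet> e k = \<eta> k powr a * (x \<bullet> e k)"
  unfolding Qpow_def using eta_powr_le by (intro infsum_multiplier_inner) auto

lemma linear_Qpow: "0 < a \<Longrightarrow> linear (Qpow J \<eta> e a)"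
  by (intro linearI eq_by_coeffs) (auto simp: Qpow_inner inner_add_left algebra_simps)

lemma Qpow_norm_le: "0 < a \<Longrightarrow> norm (Qpow J \<eta> e a x) \<le> B powr a * norm x"
proof (intro norm_le_by_coeffs)
  fix j assume "0 < a" "j \<in> J"
  then show "\<bar>Qpow J \<eta> e a x \<bullet> e j\<bar> \<le> B powr a * \<bar>x \<bullet> e j\<bar>"
    using eta_powr_le[of j a] by (simp add: Qpow_inner abs_mult mult_right_mono)
qed simp

lemma Qpow_eq_0_iff: "0 < a \<Longrightarrow> Qpow J \<eta> e a z = 0 \<longleftrightarrow> (\<forall>j\<in>Jp. z \<bullet> e j = 0)"
proof
  assume a: "0 < a" and "Qpow J \<eta> e a z = 0"
  then have "\<eta> j powr a * (z \<bullet> e j) = 0" if "j \<in> Jp" for j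
    using Qpow_inner[OF a, of j z] JpD[OF that] by simp
  then show "\<forall>j\<in>Jp. z \<bullet> e j = 0" using JpD by fastforce
next
  assume a: "0 < a" and "\<forall>j\<in>Jp. z \<bullet> e j = 0"
  then show "Qpow J \<eta> e a z = 0"
    using eta_zero by (intro eq_by_coeffs) (auto simp: Qpow_inner)
qed

text \<open>The pseudo-inverse is a \<open>THE\<close>. Uniqueness holds because the equation fixes
  the coefficients on \<open>Jp\<close>, while the remaining basis vectors lie in the kernel and
  hence are orthogonal to any candidate.\<close>

lemma Qneg_eqI:
  assumes a: "0 < a" and x: "Qpow J \<eta> e a x = y" and ort: "\<And>j. j \<in> J \<Longrightarrow> j \<notin> Jp \<Longrightarrow> x \<bullet> e j = 0"
  shows "Qneg J \<eta> e a y = x"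
  unfolding Qneg_def pseudo_inverse_def
proof (rule the_equality)
  show "Qpow J \<eta> e a x = y \<and> (\<forall>z. Qpow J \<eta> e a z = 0 \<longrightarrow> x \<bullet> z = 0)"
  proof (intro conjI allI impI x)
    fix z assume "Qpow J \<eta> e a z = 0"
    then have "\<forall>j\<in>Jp. z \<bullet> e j = 0" using a Qpow_eq_0_iff by simp
    then show "x \<bullet> z = 0" using ort by (intro inner_zero_if_coeffs_disjoint) auto
  qed
next
  fix x' assume x': "Qpow J \<eta> e a x' = y \<and> (\<forall>z. Qpow J \<eta> e a z = 0 \<longrightarrow> x' \<bullet> z = 0)"
  show "x' = x"
  proof (rule eq_by_coeffs)
    fix j assume j: "j \<in> J"
    show "x' \<bullet> e j = x \<bullet> e j"
    proof (cases "j \<in> Jp")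
      case True
      have "\<eta> j powr a * (x' \<bullet> e j) = \<eta> j powr a * (x \<bullet> e j)"
        using x x' Qpow_inner[OF a j] by metis
      then show ?thesis using JpD(2)[OF True] by simp
    next
      case False
      then have "Qpow J \<eta> e a (e j) = 0"
        using a j Jp_subset by (auto simp: Qpow_eq_0_iff inner_basis subset_eq)
      then have "x' \<bullet> e j = 0" using x' by blast
      then show ?thesis using ort[OF j False] by simp
    qed
  qed
qed

lemma Qpow_scaled_basis: "0 < a \<Longrightarrow> j \<in> J \<Longrightarrow> Qpow J \<eta> e a (c *\<^sub>R e j) = (c * \<eta> j powr a) *\<^sub>R e j"
  by (intro eq_by_coeffs) (auto simp: Qpow_inner inner_basis)

lemma Qneg_basis: "0 < a \<Longrightarrow> j \<in> Jp \<Longrightarrow> Qneg J \<eta> e a (c *\<^sub>R e j) = (c * \<eta> j powr - a) *\<^sub>R e j"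
proof (rule Qneg_eqI)
  assume a: "0 < a" and j: "j \<in> Jp"
  have "\<eta> j powr - a * \<eta> j powr a = 1"
    using JpD(2)[OF j] powr_add[of "\<eta> j" "- a" a] by simp
  then show "Qpow J \<eta> e a ((c * \<eta> j powr - a) *\<^sub>R e j) = c *\<^sub>R e j"
    using Qpow_scaled_basis[OF a JpD(1)[OF j]] by (simp add: mult.assoc)
qed (auto simp: inner_basis JpD)

lemma basis_in_U0: "j \<in> Jp \<Longrightarrow> c *\<^sub>R e j \<in> U0 J \<eta> e"
proof -
  assume j: "j \<in> Jp"
  have "\<eta> j powr - (1/2) * \<eta> j powr (1/2) = 1"
    using JpD(2)[OF j] powr_add[of "\<eta> j" "- (1/2)" "1/2"] by simp
  then have "Qpow J \<eta> e (1/2) ((c * \<eta> j powr - (1/2)) *\<^sub>R e j) = c *\<^sub>R e j"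
    using Qpow_scaled_basis[of "1/2", OF _ JpD(1)[OF j]] by (simp add: mult.assoc)
  then show ?thesis unfolding U0_def by (metis rangeI)
qed

lemma U0_add: "x \<in> U0 J \<eta> e \<Longrightarrow> y \<in> U0 J \<eta> e \<Longrightarrow> x + y \<in> U0 J \<eta> e"
proof -
  assume "x \<in> U0 J \<eta> e" "y \<in> U0 J \<eta> e"
  then obtain x' y' where "x = Qpow J \<eta> e (1/2) x'" "y = Qpow J \<eta> e (1/2) y'"
    by (auto simp: U0_def)
  then have "x + y = Qpow J \<eta> e (1/2) (x' + y')"
    by (simp add: linear_add[OF linear_Qpow])
  then show ?thesis unfolding U0_def by (rule range_eqI)
qed

lemma U0_scale: "x \<in> U0 J \<eta> e \<Longrightarrow> c *\<^sub>R x \<in> U0 J \<eta> e"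
proof -
  assume "x \<in> U0 J \<eta> e"
  then obtain x' where "x = Qpow J \<eta> e (1/2) x'" by (auto simp: U0_def)
  then have "c *\<^sub>R x = Qpow J \<eta> e (1/2) (c *\<^sub>R x')"
    by (simp add: linear_scale[OF linear_Qpow])
  then show ?thesis unfolding U0_def by (rule range_eqI)
qed

lemma U0_orthogonal: "x \<in> U0 J \<eta> e \<Longrightarrow> j \<in> J \<Longrightarrow> j \<notin> Jp \<Longrightarrow> x \<bullet> e j = 0"
  by (auto simp: U0_def Qpow_inner eta_zero)

text \<open>A vector of \<open>U0\<close> has no component in the kernel, so it is the
  pseudo-inverse of its own image. This is what makes the bound on \<Psi> applicable to
  \<open>U0\<close>.\<close>

lemma U0_subset_Qneg_space: "0 < a \<Longrightarrow> U0 J \<eta> e \<subseteq> Qneg_space J \<eta> e a"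
proof
  fix x assume a: "0 < a" and x: "x \<in> U0 J \<eta> e"
  have "Qneg J \<eta> e a (Qpow J \<eta> e a x) = x"
    using U0_orthogonal[OF x] by (intro Qneg_eqI a refl) auto
  then show "x \<in> Qneg_space J \<eta> e a" unfolding Qneg_space_def by (metis image_eqI rangeI)
qed

text \<open>A preimage \<open>z\<close> of \<open>x\<close> may have components in the kernel.
  Deleting them gives \<open>y\<close> with the same image, and \<open>y\<close> is the
  pseudo-inverse, whose norm is the norm of \<open>x\<close> in \<open>U0\<close>.\<close>

lemma norm_le_U0_norm: "x \<in> U0 J \<eta> e \<Longrightarrow> norm x \<le> B powr (1/2) * U0_norm J \<eta> e x"
proof -
  assume x: "x \<in> U0 J \<eta> e"
  then obtain z where z: "x = Qpow J \<eta> e (1/2) z" by (auto simp: U0_def)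
  define a where "a j = (if j \<in> Jp then 1 else 0 :: real)" for j
  define y where "y = (\<Sum>\<^sub>\<infinity>j\<in>J. (a j * (z \<bullet> e j)) *\<^sub>R e j)"
  have y: "y \<bullet> e j = a j * (z \<bullet> e j)" if "j \<in> J" for j
    unfolding y_def by (rule infsum_multiplier_inner[of _ 1]) (auto simp: a_def that)
  have Qy: "Qpow J \<eta> e (1/2) y = x"
    unfolding z by (intro eq_by_coeffs) (auto simp: Qpow_inner y a_def eta_zero)
  have "Qneg J \<eta> e (1/2) x = y"
    using Qy by (intro Qneg_eqI) (auto simp: y a_def)
  then show ?thesis unfolding U0_norm_def using Qpow_norm_le[of "1/2" y] Qy by simp
qed

end

section \<open>Increments of the Wiener process\<close>

text \<open>\<open>normal_law\<close> is a point mass for \<open>v = 0\<close>, which occurs for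
  intervals of length zero and for directions without noise, so every moment is computed in two
  cases. The fourth moment will control the quadratic variation.\<close>

lemma normal_law_moments:
  assumes d: "distr M borel Y = normal_law 0 v" and v: "0 \<le> v"
    and [measurable]: "(Y :: 'w \<Rightarrow> real) \<in> borel_measurable M"
  shows "integrable M (\<lambda>\<omega>. Y \<omega> ^ k)" and "(\<integral>\<omega>. Y \<omega> \<partial>M) = 0"
    and "(\<integral>\<omega>. Y \<omega> ^ 2 \<partial>M) = v" and "(\<integral>\<omega>. Y \<omega> ^ 4 \<partial>M) = 3 * v\<^sup>2"
proof -
  have pow: "has_bochner_integral M (\<lambda>\<omega>. Y \<omega> ^ k) c"
    if "has_bochner_integral (normal_law 0 v) (\<lambda>x. x ^ k) c" for k c
    using that unfolding d[symmetric] by (simp add: has_bochner_integral_iff integrable_distr_eq integral_distr)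
  have *: "integrable (normal_law 0 v) (\<lambda>x. x ^ k)" for k
  proof (cases "v = 0")
    case True
    have "integrable (return borel (0::real)) (\<lambda>x. x ^ k :: real)"
      by (subst integrable_iff_bounded) (simp add: nn_integral_return)
    then show ?thesis using True by (simp add: normal_law_def)
  next
    case False
    then show ?thesis
      using v integrable_normal_moment[of "sqrt v" 0 k]
      by (simp add: normal_law_def integrable_density)
  qed
  have hb: "has_bochner_integral (normal_law 0 v) (\<lambda>x. x ^ k) c"
    if "v = 0 \<Longrightarrow> c = 0 ^ k" "v \<noteq> 0 \<Longrightarrow> integral\<^sup>L lborel (\<lambda>x. normal_density 0 (sqrt v) x * x ^ k) = c" for k c
  proof -
    have "integral\<^sup>L (normal_law 0 v) (\<lambda>x. x ^ k) = c"
    proof (cases "v = 0")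
      case True then show ?thesis using that(1) by (simp add: normal_law_def integral_return)
    next
      case False then show ?thesis
        using v that(2) by (simp add: normal_law_def integral_density)
    qed
    then show ?thesis using * by (simp add: has_bochner_integral_iff)
  qed
  show "integrable M (\<lambda>\<omega>. Y \<omega> ^ k)"
    using pow[of k] * by (metis has_bochner_integral_iff)
  have "has_bochner_integral M (\<lambda>\<omega>. Y \<omega> ^ 1) 0"
    using v integral_normal_moment_odd[of "sqrt v" 0 0] by (intro pow hb) auto
  then show "(\<integral>\<omega>. Y \<omega> \<partial>M) = 0" by (simp add: has_bochner_integral_iff)
  have "has_bochner_integral M (\<lambda>\<omega>. Y \<omega> ^ 2) v"
    using v integral_normal_moment_even[of "sqrt v" 0 1] by (intro pow hb) auto
  then show "(\<integral>\<omega>. Y \<omega> ^ 2 \<partial>M) = v" by (simp add: has_bochner_integral_iff)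
  have "has_bochner_integral M (\<lambda>\<omega>. Y \<omega> ^ 4) (3 * v\<^sup>2)"
    using v integral_normal_moment_even[of "sqrt v" 0 2]
    by (intro pow hb) (auto simp: fact_numeral power2_eq_square field_simps)
  then show "(\<integral>\<omega>. Y \<omega> ^ 4 \<partial>M) = 3 * v\<^sup>2" by (simp add: has_bochner_integral_iff)
qed

locale q_wiener = prob_space M + eigen J e \<eta> B
  for M :: "'w measure" and J :: "'j set" and e :: "'j \<Rightarrow> 'u::{real_inner, banach, second_countable_topology}"
    and \<eta> :: "'j \<Rightarrow> real" and B :: real +
  fixes F :: "real \<Rightarrow> 'w measure" and T :: real and Q :: "'u \<Rightarrow>\<^sub>L 'u" and W :: "real \<Rightarrow> 'w \<Rightarrow> 'u"
  assumes filt: "filtered M F"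
    and wiener: "Q_Wiener_process M F T Q W"
    and eigenvector: "j \<in> J \<Longrightarrow> blinfun_apply Q (e j) = \<eta> j *\<^sub>R e j"
    and countable_J: "countable J"
    and trace_le: "finite K \<Longrightarrow> K \<subseteq> J \<Longrightarrow> sum \<eta> K \<le> B"
begin

lemma subalg: "0 \<le> t \<Longrightarrow> subalgebra M (F t)"
  using filt by (auto simp: filtered_def)

lemma space_F: "0 \<le> t \<Longrightarrow> space (F t) = space M"
  using subalg by (auto simp: subalgebra_def)

lemma sets_F: "0 \<le> t \<Longrightarrow> sets (F t) \<subseteq> sets M"
  using subalg by (auto simp: subalgebra_def)

lemma F_mono: "0 \<le> s \<Longrightarrow> s \<le> t \<Longrightarrow> sets (F s) \<subseteq> sets (F t)"
  using filt by (auto simp: filtered_def)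

lemma measurable_F_M: "0 \<le> t \<Longrightarrow> X \<in> measurable (F t) N \<Longrightarrow> X \<in> measurable M N"
  using subalg measurable_from_subalg by blast

lemma measurable_F_mono: "0 \<le> s \<Longrightarrow> s \<le> t \<Longrightarrow> X \<in> measurable (F s) N \<Longrightarrow> X \<in> measurable (F t) N"
proof (rule measurable_from_subalg)
  assume "0 \<le> s" "s \<le> t"
  then show "subalgebra (F t) (F s)" using F_mono space_F by (simp add: subalgebra_def)
qed

lemma W_measurable: "t \<in> {0..T} \<Longrightarrow> W t \<in> borel_measurable (F t)"
  using wiener by (auto simp: Q_Wiener_process_def)

lemma W_measurable': "0 \<le> s \<Longrightarrow> s \<le> t \<Longrightarrow> s \<le> T \<Longrightarrow> W s \<in> borel_measurable (F t)"
  by (rule measurable_F_mono[OF _ _ W_measurable]) auto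

lemma W_measurable_M: "0 \<le> s \<Longrightarrow> s \<le> T \<Longrightarrow> W s \<in> borel_measurable M"
  by (rule measurable_F_M[OF _ W_measurable]) auto

lemma W_continuous: "AE \<omega> in M. continuous_on {0..T} (\<lambda>t. W t \<omega>)"
  using wiener by (auto simp: Q_Wiener_process_def)

text \<open>An adapted \<open>X\<close> generates a \<sigma>-algebra inside \<open>F s\<close>, and
  a function \<open>g\<close> of the increment generates one inside that of the increment;
  independence passes to both.\<close>

lemma indep_increment:
  fixes X :: "'w \<Rightarrow> real" and g :: "'u \<Rightarrow> real"
  assumes s: "0 \<le> s" "s \<le> t" "t \<le> T" and X: "X \<in> borel_measurable (F s)"
    and g: "g \<in> borel_measurable borel"
  shows "indep_var borel X borel (\<lambda>\<omega>. g (W t \<omega> - W s \<omega>))"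
proof -
  let ?D = "\<lambda>\<omega>. W t \<omega> - W s \<omega>" and ?G = "\<lambda>\<omega>. g (W t \<omega> - W s \<omega>)"
  have XM: "X \<in> borel_measurable M" using measurable_F_M s X by blast
  have DM: "?D \<in> borel_measurable M"
    using W_measurable_M[of t] W_measurable_M[of s] s by auto
  then have GM: "?G \<in> borel_measurable M" using measurable_compose[OF DM g] by simp
  have ind: "indep_set (sets (F s)) {?D -` A \<inter> space M | A. A \<in> sets borel}"
    using wiener s by (auto simp: Q_Wiener_process_def)
  have 1: "sigma_sets (space M) {X -` A \<inter> space M | A. A \<in> sets borel} \<subseteq> sets (F s)"
    unfolding space_F[OF s(1), symmetric]
    by (rule sets.sigma_sets_subset) (use measurable_sets[OF X] in auto)
  have "{?G -` A \<inter> space M | A. A \<in> sets borel} \<subseteq> {?D -` A \<inter> space M | A. A \<in> sets borel}"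
  proof safe
    fix A :: "real set" assume "A \<in> sets borel"
    then have "g -` A \<in> sets borel" using measurable_sets[OF g] by simp
    moreover have "?G -` A \<inter> space M = ?D -` (g -` A) \<inter> space M" by auto
    ultimately show "\<exists>A'. ?G -` A \<inter> space M = ?D -` A' \<inter> space M \<and> A' \<in> sets borel" by blast
  qed
  \<comment> \<open>Independence is given for the family of preimages itself. As this is already a
    \<sigma>-algebra, the one generated by \<open>g\<close> of the increment stays inside
    it.\<close>
  moreover have "sigma_algebra (space M) {?D -` A \<inter> space M | A. A \<in> sets borel}"
  proof -
    have "sets (vimage_algebra (space M) ?D borel) = {?D -` A \<inter> space M | A. A \<in> sets borel}"
      by (rule sets_vimage_algebra2) simp
    then show ?thesis
      using sets.sigma_algebra_axioms[of "vimage_algebra (space M) ?D borel"] by simp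
  qed
  ultimately have 2: "sigma_sets (space M) {?G -` A \<inter> space M | A. A \<in> sets borel}
     \<subseteq> {?D -` A \<inter> space M | A. A \<in> sets borel}"
    by - (rule sigma_algebra.sigma_sets_subset)
  show ?thesis unfolding indep_var_eq
  proof (intro conjI XM GM)
    show "indep_set (sigma_sets (space M) {X -` A \<inter> space M |A. A \<in> sets borel})
       (sigma_sets (space M) {?G -` A \<inter> space M |A. A \<in> sets borel})"
      unfolding indep_sets2_eq
    proof (intro conjI ballI)
      have *: "sets (F s) \<subseteq> events" "{?D -` A \<inter> space M | A. A \<in> sets borel} \<subseteq> events"
        using ind by (simp_all only: indep_sets2_eq)
      show "sigma_sets (space M) {X -` A \<inter> space M |A. A \<in> sets borel} \<subseteq> events"
        by (rule subset_trans[OF 1 *(1)])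
      show "sigma_sets (space M) {?G -` A \<inter> space M |A. A \<in> sets borel} \<subseteq> events"
        by (rule subset_trans[OF 2 *(2)])
      fix a b assume "a \<in> sigma_sets (space M) {X -` A \<inter> space M |A. A \<in> sets borel}"
        "b \<in> sigma_sets (space M) {?G -` A \<inter> space M |A. A \<in> sets borel}"
      then have "a \<in> sets (F s)" "b \<in> {?D -` A \<inter> space M | A. A \<in> sets borel}"
        by - (erule subsetD[OF 1], erule subsetD[OF 2])
      with ind show "prob (a \<inter> b) = prob a * prob b"
        by (simp only: indep_sets2_eq)
    qed
  qed
qed

lemma increment_law:
  assumes "0 \<le> s" "s \<le> t" "t \<le> T"
  shows "distr M borel (\<lambda>\<omega>. (W t \<omega> - W s \<omega>) \<bullet> u) = normal_law 0 ((t - s) * (blinfun_apply Q u \<bullet> u))"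
  using wiener assms by (auto simp: Q_Wiener_process_def)

text \<open>For \<open>j\<close> in \<open>Jp\<close> this is the increment over [a, b] of a
  standard Brownian motion: the normalisation makes the variance the length of the interval.\<close>

definition \<beta> :: "'j \<Rightarrow> real \<Rightarrow> real \<Rightarrow> 'w \<Rightarrow> real" where
  "\<beta> j a b \<omega> = ((W b \<omega> - W a \<omega>) \<bullet> e j) / sqrt (\<eta> j)"

lemma beta_measurable_F:
  "0 \<le> a \<Longrightarrow> a \<le> b \<Longrightarrow> b \<le> c \<Longrightarrow> b \<le> T \<Longrightarrow> \<beta> j a b \<in> borel_measurable (F c)"
  using W_measurable'[of a c] W_measurable'[of b c] unfolding \<beta>_def by simp

lemma beta_measurable [measurable]:
  "0 \<le> a \<Longrightarrow> a \<le> b \<Longrightarrow> b \<le> T \<Longrightarrow> \<beta> j a b \<in> borel_measurable M"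
  by (rule measurable_F_M[OF _ beta_measurable_F[of a b b]]) auto

lemma beta_add: "\<beta> j a b \<omega> + \<beta> j b c \<omega> = \<beta> j a c \<omega>"
  unfolding \<beta>_def by (simp add: add_divide_distrib[symmetric] inner_diff_left)

lemma beta_self [simp]: "\<beta> j a a \<omega> = 0"
  by (simp add: \<beta>_def)

lemma beta_law:
  assumes "0 \<le> a" "a \<le> b" "b \<le> T" "i \<in> Jp"
  shows "distr M borel (\<beta> i a b) = normal_law 0 (b - a)"
proof -
  define u where "u = (1 / sqrt (\<eta> i)) *\<^sub>R e i"
  have i: "i \<in> J" "0 < \<eta> i" using JpD assms by auto
  have "blinfun_apply Q u \<bullet> u = 1"
    using i by (simp add: u_def blinfun.scaleR_right eigenvector inner_basis)
  moreover have "(\<lambda>\<omega>. (W b \<omega> - W a \<omega>) \<bullet> u) = \<beta> i a b"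
    by (auto simp: \<beta>_def u_def)
  ultimately show ?thesis using increment_law[OF assms(1-3), of u] by simp
qed

lemma beta_moments:
  assumes "0 \<le> a" "a \<le> b" "b \<le> T" "i \<in> Jp"
  shows "integrable M (\<lambda>\<omega>. \<beta> i a b \<omega> ^ k)" and "(\<integral>\<omega>. \<beta> i a b \<omega> \<partial>M) = 0"
    and "(\<integral>\<omega>. \<beta> i a b \<omega> ^ 2 \<partial>M) = b - a" and "(\<integral>\<omega>. \<beta> i a b \<omega> ^ 4 \<partial>M) = 3 * (b - a)\<^sup>2"
  using normal_law_moments[OF beta_law[OF assms]] assms beta_measurable[OF assms(1-3)] by auto

lemma integrable_mult_L2:
  fixes X Y :: "'w \<Rightarrow> real"
  assumes [measurable]: "X \<in> borel_measurable M" "Y \<in> borel_measurable M"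
    and "integrable M (\<lambda>\<omega>. X \<omega> ^ 2)" "integrable M (\<lambda>\<omega>. Y \<omega> ^ 2)"
  shows "integrable M (\<lambda>\<omega>. X \<omega> * Y \<omega>)"
proof (rule Bochner_Integration.integrable_bound)
  show "integrable M (\<lambda>\<omega>. X \<omega> ^ 2 + Y \<omega> ^ 2)" using assms by auto
  show "AE \<omega> in M. norm (X \<omega> * Y \<omega>) \<le> norm (X \<omega> ^ 2 + Y \<omega> ^ 2)"
  proof (intro AE_I2)
    fix \<omega>
    have "2 * (\<bar>X \<omega>\<bar> * \<bar>Y \<omega>\<bar>) \<le> X \<omega> ^ 2 + Y \<omega> ^ 2"
      using sum_squares_bound[of "\<bar>X \<omega>\<bar>" "\<bar>Y \<omega>\<bar>"] by simp
    moreover have "0 \<le> \<bar>X \<omega>\<bar> * \<bar>Y \<omega>\<bar>" by simp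
    moreover have "norm (X \<omega> * Y \<omega>) = \<bar>X \<omega>\<bar> * \<bar>Y \<omega>\<bar>" by (simp add: abs_mult)
    moreover have "norm (X \<omega> ^ 2 + Y \<omega> ^ 2) = X \<omega> ^ 2 + Y \<omega> ^ 2" by simp
    ultimately show "norm (X \<omega> * Y \<omega>) \<le> norm (X \<omega> ^ 2 + Y \<omega> ^ 2)" by linarith
  qed
qed simp

text \<open>Polarisation: the law of the increment is known in every single direction. In the sum
  \<open>u\<close> of two normalised eigenvectors the variance is twice the length of the interval,
  the sum of the two variances, so the mixed moment vanishes.\<close>

lemma beta_mean_product:
  assumes "0 \<le> a" "a \<le> b" "b \<le> T" "i \<in> Jp" "j \<in> Jp"
  shows "integrable M (\<lambda>\<omega>. \<beta> i a b \<omega> * \<beta> j a b \<omega>)"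
    and "(\<integral>\<omega>. \<beta> i a b \<omega> * \<beta> j a b \<omega> \<partial>M) = (if i = j then b - a else 0)"
proof -
  note [measurable] = beta_measurable[OF assms(1-3)]
  have sq: "integrable M (\<lambda>\<omega>. \<beta> k a b \<omega> ^ 2)" if "k \<in> Jp" for k
    using beta_moments(1)[OF assms(1-3) that] .
  show int: "integrable M (\<lambda>\<omega>. \<beta> i a b \<omega> * \<beta> j a b \<omega>)"
    using assms by (intro integrable_mult_L2 sq) auto
  show "(\<integral>\<omega>. \<beta> i a b \<omega> * \<beta> j a b \<omega> \<partial>M) = (if i = j then b - a else 0)"
  proof (cases "i = j")
    case True then show ?thesis using beta_moments(3)[OF assms(1-4)] by (simp add: power2_eq_square)
  next
    case False
    define u where "u = (1 / sqrt (\<eta> i)) *\<^sub>R e i + (1 / sqrt (\<eta> j)) *\<^sub>R e j"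
    have ij: "i \<in> J" "0 < \<eta> i" "j \<in> J" "0 < \<eta> j" using JpD assms by auto
    have Qu: "blinfun_apply Q u \<bullet> u = 2"
      using ij False
      by (simp add: u_def blinfun.scaleR_right blinfun.add_right eigenvector inner_basis
          inner_add_left inner_add_right)
    have u: "(\<lambda>\<omega>. (W b \<omega> - W a \<omega>) \<bullet> u) = (\<lambda>\<omega>. \<beta> i a b \<omega> + \<beta> j a b \<omega>)"
      by (auto simp: \<beta>_def u_def inner_add_right)
    have "distr M borel (\<lambda>\<omega>. \<beta> i a b \<omega> + \<beta> j a b \<omega>) = normal_law 0 ((b - a) * 2)"
      using increment_law[OF assms(1-3), of u] unfolding Qu u .
    then have "(\<integral>\<omega>. (\<beta> i a b \<omega> + \<beta> j a b \<omega>) ^ 2 \<partial>M) = (b - a) * 2"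
      using assms by (intro normal_law_moments(3)) auto
    moreover have "(\<integral>\<omega>. (\<beta> i a b \<omega> + \<beta> j a b \<omega>) ^ 2 \<partial>M)
      = (\<integral>\<omega>. \<beta> i a b \<omega> ^ 2 + \<beta> j a b \<omega> ^ 2 + 2 * (\<beta> i a b \<omega> * \<beta> j a b \<omega>) \<partial>M)"
      by (intro Bochner_Integration.integral_cong) (auto simp: power2_sum)
    moreover have "\<dots> = (b - a) + (b - a) + 2 * (\<integral>\<omega>. \<beta> i a b \<omega> * \<beta> j a b \<omega> \<partial>M)"
      using int sq assms beta_moments(3)[OF assms(1-3)] by simp
    ultimately show ?thesis using False by simp
  qed
qed

section \<open>Adapted factors times later increments, and their covariances\<close>

lemma adapted_times_increment:
  fixes X :: "'w \<Rightarrow> real" and g :: "'u \<Rightarrow> real"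
  assumes a: "0 \<le> a" "a \<le> b" "b \<le> T" and X: "X \<in> borel_measurable (F a)"
    and Xi: "integrable M X" and g: "g \<in> borel_measurable borel"
    and gi: "integrable M (\<lambda>\<omega>. g (W b \<omega> - W a \<omega>))"
  shows "integrable M (\<lambda>\<omega>. X \<omega> * g (W b \<omega> - W a \<omega>))"
    and "(\<integral>\<omega>. X \<omega> * g (W b \<omega> - W a \<omega>) \<partial>M) = (\<integral>\<omega>. X \<omega> \<partial>M) * (\<integral>\<omega>. g (W b \<omega> - W a \<omega>) \<partial>M)"
proof -
  note i = indep_increment[OF a X g]
  show "integrable M (\<lambda>\<omega>. X \<omega> * g (W b \<omega> - W a \<omega>))"
    by (rule indep_var_integrable[OF i Xi gi])
  show "(\<integral>\<omega>. X \<omega> * g (W b \<omega> - W a \<omega>) \<partial>M) = (\<integral>\<omega>. X \<omega> \<partial>M) * (\<integral>\<omega>. g (W b \<omega> - W a \<omega>) \<partial>M)"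
    by (rule indep_var_lebesgue_integral[OF i Xi gi])
qed

lemma adapted_times_beta:
  fixes X :: "'w \<Rightarrow> real"
  assumes a: "0 \<le> a" "a \<le> b" "b \<le> T" and X: "X \<in> borel_measurable (F a)"
    and Xi: "integrable M X" and i: "i \<in> Jp"
  shows "integrable M (\<lambda>\<omega>. X \<omega> * \<beta> i a b \<omega> ^ k)"
    and "(\<integral>\<omega>. X \<omega> * \<beta> i a b \<omega> \<partial>M) = 0"
proof -
  have *: "integrable M (\<lambda>\<omega>. (\<lambda>x. (x \<bullet> e i / sqrt (\<eta> i)) ^ k) (W b \<omega> - W a \<omega>))" for k
    using beta_moments(1)[OF a i, of k] by (simp add: \<beta>_def)
  show "integrable M (\<lambda>\<omega>. X \<omega> * \<beta> i a b \<omega> ^ k)"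
    using adapted_times_increment(1)[OF a X Xi _ *] by (simp add: \<beta>_def)
  show "(\<integral>\<omega>. X \<omega> * \<beta> i a b \<omega> \<partial>M) = 0"
    using adapted_times_increment(2)[OF a X Xi _ *[of 1]] beta_moments(2)[OF a i] JpD(2)[OF i]
    unfolding \<beta>_def by simp
qed

text \<open>The product of two coordinates over one interval is a single function \<open>g\<close>
  of the increment in U, so independence of the past applies to it at once.\<close>

lemma adapted_times_beta_beta:
  fixes X :: "'w \<Rightarrow> real"
  assumes a: "0 \<le> a" "a \<le> b" "b \<le> T" and X: "X \<in> borel_measurable (F a)"
    and Xi: "integrable M X" and ij: "i \<in> Jp" "j \<in> Jp"
  shows "integrable M (\<lambda>\<omega>. X \<omega> * (\<beta> i a b \<omega> * \<beta> j a b \<omega>))"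
    and "(\<integral>\<omega>. X \<omega> * (\<beta> i a b \<omega> * \<beta> j a b \<omega>) \<partial>M) = (if i = j then (\<integral>\<omega>. X \<omega> \<partial>M) * (b - a) else 0)"
proof -
  define g where "g x = (x \<bullet> e i / sqrt (\<eta> i)) * (x \<bullet> e j / sqrt (\<eta> j))" for x
  have [measurable]: "g \<in> borel_measurable borel" unfolding g_def by measurable
  have g: "g (W b \<omega> - W a \<omega>) = \<beta> i a b \<omega> * \<beta> j a b \<omega>" for \<omega> by (simp add: g_def \<beta>_def)
  have gi: "integrable M (\<lambda>\<omega>. g (W b \<omega> - W a \<omega>))"
    unfolding g by (rule beta_mean_product[OF a ij])
  show "integrable M (\<lambda>\<omega>. X \<omega> * (\<beta> i a b \<omega> * \<beta> j a b \<omega>))"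
    using adapted_times_increment(1)[OF a X Xi _ gi] by (simp add: g)
  show "(\<integral>\<omega>. X \<omega> * (\<beta> i a b \<omega> * \<beta> j a b \<omega>) \<partial>M) = (if i = j then (\<integral>\<omega>. X \<omega> \<partial>M) * (b - a) else 0)"
    using adapted_times_increment(2)[OF a X Xi _ gi] beta_mean_product(2)[OF a ij] by (simp add: g)
qed

text \<open>Square integrable random variables known at time \<open>a\<close>: the admissible
  coefficients of an increment that starts at \<open>a\<close>.\<close>

definition L2F :: "real \<Rightarrow> ('w \<Rightarrow> real) \<Rightarrow> bool" where
  "L2F a X \<longleftrightarrow> X \<in> borel_measurable (F a) \<and> integrable M (\<lambda>\<omega>. X \<omega> ^ 2)"

lemma L2F_D: "L2F a X \<Longrightarrow> X \<in> borel_measurable (F a)" "L2F a X \<Longrightarrow> integrable M (\<lambda>\<omega>. X \<omega> ^ 2)"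
  by (auto simp: L2F_def)

lemma L2F_measurable: "0 \<le> a \<Longrightarrow> L2F a X \<Longrightarrow> X \<in> borel_measurable M"
  using measurable_F_M by (auto simp: L2F_def)

lemma L2F_mono: "0 \<le> a \<Longrightarrow> a \<le> b \<Longrightarrow> L2F a X \<Longrightarrow> L2F b X"
  using measurable_F_mono by (auto simp: L2F_def)

lemma L2F_mult: "0 \<le> a \<Longrightarrow> 0 \<le> b \<Longrightarrow> L2F a X \<Longrightarrow> L2F b Y \<Longrightarrow> integrable M (\<lambda>\<omega>. X \<omega> * Y \<omega>)"
  using L2F_measurable L2F_D by (intro integrable_mult_L2) auto

lemma L2F_beta_mult:
  assumes a: "0 \<le> a" "a \<le> b" "b \<le> T" and X: "L2F a X" and i: "i \<in> Jp"
  shows "L2F b (\<lambda>\<omega>. X \<omega> * \<beta> i a b \<omega>)"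
proof -
  have [measurable]: "X \<in> borel_measurable (F b)" "\<beta> i a b \<in> borel_measurable (F b)"
    using L2F_D(1)[OF L2F_mono[OF a(1,2) X]] beta_measurable_F a by auto
  have "integrable M (\<lambda>\<omega>. X \<omega> ^ 2 * \<beta> i a b \<omega> ^ 2)"
    using L2F_D[OF X] by (intro adapted_times_beta(1)[OF a] i) auto
  then show ?thesis by (auto simp: L2F_def power_mult_distrib)
qed

lemma L2F_const: "0 \<le> a \<Longrightarrow> L2F a (\<lambda>_. c)"
  by (simp add: L2F_def)

lemma L2F_beta: "0 \<le> a \<Longrightarrow> a \<le> b \<Longrightarrow> b \<le> T \<Longrightarrow> i \<in> Jp \<Longrightarrow> L2F b (\<beta> i a b)"
  using L2F_beta_mult[of a b "\<lambda>_. 1" i] L2F_const by simp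

lemma L2F_product_times_beta:
  assumes "0 \<le> a" "a \<le> b" "b \<le> T" "L2F a X" "L2F a Y" "i \<in> Jp"
  shows "integrable M (\<lambda>\<omega>. (X \<omega> * Y \<omega>) * \<beta> i a b \<omega>)" "(\<integral>\<omega>. (X \<omega> * Y \<omega>) * \<beta> i a b \<omega> \<partial>M) = 0"
proof -
  have m: "(\<lambda>\<omega>. X \<omega> * Y \<omega>) \<in> borel_measurable (F a)" using assms by (auto simp: L2F_def)
  have i: "integrable M (\<lambda>\<omega>. X \<omega> * Y \<omega>)" using assms by (intro L2F_mult[of a a]) auto
  show "integrable M (\<lambda>\<omega>. (X \<omega> * Y \<omega>) * \<beta> i a b \<omega>)"
    using adapted_times_beta(1)[OF assms(1-3) m i assms(6), of 1] by simp
  show "(\<integral>\<omega>. (X \<omega> * Y \<omega>) * \<beta> i a b \<omega> \<partial>M) = 0"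
    by (rule adapted_times_beta(2)[OF assms(1-3) m i assms(6)])
qed

text \<open>If \<open>b \<le> c\<close>, the whole first factor is known at time \<open>c\<close>,
  and the later increment is centred. Otherwise both intervals are cut at \<open>c\<close> and at
  \<open>m = min b d\<close>; every resulting product contains a centred increment independent of
  the rest, except the one over the common interval [c, m].\<close>

lemma covariance_ordered:
  assumes a: "0 \<le> a" "a \<le> b" "b \<le> T" and c: "a \<le> c" "c \<le> d" "d \<le> T"
    and X: "L2F a X" and Y: "L2F c Y" and ij: "i \<in> Jp" "j \<in> Jp"
  shows "(\<integral>\<omega>. (X \<omega> * \<beta> i a b \<omega>) * (Y \<omega> * \<beta> j c d \<omega>) \<partial>M)
    = (if i = j then (\<integral>\<omega>. X \<omega> * Y \<omega> \<partial>M) * max 0 (min b d - max a c) else 0)"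
proof -
  have c0: "0 \<le> c" "0 \<le> b" "0 \<le> d" using a c by auto
  show ?thesis
  proof (cases "b \<le> c")
    case True
    have "L2F b (\<lambda>\<omega>. X \<omega> * \<beta> i a b \<omega>)" by (rule L2F_beta_mult[OF a X ij(1)])
    then have Z: "L2F c (\<lambda>\<omega>. X \<omega> * \<beta> i a b \<omega>)" using L2F_mono True c0 by blast
    have "(\<integral>\<omega>. (X \<omega> * \<beta> i a b \<omega> * Y \<omega>) * \<beta> j c d \<omega> \<partial>M) = 0"
      using L2F_D(1)[OF Z] L2F_D(1)[OF Y] L2F_mult[OF c0(1) c0(1) Z Y]
      by (intro adapted_times_beta(2) c0 c ij) auto
    then show ?thesis using True a c by (simp add: mult.assoc)
  next
    case False
    then have cb: "c \<le> b" by simp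
    define m where "m = min b d"
    have m: "c \<le> m" "m \<le> b" "m \<le> d" "m \<le> T" "0 \<le> m" using cb c c0 a by (auto simp: m_def)
    have Xc: "L2F c X" using L2F_mono[OF a(1) c(1) X] .
    have Z: "L2F c (\<lambda>\<omega>. X \<omega> * \<beta> i a c \<omega>)" using a c by (intro L2F_beta_mult X ij) auto
    have Xm: "L2F m (\<lambda>\<omega>. X \<omega> * \<beta> i c m \<omega>)" "L2F m (\<lambda>\<omega>. Y \<omega> * \<beta> j c m \<omega>)"
      using Xc Y c0 m ij by (auto intro!: L2F_beta_mult)
    have Xm': "L2F m X" "L2F m Y" using L2F_mono[OF c0(1) m(1)] Xc Y by auto
    have i1: "integrable M (\<lambda>\<omega>. (X \<omega> * \<beta> i a c \<omega> * Y \<omega>) * \<beta> j c d \<omega>)"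
      "(\<integral>\<omega>. (X \<omega> * \<beta> i a c \<omega> * Y \<omega>) * \<beta> j c d \<omega> \<partial>M) = 0"
      by (rule L2F_product_times_beta[OF c0(1) c(2,3) Z Y ij(2)])+
    have i2: "integrable M (\<lambda>\<omega>. (X \<omega> * Y \<omega>) * (\<beta> i c m \<omega> * \<beta> j c m \<omega>))"
      "(\<integral>\<omega>. (X \<omega> * Y \<omega>) * (\<beta> i c m \<omega> * \<beta> j c m \<omega>) \<partial>M) = (if i = j then (\<integral>\<omega>. X \<omega> * Y \<omega> \<partial>M) * (m - c) else 0)"
      using L2F_D(1)[OF Xc] L2F_D(1)[OF Y] L2F_mult[OF c0(1) c0(1) Xc Y] c0 m ij
      by (intro adapted_times_beta_beta; simp)+
    have i3: "integrable M (\<lambda>\<omega>. (X \<omega> * \<beta> i c m \<omega> * Y \<omega>) * \<beta> j m d \<omega>)"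
      "(\<integral>\<omega>. (X \<omega> * \<beta> i c m \<omega> * Y \<omega>) * \<beta> j m d \<omega> \<partial>M) = 0"
      by (rule L2F_product_times_beta[OF m(5,3) c(3) Xm(1) Xm'(2) ij(2)])+
    have i4: "integrable M (\<lambda>\<omega>. (Y \<omega> * \<beta> j c m \<omega> * X \<omega>) * \<beta> i m b \<omega>)"
      "(\<integral>\<omega>. (Y \<omega> * \<beta> j c m \<omega> * X \<omega>) * \<beta> i m b \<omega> \<partial>M) = 0"
      by (rule L2F_product_times_beta[OF m(5,2) a(3) Xm(2) Xm'(1) ij(1)])+
    \<comment> \<open>\<open>m\<close> is the right end of one of the two intervals, so one of the
      remainders after \<open>m\<close> is trivial and their product never appears.\<close>
    have z: "\<beta> j m d \<omega> = 0 \<or> \<beta> i m b \<omega> = 0" for \<omega> by (auto simp: m_def min_def)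
    have split: "\<beta> i a b \<omega> * \<beta> j c d \<omega>
      = \<beta> i a c \<omega> * \<beta> j c d \<omega> + \<beta> i c m \<omega> * \<beta> j c m \<omega> + \<beta> i c m \<omega> * \<beta> j m d \<omega> + \<beta> i m b \<omega> * \<beta> j c m \<omega>" for \<omega>
    proof -
      have "\<beta> i a b \<omega> = \<beta> i a c \<omega> + (\<beta> i c m \<omega> + \<beta> i m b \<omega>)" "\<beta> j c d \<omega> = \<beta> j c m \<omega> + \<beta> j m d \<omega>"
        by (simp_all add: beta_add)
      then show ?thesis using z[of \<omega>] by (auto simp: algebra_simps)
    qed
    have "(X \<omega> * \<beta> i a b \<omega>) * (Y \<omega> * \<beta> j c d \<omega>)
      = (X \<omega> * \<beta> i a c \<omega> * Y \<omega>) * \<beta> j c d \<omega> + (X \<omega> * Y \<omega>) * (\<beta> i c m \<omega> * \<beta> j c m \<omega>)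
       + (X \<omega> * \<beta> i c m \<omega> * Y \<omega>) * \<beta> j m d \<omega> + (Y \<omega> * \<beta> j c m \<omega> * X \<omega>) * \<beta> i m b \<omega>" for \<omega>
    proof -
      have "(X \<omega> * \<beta> i a b \<omega>) * (Y \<omega> * \<beta> j c d \<omega>) = (X \<omega> * Y \<omega>) * (\<beta> i a b \<omega> * \<beta> j c d \<omega>)" by simp
      then show ?thesis unfolding split by (simp add: algebra_simps)
    qed
    then have "(\<integral>\<omega>. (X \<omega> * \<beta> i a b \<omega>) * (Y \<omega> * \<beta> j c d \<omega>) \<partial>M)
      = (if i = j then (\<integral>\<omega>. X \<omega> * Y \<omega> \<partial>M) * (m - c) else 0)"
      using i1 i2 i3 i4 by simp
    then show ?thesis using c m unfolding m_def by (simp add: max_def)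
  qed
qed

lemma covariance:
  assumes a: "0 \<le> a" "a \<le> b" "b \<le> T" and c: "0 \<le> c" "c \<le> d" "d \<le> T"
    and X: "L2F a X" and Y: "L2F c Y" and ij: "i \<in> Jp" "j \<in> Jp"
  shows "(\<integral>\<omega>. (X \<omega> * \<beta> i a b \<omega>) * (Y \<omega> * \<beta> j c d \<omega>) \<partial>M)
    = (if i = j then (\<integral>\<omega>. X \<omega> * Y \<omega> \<partial>M) * max 0 (min b d - max a c) else 0)"
proof (cases "a \<le> c")
  case True then show ?thesis using assms by (intro covariance_ordered) auto
next
  case False
  then have "(\<integral>\<omega>. (Y \<omega> * \<beta> j c d \<omega>) * (X \<omega> * \<beta> i a b \<omega>) \<partial>M)
    = (if j = i then (\<integral>\<omega>. Y \<omega> * X \<omega> \<partial>M) * max 0 (min d b - max c a) else 0)"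
    using assms by (intro covariance_ordered) auto
  then show ?thesis by (simp add: mult.commute min.commute max.commute)
qed

end

section \<open>Mean squares\<close>

text \<open>From (a + b)^2 \<le> 2 a^2 + 2 b^2. Working with squares throughout avoids roots of
  extended reals; the factors 2 only enter constants.\<close>

lemma ennreal_norm_sq_triangle:
  fixes x y z :: "'a::real_normed_vector"
  shows "ennreal ((norm (x - z))\<^sup>2) \<le> 2 * ennreal ((norm (x - y))\<^sup>2) + 2 * ennreal ((norm (y - z))\<^sup>2)"
proof -
  have "norm (x - z) \<le> norm (x - y) + norm (y - z)"
    using norm_triangle_ineq[of "x - y" "y - z"] by simp
  then have "(norm (x - z))\<^sup>2 \<le> (norm (x - y) + norm (y - z))\<^sup>2" by (intro power_mono) auto
  also have "\<dots> \<le> 2 * (norm (x - y))\<^sup>2 + 2 * (norm (y - z))\<^sup>2"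
    using sum_squares_bound[of "norm (x - y)" "norm (y - z)"] by (simp add: power2_sum)
  finally have "ennreal ((norm (x - z))\<^sup>2) \<le> ennreal (2 * (norm (x - y))\<^sup>2 + 2 * (norm (y - z))\<^sup>2)"
    by (rule ennreal_leI)
  also have "\<dots> = 2 * ennreal ((norm (x - y))\<^sup>2) + 2 * ennreal ((norm (y - z))\<^sup>2)"
    by (simp add: ennreal_mult)
  finally show ?thesis .
qed

lemma mean_square_triangle:
  fixes f g h :: "'w \<Rightarrow> 'h::{real_normed_vector, second_countable_topology}"
  assumes [measurable]: "f \<in> borel_measurable M" "g \<in> borel_measurable M" "h \<in> borel_measurable M"
  shows "mean_square M (\<lambda>\<omega>. f \<omega> - h \<omega>)
    \<le> 2 * mean_square M (\<lambda>\<omega>. f \<omega> - g \<omega>) + 2 * mean_square M (\<lambda>\<omega>. g \<omega> - h \<omega>)"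
proof -
  have "mean_square M (\<lambda>\<omega>. f \<omega> - h \<omega>)
    \<le> (\<integral>\<^sup>+\<omega>. 2 * ennreal ((norm (f \<omega> - g \<omega>))\<^sup>2) + 2 * ennreal ((norm (g \<omega> - h \<omega>))\<^sup>2) \<partial>M)"
    unfolding mean_square_def by (intro nn_integral_mono ennreal_norm_sq_triangle)
  also have "\<dots> = 2 * mean_square M (\<lambda>\<omega>. f \<omega> - g \<omega>) + 2 * mean_square M (\<lambda>\<omega>. g \<omega> - h \<omega>)"
    unfolding mean_square_def by (simp add: nn_integral_add nn_integral_cmult)
  finally show ?thesis .
qed

lemma mean_square_commute:
  "mean_square M (\<lambda>\<omega>. f \<omega> - g \<omega>) = mean_square M (\<lambda>\<omega>. g \<omega> - f \<omega>)"
  by (simp add: mean_square_def norm_minus_commute)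

lemma mean_square_fatou:
  fixes f :: "nat \<Rightarrow> 'w \<Rightarrow> 'h::{real_normed_vector, second_countable_topology}"
  assumes [measurable]: "\<And>n. f n \<in> borel_measurable M"
    and lim: "AE \<omega> in M. (\<lambda>n. f n \<omega>) \<longlonglongrightarrow> g \<omega>"
  shows "mean_square M g \<le> liminf (\<lambda>n. mean_square M (f n))"
proof -
  have "mean_square M g = (\<integral>\<^sup>+\<omega>. liminf (\<lambda>n. ennreal ((norm (f n \<omega>))\<^sup>2)) \<partial>M)"
    unfolding mean_square_def
  proof (rule nn_integral_cong_AE, use lim in eventually_elim)
    case (elim \<omega>)
    then have "(\<lambda>n. ennreal ((norm (f n \<omega>))\<^sup>2)) \<longlonglongrightarrow> ennreal ((norm (g \<omega>))\<^sup>2)"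
      by (intro tendsto_intros) auto
    then show "ennreal ((norm (g \<omega>))\<^sup>2) = liminf (\<lambda>n. ennreal ((norm (f n \<omega>))\<^sup>2))"
      by (rule lim_imp_Liminf[symmetric, rotated]) simp
  qed
  also have "\<dots> \<le> liminf (\<lambda>n. mean_square M (f n))"
    unfolding mean_square_def by (rule nn_integral_liminf) measurable
  finally show ?thesis .
qed

lemma mean_square_fatou_le:
  fixes f :: "nat \<Rightarrow> 'w \<Rightarrow> 'h::{real_normed_vector, second_countable_topology}"
  assumes "\<And>n. f n \<in> borel_measurable M"
    and "AE \<omega> in M. (\<lambda>n. f n \<omega>) \<longlonglongrightarrow> g \<omega>"
    and "\<forall>\<^sub>F n in sequentially. mean_square M (f n) \<le> c"
  shows "mean_square M g \<le> c"
proof -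
  have "liminf (\<lambda>n. mean_square M (f n)) \<le> liminf (\<lambda>n. c)"
    by (rule Liminf_mono) (rule assms)
  then show ?thesis using mean_square_fatou[OF assms(1,2)] by (simp add: Liminf_const)
qed

section \<open>Finite stochastic sums and the isometry\<close>

context eigen
begin

text \<open>The squared Hilbert-Schmidt norm of an operator on \<open>U0\<close> that is represented
  only by its values on the basis. Step processes are handled in this form, without any operator
  behind them.\<close>

definition hs :: "('j \<Rightarrow> 'h::real_normed_vector) \<Rightarrow> ennreal" where
  "hs z = (\<Sum>\<^sub>\<infinity>j\<in>Jp. ennreal ((norm (z j))\<^sup>2))"

text \<open>The \<open>f j\<close> with \<open>\<eta> j > 0\<close> form an orthonormal basis of \<open>U0\<close>.\<close>

definition f :: "'j \<Rightarrow> 'u" where "f j = sqrt (\<eta> j) *\<^sub>R e j"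

lemma HS_norm_sq_eq_hs: "HS_norm_sq J \<eta> e A = hs (\<lambda>j. A (f j))"
  by (simp add: HS_norm_sq_def hs_def f_def Jp_def)

lemma hs_mono: "(\<And>j. j \<in> Jp \<Longrightarrow> norm (x j) \<le> norm (y j)) \<Longrightarrow> hs x \<le> hs y"
  unfolding hs_def by (intro infsum_mono nonneg_summable_on_complete ennreal_leI power_mono) auto

lemma hs_cong: "(\<And>j. j \<in> Jp \<Longrightarrow> norm (x j) = norm (y j)) \<Longrightarrow> hs x = hs y"
  by (intro antisym hs_mono) auto

lemma hs_finite: "finite K \<Longrightarrow> K \<subseteq> Jp \<Longrightarrow> (\<And>j. j \<in> Jp \<Longrightarrow> j \<notin> K \<Longrightarrow> z j = 0) \<Longrightarrow>
    hs z = (\<Sum>j\<in>K. ennreal ((norm (z j))\<^sup>2))"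
  unfolding hs_def by (subst infsum_finite[symmetric], simp, intro infsum_cong_neutral) auto

lemma hs_triangle: "hs (\<lambda>j. x j - z j) \<le> 2 * hs (\<lambda>j. x j - y j) + 2 * hs (\<lambda>j. y j - z j)"
proof -
  have *: "(g :: 'j \<Rightarrow> ennreal) summable_on Jp" for g by (rule nonneg_summable_on_complete) simp
  have c: "(\<Sum>\<^sub>\<infinity>j\<in>Jp. 2 * g j) = 2 * infsum g Jp" for g :: "'j \<Rightarrow> ennreal"
    unfolding mult_2 by (rule infsum_add[OF * *])
  have "hs (\<lambda>j. x j - z j) \<le> (\<Sum>\<^sub>\<infinity>j\<in>Jp. 2 * ennreal ((norm (x j - y j))\<^sup>2) + 2 * ennreal ((norm (y j - z j))\<^sup>2))"
    unfolding hs_def by (intro infsum_mono * ennreal_norm_sq_triangle)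
  also have "\<dots> = 2 * hs (\<lambda>j. x j - y j) + 2 * hs (\<lambda>j. y j - z j)"
    unfolding hs_def c[symmetric] by (rule infsum_add[OF * *])
  finally show ?thesis .
qed

end

context q_wiener
begin

text \<open>A fixed enumeration of \<open>Jp\<close> yields increasing finite sets, so that nets
  over finite sets become sequences. If \<open>Jp\<close> is finite the sets are eventually equal to
  it; \<open>N 0\<close> is empty.\<close>

definition N :: "nat \<Rightarrow> 'j set" where "N n = {j\<in>Jp. to_nat_on Jp j < n}"

lemma countable_Jp: "countable Jp"
  using countable_J Jp_subset countable_subset by blast

lemma finite_N: "finite (N n)"
proof -
  have "inj_on (to_nat_on Jp) (N n)"
    using inj_on_to_nat_on[OF countable_Jp] by (rule inj_on_subset) (auto simp: N_def)
  moreover have "to_nat_on Jp ` N n \<subseteq> {..<n}" by (auto simp: N_def)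
  ultimately show ?thesis using finite_imageD finite_subset finite_lessThan by metis
qed

lemma N_subset: "N n \<subseteq> Jp" by (auto simp: N_def)

lemma N_mono: "m \<le> n \<Longrightarrow> N m \<subseteq> N n" by (auto simp: N_def)

lemma incseq_N: "incseq N" using N_mono by (simp add: incseq_def)

lemma N_union: "(\<Union>n. N n) = Jp" by (auto simp: N_def)

lemma finite_subset_N: "finite K \<Longrightarrow> K \<subseteq> Jp \<Longrightarrow> \<exists>n. K \<subseteq> N n"
proof (induction K rule: finite_induct)
  case (insert a A)
  then obtain n where n: "A \<subseteq> N n" by auto
  have "a \<in> (\<Union>n. N n)" using insert N_union by simp
  then obtain m where "a \<in> N m" by blast
  with n
  have "insert a A \<subseteq> N (max n m)" using N_mono[of n "max n m"] N_mono[of m "max n m"] by auto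
  then show ?case by blast
qed auto

text \<open>The sets \<open>N n\<close> are cofinal among the finite subsets of \<open>Jp\<close>.
  The supremum becomes a countable one, from which measurability of \<open>hs\<close> in a parameter
  follows.\<close>

lemma infsum_Jp_SUP: "infsum g Jp = (SUP n. sum g (N n))" for g :: "'j \<Rightarrow> ennreal"
proof (rule antisym)
  have "sum g K \<le> (SUP n. sum g (N n))" if K: "finite K" "K \<subseteq> Jp" for K
  proof -
    obtain n where "K \<subseteq> N n" using finite_subset_N[OF K] by blast
    then have "sum g K \<le> sum g (N n)" by (intro sum_mono2 finite_N) auto
    then show ?thesis by (rule order_trans) (rule SUP_upper, simp)
  qed
  then show "infsum g Jp \<le> (SUP n. sum g (N n))"
    by (subst nonneg_infsum_complete) (auto intro!: SUP_least)
  show "(SUP n. sum g (N n)) \<le> infsum g Jp"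
  proof (rule SUP_least)
    fix n
    show "sum g (N n) \<le> infsum g Jp"
      using finite_N N_subset by (subst nonneg_infsum_complete) (auto intro!: SUP_upper)
  qed
qed

lemma hs_SUP: "hs z = (SUP n. \<Sum>j\<in>N n. ennreal ((norm (z j))\<^sup>2))"
  unfolding hs_def by (rule infsum_Jp_SUP)

lemma hs_measurable:
  fixes z :: "'a \<Rightarrow> 'j \<Rightarrow> 'h::{real_normed_vector, second_countable_topology}"
  assumes "\<And>j. j \<in> Jp \<Longrightarrow> (\<lambda>x. z x j) \<in> borel_measurable A"
  shows "(\<lambda>x. hs (z x)) \<in> borel_measurable A"
  unfolding hs_SUP
proof (intro borel_measurable_SUP borel_measurable_sum)
  fix n j assume "j \<in> N n"
  then have [measurable]: "(\<lambda>x. z x j) \<in> borel_measurable A" using assms N_subset by blast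
  show "(\<lambda>x. ennreal ((norm (z x j))\<^sup>2)) \<in> borel_measurable A" by measurable
qed simp

text \<open>\<open>rep a b \<Gamma> I\<close>: the random variable \<open>I\<close> is a finite sum of terms \<open>X * \<beta> j c d\<close> with \<open>X\<close> known
  at time \<open>c\<close>, and \<open>\<Gamma> s \<omega> j\<close> is the value of the corresponding step process on the basis
  vector \<open>f j\<close> of \<open>U0\<close>. In contrast to \<open>elementary\<close>, \<open>X\<close> need not be simple.\<close>

inductive rep ::
  "real \<Rightarrow> real \<Rightarrow> (real \<Rightarrow> 'w \<Rightarrow> 'j \<Rightarrow> 'h::{real_inner, second_countable_topology}) \<Rightarrow> ('w \<Rightarrow> 'h) \<Rightarrow> bool"
  for a b where
  rep_zero: "rep a b (\<lambda>_ _ _. 0) (\<lambda>_. 0)"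
| rep_term: "rep a b \<Gamma> I \<Longrightarrow> a \<le> c \<Longrightarrow> c \<le> d \<Longrightarrow> d \<le> b \<Longrightarrow> L2F c X \<Longrightarrow> j \<in> Jp \<Longrightarrow>
    rep a b (\<lambda>s \<omega> i. \<Gamma> s \<omega> i + (if i = j then (X \<omega> * indicat_real {c<..d} s) *\<^sub>R v else 0))
      (\<lambda>\<omega>. I \<omega> + (X \<omega> * \<beta> j c d \<omega>) *\<^sub>R v)"
| rep_cong: "rep a b \<Gamma> I \<Longrightarrow> (\<And>\<omega>. \<omega> \<in> space M \<Longrightarrow> I' \<omega> = I \<omega>) \<Longrightarrow>
    (\<And>s \<omega> i. \<omega> \<in> space M \<Longrightarrow> \<Gamma>' s \<omega> i = \<Gamma> s \<omega> i) \<Longrightarrow> rep a b \<Gamma>' I'"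

lemma rep_single:
  assumes "a \<le> c" "c \<le> d" "d \<le> b" "L2F c X" "j \<in> Jp"
  shows "rep a b (\<lambda>s \<omega> i. if i = j then (X \<omega> * indicat_real {c<..d} s) *\<^sub>R v else 0)
      (\<lambda>\<omega>. (X \<omega> * \<beta> j c d \<omega>) *\<^sub>R v)"
  using rep_term[OF rep_zero assms] by simp

lemma rep_add:
  assumes "rep a b \<Gamma>' I'" "rep a b \<Gamma> I"
  shows "rep a b (\<lambda>s \<omega> i. \<Gamma>' s \<omega> i + \<Gamma> s \<omega> i) (\<lambda>\<omega>. I' \<omega> + I \<omega>)"
  using assms(1)
proof (induction rule: rep.induct)
  case rep_zero then show ?case using assms(2) by simp
next
  case (rep_term \<Gamma>' I' c d X j v)
  from rep.rep_term[OF rep_term(7) rep_term(2-6), of v] show ?case by (simp add: ac_simps)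
next
  case (rep_cong \<Gamma>1 I1 I2 \<Gamma>2)
  show ?case by (rule rep.rep_cong[OF rep_cong(4)]) (simp_all add: rep_cong)
qed

lemma rep_minus: "rep a b \<Gamma> I \<Longrightarrow> rep a b (\<lambda>s \<omega> i. - \<Gamma> s \<omega> i) (\<lambda>\<omega>. - I \<omega>)"
proof (induction rule: rep.induct)
  case rep_zero then show ?case using rep.rep_zero by simp
next
  case (rep_term \<Gamma>' I' c d X j v)
  show ?case by (rule rep.rep_cong[OF rep.rep_term[OF rep_term(7) rep_term(2-6), of "- v"]]) auto
next
  case (rep_cong \<Gamma>1 I1 I2 \<Gamma>2)
  show ?case by (rule rep.rep_cong[OF rep_cong(4)]) (simp_all add: rep_cong)
qed

lemma rep_diff: "rep a b \<Gamma>' I' \<Longrightarrow> rep a b \<Gamma> I \<Longrightarrow> rep a b (\<lambda>s \<omega> i. \<Gamma>' s \<omega> i - \<Gamma> s \<omega> i) (\<lambda>\<omega>. I' \<omega> - I \<omega>)"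
  by (rule rep_cong[OF rep_add[OF _ rep_minus]]) auto

lemma rep_sum:
  "finite P \<Longrightarrow> (\<And>p. p \<in> P \<Longrightarrow> rep a b (\<Gamma> p) (I p)) \<Longrightarrow>
    rep a b (\<lambda>s \<omega> i. \<Sum>p\<in>P. \<Gamma> p s \<omega> i) (\<lambda>\<omega>. \<Sum>p\<in>P. I p \<omega>)"
proof (induction P rule: finite_induct)
  case empty then show ?case using rep_zero by simp
next
  case (insert p P) then show ?case using rep_add[of a b "\<Gamma> p" "I p"] by simp
qed

lemma rep_support: "rep a b \<Gamma> I \<Longrightarrow> \<exists>K. finite K \<and> K \<subseteq> Jp \<and> (\<forall>s. \<forall>\<omega>\<in>space M. \<forall>i. i \<notin> K \<longrightarrow> \<Gamma> s \<omega> i = 0)"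
proof (induction rule: rep.induct)
  case (rep_term \<Gamma>' I' c d X j v)
  then obtain K where "finite K" "K \<subseteq> Jp" "\<forall>s. \<forall>\<omega>\<in>space M. \<forall>i. i \<notin> K \<longrightarrow> \<Gamma>' s \<omega> i = 0" by blast
  with rep_term show ?case by (intro exI[of _ "insert j K"]) auto
next
  case (rep_cong \<Gamma>1 I1 I2 \<Gamma>2)
  then obtain K where "finite K" "K \<subseteq> Jp" "\<forall>s. \<forall>\<omega>\<in>space M. \<forall>i. i \<notin> K \<longrightarrow> \<Gamma>1 s \<omega> i = 0" by blast
  with rep_cong show ?case by (intro exI[of _ K]) auto
qed auto

lemma rep_measurable:
  assumes "0 \<le> a" "b \<le> T" "rep a b \<Gamma> I"
  shows "I \<in> borel_measurable M" and "(\<lambda>\<omega>. \<Gamma> s \<omega> i) \<in> borel_measurable M"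
proof -
  from assms(3) have "I \<in> borel_measurable M \<and> (\<forall>s i. (\<lambda>\<omega>. \<Gamma> s \<omega> i) \<in> borel_measurable M)"
  proof (induction rule: rep.induct)
    case (rep_term \<Gamma>' I' c d X j v)
    then have [measurable]: "X \<in> borel_measurable M" "\<beta> j c d \<in> borel_measurable M"
      "I' \<in> borel_measurable M" "\<And>s i. (\<lambda>\<omega>. \<Gamma>' s \<omega> i) \<in> borel_measurable M"
      using L2F_measurable[of c X] assms(1,2) by auto
    show ?case by auto
  next
    case (rep_cong \<Gamma>1 I1 I2 \<Gamma>2)
    then show ?case using measurable_cong[of M I2 I1 borel]
      measurable_cong[of M "\<lambda>\<omega>. \<Gamma>2 s \<omega> i" "\<lambda>\<omega>. \<Gamma>1 s \<omega> i" borel for s i] by (simp cong: measurable_cong)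
  qed auto
  then show "I \<in> borel_measurable M" and "(\<lambda>\<omega>. \<Gamma> s \<omega> i) \<in> borel_measurable M" by auto
qed

text \<open>Turns a derivation of \<open>rep\<close> into an explicit family of \<open>n\<close>
  terms, on which a squared norm can be expanded as a double sum.\<close>

lemma rep_sum_form:
  fixes I :: "'w \<Rightarrow> 'h::{real_inner, second_countable_topology}"
  shows "rep a b \<Gamma> I \<Longrightarrow> \<exists>(n::nat) X c d j v.
     (\<forall>p<n. a \<le> c p \<and> c p \<le> d p \<and> d p \<le> b \<and> L2F (c p) (X p) \<and> j p \<in> Jp) \<and>
     (\<forall>\<omega>\<in>space M. I \<omega> = (\<Sum>p<n. (X p \<omega> * \<beta> (j p) (c p) (d p) \<omega>) *\<^sub>R v p) \<and>
       (\<forall>s i. \<Gamma> s \<omega> i = (\<Sum>p<n. if i = j p then (X p \<omega> * indicat_real {c p<..d p} s) *\<^sub>R v p else 0)))"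
proof (induction rule: rep.induct)
  case rep_zero then show ?case by (intro exI[of _ 0]) auto
next
  case (rep_term \<Gamma>' I' c' d' X' j' v')
  then obtain n :: nat and X c d j v where *:
    "\<And>p. p < n \<Longrightarrow> a \<le> c p \<and> c p \<le> d p \<and> d p \<le> b \<and> L2F (c p) (X p) \<and> j p \<in> Jp"
    "\<And>\<omega>. \<omega> \<in> space M \<Longrightarrow> I' \<omega> = (\<Sum>p<n. (X p \<omega> * \<beta> (j p) (c p) (d p) \<omega>) *\<^sub>R v p)"
    "\<And>\<omega> s i. \<omega> \<in> space M \<Longrightarrow> \<Gamma>' s \<omega> i = (\<Sum>p<n. if i = j p then (X p \<omega> * indicat_real {c p<..d p} s) *\<^sub>R v p else 0)"
    by blast
  \<comment> \<open>The new term is stored at index \<open>n\<close> by function updates; these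
    leave the first \<open>n\<close> terms alone.\<close>
  have upd: "(\<Sum>p<n. G ((X(n := X')) p) ((c(n := c')) p) ((d(n := d')) p) ((j(n := j')) p) ((v(n := v')) p))
    = (\<Sum>p<n. G (X p) (c p) (d p) (j p) (v p))" for G :: "_ \<Rightarrow> _ \<Rightarrow> _ \<Rightarrow> _ \<Rightarrow> _ \<Rightarrow> 'h"
    by (intro sum.cong) auto
  show ?case
  proof (intro exI conjI allI impI ballI)
    fix p assume "p < Suc n"
    then show "a \<le> (c(n := c')) p" "(c(n := c')) p \<le> (d(n := d')) p" "(d(n := d')) p \<le> b"
      "L2F ((c(n := c')) p) ((X(n := X')) p)" "(j(n := j')) p \<in> Jp"
      using rep_term(2-6) *(1)[of p] by (auto simp: less_Suc_eq)
  next
    fix \<omega> assume \<omega>: "\<omega> \<in> space M"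
    show "I' \<omega> + (X' \<omega> * \<beta> j' c' d' \<omega>) *\<^sub>R v' = (\<Sum>p<Suc n. ((X(n := X')) p \<omega> * \<beta> ((j(n := j')) p) ((c(n := c')) p) ((d(n := d')) p) \<omega>) *\<^sub>R (v(n := v')) p)"
      using upd[of "\<lambda>X c d j v. (X \<omega> * \<beta> j c d \<omega>) *\<^sub>R v"] by (simp add: *(2)[OF \<omega>])
    fix s i
    show "\<Gamma>' s \<omega> i + (if i = j' then (X' \<omega> * indicat_real {c'<..d'} s) *\<^sub>R v' else 0)
      = (\<Sum>p<Suc n. if i = (j(n := j')) p then ((X(n := X')) p \<omega> * indicat_real {(c(n := c')) p<..(d(n := d')) p} s) *\<^sub>R (v(n := v')) p else 0)"
      using upd[of "\<lambda>X c d j v. if i = j then (X \<omega> * indicat_real {c<..d} s) *\<^sub>R v else 0"] by (simp add: *(3)[OF \<omega>])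
  qed
next
  case (rep_cong \<Gamma>1 I1 I2 \<Gamma>2)
  then show ?case by simp
qed

lemma integral_double_sum:
  fixes g :: "nat \<Rightarrow> nat \<Rightarrow> 'a \<Rightarrow> real"
  assumes "\<And>p q. p < n \<Longrightarrow> q < n \<Longrightarrow> integrable A (g p q)"
  shows "(\<integral>x. (\<Sum>p<n. \<Sum>q<n. g p q x) \<partial>A) = (\<Sum>p<n. \<Sum>q<n. \<integral>x. g p q x \<partial>A)"
proof -
  have "(\<integral>x. (\<Sum>p<n. \<Sum>q<n. g p q x) \<partial>A) = (\<Sum>p<n. \<integral>x. (\<Sum>q<n. g p q x) \<partial>A)"
    using assms by (intro Bochner_Integration.integral_sum Bochner_Integration.integrable_sum) auto
  also have "\<dots> = (\<Sum>p<n. \<Sum>q<n. \<integral>x. g p q x \<partial>A)"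
    using assms by (intro sum.cong refl Bochner_Integration.integral_sum) auto
  finally show ?thesis .
qed

text \<open>The length of the overlap is the same expression as in \<open>covariance\<close>. This
  agreement is the whole content of the isometry.\<close>

lemma nn_integral_overlap:
  fixes c d c' d' :: real
  shows "integrable lborel (\<lambda>s. indicat_real {c<..d} s * indicat_real {c'<..d'} s)"
    and "(\<integral>s. indicat_real {c<..d} s * indicat_real {c'<..d'} s \<partial>lborel) = max 0 (min d d' - max c c')"
proof -
  have *: "(\<lambda>s. indicat_real {c<..d} s * indicat_real {c'<..d'} s) = indicat_real {max c c'<..min d d'}"
    by (auto simp: indicator_def fun_eq_iff)
  show "integrable lborel (\<lambda>s. indicat_real {c<..d} s * indicat_real {c'<..d'} s)"
    unfolding * by (cases "max c c' \<le> min d d'") (auto intro!: integrable_real_indicator)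
  show "(\<integral>s. indicat_real {c<..d} s * indicat_real {c'<..d'} s \<partial>lborel) = max 0 (min d d' - max c c')"
  proof (cases "max c c' \<le> min d d'")
    case True
    have "(\<integral>s. indicat_real {u<..w} s \<partial>lborel) = max 0 (w - u)" if "u \<le> w" for u w :: real
      using that by simp
    from this[OF True] show ?thesis unfolding * .
  next
    case False
    then have e: "{max c c'<..min d d'} = {}" by auto
    have "min d d' - max c c' \<le> 0" using False by linarith
    then have "max 0 (min d d' - max c c') = 0" by (rule max_absorb1)
    then show ?thesis unfolding * e by simp
  qed
qed

text \<open>Both sides are the double sum of \<open>\<kappa> p q * len p q\<close>: on the left by
  the covariances of the terms, on the right because the product of the indicators of two intervals
  integrates to their overlap.\<close>

theorem isometry:
  fixes I :: "'w \<Rightarrow> 'h::{real_inner, second_countable_topology}"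
  assumes ab: "0 \<le> a" "b \<le> T" and rep: "rep a b \<Gamma> I"
  shows "mean_square M I = (\<integral>\<^sup>+s\<in>{a..b}. (\<integral>\<^sup>+\<omega>. hs (\<Gamma> s \<omega>) \<partial>M) \<partial>lborel)"
proof -
  obtain n :: nat and X c d j v where *:
    "\<And>p. p < n \<Longrightarrow> a \<le> c p \<and> c p \<le> d p \<and> d p \<le> b \<and> L2F (c p) (X p) \<and> j p \<in> Jp"
    "\<And>\<omega>. \<omega> \<in> space M \<Longrightarrow> I \<omega> = (\<Sum>p<n. (X p \<omega> * \<beta> (j p) (c p) (d p) \<omega>) *\<^sub>R v p)"
    "\<And>\<omega> s i. \<omega> \<in> space M \<Longrightarrow> \<Gamma> s \<omega> i = (\<Sum>p<n. if i = j p then (X p \<omega> * indicat_real {c p<..d p} s) *\<^sub>R v p else 0)"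
    using rep_sum_form[OF rep] by blast
  define K where "K = j ` {..<n}"
  have K: "finite K" "K \<subseteq> Jp" using * by (auto simp: K_def)
  define x where "x p \<omega> = X p \<omega> * \<beta> (j p) (c p) (d p) \<omega>" for p \<omega>
  define ind where "ind p = indicat_real {c p<..d p}" for p
  define \<kappa> where "\<kappa> p q = (if j p = j q then (\<integral>\<omega>. X p \<omega> * X q \<omega> \<partial>M) * (v p \<bullet> v q) else 0)" for p q
  define len where "len p q = max 0 (min (d p) (d q) - max (c p) (c q))" for p q
  have bnd: "0 \<le> c p" "c p \<le> d p" "d p \<le> T" "L2F (c p) (X p)" "j p \<in> Jp" if "p < n" for p
    using *(1)[OF that] ab by auto
  have xL2: "L2F (d p) (x p)" if "p < n" for p
    unfolding x_def using bnd[OF that] by (intro L2F_beta_mult)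
  have xx: "integrable M (\<lambda>\<omega>. x p \<omega> * x q \<omega>)" if "p < n" "q < n" for p q
    using L2F_mult[OF _ _ xL2[OF that(1)] xL2[OF that(2)]] bnd that by (meson order_trans)
  have XX: "integrable M (\<lambda>\<omega>. X p \<omega> * X q \<omega>)" if "p < n" "q < n" for p q
    using L2F_mult[OF _ _ bnd(4)[OF that(1)] bnd(4)[OF that(2)]] bnd that by blast
  have Exx: "(\<integral>\<omega>. x p \<omega> * x q \<omega> \<partial>M) * (v p \<bullet> v q) = \<kappa> p q * len p q" if "p < n" "q < n" for p q
    unfolding x_def \<kappa>_def len_def
    using covariance[OF bnd(1-3)[OF that(1)] bnd(1-3)[OF that(2)] bnd(4)[OF that(1)] bnd(4)[OF that(2)]
        bnd(5)[OF that(1)] bnd(5)[OF that(2)]] by simp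
  have sq: "(norm (\<Sum>p\<in>P. y p *\<^sub>R v p))\<^sup>2 = (\<Sum>p\<in>P. \<Sum>q\<in>P. y p * y q * (v p \<bullet> v q))" for P and y :: "nat \<Rightarrow> real"
    unfolding power2_norm_eq_inner inner_sum_left inner_sum_right
    by (intro sum.cong refl) (simp add: inner_commute mult_ac)
  have "mean_square M I = (\<integral>\<^sup>+\<omega>. ennreal (\<Sum>p<n. \<Sum>q<n. x p \<omega> * x q \<omega> * (v p \<bullet> v q)) \<partial>M)"
    unfolding mean_square_def by (intro nn_integral_cong) (simp add: *(2) sq[symmetric] x_def)
  also have "\<dots> = ennreal (\<integral>\<omega>. (\<Sum>p<n. \<Sum>q<n. x p \<omega> * x q \<omega> * (v p \<bullet> v q)) \<partial>M)"
    by (intro nn_integral_eq_integral Bochner_Integration.integrable_sum integrable_mult_left xx)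
       (auto simp: sq[symmetric])
  also have "(\<integral>\<omega>. (\<Sum>p<n. \<Sum>q<n. x p \<omega> * x q \<omega> * (v p \<bullet> v q)) \<partial>M) = (\<Sum>p<n. \<Sum>q<n. \<kappa> p q * len p q)"
    using xx Exx by (subst integral_double_sum) (auto intro!: sum.cong)
  finally have lhs: "mean_square M I = ennreal (\<Sum>p<n. \<Sum>q<n. \<kappa> p q * len p q)" .

  \<comment> \<open>The squared Hilbert-Schmidt norm of the step process at time \<open>s\<close>:
    two terms interact only if they belong to the same basis vector.\<close>
  define g where "g s \<omega> = (\<Sum>p<n. \<Sum>q<n. (if j p = j q then X p \<omega> * X q \<omega> * (ind p s * ind q s) * (v p \<bullet> v q) else 0))" for s \<omega>
  have gi: "(\<Sum>i\<in>K. (norm (\<Gamma> s \<omega> i))\<^sup>2) = g s \<omega>" if \<omega>: "\<omega> \<in> space M" for s \<omega>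
  proof -
    have "(norm (\<Gamma> s \<omega> i))\<^sup>2 = (\<Sum>p<n. \<Sum>q<n. (if i = j p then X p \<omega> * ind p s else 0) * (if i = j q then X q \<omega> * ind q s else 0) * (v p \<bullet> v q))" for i
    proof -
      have "\<Gamma> s \<omega> i = (\<Sum>p<n. (if i = j p then X p \<omega> * ind p s else 0) *\<^sub>R v p)"
        unfolding *(3)[OF \<omega>] ind_def by (intro sum.cong) auto
      then show ?thesis by (simp only: sq)
    qed
    then have "(\<Sum>i\<in>K. (norm (\<Gamma> s \<omega> i))\<^sup>2) = (\<Sum>i\<in>K. \<Sum>p<n. \<Sum>q<n. (if i = j p then X p \<omega> * ind p s else 0) * (if i = j q then X q \<omega> * ind q s else 0) * (v p \<bullet> v q))"
      by simp
    also have "\<dots> = (\<Sum>p<n. \<Sum>q<n. \<Sum>i\<in>K. (if i = j p then X p \<omega> * ind p s else 0) * (if i = j q then X q \<omega> * ind q s else 0) * (v p \<bullet> v q))"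
      by (subst sum.swap, intro sum.cong refl, subst sum.swap, rule refl)
    also have "\<dots> = g s \<omega>"
      unfolding g_def
    proof (intro sum.cong refl)
      fix p q assume "p \<in> {..<n}" "q \<in> {..<n}"
      have "(\<Sum>i\<in>K. (if i = j p then X p \<omega> * ind p s else 0) * (if i = j q then X q \<omega> * ind q s else 0) * (v p \<bullet> v q))
        = (\<Sum>i\<in>K. if i = j p then (if j p = j q then X p \<omega> * X q \<omega> * (ind p s * ind q s) * (v p \<bullet> v q) else 0) else 0)"
        by (intro sum.cong) auto
      also have "\<dots> = (if j p = j q then X p \<omega> * X q \<omega> * (ind p s * ind q s) * (v p \<bullet> v q) else 0)"
        using K \<open>p \<in> {..<n}\<close> by (subst sum.delta) (auto simp: K_def)
      finally show "(\<Sum>i\<in>K. (if i = j p then X p \<omega> * ind p s else 0) * (if i = j q then X q \<omega> * ind q s else 0) * (v p \<bullet> v q))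
        = (if j p = j q then X p \<omega> * X q \<omega> * (ind p s * ind q s) * (v p \<bullet> v q) else 0)" .
    qed
    finally show ?thesis .
  qed
  have g_nonneg: "0 \<le> g s \<omega>" if "\<omega> \<in> space M" for s \<omega>
    unfolding gi[OF that, symmetric] by (intro sum_nonneg) auto
  have gint: "integrable M (g s)" for s
    unfolding g_def
  proof (intro Bochner_Integration.integrable_sum)
    fix p q assume "p \<in> {..<n}" "q \<in> {..<n}"
    then show "integrable M (\<lambda>\<omega>. if j p = j q then X p \<omega> * X q \<omega> * (ind p s * ind q s) * (v p \<bullet> v q) else 0)"
      using XX[of p q] by (cases "j p = j q") auto
  qed
  have Eg: "(\<integral>\<omega>. g s \<omega> \<partial>M) = (\<Sum>p<n. \<Sum>q<n. \<kappa> p q * (ind p s * ind q s))" for s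
  proof -
    have i: "integrable M (\<lambda>\<omega>. if j p = j q then X p \<omega> * X q \<omega> * (ind p s * ind q s) * (v p \<bullet> v q) else 0)" if "p < n" "q < n" for p q
      using XX[OF that] by (cases "j p = j q") auto
    have "(\<integral>\<omega>. g s \<omega> \<partial>M) = (\<Sum>p<n. \<Sum>q<n. (\<integral>\<omega>. (if j p = j q then X p \<omega> * X q \<omega> * (ind p s * ind q s) * (v p \<bullet> v q) else 0) \<partial>M))"
      unfolding g_def using i by (rule integral_double_sum)
    also have "\<dots> = (\<Sum>p<n. \<Sum>q<n. \<kappa> p q * (ind p s * ind q s))"
      using XX by (intro sum.cong refl) (auto simp: \<kappa>_def)
    finally show ?thesis .
  qed
  have "(\<integral>\<^sup>+\<omega>. hs (\<Gamma> s \<omega>) \<partial>M) = ennreal (\<Sum>p<n. \<Sum>q<n. \<kappa> p q * (ind p s * ind q s))" for s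
  proof -
    have "(\<integral>\<^sup>+\<omega>. hs (\<Gamma> s \<omega>) \<partial>M) = (\<integral>\<^sup>+\<omega>. ennreal (g s \<omega>) \<partial>M)"
    proof (rule nn_integral_cong)
      fix \<omega> assume \<omega>: "\<omega> \<in> space M"
      have "hs (\<Gamma> s \<omega>) = (\<Sum>i\<in>K. ennreal ((norm (\<Gamma> s \<omega> i))\<^sup>2))"
        using K \<omega> by (intro hs_finite) (auto simp: *(3) K_def intro!: sum.neutral)
      then show "hs (\<Gamma> s \<omega>) = ennreal (g s \<omega>)" by (simp add: gi[OF \<omega>])
    qed
    also have "\<dots> = ennreal (\<integral>\<omega>. g s \<omega> \<partial>M)"
      using g_nonneg by (intro nn_integral_eq_integral gint) auto
    finally show ?thesis unfolding Eg .
  qed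
  note in1 = this
  have nn: "0 \<le> (\<Sum>p<n. \<Sum>q<n. \<kappa> p q * (ind p s * ind q s))" for s
    unfolding Eg[symmetric] using g_nonneg by (intro integral_nonneg_AE) auto
  have "(\<integral>\<^sup>+s\<in>{a..b}. (\<integral>\<^sup>+\<omega>. hs (\<Gamma> s \<omega>) \<partial>M) \<partial>lborel) = (\<integral>\<^sup>+s. ennreal (\<Sum>p<n. \<Sum>q<n. \<kappa> p q * (ind p s * ind q s)) \<partial>lborel)"
  proof (rule nn_integral_cong)
    fix s :: real
    show "(\<integral>\<^sup>+\<omega>. hs (\<Gamma> s \<omega>) \<partial>M) * indicator {a..b} s = ennreal (\<Sum>p<n. \<Sum>q<n. \<kappa> p q * (ind p s * ind q s))"
    proof (cases "s \<in> {a..b}")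
      case False
      have "ind p s = 0" if "p < n" for p using *(1)[OF that] False by (auto simp: ind_def indicator_def)
      then show ?thesis using False by simp
    qed (simp add: in1)
  qed
  also have "\<dots> = ennreal (\<integral>s. (\<Sum>p<n. \<Sum>q<n. \<kappa> p q * (ind p s * ind q s)) \<partial>lborel)"
    unfolding ind_def
    by (intro nn_integral_eq_integral Bochner_Integration.integrable_sum integrable_mult_right nn_integral_overlap(1))
       (use nn in \<open>simp add: ind_def\<close>)
  also have "(\<integral>s. (\<Sum>p<n. \<Sum>q<n. \<kappa> p q * (ind p s * ind q s)) \<partial>lborel) = (\<Sum>p<n. \<Sum>q<n. \<kappa> p q * len p q)"
    unfolding ind_def len_def
    by (subst integral_double_sum) (auto intro!: integrable_mult_right nn_integral_overlap(1) simp: nn_integral_overlap(2))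
  finally show ?thesis unfolding lhs by simp
qed

end

section \<open>Completeness of \<open>L2\<close> and the Ito bound\<close>

lemma ennreal_tendsto_0_if_small:
  fixes g :: "nat \<Rightarrow> ennreal"
  assumes "\<And>\<epsilon>::real. 0 < \<epsilon> \<Longrightarrow> \<exists>K. \<forall>n\<ge>K. g n \<le> ennreal \<epsilon>"
  shows "g \<longlonglongrightarrow> 0"
proof (rule order_tendstoI)
  fix y :: ennreal assume "0 < y"
  then obtain z where z: "0 < z" "z < y" using dense by blast
  then obtain \<epsilon> where e: "z = ennreal \<epsilon>" by (cases z) auto
  then have "0 < \<epsilon>" using z by simp
  from assms[OF this] obtain K where "\<And>n. K \<le> n \<Longrightarrow> g n \<le> ennreal \<epsilon>" by blast
  then have "\<And>n. K \<le> n \<Longrightarrow> g n < y" using z e by (metis order_le_less_trans)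
  then show "\<forall>\<^sub>F n in sequentially. g n < y" unfolding eventually_sequentially by blast
qed simp

lemma ennreal_tendsto_0_small:
  fixes g :: "nat \<Rightarrow> ennreal"
  assumes "g \<longlonglongrightarrow> 0" "0 < (\<epsilon>::real)"
  shows "\<exists>K. \<forall>n\<ge>K. g n \<le> ennreal \<epsilon>"
  using order_tendstoD(2)[OF assms(1), of "ennreal \<epsilon>"] assms(2)
  by (auto simp: eventually_sequentially intro: less_imp_le)

text \<open>Riesz-Fischer: along a subsequence the successive differences are summable in mean, so
  it converges almost surely. Fatou's lemma then compares the limit with every late member of the
  full sequence.\<close>

lemma (in prob_space) mean_square_Cauchy_limit:
  fixes g :: "nat \<Rightarrow> 'a \<Rightarrow> 'h::{real_normed_vector, banach, second_countable_topology}"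
  assumes [measurable]: "\<And>n. g n \<in> borel_measurable M"
    and Cauchy: "\<And>\<epsilon>::real. 0 < \<epsilon> \<Longrightarrow> \<exists>K. \<forall>m\<ge>K. \<forall>n\<ge>K. mean_square M (\<lambda>\<omega>. g m \<omega> - g n \<omega>) \<le> ennreal \<epsilon>"
  obtains I where "I \<in> borel_measurable M" "(\<lambda>n. mean_square M (\<lambda>\<omega>. I \<omega> - g n \<omega>)) \<longlonglongrightarrow> 0"
proof -
  have "\<forall>k. \<exists>K. \<forall>m\<ge>K. \<forall>n\<ge>K. mean_square M (\<lambda>\<omega>. g m \<omega> - g n \<omega>) \<le> ennreal ((1/4)^k)"
    using Cauchy by simp
  then obtain K where K: "\<And>k m n. K k \<le> m \<Longrightarrow> K k \<le> n \<Longrightarrow>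
      mean_square M (\<lambda>\<omega>. g m \<omega> - g n \<omega>) \<le> ennreal ((1/4)^k)" by metis
  \<comment> \<open>Summing all earlier thresholds makes both \<open>r k\<close> and
    \<open>r (Suc k)\<close> exceed \<open>K k\<close> although \<open>K\<close> need not be
    monotone; the summand \<open>k\<close> makes the indices unbounded.\<close>
  define r where "r k = k + (\<Sum>i\<le>k. K i)" for k
  have rK: "K k \<le> r k" "K k \<le> r (Suc k)" "k \<le> r k" for k
    using member_le_sum[of k "{..k}" K] by (auto simp: r_def)
  define d where "d k \<omega> = g (r (Suc k)) \<omega> - g (r k) \<omega>" for k \<omega>
  have [measurable]: "d k \<in> borel_measurable M" for k unfolding d_def by measurable
  have Ed: "(\<integral>\<^sup>+\<omega>. ennreal (norm (d k \<omega>)) \<partial>M) \<le> ennreal (2 * (1/2)^k)" for k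
  proof -
    \<comment> \<open>The bound x \<le> \<epsilon> + x^2/\<epsilon> with \<epsilon> = 2^-k passes
      from mean squares to means; a mean square of 4^-k then leaves 2 * 2^-k.\<close>
    have "norm x \<le> (1/2)^k + 2^k * (norm x)\<^sup>2" for x :: 'h
    proof (cases "norm x \<le> (1/2)^k")
      case False
      then have "norm x * (1/2)^k \<le> norm x * norm x" by (intro mult_left_mono) auto
      then have "norm x \<le> 2^k * (norm x)\<^sup>2" by (simp add: power2_eq_square field_simps power_divide)
      moreover have "(0::real) \<le> (1/2)^k" by simp
      ultimately show ?thesis by linarith
    next
      case True
      moreover have "(0::real) \<le> 2^k * (norm x)\<^sup>2" by simp
      ultimately show ?thesis by linarith
    qed
    then have "(\<integral>\<^sup>+\<omega>. ennreal (norm (d k \<omega>)) \<partial>M)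
      \<le> (\<integral>\<^sup>+\<omega>. ennreal ((1/2)^k) + ennreal (2^k) * ennreal ((norm (d k \<omega>))\<^sup>2) \<partial>M)"
      by (intro nn_integral_mono) (simp add: ennreal_mult[symmetric] ennreal_plus[symmetric] del: ennreal_plus)
    also have "\<dots> = ennreal ((1/2)^k) + ennreal (2^k) * mean_square M (d k)"
      by (simp add: nn_integral_add nn_integral_cmult mean_square_def emeasure_space_1)
    also have "\<dots> \<le> ennreal ((1/2)^k) + ennreal (2^k) * ennreal ((1/4)^k)"
      unfolding d_def by (intro add_left_mono mult_left_mono K rK) simp
    also have "\<dots> = ennreal ((1/2)^k + 2^k * (1/4)^k)"
      by (simp add: ennreal_mult[symmetric] ennreal_plus[symmetric] del: ennreal_plus)
    also have "(1/2)^k + 2^k * (1/4)^k = (2 * (1/2)^k :: real)"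
      by (simp add: power_mult_distrib[symmetric])
    finally show ?thesis .
  qed
  have "(\<integral>\<^sup>+\<omega>. (\<Sum>k. ennreal (norm (d k \<omega>))) \<partial>M) = (\<Sum>k. \<integral>\<^sup>+\<omega>. ennreal (norm (d k \<omega>)) \<partial>M)"
    by (rule nn_integral_suminf) simp
  also have "\<dots> \<le> (\<Sum>k. ennreal (2 * (1/2)^k))"
    by (intro suminf_le Ed) auto
  also have "\<dots> = ennreal (\<Sum>k. 2 * (1/2)^k)"
    by (intro suminf_ennreal2) (auto intro!: summable_mult summable_geometric)
  finally have "(\<integral>\<^sup>+\<omega>. (\<Sum>k. ennreal (norm (d k \<omega>))) \<partial>M) \<noteq> \<infinity>"
    by (auto simp: top_unique)
  then have "AE \<omega> in M. (\<Sum>k. ennreal (norm (d k \<omega>))) \<noteq> \<infinity>"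
    by (intro nn_integral_PInf_AE) simp_all
  then have conv: "AE \<omega> in M. (\<lambda>k. g (r k) \<omega>) \<longlonglongrightarrow> lim (\<lambda>k. g (r k) \<omega>)"
  proof eventually_elim
    case (elim \<omega>)
    then have "summable (\<lambda>k. norm (d k \<omega>))"
      by (intro summable_suminf_not_top) auto
    then have "summable (\<lambda>k. d k \<omega>)" by (rule summable_norm_cancel)
    then have "convergent (\<lambda>n. \<Sum>k<n. d k \<omega>)" by (simp add: summable_iff_convergent)
    moreover have "(\<Sum>k<n. d k \<omega>) = g (r n) \<omega> - g (r 0) \<omega>" for n
      unfolding d_def by (rule sum_lessThan_telescope)
    ultimately have "convergent (\<lambda>n. g (r n) \<omega> - g (r 0) \<omega>)" by simp
    then have "convergent (\<lambda>n. (g (r n) \<omega> - g (r 0) \<omega>) + g (r 0) \<omega>)"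
      by (rule convergent_add) (rule convergent_const)
    then show ?case by (simp add: convergent_LIMSEQ_iff)
  qed
  define I where "I \<omega> = lim (\<lambda>k. g (r k) \<omega>)" for \<omega>
  have [measurable]: "I \<in> borel_measurable M" unfolding I_def by measurable
  have "(\<lambda>n. mean_square M (\<lambda>\<omega>. I \<omega> - g n \<omega>)) \<longlonglongrightarrow> 0"
  proof (rule ennreal_tendsto_0_if_small)
    fix \<epsilon> :: real assume "0 < \<epsilon>"
    then obtain K' where K': "\<And>m n. K' \<le> m \<Longrightarrow> K' \<le> n \<Longrightarrow> mean_square M (\<lambda>\<omega>. g m \<omega> - g n \<omega>) \<le> ennreal \<epsilon>"
      using Cauchy by blast
    have "mean_square M (\<lambda>\<omega>. I \<omega> - g n \<omega>) \<le> ennreal \<epsilon>" if n: "K' \<le> n" for n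
    proof (rule mean_square_fatou_le[where f="\<lambda>k \<omega>. g (r k) \<omega> - g n \<omega>"])
      show "AE \<omega> in M. (\<lambda>k. g (r k) \<omega> - g n \<omega>) \<longlonglongrightarrow> I \<omega> - g n \<omega>"
        using conv by eventually_elim (auto simp: I_def intro!: tendsto_diff)
      show "\<forall>\<^sub>F k in sequentially. mean_square M (\<lambda>\<omega>. g (r k) \<omega> - g n \<omega>) \<le> ennreal \<epsilon>"
        unfolding eventually_sequentially
      proof (intro exI allI impI)
        fix k assume "K' \<le> k"
        then show "mean_square M (\<lambda>\<omega>. g (r k) \<omega> - g n \<omega>) \<le> ennreal \<epsilon>"
          using K'[OF order_trans[OF _ rK(3)] n] by simp
      qed
    qed simp
    then show "\<exists>K. \<forall>n\<ge>K. mean_square M (\<lambda>\<omega>. I \<omega> - g n \<omega>) \<le> ennreal \<epsilon>" by blast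
  qed
  with \<open>I \<in> borel_measurable M\<close> show ?thesis by (rule that)
qed


context q_wiener
begin

lemma increment_null_direction:
  assumes "0 \<le> s" "s \<le> t" "t \<le> T" "j \<in> J" "j \<notin> Jp"
  shows "AE \<omega> in M. (W t \<omega> - W s \<omega>) \<bullet> e j = 0"
proof -
  have [measurable]: "(\<lambda>\<omega>. (W t \<omega> - W s \<omega>) \<bullet> e j) \<in> borel_measurable M"
    using W_measurable_M[of s] W_measurable_M[of t] assms by auto
  have "distr M borel (\<lambda>\<omega>. (W t \<omega> - W s \<omega>) \<bullet> e j) = normal_law 0 0"
    using increment_law[OF assms(1-3), of "e j"] eigenvector[OF assms(4)] eta_zero[OF assms(4,5)] by simp
  from normal_law_moments(1,3)[OF this]
  have *: "integrable M (\<lambda>\<omega>. ((W t \<omega> - W s \<omega>) \<bullet> e j) ^ 2)" "(\<integral>\<omega>. ((W t \<omega> - W s \<omega>) \<bullet> e j) ^ 2 \<partial>M) = 0"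
    by simp_all
  have "AE \<omega> in M. ((W t \<omega> - W s \<omega>) \<bullet> e j) ^ 2 = 0"
    using *(2) by (subst (asm) integral_nonneg_eq_0_iff_AE[OF *(1)]) auto
  then show ?thesis by eventually_elim simp
qed

text \<open>Outside one null set the increment has no component in the countably many directions
  without noise. The partial sums are then its projections, and these converge by
  \<open>proj_tendsto\<close>.\<close>

lemma increment_expansion:
  assumes "0 \<le> s" "s \<le> t" "t \<le> T"
  shows "AE \<omega> in M. (\<lambda>n. \<Sum>j\<in>N n. \<beta> j s t \<omega> *\<^sub>R f j) \<longlonglongrightarrow> W t \<omega> - W s \<omega>"
proof -
  have "AE \<omega> in M. \<forall>j\<in>J - Jp. (W t \<omega> - W s \<omega>) \<bullet> e j = 0"
    using countable_J increment_null_direction[OF assms] by (intro AE_ball_countable') auto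
  then show ?thesis
  proof eventually_elim
    case (elim \<omega>)
    have "(\<Sum>j\<in>N n. \<beta> j s t \<omega> *\<^sub>R f j) = proj (N n) (W t \<omega> - W s \<omega>)" for n
      unfolding proj_def
    proof (rule sum.cong[OF refl])
      fix j assume "j \<in> N n"
      then have "0 < \<eta> j" using N_subset JpD by blast
      then show "\<beta> j s t \<omega> *\<^sub>R f j = ((W t \<omega> - W s \<omega>) \<bullet> e j) *\<^sub>R e j"
        by (simp add: \<beta>_def f_def)
    qed
    moreover have "(\<lambda>n. proj (N n) (W t \<omega> - W s \<omega>)) \<longlonglongrightarrow> W t \<omega> - W s \<omega>"
      using finite_N N_subset Jp_subset incseq_N elim N_union by (intro proj_tendsto) blast+
    ultimately show ?case by simp
  qed
qed

section \<open>Elementary integrals as limits of finite stochastic sums\<close>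

lemma elementary_times:
  assumes "elementary F a b \<tau> k S"
  shows "m \<le> k \<Longrightarrow> a \<le> \<tau> m" and "m \<le> k \<Longrightarrow> \<tau> m \<le> b" and "m < k \<Longrightarrow> \<tau> m \<le> \<tau> (Suc m)"
proof -
  have *: "\<tau> 0 = a" "\<tau> k = b" "\<And>m. m < k \<Longrightarrow> \<tau> m \<le> \<tau> (Suc m)"
    using assms by (auto simp: elementary_def)
  have mono: "\<tau> m \<le> \<tau> n" if "m \<le> n" "n \<le> k" for m n
    using that
  proof (induction n rule: dec_induct)
    case (step n) then show ?case using *(3)[of n] by simp
  qed simp
  show "m \<le> k \<Longrightarrow> a \<le> \<tau> m" "m \<le> k \<Longrightarrow> \<tau> m \<le> b" using mono[of 0 m] mono[of m k] * by auto
  show "m < k \<Longrightarrow> \<tau> m \<le> \<tau> (Suc m)" by (rule *(3))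
qed

lemma elementary_value_measurable:
  fixes S :: "nat \<Rightarrow> 'w \<Rightarrow> ('u \<Rightarrow>\<^sub>L 'h::{real_inner, second_countable_topology})"
  assumes "0 \<le> a" "elementary F a b \<tau> k S" "m < k"
  shows "(\<lambda>\<omega>. blinfun_apply (S m \<omega>) u) \<in> borel_measurable M"
proof -
  have "simple_function (F (\<tau> m)) (S m)" using assms by (auto simp: elementary_def)
  then have "simple_function (F (\<tau> m)) (\<lambda>\<omega>. blinfun_apply (S m \<omega>) u)"
    by (rule simple_function_compose1)
  then have "(\<lambda>\<omega>. blinfun_apply (S m \<omega>) u) \<in> borel_measurable (F (\<tau> m))"
    by (rule borel_measurable_simple_function)
  moreover have "0 \<le> \<tau> m" using elementary_times(1)[OF assms(2), of m] assms by simp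
  ultimately show ?thesis by (rule measurable_F_M[rotated])
qed

text \<open>\<open>S m\<close> is split into its finitely many values, so that only fixed operators
  are applied to the increment and no measurability of operator evaluation in both arguments has to
  be discussed.\<close>

lemma elementary_integral_measurable:
  fixes S :: "nat \<Rightarrow> 'w \<Rightarrow> ('u \<Rightarrow>\<^sub>L 'h::{real_inner, second_countable_topology})"
  assumes ab: "0 \<le> a" "b \<le> T" and el: "elementary F a b \<tau> k S"
  shows "elementary_integral W \<tau> k S \<in> borel_measurable M"
  unfolding elementary_integral_def
proof (intro borel_measurable_sum)
    fix m assume m: "m \<in> {..<k}"
    have \<tau>: "0 \<le> \<tau> m" "\<tau> m \<le> T" "0 \<le> \<tau> (Suc m)" "\<tau> (Suc m) \<le> T"
      using elementary_times(1,2)[OF el, of m] elementary_times(1,2)[OF el, of "Suc m"] m ab by auto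
    have sf: "simple_function (F (\<tau> m)) (S m)" using el m by (auto simp: elementary_def)
    have fin: "finite (S m ` space M)" using simple_functionD(1)[OF sf] space_F[OF \<tau>(1)] by simp
    have "(\<lambda>\<omega>. \<Sum>v\<in>S m ` space M. indicat_real (S m -` {v} \<inter> space M) \<omega> *\<^sub>R blinfun_apply v (W (\<tau> (Suc m)) \<omega> - W (\<tau> m) \<omega>)) \<in> borel_measurable M"
    proof (intro borel_measurable_sum borel_measurable_scaleR)
      fix v
      have "S m -` {v} \<inter> space M \<in> sets M"
        using simple_functionD(2)[OF sf, of "{v}"] space_F[OF \<tau>(1)] sets_F[OF \<tau>(1)] by auto
      then show "indicat_real (S m -` {v} \<inter> space M) \<in> borel_measurable M" by simp
      have d: "(\<lambda>\<omega>. W (\<tau> (Suc m)) \<omega> - W (\<tau> m) \<omega>) \<in> borel_measurable M"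
        using W_measurable_M \<tau> by auto
      have "blinfun_apply v \<in> borel_measurable borel"
        by (intro borel_measurable_continuous_onI linear_continuous_on blinfun.bounded_linear_right)
      from measurable_compose[OF d this]
      show "(\<lambda>\<omega>. blinfun_apply v (W (\<tau> (Suc m)) \<omega> - W (\<tau> m) \<omega>)) \<in> borel_measurable M" .
    qed
    also have "?this \<longleftrightarrow> (\<lambda>\<omega>. blinfun_apply (S m \<omega>) (W (\<tau> (Suc m)) \<omega> - W (\<tau> m) \<omega>)) \<in> borel_measurable M"
    proof (rule measurable_cong)
      fix \<omega> assume \<omega>: "\<omega> \<in> space M"
      have "(\<Sum>v\<in>S m ` space M. indicat_real (S m -` {v} \<inter> space M) \<omega> *\<^sub>R blinfun_apply v x)
        = (\<Sum>v\<in>S m ` space M. if v = S m \<omega> then blinfun_apply v x else 0)" for x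
        using \<omega> by (intro sum.cong) (auto simp: indicator_def)
      then show "(\<Sum>v\<in>S m ` space M. indicat_real (S m -` {v} \<inter> space M) \<omega> *\<^sub>R blinfun_apply v (W (\<tau> (Suc m)) \<omega> - W (\<tau> m) \<omega>))
        = blinfun_apply (S m \<omega>) (W (\<tau> (Suc m)) \<omega> - W (\<tau> m) \<omega>)"
        using fin \<omega> by simp
    qed
    finally show "(\<lambda>\<omega>. blinfun_apply (S m \<omega>) (W (\<tau> (Suc m)) \<omega> - W (\<tau> m) \<omega>)) \<in> borel_measurable M" .
  qed

text \<open>Restricted to finitely many coordinates, an elementary integral becomes a finite sum as
  in \<open>rep\<close>: every value \<open>v\<close> of \<open>S m\<close> contributes the
  indicator of the event \<open>S m = v\<close> as the coefficient known at time
  \<open>\<tau> m\<close>.\<close>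

lemma rep_elementary_proj:
  fixes S :: "nat \<Rightarrow> 'w \<Rightarrow> ('u \<Rightarrow>\<^sub>L 'h::{real_inner, second_countable_topology})"
  assumes a: "0 \<le> a" and el: "elementary F a b \<tau> k S" and L: "finite L" "L \<subseteq> Jp"
  shows "rep a b (\<lambda>s \<omega> j. if j \<in> L then elementary_process \<tau> k S s \<omega> (f j) else 0)
    (\<lambda>\<omega>. \<Sum>m<k. \<Sum>j\<in>L. \<beta> j (\<tau> m) (\<tau> (Suc m)) \<omega> *\<^sub>R blinfun_apply (S m \<omega>) (f j))"
proof -
  define X where "X m v = indicat_real {\<omega>\<in>space M. S m \<omega> = v}" for m v
  have sf: "simple_function (F (\<tau> m)) (S m)" if "m < k" for m using el that by (auto simp: elementary_def)
  have \<tau>: "a \<le> \<tau> m" "\<tau> m \<le> \<tau> (Suc m)" "\<tau> (Suc m) \<le> b" if "m < k" for m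
    using elementary_times[OF el, of m] elementary_times[OF el, of "Suc m"] that by auto
  have fin: "finite (S m ` space M)" if "m < k" for m
    using simple_functionD(1)[OF sf[OF that]] space_F \<tau>[OF that] a by simp
  have X: "L2F (\<tau> m) (X m v)" if "m < k" for m v
  proof -
    have "S m -` {v} \<inter> space (F (\<tau> m)) \<in> sets (F (\<tau> m))" by (rule simple_functionD(2)[OF sf[OF that]])
    moreover have "S m -` {v} \<inter> space (F (\<tau> m)) = {\<omega>\<in>space M. S m \<omega> = v}"
      using space_F \<tau>[OF that] a by auto
    ultimately have s: "{\<omega>\<in>space M. S m \<omega> = v} \<in> sets (F (\<tau> m))" by simp
    then have s': "{\<omega>\<in>space M. S m \<omega> = v} \<in> sets M" using sets_F[of "\<tau> m"] \<tau>[OF that] a by auto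
    have sq: "(indicat_real A x)\<^sup>2 = indicat_real A x" for A :: "'w set" and x by (simp add: indicator_def)
    show ?thesis unfolding L2F_def X_def sq using s s'
      by (auto intro!: integrable_real_indicator simp: emeasure_eq_measure)
  qed
  have "rep a b
    (\<lambda>s \<omega> i. \<Sum>m<k. \<Sum>j\<in>L. \<Sum>v\<in>S m ` space M. if i = j then (X m v \<omega> * indicat_real {\<tau> m<..\<tau> (Suc m)} s) *\<^sub>R blinfun_apply v (f j) else 0)
    (\<lambda>\<omega>. \<Sum>m<k. \<Sum>j\<in>L. \<Sum>v\<in>S m ` space M. (X m v \<omega> * \<beta> j (\<tau> m) (\<tau> (Suc m)) \<omega>) *\<^sub>R blinfun_apply v (f j))"
    using L fin \<tau> X by (intro rep_sum rep_single) auto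
  then show ?thesis
  proof (rule rep_cong)
    fix \<omega> assume \<omega>: "\<omega> \<in> space M"
    have *: "(\<Sum>v\<in>S m ` space M. (X m v \<omega> * y) *\<^sub>R blinfun_apply v u) = y *\<^sub>R blinfun_apply (S m \<omega>) u"
      if "m < k" for m y u
    proof -
      have "(\<Sum>v\<in>S m ` space M. (X m v \<omega> * y) *\<^sub>R blinfun_apply v u)
        = (\<Sum>v\<in>S m ` space M. if v = S m \<omega> then y *\<^sub>R blinfun_apply v u else 0)"
        using \<omega> by (intro sum.cong) (auto simp: X_def)
      then show ?thesis using fin[OF that] \<omega> by simp
    qed
    then show "(\<Sum>m<k. \<Sum>j\<in>L. \<beta> j (\<tau> m) (\<tau> (Suc m)) \<omega> *\<^sub>R blinfun_apply (S m \<omega>) (f j))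
      = (\<Sum>m<k. \<Sum>j\<in>L. \<Sum>v\<in>S m ` space M. (X m v \<omega> * \<beta> j (\<tau> m) (\<tau> (Suc m)) \<omega>) *\<^sub>R blinfun_apply v (f j))"
      by simp
    fix s i
    have "(\<Sum>m<k. \<Sum>j\<in>L. \<Sum>v\<in>S m ` space M. if i = j then (X m v \<omega> * indicat_real {\<tau> m<..\<tau> (Suc m)} s) *\<^sub>R blinfun_apply v (f j) else 0)
      = (\<Sum>m<k. \<Sum>j\<in>L. if i = j then indicat_real {\<tau> m<..\<tau> (Suc m)} s *\<^sub>R blinfun_apply (S m \<omega>) (f j) else 0)"
      by (intro sum.cong refl) (auto simp: *)
    also have "\<dots> = (if i \<in> L then elementary_process \<tau> k S s \<omega> (f i) else 0)"
      using L by (simp add: elementary_process_def)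
    finally show "(if i \<in> L then elementary_process \<tau> k S s \<omega> (f i) else 0)
      = (\<Sum>m<k. \<Sum>j\<in>L. \<Sum>v\<in>S m ` space M. if i = j then (X m v \<omega> * indicat_real {\<tau> m<..\<tau> (Suc m)} s) *\<^sub>R blinfun_apply v (f j) else 0)"
      by simp
  qed
qed

text \<open>The truncations to \<open>N n\<close> converge almost surely to the elementary integral,
  so the isometry survives as an inequality by Fatou's lemma. Once \<open>N n\<close> contains the
  finite support of \<Gamma>, truncating only decreases the Hilbert-Schmidt distance.\<close>

lemma elementary_rep_bound:
  fixes S :: "nat \<Rightarrow> 'w \<Rightarrow> ('u \<Rightarrow>\<^sub>L 'h::{real_inner, second_countable_topology})"
  assumes a: "0 \<le> a" "b \<le> T" and el: "elementary F a b \<tau> k S" and G: "rep a b \<Gamma> G"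
  shows "mean_square M (\<lambda>\<omega>. elementary_integral W \<tau> k S \<omega> - G \<omega>)
    \<le> (\<integral>\<^sup>+s\<in>{a..b}. (\<integral>\<^sup>+\<omega>. hs (\<lambda>j. elementary_process \<tau> k S s \<omega> (f j) - \<Gamma> s \<omega> j) \<partial>M) \<partial>lborel)"
    (is "_ \<le> ?R")
proof -
  define I where "I n \<omega> = (\<Sum>m<k. \<Sum>j\<in>N n. \<beta> j (\<tau> m) (\<tau> (Suc m)) \<omega> *\<^sub>R blinfun_apply (S m \<omega>) (f j))" for n \<omega>
  define P where "P n s \<omega> j = (if j \<in> N n then elementary_process \<tau> k S s \<omega> (f j) else 0)" for n s \<omega> j
  have rep: "rep a b (P n) (I n)" for n
    unfolding P_def[abs_def] I_def[abs_def] by (rule rep_elementary_proj[OF a(1) el finite_N N_subset])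
  obtain K where K: "finite K" "K \<subseteq> Jp" "\<And>s \<omega> i. \<omega> \<in> space M \<Longrightarrow> i \<notin> K \<Longrightarrow> \<Gamma> s \<omega> i = 0"
    using rep_support[OF G] by blast
  obtain n0 where n0: "K \<subseteq> N n0" using finite_subset_N[OF K(1,2)] by blast
  have "AE \<omega> in M. \<forall>m\<in>{..<k}. (\<lambda>n. \<Sum>j\<in>N n. \<beta> j (\<tau> m) (\<tau> (Suc m)) \<omega> *\<^sub>R f j) \<longlonglongrightarrow> W (\<tau> (Suc m)) \<omega> - W (\<tau> m) \<omega>"
  proof (rule AE_finite_allI)
    fix m assume m: "m \<in> {..<k}"
    then show "AE \<omega> in M. (\<lambda>n. \<Sum>j\<in>N n. \<beta> j (\<tau> m) (\<tau> (Suc m)) \<omega> *\<^sub>R f j) \<longlonglongrightarrow> W (\<tau> (Suc m)) \<omega> - W (\<tau> m) \<omega>"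
      using elementary_times[OF el, of m] elementary_times[OF el, of "Suc m"] a
      by (intro increment_expansion) auto
  qed simp
  then have lim: "AE \<omega> in M. (\<lambda>n. I n \<omega> - G \<omega>) \<longlonglongrightarrow> elementary_integral W \<tau> k S \<omega> - G \<omega>"
  proof eventually_elim
    case (elim \<omega>)
    have "(\<lambda>n. \<Sum>m<k. blinfun_apply (S m \<omega>) (\<Sum>j\<in>N n. \<beta> j (\<tau> m) (\<tau> (Suc m)) \<omega> *\<^sub>R f j)) \<longlonglongrightarrow> elementary_integral W \<tau> k S \<omega>"
      unfolding elementary_integral_def using elim by (intro tendsto_sum blinfun.tendsto tendsto_const) auto
    then show ?case
      unfolding I_def by (intro tendsto_diff tendsto_const) (simp add: blinfun.sum_right blinfun.scaleR_right)
  qed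
  show ?thesis
  proof (rule mean_square_fatou_le[OF _ lim])
    show "(\<lambda>\<omega>. I n \<omega> - G \<omega>) \<in> borel_measurable M" for n
      by (rule rep_measurable(1)[OF a rep_diff[OF rep G]])
    show "\<forall>\<^sub>F n in sequentially. mean_square M (\<lambda>\<omega>. I n \<omega> - G \<omega>) \<le> ?R"
      unfolding eventually_sequentially
    proof (intro exI allI impI)
      fix n assume "n0 \<le> n"
      then have n: "K \<subseteq> N n" using n0 N_mono by blast
      have "mean_square M (\<lambda>\<omega>. I n \<omega> - G \<omega>) = (\<integral>\<^sup>+s\<in>{a..b}. (\<integral>\<^sup>+\<omega>. hs (\<lambda>j. P n s \<omega> j - \<Gamma> s \<omega> j) \<partial>M) \<partial>lborel)"
        by (rule isometry[OF a rep_diff[OF rep G]])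
      also have "\<dots> \<le> ?R"
      proof (intro nn_integral_mono mult_right_mono hs_mono)
        fix s \<omega> j assume "\<omega> \<in> space M"
        then show "norm (P n s \<omega> j - \<Gamma> s \<omega> j) \<le> norm (elementary_process \<tau> k S s \<omega> (f j) - \<Gamma> s \<omega> j)"
          using K(3)[of \<omega> j s] n by (cases "j \<in> K") (auto simp: P_def)
      qed simp
      finally show "mean_square M (\<lambda>\<omega>. I n \<omega> - G \<omega>) \<le> ?R" .
    qed
  qed
qed

lemma f_in_U0: "j \<in> Jp \<Longrightarrow> f j \<in> U0 J \<eta> e"
  unfolding f_def by (rule basis_in_U0)

section \<open>Predictable processes: joint measurability and Fubini\<close>

abbreviation predictable_generators :: "real \<Rightarrow> real \<Rightarrow> (real \<times> 'w) set set" where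
  "predictable_generators a b \<equiv>
     {{s<..t} \<times> A | s t A. a \<le> s \<and> s \<le> t \<and> t \<le> b \<and> A \<in> sets (F s)} \<union> {{a} \<times> A | A. A \<in> sets (F a)}"

lemma predictable_generators_subset:
  assumes "0 \<le> a" "a \<le> b"
  shows "predictable_generators a b \<subseteq> Pow ({a..b} \<times> space M)"
proof
  fix A assume "A \<in> predictable_generators a b"
  then consider s t C where "A = {s<..t} \<times> C" "a \<le> s" "s \<le> t" "t \<le> b" "C \<in> sets (F s)"
    | C where "A = {a} \<times> C" "C \<in> sets (F a)" by blast
  then show "A \<in> Pow ({a..b} \<times> space M)"
  proof cases
    case 1
    then show ?thesis using sets.sets_into_space[of C "F s"] space_F[of s] assms by auto
  next
    case 2
    then show ?thesis using sets.sets_into_space[of C "F a"] space_F[of a] assms by auto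
  qed
qed

text \<open>Predictable sets are measurable in the product, but their \<sigma>-algebra lives on
  [a, b] times \<Omega>; multiplication by the indicator extends \<open>g\<close> by zero to the
  whole product.\<close>

lemma predictable_measurable:
  fixes g :: "real \<times> 'w \<Rightarrow> 'h::{real_normed_vector, second_countable_topology}"
  assumes ab: "0 \<le> a" and g: "g \<in> borel_measurable (predictable_algebra M F a b)"
  shows "(\<lambda>x. indicat_real ({a..b} \<times> space M) x *\<^sub>R g x) \<in> borel_measurable (borel \<Otimes>\<^sub>M M)"
proof -
  let ?S = "{a..b} \<times> space M" and ?B = "borel \<Otimes>\<^sub>M M :: (real \<times> 'w) measure"
  let ?G = "{{s<..t} \<times> A | s t A. a \<le> s \<and> s \<le> t \<and> t \<le> b \<and> A \<in> sets (F s)} \<union> {{a} \<times> A | A. A \<in> sets (F a)}"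
  have S: "?S \<in> sets ?B" by (intro pair_measureI) auto
  have G: "A \<in> sets ?B" if "A \<in> ?G" for A
  proof -
    from that consider s t C where "A = {s<..t} \<times> C" "a \<le> s" "s \<le> t" "t \<le> b" "C \<in> sets (F s)"
      | C where "A = {a} \<times> C" "C \<in> sets (F a)" by blast
    note cs = this
    from cs show "A \<in> sets ?B"
    proof cases
      case 1
      then have "C \<in> sets M" using sets_F[of s] ab by auto
      then show ?thesis unfolding 1 by (intro pair_measureI) auto
    next
      case 2
      then have "C \<in> sets M" using sets_F[of a] ab by auto
      then show ?thesis unfolding 2 by (intro pair_measureI) auto
    qed
  qed
  show ?thesis
  proof (cases "a \<le> b")
    case False
    then show ?thesis by simp
  next
    case True
    have GS: "?G \<subseteq> Pow ?S" by (rule predictable_generators_subset[OF ab True])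
    have "g \<in> borel_measurable (restrict_space ?B ?S)"
    proof (rule measurable_from_subalg[OF _ g])
      have sp: "space (restrict_space ?B ?S) = ?S" by (auto simp: space_restrict_space space_pair_measure)
      have "sets (sigma ?S ?G) \<subseteq> sets (restrict_space ?B ?S)"
        unfolding sets_measure_of[OF GS]
      proof (subst sp[symmetric], rule sets.sigma_sets_subset)
        show "?G \<subseteq> sets (restrict_space ?B ?S)"
        proof
          fix A assume A: "A \<in> ?G"
          have "A \<in> sets ?B" by (rule G[OF A])
          moreover have "A \<subseteq> ?S" using subsetD[OF GS A] by (simp only: Pow_iff)
          moreover have "?S \<inter> space ?B \<in> sets ?B" using S by (rule sets.Int) simp
          ultimately show "A \<in> sets (restrict_space ?B ?S)" by (simp add: sets_restrict_space_iff)
        qed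
      qed
      then show "subalgebra (restrict_space ?B ?S) (predictable_algebra M F a b)"
        unfolding subalgebra_def predictable_algebra_def sp space_measure_of[OF GS] by simp
    qed
    then show ?thesis
      using S by (subst (asm) borel_measurable_restrict_space_iff) (auto simp: space_pair_measure)
  qed
qed

lemma hs_difference_measurable:
  fixes Y :: "real \<Rightarrow> 'w \<Rightarrow> 'u \<Rightarrow> 'h::{real_inner, second_countable_topology}"
  assumes ab: "0 \<le> a" and Y: "predictable_HS_process M F J \<eta> e a b Y" and el: "elementary F a b \<tau> k S"
  shows "(\<lambda>(s, \<omega>). hs (\<lambda>j. Y s \<omega> (f j) - elementary_process \<tau> k S s \<omega> (f j)) * indicator {a..b} s)
    \<in> borel_measurable (lborel \<Otimes>\<^sub>M M)"
proof -
  have Y': "(\<lambda>x. indicat_real ({a..b} \<times> space M) x *\<^sub>R Y (fst x) (snd x) (f j)) \<in> borel_measurable (borel \<Otimes>\<^sub>M M)"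
    if "j \<in> Jp" for j
  proof -
    have "(\<lambda>(s, \<omega>). Y s \<omega> (f j)) \<in> borel_measurable (predictable_algebra M F a b)"
      using Y f_in_U0[OF that] by (auto simp: predictable_HS_process_def)
    from predictable_measurable[OF ab this] show ?thesis by (simp add: case_prod_beta')
  qed
  have S [measurable]: "(\<lambda>\<omega>. blinfun_apply (S m \<omega>) u) \<in> borel_measurable M" if "m < k" for m u
    by (rule elementary_value_measurable[OF ab el that])
  have E: "(\<lambda>x. elementary_process \<tau> k S (fst x) (snd x) u) \<in> borel_measurable (borel \<Otimes>\<^sub>M M)" for u
    unfolding elementary_process_def
  proof (intro borel_measurable_sum borel_measurable_scaleR)
    fix m assume "m \<in> {..<k}"
    then show "(\<lambda>x. blinfun_apply (S m (snd x)) u) \<in> borel_measurable (borel \<Otimes>\<^sub>M M)"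
      using S[of m u] by (intro measurable_compose[OF measurable_snd]) auto
    show "(\<lambda>x. indicat_real {\<tau> m<..\<tau> (Suc m)} (fst x)) \<in> borel_measurable (borel \<Otimes>\<^sub>M M)"
      by (intro measurable_compose[OF measurable_fst]) simp
  qed
  have "(\<lambda>x. hs (\<lambda>j. indicat_real ({a..b} \<times> space M) x *\<^sub>R Y (fst x) (snd x) (f j)
      - elementary_process \<tau> k S (fst x) (snd x) (f j)) * indicator {a..b} (fst x)) \<in> borel_measurable (borel \<Otimes>\<^sub>M M)"
    by (intro borel_measurable_times_ennreal hs_measurable borel_measurable_diff Y' E
        measurable_compose[OF measurable_fst] borel_measurable_indicator)
       (auto intro: borel_closed)
  also have "?this \<longleftrightarrow> (\<lambda>(s, \<omega>). hs (\<lambda>j. Y s \<omega> (f j) - elementary_process \<tau> k S s \<omega> (f j)) * indicator {a..b} s)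
    \<in> borel_measurable (borel \<Otimes>\<^sub>M M)"
    by (intro measurable_cong) (auto simp: space_pair_measure indicator_def)
  also have "\<dots> \<longleftrightarrow> ?thesis" by (subst measurable_cong_sets[OF sets_pair_measure_cong[OF sets_lborel refl] refl]) (rule refl)
  finally show ?thesis .
qed

text \<open>The definition of the integral has the time integral inside the expectation, the
  isometry has it outside. This exchange connects the two.\<close>

lemma hs_difference_fubini:
  fixes Y :: "real \<Rightarrow> 'w \<Rightarrow> 'u \<Rightarrow> 'h::{real_inner, second_countable_topology}"
  assumes ab: "0 \<le> a" and Y: "predictable_HS_process M F J \<eta> e a b Y" and el: "elementary F a b \<tau> k S"
  shows "(\<integral>\<^sup>+\<omega>. (\<integral>\<^sup>+s\<in>{a..b}. HS_norm_sq J \<eta> e (\<lambda>u. Y s \<omega> u - elementary_process \<tau> k S s \<omega> u) \<partial>lborel) \<partial>M)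
    = (\<integral>\<^sup>+s\<in>{a..b}. (\<integral>\<^sup>+\<omega>. hs (\<lambda>j. Y s \<omega> (f j) - elementary_process \<tau> k S s \<omega> (f j)) \<partial>M) \<partial>lborel)"
proof -
  interpret P: pair_sigma_finite lborel M ..
  have "(\<integral>\<^sup>+\<omega>. (\<integral>\<^sup>+s\<in>{a..b}. HS_norm_sq J \<eta> e (\<lambda>u. Y s \<omega> u - elementary_process \<tau> k S s \<omega> u) \<partial>lborel) \<partial>M)
    = (\<integral>\<^sup>+s. (\<integral>\<^sup>+\<omega>. hs (\<lambda>j. Y s \<omega> (f j) - elementary_process \<tau> k S s \<omega> (f j)) * indicator {a..b} s \<partial>M) \<partial>lborel)"
    unfolding HS_norm_sq_eq_hs by (rule P.Fubini'[OF hs_difference_measurable[OF assms]])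
  also have "\<dots> = (\<integral>\<^sup>+s\<in>{a..b}. (\<integral>\<^sup>+\<omega>. hs (\<lambda>j. Y s \<omega> (f j) - elementary_process \<tau> k S s \<omega> (f j)) \<partial>M) \<partial>lborel)"
    by (intro nn_integral_cong) (auto simp: indicator_def)
  finally show ?thesis .
qed

lemma predictable_section_measurable:
  fixes Y :: "real \<Rightarrow> 'w \<Rightarrow> 'u \<Rightarrow> 'h::{real_inner, second_countable_topology}"
  assumes ab: "0 \<le> a" and Y: "predictable_HS_process M F J \<eta> e a b Y" and s: "s \<in> {a..b}" and j: "j \<in> Jp"
  shows "(\<lambda>\<omega>. Y s \<omega> (f j)) \<in> borel_measurable M"
proof -
  have "(\<lambda>(s, \<omega>). Y s \<omega> (f j)) \<in> borel_measurable (predictable_algebra M F a b)"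
    using Y f_in_U0[OF j] by (auto simp: predictable_HS_process_def)
  from predictable_measurable[OF ab this]
  have "(\<lambda>x. indicat_real ({a..b} \<times> space M) x *\<^sub>R Y (fst x) (snd x) (f j)) \<in> borel_measurable (borel \<Otimes>\<^sub>M M)"
    by (simp add: case_prod_beta')
  from measurable_compose_Pair1[OF _ this, of s]
  have "(\<lambda>\<omega>. indicat_real ({a..b} \<times> space M) (s, \<omega>) *\<^sub>R Y s \<omega> (f j)) \<in> borel_measurable M" by simp
  also have "?this \<longleftrightarrow> ?thesis" using s by (intro measurable_cong) (auto simp: indicator_def)
  finally show ?thesis .
qed

lemma ennreal_add_le_limit:
  fixes x c :: ennreal and D :: "nat \<Rightarrow> ennreal"
  assumes "\<And>n. x \<le> D n + c" "D \<longlonglongrightarrow> 0"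
  shows "x \<le> c"
proof -
  have "(\<lambda>n. D n + c) \<longlonglongrightarrow> 0 + c" by (intro tendsto_add assms tendsto_const)
  then show ?thesis using assms(1) by (intro LIMSEQ_le_const[of "\<lambda>n. D n + c"]) auto
qed

text \<open>Compares an arbitrary version of an integral with a finite sum, and thereby gives
  uniqueness and approximation alike. Both differences, \<open>I - G\<close> of random variables and
  the one of integrands, are split at the approximating elementary process; each split costs a
  factor 2, hence the 4, and the other parts vanish in the limit.\<close>

theorem ito_bound:
  fixes I :: "'w \<Rightarrow> 'h::{real_inner, second_countable_topology}"
  assumes ab: "0 \<le> a" "a \<le> b" "b \<le> T" and I: "is_ito_integral M F J \<eta> e W a b X I"
    and G: "rep a b \<Gamma> G"
    and le: "\<And>s. a < s \<Longrightarrow> s \<le> b \<Longrightarrow> (\<integral>\<^sup>+\<omega>. hs (\<lambda>j. X s \<omega> (f j) - \<Gamma> s \<omega> j) \<partial>M) \<le> ennreal \<epsilon>"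
    and \<epsilon>: "0 \<le> \<epsilon>"
  shows "mean_square M (\<lambda>\<omega>. I \<omega> - G \<omega>) \<le> ennreal (4 * (b - a) * \<epsilon>)"
proof -
  obtain Y \<tau> k S where Y: "predictable_HS_process M F J \<eta> e a b Y"
    and XY: "\<And>s. s \<in> {a..b} \<Longrightarrow> AE \<omega> in M. \<forall>u\<in>U0 J \<eta> e. X s \<omega> u = Y s \<omega> u"
    and el: "\<And>n. elementary F a b (\<tau> n) (k n) (S n)"
    and lim1: "(\<lambda>n. \<integral>\<^sup>+\<omega>. (\<integral>\<^sup>+s\<in>{a..b}.
               HS_norm_sq J \<eta> e (\<lambda>u. Y s \<omega> u - elementary_process (\<tau> n) (k n) (S n) s \<omega> u) \<partial>lborel) \<partial>M) \<longlonglongrightarrow> 0"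
    and lim2: "(\<lambda>n. mean_square M (\<lambda>\<omega>. I \<omega> - elementary_integral W (\<tau> n) (k n) (S n) \<omega>)) \<longlonglongrightarrow> 0"
    and Im: "I \<in> borel_measurable M"
    using I unfolding is_ito_integral_def by blast
  define ep where "ep n s \<omega> j = elementary_process (\<tau> n) (k n) (S n) s \<omega> (f j)" for n s \<omega> j
  define ei where "ei n = elementary_integral W (\<tau> n) (k n) (S n)" for n
  define A where "A n s = (\<integral>\<^sup>+\<omega>. hs (\<lambda>j. Y s \<omega> (f j) - ep n s \<omega> j) \<partial>M)" for n s
  have Gm: "G \<in> borel_measurable M" "\<And>s j. (\<lambda>\<omega>. \<Gamma> s \<omega> j) \<in> borel_measurable M"
    using rep_measurable[OF ab(1,3) G] by auto
  have eim: "ei n \<in> borel_measurable M" for n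
    unfolding ei_def by (rule elementary_integral_measurable[OF ab(1,3) el])
  have epm: "(\<lambda>\<omega>. ep n s \<omega> j) \<in> borel_measurable M" for n s j
    unfolding ep_def elementary_process_def
    using elementary_value_measurable[OF ab(1) el] by (intro borel_measurable_sum borel_measurable_scaleR) auto
  have Aint: "(\<lambda>n. \<integral>\<^sup>+s\<in>{a..b}. A n s \<partial>lborel) \<longlonglongrightarrow> 0"
    using lim1 unfolding hs_difference_fubini[OF ab(1) Y el] A_def ep_def .
  have Am: "(\<lambda>s. A n s * indicator {a..b} s) \<in> borel_measurable lborel" for n
  proof -
    have "(\<lambda>s. \<integral>\<^sup>+\<omega>. hs (\<lambda>j. Y s \<omega> (f j) - ep n s \<omega> j) * indicator {a..b} s \<partial>M) \<in> borel_measurable lborel"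
      using hs_difference_measurable[OF ab(1) Y el[of n]] unfolding ep_def
      by (rule borel_measurable_nn_integral)
    also have "(\<lambda>s. \<integral>\<^sup>+\<omega>. hs (\<lambda>j. Y s \<omega> (f j) - ep n s \<omega> j) * indicator {a..b} s \<partial>M) = (\<lambda>s. A n s * indicator {a..b} s)"
      by (auto simp: A_def indicator_def)
    finally show ?thesis .
  qed
  have bound: "(\<integral>\<^sup>+\<omega>. hs (\<lambda>j. ep n s \<omega> j - \<Gamma> s \<omega> j) \<partial>M) \<le> 2 * A n s + 2 * ennreal \<epsilon>"
    if s: "a < s" "s \<le> b" for n s
  proof -
    have sab: "s \<in> {a..b}" using s by simp
    note Ym = predictable_section_measurable[OF ab(1) Y sab]
    have m1: "(\<lambda>\<omega>. hs (\<lambda>j. ep n s \<omega> j - Y s \<omega> (f j))) \<in> borel_measurable M"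
      using Ym epm by (intro hs_measurable borel_measurable_diff) auto
    have m2: "(\<lambda>\<omega>. hs (\<lambda>j. Y s \<omega> (f j) - \<Gamma> s \<omega> j)) \<in> borel_measurable M"
      using Ym Gm by (intro hs_measurable borel_measurable_diff) auto
    have "(\<integral>\<^sup>+\<omega>. hs (\<lambda>j. ep n s \<omega> j - \<Gamma> s \<omega> j) \<partial>M)
      \<le> (\<integral>\<^sup>+\<omega>. 2 * hs (\<lambda>j. ep n s \<omega> j - Y s \<omega> (f j)) + 2 * hs (\<lambda>j. Y s \<omega> (f j) - \<Gamma> s \<omega> j) \<partial>M)"
      by (intro nn_integral_mono hs_triangle)
    also have "\<dots> = 2 * (\<integral>\<^sup>+\<omega>. hs (\<lambda>j. ep n s \<omega> j - Y s \<omega> (f j)) \<partial>M) + 2 * (\<integral>\<^sup>+\<omega>. hs (\<lambda>j. Y s \<omega> (f j) - \<Gamma> s \<omega> j) \<partial>M)"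
      using m1 m2 by (simp add: nn_integral_add nn_integral_cmult)
    also have "(\<integral>\<^sup>+\<omega>. hs (\<lambda>j. ep n s \<omega> j - Y s \<omega> (f j)) \<partial>M) = A n s"
      unfolding A_def by (intro nn_integral_cong hs_cong) (simp add: norm_minus_commute)
    \<comment> \<open>Only \<open>Y\<close> is known to be measurable. For fixed \<open>s\<close> it
      agrees with \<open>X\<close> almost surely, and the upper integral of the distance does not
      notice the difference.\<close>
    also have "(\<integral>\<^sup>+\<omega>. hs (\<lambda>j. Y s \<omega> (f j) - \<Gamma> s \<omega> j) \<partial>M) = (\<integral>\<^sup>+\<omega>. hs (\<lambda>j. X s \<omega> (f j) - \<Gamma> s \<omega> j) \<partial>M)"
    proof (rule nn_integral_cong_AE, use XY[OF sab] in eventually_elim)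
      case (elim \<omega>)
      then show ?case using f_in_U0 by (intro hs_cong) auto
    qed
    finally show ?thesis using le[OF s] by (meson add_left_mono mult_left_mono order_trans zero_le)
  qed
  have main: "mean_square M (\<lambda>\<omega>. I \<omega> - G \<omega>)
    \<le> (2 * mean_square M (\<lambda>\<omega>. I \<omega> - ei n \<omega>) + 4 * (\<integral>\<^sup>+s\<in>{a..b}. A n s \<partial>lborel)) + ennreal (4 * (b - a) * \<epsilon>)" for n
  proof -
    have "mean_square M (\<lambda>\<omega>. ei n \<omega> - G \<omega>)
      \<le> (\<integral>\<^sup>+s\<in>{a..b}. (\<integral>\<^sup>+\<omega>. hs (\<lambda>j. ep n s \<omega> j - \<Gamma> s \<omega> j) \<partial>M) \<partial>lborel)"
      unfolding ei_def ep_def by (rule elementary_rep_bound[OF ab(1,3) el G])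
    also have "\<dots> \<le> (\<integral>\<^sup>+s. 2 * (A n s * indicator {a..b} s) + 2 * ennreal \<epsilon> * indicator {a..b} s \<partial>lborel)"
    proof (rule nn_integral_mono_AE)
      \<comment> \<open>Step processes live on left-open intervals, so nothing is assumed at the
        left end \<open>a\<close>; this is a single point of time.\<close>
      have "AE s in lborel. s \<noteq> a" by (rule AE_lborel_singleton)
      then show "AE s in lborel. (\<integral>\<^sup>+\<omega>. hs (\<lambda>j. ep n s \<omega> j - \<Gamma> s \<omega> j) \<partial>M) * indicator {a..b} s
        \<le> 2 * (A n s * indicator {a..b} s) + 2 * ennreal \<epsilon> * indicator {a..b} s"
      proof eventually_elim
        case (elim s)
        then show ?case using bound[of s n] by (auto simp: indicator_def)
      qed
    qed
    also have "\<dots> = 2 * (\<integral>\<^sup>+s\<in>{a..b}. A n s \<partial>lborel) + 2 * ennreal \<epsilon> * emeasure lborel {a..b}"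
      using Am[of n] by (simp add: nn_integral_add nn_integral_cmult)
    also have "2 * ennreal \<epsilon> * emeasure lborel {a..b} = ennreal (2 * (b - a) * \<epsilon>)"
    proof -
      have "ennreal (2 * \<epsilon> * (b - a)) = ennreal (2 * \<epsilon>) * ennreal (b - a)"
        using ab \<epsilon> by (intro ennreal_mult) auto
      moreover have "ennreal (2 * \<epsilon>) = 2 * ennreal \<epsilon>" using \<epsilon> by (simp add: ennreal_mult)
      moreover have "2 * (b - a) * \<epsilon> = 2 * \<epsilon> * (b - a)" by simp
      ultimately show ?thesis using ab by (metis emeasure_lborel_Icc)
    qed
    finally have 1: "mean_square M (\<lambda>\<omega>. ei n \<omega> - G \<omega>) \<le> 2 * (\<integral>\<^sup>+s\<in>{a..b}. A n s \<partial>lborel) + ennreal (2 * (b - a) * \<epsilon>)" .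
    have "mean_square M (\<lambda>\<omega>. I \<omega> - G \<omega>) \<le> 2 * mean_square M (\<lambda>\<omega>. I \<omega> - ei n \<omega>) + 2 * mean_square M (\<lambda>\<omega>. ei n \<omega> - G \<omega>)"
      by (rule mean_square_triangle[OF Im eim Gm(1)])
    also have "\<dots> \<le> 2 * mean_square M (\<lambda>\<omega>. I \<omega> - ei n \<omega>) + 2 * (2 * (\<integral>\<^sup>+s\<in>{a..b}. A n s \<partial>lborel) + ennreal (2 * (b - a) * \<epsilon>))"
      by (intro add_left_mono mult_left_mono 1) simp
    also have "2 * (2 * (\<integral>\<^sup>+s\<in>{a..b}. A n s \<partial>lborel) + ennreal (2 * (b - a) * \<epsilon>))
      = 4 * (\<integral>\<^sup>+s\<in>{a..b}. A n s \<partial>lborel) + ennreal (4 * (b - a) * \<epsilon>)"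
    proof -
      have "2 * ennreal (2 * (b - a) * \<epsilon>) = ennreal (4 * (b - a) * \<epsilon>)"
        using ab \<epsilon> by (subst ennreal_numeral[symmetric], subst ennreal_mult[symmetric]) auto
      then show ?thesis by (simp add: distrib_left mult.assoc[symmetric])
    qed
    finally show ?thesis by (simp add: add.assoc)
  qed
  have "(\<lambda>n. 2 * mean_square M (\<lambda>\<omega>. I \<omega> - ei n \<omega>) + 4 * (\<integral>\<^sup>+s\<in>{a..b}. A n s \<partial>lborel)) \<longlonglongrightarrow> 2 * 0 + 4 * 0"
    using lim2 Aint unfolding ei_def by (intro tendsto_add ennreal_tendsto_cmult) auto
  then show ?thesis by (intro ennreal_add_le_limit[OF main]) simp
qed

end

section \<open>The operators and the inner integral\<close>

context q_wiener
begin

definition total :: "('j \<Rightarrow> real) \<Rightarrow> real" where "total g = infsum g Jp"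

definition tail :: "('j \<Rightarrow> real) \<Rightarrow> nat \<Rightarrow> real" where "tail g n = total g - sum g (N n)"

text \<open>Bounded finite sums make the nonnegative family summable. A finite set disjoint from
  \<open>N n\<close> can be added to \<open>N n\<close> below the total, so it fits into the
  tail.\<close>

lemma total_bounds:
  assumes g: "\<And>j. j \<in> Jp \<Longrightarrow> 0 \<le> g j" and b: "\<And>K. finite K \<Longrightarrow> K \<subseteq> Jp \<Longrightarrow> sum g K \<le> C"
  shows "\<And>K. finite K \<Longrightarrow> K \<subseteq> Jp \<Longrightarrow> sum g K \<le> total g" and "0 \<le> total g"
    and "0 \<le> tail g n" and "tail g \<longlonglongrightarrow> 0"
    and "\<And>K. finite K \<Longrightarrow> K \<subseteq> Jp \<Longrightarrow> K \<inter> N n = {} \<Longrightarrow> sum g K \<le> tail g n"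
proof -
  have sm: "g summable_on Jp"
    using g b by (intro nonneg_bdd_above_summable_on) (auto intro!: bdd_aboveI[of _ C])
  show le: "\<And>K. finite K \<Longrightarrow> K \<subseteq> Jp \<Longrightarrow> sum g K \<le> total g"
    unfolding total_def using sm g by (intro finite_sum_le_infsum) auto
  show "0 \<le> total g" using le[of "{}"] by simp
  show "0 \<le> tail g n" using le[OF finite_N N_subset] by (simp add: tail_def)
  have fl: "filterlim N (finite_subsets_at_top Jp) sequentially"
    unfolding filterlim_finite_subsets_at_top
  proof (intro allI impI)
    fix X assume "finite X \<and> X \<subseteq> Jp"
    then obtain n0 where "X \<subseteq> N n0" using finite_subset_N by blast
    then show "\<forall>\<^sub>F y in sequentially. finite (N y) \<and> X \<subseteq> N y \<and> N y \<subseteq> Jp"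
      unfolding eventually_sequentially using finite_N N_subset N_mono by blast
  qed
  have "(sum g \<longlongrightarrow> total g) (finite_subsets_at_top Jp)"
    using has_sum_infsum[OF sm] by (simp add: has_sum_def total_def)
  from filterlim_compose[OF this fl] have "(\<lambda>n. sum g (N n)) \<longlonglongrightarrow> total g" .
  from tendsto_diff[OF tendsto_const[of "total g"] this]
  show "tail g \<longlonglongrightarrow> 0" by (simp add: tail_def[abs_def])
  show "\<And>K. finite K \<Longrightarrow> K \<subseteq> Jp \<Longrightarrow> K \<inter> N n = {} \<Longrightarrow> sum g K \<le> tail g n"
  proof -
    fix K assume K: "finite K" "K \<subseteq> Jp" "K \<inter> N n = {}"
    have "sum g K + sum g (N n) = sum g (K \<union> N n)"
      using K finite_N by (intro sum.union_disjoint[symmetric]) auto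
    also have "\<dots> \<le> total g" using K finite_N N_subset by (intro le) auto
    finally show "sum g K \<le> tail g n" by (simp add: tail_def)
  qed
qed

lemma hs_le:
  assumes "\<And>n. (\<Sum>j\<in>N n. (norm (z j))\<^sup>2) \<le> C"
  shows "hs z \<le> ennreal C"
  unfolding hs_SUP
proof (rule SUP_least)
  fix n
  have "(\<Sum>j\<in>N n. ennreal ((norm (z j))\<^sup>2)) = ennreal (\<Sum>j\<in>N n. (norm (z j))\<^sup>2)" by simp
  also have "\<dots> \<le> ennreal C" by (rule ennreal_leI) (rule assms)
  finally show "(\<Sum>j\<in>N n. ennreal ((norm (z j))\<^sup>2)) \<le> ennreal C" .
qed

lemma mean_square_0_AE:
  fixes g :: "'w \<Rightarrow> 'h::{real_normed_vector, second_countable_topology}"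
  assumes [measurable]: "g \<in> borel_measurable M" and "mean_square M g = 0"
  shows "AE \<omega> in M. g \<omega> = 0"
proof -
  have "AE \<omega> in M. ennreal ((norm (g \<omega>))\<^sup>2) = 0"
    using assms(2) unfolding mean_square_def by (subst (asm) nn_integral_0_iff_AE) auto
  then show ?thesis by eventually_elim simp
qed

end

text \<open>The witnesses of the existential assumptions, the operator \<open>S\<close> that
  represents \<Phi> on \<open>U0\<close> and the bound \<open>c\<close> for \<Psi>, are fixed so
  that the constants can be expressed in them.\<close>

locale operators = q_wiener M J e \<eta> B F T Q W
  for M :: "'w measure" and J :: "'j set" and e :: "'j \<Rightarrow> 'u::{real_inner, banach, second_countable_topology}"
    and \<eta> :: "'j \<Rightarrow> real" and B :: real and F :: "real \<Rightarrow> 'w measure" and T :: real and Q :: "'u \<Rightarrow>\<^sub>L 'u"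
    and W :: "real \<Rightarrow> 'w \<Rightarrow> 'u" +
  fixes S :: "'u \<Rightarrow>\<^sub>L 'h::{real_inner, banach, second_countable_topology}" and \<Phi> :: "'u \<Rightarrow> 'h"
    and \<Psi> :: "'h \<Rightarrow> 'u \<Rightarrow> 'h" and \<alpha> c :: real
  assumes alpha: "0 < \<alpha>" and c: "0 \<le> c"
    and Phi_eq: "u \<in> U0 J \<eta> e \<Longrightarrow> \<Phi> u = blinfun_apply S u"
    and Psi_linear: "u \<in> U0 J \<eta> e \<Longrightarrow> linear (\<lambda>x. \<Psi> x u)"
    and Psi_bounded: "\<exists>A. bounded_op_Qneg_space J \<eta> e \<alpha> (c * norm x) A \<and> (\<forall>u\<in>U0 J \<eta> e. \<Psi> x u = A u)"
begin

lemma Psi_norm_le: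
  assumes "u \<in> U0 J \<eta> e"
  shows "norm (\<Psi> x u) \<le> c * norm x * norm (Qpow J \<eta> e \<alpha> u)"
proof -
  obtain A where A: "bounded_op_Qneg_space J \<eta> e \<alpha> (c * norm x) A" "\<forall>u\<in>U0 J \<eta> e. \<Psi> x u = A u"
    using Psi_bounded by blast
  then show ?thesis
    using assms subsetD[OF U0_subset_Qneg_space[OF alpha] assms] by (simp add: bounded_op_Qneg_space_def)
qed

lemma Psi_bounded_linear: "u \<in> U0 J \<eta> e \<Longrightarrow> bounded_linear (\<lambda>x. \<Psi> x u)"
proof -
  assume u: "u \<in> U0 J \<eta> e"
  show ?thesis
  proof (intro bounded_linear.intro bounded_linear_axioms.intro exI allI)
    show "linear (\<lambda>x. \<Psi> x u)" by (rule Psi_linear[OF u])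
    show "norm (\<Psi> x u) \<le> norm x * (c * norm (Qpow J \<eta> e \<alpha> u))" for x
      using Psi_norm_le[OF u, of x] by (simp add: mult_ac)
  qed
qed

text \<open>\<open>c\<close> times the norm of Q^\<alpha> (f j), thus a bound for the norm of the
  linear map sending \<open>x\<close> to \<open>\<Psi> x (f j)\<close>. Together with
  \<open>q\<close> it bounds \<open>b i j\<close> by a product that separates the indices.\<close>

definition p :: "'j \<Rightarrow> real" where "p j = c * \<eta> j powr \<alpha> * sqrt (\<eta> j)"

definition q :: "'j \<Rightarrow> real" where "q i = norm (blinfun_apply S (f i))"

text \<open>In the bases \<open>f\<close> the double integral is formally the sum of \<open>I (i,j) *\<^sub>R b i j\<close>, where \<open>I (i,j)\<close> is
  the iterated integral of two standard Brownian motions.\<close>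

definition b :: "'j \<Rightarrow> 'j \<Rightarrow> 'h" where "b i j = \<Psi> (blinfun_apply S (f i)) (f j)"

lemma Psi_f_norm_le: "j \<in> Jp \<Longrightarrow> norm (\<Psi> x (f j)) \<le> norm x * p j"
proof -
  assume j: "j \<in> Jp"
  have "norm (Qpow J \<eta> e \<alpha> (f j)) = \<eta> j powr \<alpha> * sqrt (\<eta> j)"
    using Qpow_scaled_basis[OF alpha JpD(1)[OF j]] JpD[OF j] inner_basis[of j j]
    by (simp add: f_def norm_eq_sqrt_inner mult.commute)
  then show ?thesis using Psi_norm_le[OF f_in_U0[OF j], of x] by (simp add: p_def mult_ac)
qed

lemma b_norm_le: "j \<in> Jp \<Longrightarrow> norm (b i j) \<le> q i * p j"
  unfolding b_def q_def by (rule Psi_f_norm_le)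

text \<open>After \<eta> j powr \<alpha> is bounded by a power of \<open>B\<close>, the factor
  \<eta> j coming from the normalisation of \<open>f j\<close> is left, and the trace sums
  it.\<close>

lemma p_sq_bound: "finite K \<Longrightarrow> K \<subseteq> Jp \<Longrightarrow> (\<Sum>j\<in>K. (p j)\<^sup>2) \<le> c\<^sup>2 * (B powr \<alpha>)\<^sup>2 * B"
proof -
  assume K: "finite K" "K \<subseteq> Jp"
  have "(\<Sum>j\<in>K. (p j)\<^sup>2) \<le> (\<Sum>j\<in>K. c\<^sup>2 * (B powr \<alpha>)\<^sup>2 * \<eta> j)"
  proof (rule sum_mono)
    fix j assume "j \<in> K"
    then have j: "j \<in> J" "0 < \<eta> j" using K JpD by auto
    have "(\<eta> j powr \<alpha>)\<^sup>2 \<le> (B powr \<alpha>)\<^sup>2"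
      using eta_powr_le[OF j(1) alpha] by (intro power_mono) auto
    then have "c\<^sup>2 * (\<eta> j powr \<alpha>)\<^sup>2 * \<eta> j \<le> c\<^sup>2 * (B powr \<alpha>)\<^sup>2 * \<eta> j"
      using j by (intro mult_right_mono mult_left_mono) auto
    then show "(p j)\<^sup>2 \<le> c\<^sup>2 * (B powr \<alpha>)\<^sup>2 * \<eta> j" using j by (simp add: p_def power_mult_distrib)
  qed
  also have "\<dots> = c\<^sup>2 * (B powr \<alpha>)\<^sup>2 * sum \<eta> K" by (simp add: sum_distrib_left)
  also have "\<dots> \<le> c\<^sup>2 * (B powr \<alpha>)\<^sup>2 * B"
    using K Jp_subset by (intro mult_left_mono trace_le) auto
  finally show ?thesis .
qed

lemma q_sq_bound: "finite K \<Longrightarrow> K \<subseteq> Jp \<Longrightarrow> (\<Sum>j\<in>K. (q j)\<^sup>2) \<le> (norm S)\<^sup>2 * B"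
proof -
  assume K: "finite K" "K \<subseteq> Jp"
  have "(\<Sum>j\<in>K. (q j)\<^sup>2) \<le> (\<Sum>j\<in>K. (norm S)\<^sup>2 * \<eta> j)"
  proof (rule sum_mono)
    fix j assume "j \<in> K"
    then have j: "j \<in> J" "0 < \<eta> j" using K JpD by auto
    have "norm (f j) = sqrt (\<eta> j)" using j inner_basis[of j j] by (simp add: f_def norm_eq_sqrt_inner)
    then have "q j \<le> norm S * sqrt (\<eta> j)" using norm_blinfun[of S "f j"] by (simp add: q_def)
    then have "(q j)\<^sup>2 \<le> (norm S * sqrt (\<eta> j))\<^sup>2" by (intro power_mono) (auto simp: q_def)
    then show "(q j)\<^sup>2 \<le> (norm S)\<^sup>2 * \<eta> j" using j by (simp add: power_mult_distrib)
  qed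
  also have "\<dots> = (norm S)\<^sup>2 * sum \<eta> K" by (simp add: sum_distrib_left)
  also have "\<dots> \<le> (norm S)\<^sup>2 * B"
    using K Jp_subset by (intro mult_left_mono trace_le) auto
  finally show ?thesis .
qed

abbreviation "P2 \<equiv> total (\<lambda>j. (p j)\<^sup>2)"
abbreviation "Q2 \<equiv> total (\<lambda>j. (q j)\<^sup>2)"

lemma p_total:
  shows "finite K \<Longrightarrow> K \<subseteq> Jp \<Longrightarrow> (\<Sum>j\<in>K. (p j)\<^sup>2) \<le> P2" and "0 \<le> P2"
    and "0 \<le> tail (\<lambda>j. (p j)\<^sup>2) n" and "tail (\<lambda>j. (p j)\<^sup>2) \<longlonglongrightarrow> 0"
    and "finite K \<Longrightarrow> K \<subseteq> Jp \<Longrightarrow> K \<inter> N n = {} \<Longrightarrow> (\<Sum>j\<in>K. (p j)\<^sup>2) \<le> tail (\<lambda>j. (p j)\<^sup>2) n"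
proof -
  note * = total_bounds[where g="\<lambda>j. (p j)\<^sup>2", OF zero_le_power2 p_sq_bound]
  show "finite K \<Longrightarrow> K \<subseteq> Jp \<Longrightarrow> (\<Sum>j\<in>K. (p j)\<^sup>2) \<le> P2" by (rule *(1))
  show "0 \<le> P2" by (rule *(2))
  show "0 \<le> tail (\<lambda>j. (p j)\<^sup>2) n" by (rule *(3))
  show "tail (\<lambda>j. (p j)\<^sup>2) \<longlonglongrightarrow> 0" by (rule *(4))
  show "finite K \<Longrightarrow> K \<subseteq> Jp \<Longrightarrow> K \<inter> N n = {} \<Longrightarrow> (\<Sum>j\<in>K. (p j)\<^sup>2) \<le> tail (\<lambda>j. (p j)\<^sup>2) n" by (rule *(5))
qed

lemma q_total:
  shows "finite K \<Longrightarrow> K \<subseteq> Jp \<Longrightarrow> (\<Sum>j\<in>K. (q j)\<^sup>2) \<le> Q2" and "0 \<le> Q2"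
    and "0 \<le> tail (\<lambda>j. (q j)\<^sup>2) n" and "tail (\<lambda>j. (q j)\<^sup>2) \<longlonglongrightarrow> 0"
    and "finite K \<Longrightarrow> K \<subseteq> Jp \<Longrightarrow> K \<inter> N n = {} \<Longrightarrow> (\<Sum>j\<in>K. (q j)\<^sup>2) \<le> tail (\<lambda>j. (q j)\<^sup>2) n"
proof -
  note * = total_bounds[where g="\<lambda>j. (q j)\<^sup>2", OF zero_le_power2 q_sq_bound]
  show "finite K \<Longrightarrow> K \<subseteq> Jp \<Longrightarrow> (\<Sum>j\<in>K. (q j)\<^sup>2) \<le> Q2" by (rule *(1))
  show "0 \<le> Q2" by (rule *(2))
  show "0 \<le> tail (\<lambda>j. (q j)\<^sup>2) n" by (rule *(3))
  show "tail (\<lambda>j. (q j)\<^sup>2) \<longlonglongrightarrow> 0" by (rule *(4))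
  show "finite K \<Longrightarrow> K \<subseteq> Jp \<Longrightarrow> K \<inter> N n = {} \<Longrightarrow> (\<Sum>j\<in>K. (q j)\<^sup>2) \<le> tail (\<lambda>j. (q j)\<^sup>2) n" by (rule *(5))
qed

lemma HS_op_Phi: "HS_op J \<eta> e \<Phi>"
  unfolding HS_op_def
proof (intro conjI)
  show "linear_on_subspace (U0 J \<eta> e) \<Phi>"
    by (auto simp: linear_on_subspace_def Phi_eq U0_add U0_scale blinfun.add_right blinfun.scaleR_right)
  show "\<exists>c. \<forall>u\<in>U0 J \<eta> e. norm (\<Phi> u) \<le> c * U0_norm J \<eta> e u"
  proof (intro exI ballI)
    fix u assume u: "u \<in> U0 J \<eta> e"
    have "norm (\<Phi> u) \<le> norm S * norm u" using norm_blinfun[of S u] u by (simp add: Phi_eq)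
    also have "\<dots> \<le> norm S * (B powr (1/2) * U0_norm J \<eta> e u)"
      by (intro mult_left_mono norm_le_U0_norm u) auto
    finally show "norm (\<Phi> u) \<le> (norm S * B powr (1/2)) * U0_norm J \<eta> e u" by (simp add: mult_ac)
  qed
  have "HS_norm_sq J \<eta> e \<Phi> \<le> ennreal Q2"
    unfolding HS_norm_sq_eq_hs
  proof (rule hs_le)
    fix n
    have "(\<Sum>j\<in>N n. (norm (\<Phi> (f j)))\<^sup>2) = (\<Sum>j\<in>N n. (q j)\<^sup>2)"
      using N_subset f_in_U0 by (intro sum.cong refl) (auto simp: q_def Phi_eq subset_eq)
    then show "(\<Sum>j\<in>N n. (norm (\<Phi> (f j)))\<^sup>2) \<le> Q2" using q_total(1)[OF finite_N N_subset] by simp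
  qed
  then show "HS_norm_sq J \<eta> e \<Phi> < \<infinity>" by (metis ennreal_less_top infinity_ennreal_def order_le_less_trans)
qed

lemma Psi_sum_sq_le: "finite K \<Longrightarrow> K \<subseteq> Jp \<Longrightarrow> (\<Sum>j\<in>K. (norm (\<Psi> x (f j)))\<^sup>2) \<le> (norm x)\<^sup>2 * (\<Sum>j\<in>K. (p j)\<^sup>2)"
  unfolding sum_distrib_left
proof (rule sum_mono)
  fix j assume "finite K" "K \<subseteq> Jp" "j \<in> K"
  then have "norm (\<Psi> x (f j)) \<le> norm x * p j" using Psi_f_norm_le by blast
  then have "(norm (\<Psi> x (f j)))\<^sup>2 \<le> (norm x * p j)\<^sup>2" by (intro power_mono) auto
  then show "(norm (\<Psi> x (f j)))\<^sup>2 \<le> (norm x)\<^sup>2 * (p j)\<^sup>2" by (simp add: power_mult_distrib)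
qed

text \<open>Holds for every \<open>x\<close>, because a predictable modification must have
  Hilbert-Schmidt values for every \<omega> and not only almost surely.\<close>

lemma HS_op_Psi: "HS_op J \<eta> e (\<Psi> x)"
  unfolding HS_op_def
proof (intro conjI)
  obtain A where A: "bounded_op_Qneg_space J \<eta> e \<alpha> (c * norm x) A" "\<forall>u\<in>U0 J \<eta> e. \<Psi> x u = A u"
    using Psi_bounded by blast
  then show "linear_on_subspace (U0 J \<eta> e) (\<Psi> x)"
    using U0_subset_Qneg_space[OF alpha]
    by (auto simp: linear_on_subspace_def bounded_op_Qneg_space_def U0_add U0_scale subset_eq)
  show "\<exists>c. \<forall>u\<in>U0 J \<eta> e. norm (\<Psi> x u) \<le> c * U0_norm J \<eta> e u"
  proof (intro exI ballI)
    fix u assume u: "u \<in> U0 J \<eta> e"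
    have "norm (\<Psi> x u) \<le> c * norm x * norm (Qpow J \<eta> e \<alpha> u)" by (rule Psi_norm_le[OF u])
    also have "\<dots> \<le> c * norm x * (B powr \<alpha> * (B powr (1/2) * U0_norm J \<eta> e u))"
    proof (intro mult_left_mono)
      have "norm (Qpow J \<eta> e \<alpha> u) \<le> B powr \<alpha> * norm u" by (rule Qpow_norm_le[OF alpha])
      also have "\<dots> \<le> B powr \<alpha> * (B powr (1/2) * U0_norm J \<eta> e u)"
        by (intro mult_left_mono norm_le_U0_norm u) auto
      finally show "norm (Qpow J \<eta> e \<alpha> u) \<le> B powr \<alpha> * (B powr (1/2) * U0_norm J \<eta> e u)" .
    qed (use c in auto)
    finally show "norm (\<Psi> x u) \<le> (c * norm x * B powr \<alpha> * B powr (1/2)) * U0_norm J \<eta> e u"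
      by (simp add: mult_ac)
  qed
  have "HS_norm_sq J \<eta> e (\<Psi> x) \<le> ennreal ((norm x)\<^sup>2 * P2)"
    unfolding HS_norm_sq_eq_hs
  proof (rule hs_le)
    fix n
    have "(\<Sum>j\<in>N n. (norm (\<Psi> x (f j)))\<^sup>2) \<le> (norm x)\<^sup>2 * (\<Sum>j\<in>N n. (p j)\<^sup>2)"
      by (rule Psi_sum_sq_le[OF finite_N N_subset])
    also have "\<dots> \<le> (norm x)\<^sup>2 * P2" by (intro mult_left_mono p_total(1) finite_N N_subset) auto
    finally show "(\<Sum>j\<in>N n. (norm (\<Psi> x (f j)))\<^sup>2) \<le> (norm x)\<^sup>2 * P2" .
  qed
  then show "HS_norm_sq J \<eta> e (\<Psi> x) < \<infinity>" by (metis ennreal_less_top infinity_ennreal_def order_le_less_trans)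
qed

section \<open>The inner integral\<close>

lemma S_increment_measurable:
  assumes "0 \<le> s" "s \<le> t" "t \<le> r" "t \<le> T"
  shows "(\<lambda>\<omega>. blinfun_apply S (W t \<omega> - W s \<omega>)) \<in> borel_measurable (F r)"
proof -
  have d: "(\<lambda>\<omega>. W t \<omega> - W s \<omega>) \<in> borel_measurable (F r)"
    using W_measurable'[of s r] W_measurable'[of t r] assms by auto
  have "blinfun_apply S \<in> borel_measurable borel"
    by (intro borel_measurable_continuous_onI linear_continuous_on blinfun.bounded_linear_right)
  from measurable_compose[OF d this] show ?thesis .
qed

text \<open>The integrand is itself elementary: one interval with the constant value
  \<open>S\<close>. The approximating sequence is therefore constant.\<close>

lemma is_ito_integral_Phi:
  assumes "0 \<le> s" "s \<le> t" "t \<le> T"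
  shows "is_ito_integral M F J \<eta> e W s t (\<lambda>_ _. \<Phi>) (\<lambda>\<omega>. blinfun_apply S (W t \<omega> - W s \<omega>))"
  unfolding is_ito_integral_def
proof (intro conjI exI allI ballI AE_I2)
  show "(\<lambda>\<omega>. blinfun_apply S (W t \<omega> - W s \<omega>)) \<in> borel_measurable M"
    using S_increment_measurable[OF assms(1,2) order_refl assms(3)] assms by (intro measurable_F_M[of t]) auto
  show "predictable_HS_process M F J \<eta> e s t (\<lambda>_ _. \<Phi>)"
    using HS_op_Phi by (simp add: predictable_HS_process_def)
  define \<tau> where "\<tau> = (\<lambda>(n::nat) (m::nat). if m = 0 then s else t)"
  define A :: "nat \<Rightarrow> nat \<Rightarrow> 'w \<Rightarrow> ('u \<Rightarrow>\<^sub>L 'h)" where "A = (\<lambda>n m \<omega>. S)"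
  show "elementary F s t (\<tau> n) ((\<lambda>n. 1) n) (A n)" for n
    using assms by (auto simp: elementary_def \<tau>_def A_def)
  have "(\<integral>\<^sup>+ r\<in>{s..t}. HS_norm_sq J \<eta> e (\<lambda>u. \<Phi> u - elementary_process (\<tau> n) 1 (A n) r \<omega> u) \<partial>lborel) = 0" for n \<omega>
  proof -
    \<comment> \<open>The interval is left-open, so the elementary process is 0 instead of
      \<open>S\<close> at the left end.\<close>
    have "AE r in lborel. r \<noteq> s" by (rule AE_lborel_singleton)
    then have "AE r in lborel. HS_norm_sq J \<eta> e (\<lambda>u. \<Phi> u - elementary_process (\<tau> n) 1 (A n) r \<omega> u) * indicator {s..t} r = 0"
    proof eventually_elim
      case (elim r)
      have "hs (\<lambda>j. \<Phi> (f j) - elementary_process (\<tau> n) 1 (A n) r \<omega> (f j)) = 0" if "r \<in> {s..t}"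
      proof -
        have "hs (\<lambda>j. \<Phi> (f j) - elementary_process (\<tau> n) 1 (A n) r \<omega> (f j)) = hs (\<lambda>j. 0 :: 'h)"
          using that elim f_in_U0 by (intro hs_cong) (auto simp: elementary_process_def \<tau>_def A_def Phi_eq)
        then show ?thesis by (simp add: hs_def)
      qed
      then show ?case unfolding HS_norm_sq_eq_hs by (auto simp: indicator_def)
    qed
    then show ?thesis by (subst nn_integral_cong_AE) auto
  qed
  then show "(\<lambda>n. \<integral>\<^sup>+\<omega>. (\<integral>\<^sup>+r\<in>{s..t}. HS_norm_sq J \<eta> e (\<lambda>u. \<Phi> u - elementary_process (\<tau> n) ((\<lambda>n. 1) n) (A n) r \<omega> u) \<partial>lborel) \<partial>M) \<longlonglongrightarrow> 0"
    by simp
  show "(\<lambda>n. mean_square M (\<lambda>\<omega>. blinfun_apply S (W t \<omega> - W s \<omega>) - elementary_integral W (\<tau> n) ((\<lambda>n. 1) n) (A n) \<omega>)) \<longlonglongrightarrow> 0"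
    by (simp add: elementary_integral_def \<tau>_def A_def mean_square_def)
qed simp

text \<open>The inner integral truncated to the coordinates in \<open>N n\<close>. In contrast to
  the integral it is a finite sum, to which \<open>ito_bound\<close> applies.\<close>

definition Z :: "nat \<Rightarrow> real \<Rightarrow> real \<Rightarrow> 'w \<Rightarrow> 'h" where
  "Z n s t \<omega> = (\<Sum>i\<in>N n. \<beta> i s t \<omega> *\<^sub>R blinfun_apply S (f i))"

lemma rep_Z:
  assumes "0 \<le> s" "s \<le> t" "t \<le> T"
  shows "rep s t (\<lambda>r \<omega> i. if i \<in> N n then indicat_real {s<..t} r *\<^sub>R blinfun_apply S (f i) else 0) (Z n s t)"
proof -
  have "rep s t (\<lambda>r \<omega> i. \<Sum>j\<in>N n. if i = j then (1 * indicat_real {s<..t} r) *\<^sub>R blinfun_apply S (f j) else 0)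
    (\<lambda>\<omega>. \<Sum>j\<in>N n. (1 * \<beta> j s t \<omega>) *\<^sub>R blinfun_apply S (f j))"
    using assms N_subset by (intro rep_sum finite_N rep_single L2F_const) auto
  then show ?thesis
    by (rule rep_cong) (auto simp: Z_def finite_N)
qed

lemma Z_measurable: "0 \<le> s \<Longrightarrow> s \<le> t \<Longrightarrow> t \<le> T \<Longrightarrow> Z n s t \<in> borel_measurable M"
  using rep_measurable(1)[OF _ _ rep_Z] by simp

lemma Z_mean_square:
  assumes "0 \<le> s" "s \<le> t" "t \<le> T"
  shows "mean_square M (Z n s t) \<le> ennreal ((t - s) * Q2)"
proof -
  have "mean_square M (Z n s t) = (\<integral>\<^sup>+r\<in>{s..t}. (\<integral>\<^sup>+\<omega>. hs (\<lambda>i. if i \<in> N n then indicat_real {s<..t} r *\<^sub>R blinfun_apply S (f i) else 0) \<partial>M) \<partial>lborel)"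
    using assms by (intro isometry rep_Z) auto
  also have "\<dots> \<le> (\<integral>\<^sup>+r\<in>{s..t}. ennreal Q2 \<partial>lborel)"
  proof (intro nn_integral_mono mult_right_mono)
    fix r
    have "hs (\<lambda>i. if i \<in> N n then indicat_real {s<..t} r *\<^sub>R blinfun_apply S (f i) else 0) \<le> ennreal Q2"
    proof (rule hs_le)
      fix m
      have "(\<Sum>j\<in>N m. (norm (if j \<in> N n then indicat_real {s<..t} r *\<^sub>R blinfun_apply S (f j) else 0))\<^sup>2) \<le> (\<Sum>j\<in>N m. (q j)\<^sup>2)"
        by (intro sum_mono) (auto simp: q_def indicator_def)
      also have "\<dots> \<le> Q2" by (rule q_total(1)[OF finite_N N_subset])
      finally show "(\<Sum>j\<in>N m. (norm (if j \<in> N n then indicat_real {s<..t} r *\<^sub>R blinfun_apply S (f j) else 0))\<^sup>2) \<le> Q2" .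
    qed
    then have "(\<integral>\<^sup>+\<omega>. hs (\<lambda>i. if i \<in> N n then indicat_real {s<..t} r *\<^sub>R blinfun_apply S (f i) else 0) \<partial>M) \<le> (\<integral>\<^sup>+\<omega>. ennreal Q2 \<partial>M)"
      by (intro nn_integral_mono)
    then show "(\<integral>\<^sup>+\<omega>. hs (\<lambda>i. if i \<in> N n then indicat_real {s<..t} r *\<^sub>R blinfun_apply S (f i) else 0) \<partial>M) \<le> ennreal Q2"
      by (simp add: emeasure_space_1)
  qed simp
  also have "\<dots> = ennreal Q2 * emeasure lborel {s..t}" by (simp add: nn_integral_cmult)
  also have "\<dots> = ennreal ((t - s) * Q2)" using assms q_total(2) by (simp add: ennreal_mult mult.commute)
  finally show ?thesis .
qed

text \<open>On (s, t] the integrand and its truncation differ exactly in the coordinates outside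
  \<open>N n\<close>. As this holds for every version of the integral, it will also identify the one
  chosen by \<open>SOME\<close>.\<close>

lemma ito_Phi_approx:
  assumes "0 \<le> s" "s \<le> t" "t \<le> T" and I: "is_ito_integral M F J \<eta> e W s t (\<lambda>_ _. \<Phi>) I"
  shows "mean_square M (\<lambda>\<omega>. I \<omega> - Z n s t \<omega>) \<le> ennreal (4 * (t - s) * tail (\<lambda>j. (q j)\<^sup>2) n)"
proof (rule ito_bound[OF assms(1-3) I rep_Z[OF assms(1-3)]])
  show "0 \<le> tail (\<lambda>j. (q j)\<^sup>2) n" by (rule q_total(3))
  fix r assume r: "s < r" "r \<le> t"
  have "hs (\<lambda>j. \<Phi> (f j) - (if j \<in> N n then indicat_real {s<..t} r *\<^sub>R blinfun_apply S (f j) else 0)) \<le> ennreal (tail (\<lambda>j. (q j)\<^sup>2) n)"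
  proof (rule hs_le)
    fix m
    have "(\<Sum>j\<in>N m. (norm (\<Phi> (f j) - (if j \<in> N n then indicat_real {s<..t} r *\<^sub>R blinfun_apply S (f j) else 0)))\<^sup>2)
      = (\<Sum>j\<in>N m - N n. (q j)\<^sup>2)"
      using r N_subset f_in_U0 finite_N
      by (intro sum.mono_neutral_cong_right) (auto simp: q_def Phi_eq subset_eq)
    also have "\<dots> \<le> tail (\<lambda>j. (q j)\<^sup>2) n"
      using N_subset finite_N by (intro q_total(5)) auto
    finally show "(\<Sum>j\<in>N m. (norm (\<Phi> (f j) - (if j \<in> N n then indicat_real {s<..t} r *\<^sub>R blinfun_apply S (f j) else 0)))\<^sup>2) \<le> tail (\<lambda>j. (q j)\<^sup>2) n" .
  qed
  then have "(\<integral>\<^sup>+\<omega>. hs (\<lambda>j. \<Phi> (f j) - (if j \<in> N n then indicat_real {s<..t} r *\<^sub>R blinfun_apply S (f j) else 0)) \<partial>M)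
     \<le> (\<integral>\<^sup>+\<omega>. ennreal (tail (\<lambda>j. (q j)\<^sup>2) n) \<partial>M)" by (intro nn_integral_mono)
  then show "(\<integral>\<^sup>+\<omega>. hs (\<lambda>j. \<Phi> (f j) - (if j \<in> N n then indicat_real {s<..t} r *\<^sub>R blinfun_apply S (f j) else 0)) \<partial>M)
     \<le> ennreal (tail (\<lambda>j. (q j)\<^sup>2) n)" by (simp add: emeasure_space_1)
qed

definition V :: "real \<Rightarrow> real \<Rightarrow> 'w \<Rightarrow> 'h" where "V s t \<omega> = blinfun_apply S (W t \<omega> - W s \<omega>)"

lemma V_measurable: "0 \<le> s \<Longrightarrow> s \<le> t \<Longrightarrow> t \<le> T \<Longrightarrow> V s t \<in> borel_measurable M"
  unfolding V_def by (rule measurable_F_M[OF _ S_increment_measurable[of s t t]]) auto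

lemma V_approx:
  assumes "0 \<le> s" "s \<le> t" "t \<le> T"
  shows "mean_square M (\<lambda>\<omega>. V s t \<omega> - Z n s t \<omega>) \<le> ennreal (4 * (t - s) * tail (\<lambda>j. (q j)\<^sup>2) n)"
  unfolding V_def by (rule ito_Phi_approx[OF assms is_ito_integral_Phi[OF assms]])

text \<open>The case n = 0 of the approximation: \<open>N 0\<close> is empty, so the truncation is
  zero and the tail is the total. The factor 4 is inherited from \<open>ito_bound\<close>.\<close>

lemma V_mean_square:
  assumes "0 \<le> s" "s \<le> t" "t \<le> T"
  shows "mean_square M (V s t) \<le> ennreal (4 * (t - s) * Q2)"
proof -
  have "N 0 = {}" by (auto simp: N_def)
  then have "mean_square M (V s t) \<le> ennreal (4 * (t - s) * tail (\<lambda>j. (q j)\<^sup>2) 0)"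
    using V_approx[OF assms, of 0] by (simp add: Z_def)
  also have "tail (\<lambda>j. (q j)\<^sup>2) 0 = Q2" using \<open>N 0 = {}\<close> by (simp add: tail_def)
  finally show ?thesis .
qed

text \<open>The chosen version and \<open>V\<close> are both close to the same truncations, hence
  equal almost surely. The constant 16 is 2 * 4 + 2 * 4.\<close>

lemma inner_ito_integral:
  assumes st: "0 \<le> s" "s \<le> t" "t \<le> T"
  shows "AE \<omega> in M. ito_integral M F J \<eta> e W s t (\<lambda>_ _. \<Phi>) \<omega> = V s t \<omega>"
proof -
  define I where "I = ito_integral M F J \<eta> e W s t (\<lambda>_ _. \<Phi>)"
  have I: "is_ito_integral M F J \<eta> e W s t (\<lambda>_ _. \<Phi>) I"
    unfolding I_def ito_integral_def
    by (rule someI[of "is_ito_integral M F J \<eta> e W s t (\<lambda>_ _. \<Phi>)", OF is_ito_integral_Phi[OF st]])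
  then have Im: "I \<in> borel_measurable M" by (simp add: is_ito_integral_def)
  note m = Im V_measurable[OF st] Z_measurable[OF st]
  have "mean_square M (\<lambda>\<omega>. I \<omega> - V s t \<omega>) \<le> ennreal (16 * (t - s) * tail (\<lambda>j. (q j)\<^sup>2) n) + 0" for n
  proof -
    let ?x = "4 * (t - s) * tail (\<lambda>j. (q j)\<^sup>2) n"
    have x: "0 \<le> ?x" using st q_total(3)[of n] by simp
    have "mean_square M (\<lambda>\<omega>. I \<omega> - V s t \<omega>) \<le> 2 * mean_square M (\<lambda>\<omega>. I \<omega> - Z n s t \<omega>) + 2 * mean_square M (\<lambda>\<omega>. Z n s t \<omega> - V s t \<omega>)"
      by (intro mean_square_triangle m)
    also have "\<dots> \<le> 2 * ennreal ?x + 2 * ennreal ?x"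
      unfolding mean_square_commute[of M "Z n s t"]
      by (intro add_mono mult_left_mono ito_Phi_approx[OF st I] V_approx[OF st]) auto
    also have "2 * ennreal y + 2 * ennreal y = ennreal (4 * y)" if "0 \<le> y" for y
    proof -
      have "2 * ennreal y = ennreal (2 * y)" using that by (simp add: ennreal_mult)
      then show ?thesis using that by (simp add: ennreal_plus[symmetric] del: ennreal_plus)
    qed
    note this[OF x]
    finally show ?thesis by (simp add: algebra_simps)
  qed
  then have "mean_square M (\<lambda>\<omega>. I \<omega> - V s t \<omega>) \<le> 0"
  proof (rule ennreal_add_le_limit)
    have "(\<lambda>n. 16 * (t - s) * tail (\<lambda>j. (q j)\<^sup>2) n) \<longlonglongrightarrow> 16 * (t - s) * 0"
      by (intro tendsto_mult tendsto_const q_total(4))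
    then show "(\<lambda>n. ennreal (16 * (t - s) * tail (\<lambda>j. (q j)\<^sup>2) n)) \<longlonglongrightarrow> 0"
      by (metis ennreal_0 mult_zero_right tendsto_ennrealI)
  qed
  then have "AE \<omega> in M. I \<omega> - V s t \<omega> = 0"
    using m by (intro mean_square_0_AE) auto
  then show ?thesis unfolding I_def by simp
qed

end

section \<open>Riemann sums for the outer integral\<close>

context q_wiener
begin

text \<open>The preimage of an open set is a generator, joined with the complement of the strip (c,
  d] times \<Omega> if the set contains 0.\<close>

lemma predictable_step:
  fixes X :: "'w \<Rightarrow> 'h::{real_normed_vector, second_countable_topology}"
  assumes a: "0 \<le> a" "a \<le> c" "c \<le> d" "d \<le> b" and X: "X \<in> borel_measurable (F c)"
  shows "(\<lambda>x. indicat_real {c<..d} (fst x) *\<^sub>R X (snd x)) \<in> borel_measurable (predictable_algebra M F a b)"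
proof -
  have ab: "a \<le> b" using a by simp
  have GS: "predictable_generators a b \<subseteq> Pow ({a..b} \<times> space M)"
    using a ab by (intro predictable_generators_subset)
  have sp: "space (predictable_algebra M F a b) = {a..b} \<times> space M"
    unfolding predictable_algebra_def by (rule space_measure_of[OF GS])
  have gen: "{c<..d} \<times> A \<in> sets (predictable_algebra M F a b)" if "A \<in> sets (F c)" for A
    unfolding predictable_algebra_def sets_measure_of[OF GS] using that a by (intro sigma_sets.Basic) blast
  have c0: "0 \<le> c" using a by simp
  show ?thesis
  proof (rule borel_measurableI)
    fix A :: "'h set" assume "open A"
    then have pre: "X -` A \<inter> space M \<in> sets (F c)"
      using measurable_sets[OF X, of A] space_F[OF c0] by simp
    have all: "{c<..d} \<times> space M \<in> sets (predictable_algebra M F a b)"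
      using gen[of "space M"] sets.top[of "F c"] space_F[OF c0] by simp
    have "(\<lambda>x. indicat_real {c<..d} (fst x) *\<^sub>R X (snd x)) -` A \<inter> space (predictable_algebra M F a b)
      = ({c<..d} \<times> (X -` A \<inter> space M)) \<union> (if 0 \<in> A then space (predictable_algebra M F a b) - {c<..d} \<times> space M else {})"
      unfolding sp using a by (auto simp: indicator_def of_bool_def split: if_splits)
    also have "\<dots> \<in> sets (predictable_algebra M F a b)"
      using gen[OF pre] all by auto
    finally show "(\<lambda>x. indicat_real {c<..d} (fst x) *\<^sub>R X (snd x)) -` A \<inter> space (predictable_algebra M F a b)
      \<in> sets (predictable_algebra M F a b)" .
  qed
qed

text \<open>Dominated convergence: simple functions with |x i| \<le> 2 |X| converge pointwise, and 9
  X^2 dominates the squared differences.\<close>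

lemma simple_approximation:
  assumes a: "0 \<le> a" and X: "L2F a X" and \<delta>: "0 < (\<delta>::real)"
  shows "\<exists>x. simple_function (F a) x \<and> (\<integral>\<^sup>+\<omega>. ennreal ((X \<omega> - x \<omega>)\<^sup>2) \<partial>M) \<le> ennreal \<delta>"
proof -
  obtain x where x: "\<And>i. simple_function (F a) (x i)"
    "\<And>\<omega>. \<omega> \<in> space (F a) \<Longrightarrow> (\<lambda>i. x i \<omega>) \<longlonglongrightarrow> X \<omega>"
    "\<And>i \<omega>. \<omega> \<in> space (F a) \<Longrightarrow> dist (x i \<omega>) 0 \<le> 2 * dist (X \<omega>) 0"
    using borel_measurable_implies_sequence_metric[OF L2F_D(1)[OF X], of 0] by blast
  note sp = space_F[OF a]
  have [measurable]: "x i \<in> borel_measurable M" for i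
    using measurable_F_M[OF a borel_measurable_simple_function[OF x(1)]] .
  have [measurable]: "X \<in> borel_measurable M" by (rule L2F_measurable[OF a X])
  have w: "integrable M (\<lambda>\<omega>. 9 * (X \<omega>)\<^sup>2)" using L2F_D(2)[OF X] by simp
  have bd: "norm ((X \<omega> - x i \<omega>)\<^sup>2) \<le> 9 * (X \<omega>)\<^sup>2" if "\<omega> \<in> space M" for i \<omega>
  proof -
    have "\<bar>X \<omega> - x i \<omega>\<bar> \<le> 3 * \<bar>X \<omega>\<bar>" using x(3)[of \<omega> i] that sp by auto
    then have "\<bar>X \<omega> - x i \<omega>\<bar>\<^sup>2 \<le> (3 * \<bar>X \<omega>\<bar>)\<^sup>2" by (intro power_mono) auto
    then show ?thesis by (simp add: power_mult_distrib)
  qed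
  have lim: "(\<lambda>i. (X \<omega> - x i \<omega>)\<^sup>2) \<longlonglongrightarrow> 0" if "\<omega> \<in> space M" for \<omega>
  proof -
    have "(\<lambda>i. (X \<omega> - x i \<omega>)\<^sup>2) \<longlonglongrightarrow> (X \<omega> - X \<omega>)\<^sup>2" using that sp by (intro tendsto_intros x) auto
    then show ?thesis by simp
  qed
  have int: "integrable M (\<lambda>\<omega>. (X \<omega> - x i \<omega>)\<^sup>2)" for i
    using bd by (intro Bochner_Integration.integrable_bound[OF w]) auto
  have "(\<lambda>i. \<integral>\<omega>. (X \<omega> - x i \<omega>)\<^sup>2 \<partial>M) \<longlonglongrightarrow> (\<integral>\<omega>. 0 \<partial>M)"
    using lim bd by (intro integral_dominated_convergence[OF _ _ w]) auto
  then have "\<forall>\<^sub>F i in sequentially. (\<integral>\<omega>. (X \<omega> - x i \<omega>)\<^sup>2 \<partial>M) < \<delta>"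
    using \<delta> by (intro order_tendstoD) auto
  then obtain i where "(\<integral>\<omega>. (X \<omega> - x i \<omega>)\<^sup>2 \<partial>M) < \<delta>"
    by (auto simp: eventually_sequentially)
  then have "(\<integral>\<^sup>+\<omega>. ennreal ((X \<omega> - x i \<omega>)\<^sup>2) \<partial>M) \<le> ennreal \<delta>"
    using int by (subst nn_integral_eq_integral) (auto intro: ennreal_leI)
  with x(1) show ?thesis by blast
qed

end

locale grid = operators M J e \<eta> B F T Q W S \<Phi> \<Psi> \<alpha> c
  for M :: "'w measure" and J :: "'j set" and e :: "'j \<Rightarrow> 'u::{real_inner, banach, second_countable_topology}"
    and \<eta> :: "'j \<Rightarrow> real" and B :: real and F :: "real \<Rightarrow> 'w measure" and T :: real and Q :: "'u \<Rightarrow>\<^sub>L 'u"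
    and W :: "real \<Rightarrow> 'w \<Rightarrow> 'u" and S :: "'u \<Rightarrow>\<^sub>L 'h::{real_inner, banach, second_countable_topology}"
    and \<Phi> :: "'u \<Rightarrow> 'h" and \<Psi> :: "'h \<Rightarrow> 'u \<Rightarrow> 'h" and \<alpha> c :: real +
  fixes t h :: real
  assumes t0: "0 \<le> t" and h0: "0 < h" and thT: "t + h \<le> T"
begin

definition \<tau> :: "nat \<Rightarrow> nat \<Rightarrow> real" where "\<tau> n m = t + real m * (h / real n)"

lemma tau_0 [simp]: "\<tau> n 0 = t" by (simp add: \<tau>_def)

lemma tau_n: "0 < n \<Longrightarrow> \<tau> n n = t + h" by (simp add: \<tau>_def)

lemma tau_mono: "m \<le> m' \<Longrightarrow> \<tau> n m \<le> \<tau> n m'"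
  using h0 by (simp add: \<tau>_def divide_right_mono mult_right_mono)

lemma tau_ge: "t \<le> \<tau> n m" "0 \<le> \<tau> n m" using tau_mono[of 0 m n] t0 by auto

lemma tau_le: "m \<le> n \<Longrightarrow> 0 < n \<Longrightarrow> \<tau> n m \<le> t + h" "m \<le> n \<Longrightarrow> 0 < n \<Longrightarrow> \<tau> n m \<le> T"
  using tau_mono[of m n n] tau_n[of n] thT by auto

lemma tau_Suc: "\<tau> n m \<le> \<tau> n (Suc m)" by (rule tau_mono) simp

lemma tau_diff: "\<tau> n (Suc m) - \<tau> n m = h / real n" by (simp add: \<tau>_def algebra_simps add_divide_distrib)

text \<open>Cells are left-open, so the least \<open>m\<close> whose right end reaches
  \<open>s\<close> is the only cell containing it. At \<open>s\<close> every step process then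
  reduces to its value on that cell.\<close>

lemma grid_cell:
  assumes n: "0 < n" and s: "t < s" "s \<le> t + h"
  obtains m where "m < n" "\<tau> n m < s" "s \<le> \<tau> n (Suc m)" "s - \<tau> n m \<le> h / real n"
    "\<And>m'. indicat_real {\<tau> n m'<..\<tau> n (Suc m')} s = (if m' = m then 1 else 0)"
proof -
  define m where "m = (LEAST m. s \<le> \<tau> n (Suc m))"
  have ex: "s \<le> \<tau> n (Suc (n - 1))" using n s tau_n[OF n] by simp
  have 1: "s \<le> \<tau> n (Suc m)" unfolding m_def using ex by (rule LeastI)
  have mn: "m \<le> n - 1" unfolding m_def using ex by (rule Least_le)
  have 2: "\<tau> n m < s"
  proof (cases m)
    case 0 then show ?thesis using s by simp
  next
    case (Suc k)
    then have "k < (LEAST m. s \<le> \<tau> n (Suc m))" by (simp add: m_def)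
    then have "\<not> s \<le> \<tau> n (Suc k)" by (rule not_less_Least)
    then show ?thesis using Suc by simp
  qed
  have 3: "indicat_real {\<tau> n m'<..\<tau> n (Suc m')} s = (if m' = m then 1 else 0)" for m'
  proof -
    consider "m' = m" | "m' < m" | "m < m'" by linarith
    then show ?thesis
    proof cases
      case 1 then show ?thesis using \<open>s \<le> \<tau> n (Suc m)\<close> 2 by simp
    next
      case 2
      then have "\<tau> n (Suc m') \<le> \<tau> n m" by (intro tau_mono) simp
      then show ?thesis using \<open>\<tau> n m < s\<close> 2 by simp
    next
      case 3
      then have "\<tau> n (Suc m) \<le> \<tau> n m'" by (intro tau_mono) simp
      then show ?thesis using 1 3 by simp
    qed
  qed
  show ?thesis using that[of m] mn n 1 2 3 tau_diff[of n m] by fastforce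
qed

text \<open>Left-point sums: the inner integral is frozen at the start of each cell. The same
  \<open>n\<close> refines the grid and enlarges the set of coordinates, so that a single limit
  suffices.\<close>

definition R :: "nat \<Rightarrow> 'w \<Rightarrow> 'h" where
  "R n \<omega> = (\<Sum>m<n. \<Sum>i\<in>N n. \<Sum>j\<in>N n. (\<beta> i t (\<tau> n m) \<omega> * \<beta> j (\<tau> n m) (\<tau> n (Suc m)) \<omega>) *\<^sub>R b i j)"

text \<open>\<open>\<Gamma> n\<close> is the step process whose stochastic integral is \<open>R n\<close>.\<close>

definition \<Gamma> :: "nat \<Rightarrow> real \<Rightarrow> 'w \<Rightarrow> 'j \<Rightarrow> 'h" where
  "\<Gamma> n s \<omega> k = (\<Sum>m<n. \<Sum>i\<in>N n. \<Sum>j\<in>N n. if k = j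
     then (\<beta> i t (\<tau> n m) \<omega> * indicat_real {\<tau> n m<..\<tau> n (Suc m)} s) *\<^sub>R b i j else 0)"

lemma rep_R: "rep t (t + h) (\<Gamma> n) (R n)"
proof -
  have "rep t (t + h)
    (\<lambda>s \<omega> k. \<Sum>m<n. \<Sum>i\<in>N n. \<Sum>j\<in>N n. if k = j then (\<beta> i t (\<tau> n m) \<omega> * indicat_real {\<tau> n m<..\<tau> n (Suc m)} s) *\<^sub>R b i j else 0)
    (\<lambda>\<omega>. \<Sum>m<n. \<Sum>i\<in>N n. \<Sum>j\<in>N n. (\<beta> i t (\<tau> n m) \<omega> * \<beta> j (\<tau> n m) (\<tau> n (Suc m)) \<omega>) *\<^sub>R b i j)"
  proof (intro rep_sum finite_N finite_lessThan rep_single)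
    fix m i j assume "m \<in> {..<n}" "i \<in> N n" "j \<in> N n"
    then show "t \<le> \<tau> n m" "\<tau> n m \<le> \<tau> n (Suc m)" "\<tau> n (Suc m) \<le> t + h" "j \<in> Jp" "L2F (\<tau> n m) (\<beta> i t (\<tau> n m))"
      using tau_ge tau_Suc tau_le subsetD[OF N_subset] t0 by (auto intro!: L2F_beta)
  qed
  then show ?thesis unfolding R_def[abs_def] \<Gamma>_def[abs_def] .
qed

lemma R_measurable: "R n \<in> borel_measurable M"
  using rep_measurable(1)[OF t0 thT rep_R] .

lemma Gamma_measurable: "(\<lambda>\<omega>. \<Gamma> n s \<omega> j) \<in> borel_measurable M"
  using rep_measurable(2)[OF t0 thT rep_R] .

lemma Gamma_cell:
  assumes "m < n" "\<And>m'. indicat_real {\<tau> n m'<..\<tau> n (Suc m')} s = (if m' = m then 1 else 0)"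
  shows "\<Gamma> n s \<omega> k = (if k \<in> N n then (\<Sum>i\<in>N n. \<beta> i t (\<tau> n m) \<omega> *\<^sub>R b i k) else 0)"
proof -
  have "\<Gamma> n s \<omega> k = (\<Sum>m'<n. if m' = m then \<Sum>i\<in>N n. \<Sum>j\<in>N n. if k = j then \<beta> i t (\<tau> n m') \<omega> *\<^sub>R b i j else 0 else 0)"
    unfolding \<Gamma>_def assms(2) by (intro sum.cong refl) (auto intro!: sum.neutral sum.cong)
  also have "\<dots> = (\<Sum>i\<in>N n. \<Sum>j\<in>N n. if k = j then \<beta> i t (\<tau> n m) \<omega> *\<^sub>R b i j else 0)"
    using assms(1) by simp
  also have "\<dots> = (if k \<in> N n then (\<Sum>i\<in>N n. \<beta> i t (\<tau> n m) \<omega> *\<^sub>R b i k) else 0)"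
    using finite_N by simp
  finally show ?thesis .
qed

lemma Psi_Z: "j \<in> Jp \<Longrightarrow> \<Psi> (Z n r s \<omega>) (f j) = (\<Sum>i\<in>N n. \<beta> i r s \<omega> *\<^sub>R b i j)"
proof -
  assume j: "j \<in> Jp"
  interpret L: bounded_linear "\<lambda>x. \<Psi> x (f j)" by (rule Psi_bounded_linear[OF f_in_U0[OF j]])
  show ?thesis unfolding Z_def b_def by (simp add: L.sum L.scaleR)
qed

lemma Psi_measurable: "X \<in> borel_measurable A \<Longrightarrow> u \<in> U0 J \<eta> e \<Longrightarrow> (\<lambda>x. \<Psi> (X x) u) \<in> borel_measurable A"
proof -
  assume X: "X \<in> borel_measurable A" and u: "u \<in> U0 J \<eta> e"
  have "(\<lambda>x. \<Psi> x u) \<in> borel_measurable borel"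
    by (intro borel_measurable_continuous_onI linear_continuous_on Psi_bounded_linear u)
  from measurable_compose[OF X this] show ?thesis .
qed

text \<open>The error of \<open>\<Gamma> n\<close> at one time. Coordinates in \<open>N n\<close>
  contribute \<open>P2\<close> times the mean square distance of \<open>V\<close> from its
  truncation at the left grid point; all others contribute the tail of p^2 times the bound
  \<open>4 * h * Q2\<close> for the mean square of \<open>V\<close>.\<close>

definition eps :: "nat \<Rightarrow> real" where
  "eps n = P2 * (8 * h * tail (\<lambda>j. (q j)\<^sup>2) n + 2 * (h / real n) * Q2) + tail (\<lambda>j. (p j)\<^sup>2) n * (4 * h * Q2)"

lemma eps_nonneg: "0 \<le> eps n"
  unfolding eps_def using p_total(2,3) q_total(2,3) h0 by auto

lemma eps_tendsto: "eps \<longlonglongrightarrow> 0"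
proof -
  have "(\<lambda>n. h / real n) \<longlonglongrightarrow> 0" by (rule lim_const_over_n)
  then have "eps \<longlonglongrightarrow> P2 * (8 * h * 0 + 2 * 0 * Q2) + 0 * (4 * h * Q2)"
    unfolding eps_def[abs_def] by (intro tendsto_intros q_total(4) p_total(4))
  then show ?thesis by simp
qed

text \<open>Split at the truncation at time \<open>s\<close>: the tail term is the truncation error
  4 h, doubled, and the term with h / n is the mean square of the truncated increment over a part of
  one cell, doubled.\<close>

lemma V_Z_tau:
  assumes "m < n" "\<tau> n m < s" "s \<le> \<tau> n (Suc m)"
  shows "mean_square M (\<lambda>\<omega>. V t s \<omega> - Z n t (\<tau> n m) \<omega>) \<le> ennreal (8 * h * tail (\<lambda>j. (q j)\<^sup>2) n + 2 * (h / real n) * Q2)"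
proof -
  have n: "0 < n" using assms by simp
  have s: "t \<le> s" "s \<le> t + h" "s \<le> T" "0 \<le> \<tau> n m" "t \<le> \<tau> n m" "\<tau> n m \<le> T" "s - \<tau> n m \<le> h / real n" "0 \<le> s - \<tau> n m"
    using tau_ge[where n=n and m=m] tau_le[of "Suc m" n] assms n thT tau_diff[of n m] by auto
  have zd: "Z n t s \<omega> - Z n t (\<tau> n m) \<omega> = Z n (\<tau> n m) s \<omega>" for \<omega>
  proof -
    have "Z n (\<tau> n m) s \<omega> = (\<Sum>i\<in>N n. (\<beta> i t s \<omega> - \<beta> i t (\<tau> n m) \<omega>) *\<^sub>R blinfun_apply S (f i))"
      unfolding Z_def beta_add[of _ t "\<tau> n m" \<omega> s, symmetric] by simp
    then show ?thesis by (simp add: Z_def scaleR_diff_left sum_subtractf)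
  qed
  let ?x = "4 * (s - t) * tail (\<lambda>j. (q j)\<^sup>2) n" and ?y = "(s - \<tau> n m) * Q2"
  have xy: "0 \<le> ?x" "0 \<le> ?y" using s q_total(2) q_total(3)[of n] by auto
  have "mean_square M (\<lambda>\<omega>. V t s \<omega> - Z n t (\<tau> n m) \<omega>)
    \<le> 2 * mean_square M (\<lambda>\<omega>. V t s \<omega> - Z n t s \<omega>) + 2 * mean_square M (\<lambda>\<omega>. Z n t s \<omega> - Z n t (\<tau> n m) \<omega>)"
    using s t0 by (intro mean_square_triangle V_measurable Z_measurable) auto
  also have "\<dots> \<le> 2 * ennreal ?x + 2 * ennreal ?y"
    unfolding zd using s t0 assms by (intro add_mono mult_left_mono V_approx Z_mean_square) auto
  also have "\<dots> = ennreal (2 * ?x + 2 * ?y)"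
  proof -
    have *: "2 * ennreal z = ennreal (2 * z)" if "0 \<le> z" for z using that by (simp add: ennreal_mult)
    show ?thesis using xy by (simp only: * ) (simp add: ennreal_plus[symmetric] del: ennreal_plus)
  qed
  also have "\<dots> \<le> ennreal (8 * h * tail (\<lambda>j. (q j)\<^sup>2) n + 2 * (h / real n) * Q2)"
  proof (rule ennreal_leI)
    have "?x \<le> 4 * h * tail (\<lambda>j. (q j)\<^sup>2) n" using s q_total(3)[of n] by (intro mult_right_mono) auto
    moreover have "?y \<le> (h / real n) * Q2" using s q_total(2) by (intro mult_right_mono) auto
    ultimately show "2 * ?x + 2 * ?y \<le> 8 * h * tail (\<lambda>j. (q j)\<^sup>2) n + 2 * (h / real n) * Q2" by simp
  qed
  finally show ?thesis .
qed

lemma Gamma_error: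
  assumes n: "0 < n" and s: "t < s" "s \<le> t + h"
  shows "(\<integral>\<^sup>+\<omega>. hs (\<lambda>j. \<Psi> (V t s \<omega>) (f j) - \<Gamma> n s \<omega> j) \<partial>M) \<le> ennreal (eps n)"
proof -
  obtain m where m: "m < n" "\<tau> n m < s" "s \<le> \<tau> n (Suc m)"
    "\<And>m'. indicat_real {\<tau> n m'<..\<tau> n (Suc m')} s = (if m' = m then 1 else 0)"
    using grid_cell[OF n s] by metis
  have sT: "s \<le> T" using s thT by simp
  have Vm [measurable]: "V t s \<in> borel_measurable M" using V_measurable t0 s sT by simp
  have Zm [measurable]: "Z n t (\<tau> n m) \<in> borel_measurable M"
    using Z_measurable t0 tau_ge tau_le(2)[of m n] m n by simp
  let ?d = "\<lambda>\<omega>. (norm (V t s \<omega> - Z n t (\<tau> n m) \<omega>))\<^sup>2"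
  let ?tp = "tail (\<lambda>j. (p j)\<^sup>2) n"
  have pt: "hs (\<lambda>j. \<Psi> (V t s \<omega>) (f j) - \<Gamma> n s \<omega> j) \<le> ennreal P2 * ennreal (?d \<omega>) + ennreal ?tp * ennreal ((norm (V t s \<omega>))\<^sup>2)" for \<omega>
  proof -
    have "hs (\<lambda>j. \<Psi> (V t s \<omega>) (f j) - \<Gamma> n s \<omega> j) \<le> ennreal (P2 * ?d \<omega> + ?tp * (norm (V t s \<omega>))\<^sup>2)"
    proof (rule hs_le)
      fix k
      have G: "\<Gamma> n s \<omega> j = (if j \<in> N n then \<Psi> (Z n t (\<tau> n m) \<omega>) (f j) else 0)" if "j \<in> Jp" for j
        unfolding Gamma_cell[OF m(1,4)] using Psi_Z[OF that] by simp
      have "(\<Sum>j\<in>N k. (norm (\<Psi> (V t s \<omega>) (f j) - \<Gamma> n s \<omega> j))\<^sup>2)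
        = (\<Sum>j\<in>N k \<inter> N n. (norm (\<Psi> (V t s \<omega> - Z n t (\<tau> n m) \<omega>) (f j)))\<^sup>2) + (\<Sum>j\<in>N k - N n. (norm (\<Psi> (V t s \<omega>) (f j)))\<^sup>2)"
      proof -
        have "(\<Sum>j\<in>N k. (norm (\<Psi> (V t s \<omega>) (f j) - \<Gamma> n s \<omega> j))\<^sup>2)
          = (\<Sum>j\<in>N k \<inter> N n. (norm (\<Psi> (V t s \<omega>) (f j) - \<Gamma> n s \<omega> j))\<^sup>2) + (\<Sum>j\<in>N k - N n. (norm (\<Psi> (V t s \<omega>) (f j) - \<Gamma> n s \<omega> j))\<^sup>2)"
          by (rule sum.Int_Diff[OF finite_N])
        also have "(\<Sum>j\<in>N k \<inter> N n. (norm (\<Psi> (V t s \<omega>) (f j) - \<Gamma> n s \<omega> j))\<^sup>2)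
          = (\<Sum>j\<in>N k \<inter> N n. (norm (\<Psi> (V t s \<omega> - Z n t (\<tau> n m) \<omega>) (f j)))\<^sup>2)"
        proof (intro sum.cong refl)
          fix j assume "j \<in> N k \<inter> N n"
          then have j: "j \<in> Jp" "j \<in> N n" using N_subset by auto
          interpret L: bounded_linear "\<lambda>x. \<Psi> x (f j)" by (rule Psi_bounded_linear[OF f_in_U0[OF j(1)]])
          show "(norm (\<Psi> (V t s \<omega>) (f j) - \<Gamma> n s \<omega> j))\<^sup>2 = (norm (\<Psi> (V t s \<omega> - Z n t (\<tau> n m) \<omega>) (f j)))\<^sup>2"
            using G[OF j(1)] j(2) by (simp add: L.diff)
        qed
        also have "(\<Sum>j\<in>N k - N n. (norm (\<Psi> (V t s \<omega>) (f j) - \<Gamma> n s \<omega> j))\<^sup>2) = (\<Sum>j\<in>N k - N n. (norm (\<Psi> (V t s \<omega>) (f j)))\<^sup>2)"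
          using G subsetD[OF N_subset] by (intro sum.cong refl) (auto simp del: norm_minus_commute)
        finally show ?thesis .
      qed
      also have "\<dots> \<le> ?d \<omega> * (\<Sum>j\<in>N k \<inter> N n. (p j)\<^sup>2) + (norm (V t s \<omega>))\<^sup>2 * (\<Sum>j\<in>N k - N n. (p j)\<^sup>2)"
        using N_subset finite_N by (intro add_mono Psi_sum_sq_le) auto
      also have "\<dots> \<le> ?d \<omega> * P2 + (norm (V t s \<omega>))\<^sup>2 * ?tp"
        using N_subset finite_N by (intro add_mono mult_left_mono p_total(1) p_total(5)) auto
      finally show "(\<Sum>j\<in>N k. (norm (\<Psi> (V t s \<omega>) (f j) - \<Gamma> n s \<omega> j))\<^sup>2) \<le> P2 * ?d \<omega> + ?tp * (norm (V t s \<omega>))\<^sup>2"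
        by (simp add: mult.commute)
    qed
    also have "\<dots> = ennreal P2 * ennreal (?d \<omega>) + ennreal ?tp * ennreal ((norm (V t s \<omega>))\<^sup>2)"
      using p_total(2) p_total(3)[of n] by (simp add: ennreal_mult)
    finally show ?thesis .
  qed
  have "(\<integral>\<^sup>+\<omega>. hs (\<lambda>j. \<Psi> (V t s \<omega>) (f j) - \<Gamma> n s \<omega> j) \<partial>M)
    \<le> (\<integral>\<^sup>+\<omega>. ennreal P2 * ennreal (?d \<omega>) + ennreal ?tp * ennreal ((norm (V t s \<omega>))\<^sup>2) \<partial>M)"
    by (intro nn_integral_mono pt)
  also have "\<dots> = ennreal P2 * mean_square M (\<lambda>\<omega>. V t s \<omega> - Z n t (\<tau> n m) \<omega>) + ennreal ?tp * mean_square M (V t s)"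
    unfolding mean_square_def by (simp add: nn_integral_add nn_integral_cmult)
  also have "\<dots> \<le> ennreal P2 * ennreal (8 * h * tail (\<lambda>j. (q j)\<^sup>2) n + 2 * (h / real n) * Q2) + ennreal ?tp * ennreal (4 * h * Q2)"
  proof (intro add_mono mult_left_mono V_Z_tau m)
    have "mean_square M (V t s) \<le> ennreal (4 * (s - t) * Q2)" using t0 s sT by (intro V_mean_square) auto
    also have "\<dots> \<le> ennreal (4 * h * Q2)" using s q_total(2) by (intro ennreal_leI mult_right_mono) auto
    finally show "mean_square M (V t s) \<le> ennreal (4 * h * Q2)" .
  qed simp_all
  also have "\<dots> = ennreal (eps n)"
    unfolding eps_def using p_total(2) p_total(3)[of n] q_total(2) q_total(3)[of n] h0
    by (simp add: ennreal_mult[symmetric] ennreal_plus[symmetric] del: ennreal_plus)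
  finally show ?thesis .
qed

lemma R_approx:
  assumes I: "is_ito_integral M F J \<eta> e W t (t + h) X I" and n: "0 < n"
    and X: "\<And>s. t < s \<Longrightarrow> s \<le> t + h \<Longrightarrow> AE \<omega> in M. \<forall>j\<in>Jp. X s \<omega> (f j) = \<Psi> (V t s \<omega>) (f j)"
  shows "mean_square M (\<lambda>\<omega>. I \<omega> - R n \<omega>) \<le> ennreal (4 * h * eps n)"
proof -
  have "mean_square M (\<lambda>\<omega>. I \<omega> - R n \<omega>) \<le> ennreal (4 * ((t + h) - t) * eps n)"
  proof (rule ito_bound[OF t0 _ thT I rep_R _ eps_nonneg])
    fix s assume s: "t < s" "s \<le> t + h"
    have "(\<integral>\<^sup>+\<omega>. hs (\<lambda>j. X s \<omega> (f j) - \<Gamma> n s \<omega> j) \<partial>M) = (\<integral>\<^sup>+\<omega>. hs (\<lambda>j. \<Psi> (V t s \<omega>) (f j) - \<Gamma> n s \<omega> j) \<partial>M)"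
    proof (rule nn_integral_cong_AE, use X[OF s] in eventually_elim)
      case (elim \<omega>) then show ?case by (intro hs_cong) auto
    qed
    then show "(\<integral>\<^sup>+\<omega>. hs (\<lambda>j. X s \<omega> (f j) - \<Gamma> n s \<omega> j) \<partial>M) \<le> ennreal (eps n)"
      using Gamma_error[OF n s] by simp
  qed (use h0 in auto)
  then show ?thesis by simp
qed


section \<open>Existence of the outer integral\<close>

definition step_V :: "nat \<Rightarrow> real \<Rightarrow> 'w \<Rightarrow> 'h" where
  "step_V n s \<omega> = (\<Sum>m<n. indicat_real {\<tau> n m<..\<tau> n (Suc m)} s *\<^sub>R V t (\<tau> n m) \<omega>)"

text \<open>Paths of \<open>W\<close> are continuous only almost surely, so \<open>V\<close> itself need not be predictable; the
  limit of its left-point step functions is a predictable modification.\<close>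

definition pred_V :: "real \<Rightarrow> 'w \<Rightarrow> 'h" where "pred_V s \<omega> = lim (\<lambda>n. step_V n s \<omega>)"

lemma pred_V_predictable: "(\<lambda>x. pred_V (fst x) (snd x)) \<in> borel_measurable (predictable_algebra M F t (t + h))"
  unfolding pred_V_def step_V_def
proof (intro borel_measurable_lim_metric borel_measurable_sum predictable_step)
  fix n m :: nat assume "m \<in> {..<n}"
  then have "m \<le> n" "Suc m \<le> n" "0 < n" by auto
  then show "0 \<le> t" "t \<le> \<tau> n m" "\<tau> n m \<le> \<tau> n (Suc m)" "\<tau> n (Suc m) \<le> t + h" "V t (\<tau> n m) \<in> borel_measurable (F (\<tau> n m))"
    using t0 tau_ge tau_Suc tau_le(1)[of "Suc m" n] tau_le(2)[of m n]
    unfolding V_def by (auto intro!: S_increment_measurable)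
qed

text \<open>On a continuous path the left grid points next to \<open>s\<close>, at distance at most
  h / n, tend to \<open>s\<close>. At \<open>s = t\<close> no cell contains \<open>s\<close>, and
  both sides are 0.\<close>

lemma pred_V_modification:
  assumes s: "t \<le> s" "s \<le> t + h"
  shows "AE \<omega> in M. pred_V s \<omega> = V t s \<omega>"
  using W_continuous
proof eventually_elim
  case (elim \<omega>)
  have "(\<lambda>n. step_V n s \<omega>) \<longlonglongrightarrow> V t s \<omega>"
  proof (cases "t = s")
    case True
    have "step_V n s \<omega> = 0" for n
    proof -
      have "indicat_real {\<tau> n m<..\<tau> n (Suc m)} s = 0" for m
      proof -
        have "\<not> \<tau> n m < s" using tau_ge(1)[of n m] True by linarith
        then show ?thesis by simp
      qed
      then show ?thesis unfolding step_V_def by simp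
    qed
    then show ?thesis using True by (simp add: V_def)
  next
    case False
    then have ts: "t < s" using s by simp
    have "\<exists>r. step_V n s \<omega> = V t r \<omega> \<and> t \<le> r \<and> r \<le> s \<and> s - r \<le> h / real n" if n: "0 < n" for n
    proof -
      obtain m where m: "m < n" "\<tau> n m < s" "s - \<tau> n m \<le> h / real n"
        "\<And>m'. indicat_real {\<tau> n m'<..\<tau> n (Suc m')} s = (if m' = m then 1 else 0)"
        using grid_cell[OF n ts s(2)] by metis
      have "step_V n s \<omega> = (\<Sum>m'<n. if m' = m then V t (\<tau> n m') \<omega> else 0)"
        unfolding step_V_def m(4) by (intro sum.cong) auto
      then have "step_V n s \<omega> = V t (\<tau> n m) \<omega>" using m(1) by simp
      then show ?thesis using m tau_ge(1)[of n m] by (intro exI[of _ "\<tau> n m"]) auto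
    qed
    then obtain r where r: "\<And>n. 0 < n \<Longrightarrow> step_V n s \<omega> = V t (r n) \<omega> \<and> t \<le> r n \<and> r n \<le> s \<and> s - r n \<le> h / real n"
      by metis
    \<comment> \<open>The grid with 0 cells contains no \<open>s\<close>; the default
      \<open>s\<close> keeps the bounds below valid there, since h / 0 is 0.\<close>
    define r' where "r' n = (if n = 0 then s else r n)" for n
    have r': "t \<le> r' n" "r' n \<le> s" "s - h / real n \<le> r' n" for n
      using r[of n] ts by (auto simp: r'_def field_simps)
    have lim0: "(\<lambda>n. s - h / real n) \<longlonglongrightarrow> s - 0" by (intro tendsto_diff tendsto_const lim_const_over_n)
    have "r' \<longlonglongrightarrow> s"
    proof (rule tendsto_sandwich[where f="\<lambda>n. s - h / real n" and h="\<lambda>_. s", rotated 3])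
      show "(\<lambda>_. s) \<longlonglongrightarrow> s" by (rule tendsto_const)
      show "\<forall>\<^sub>F n in sequentially. s - h / real n \<le> r' n" by (intro always_eventually allI r')
      show "\<forall>\<^sub>F n in sequentially. r' n \<le> s" by (intro always_eventually allI r')
      show "(\<lambda>n. s - h / real n) \<longlonglongrightarrow> s" using lim0 by (simp only: diff_zero)
    qed
    moreover have "s \<in> {0..T}" "\<And>n. r' n \<in> {0..T}"
      using order_trans[OF t0 r'(1)] order_trans[OF r'(2) order_trans[OF s(2) thT]] s t0 thT by (simp_all only: atLeastAtMost_iff) auto
    ultimately have "(\<lambda>n. W (r' n) \<omega>) \<longlonglongrightarrow> W s \<omega>"
      using elim unfolding continuous_on_sequentially o_def by blast
    then have "(\<lambda>n. V t (r' n) \<omega>) \<longlonglongrightarrow> V t s \<omega>"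
      unfolding V_def by (intro blinfun.tendsto tendsto_const tendsto_diff)
    then show ?thesis
    proof (rule Lim_transform_eventually)
      show "\<forall>\<^sub>F n in sequentially. V t (r' n) \<omega> = step_V n s \<omega>"
        using eventually_gt_at_top[of 0] by eventually_elim (use r in \<open>auto simp: r'_def\<close>)
    qed
  qed
  then show ?case unfolding pred_V_def by (rule limI)
qed

lemma predictable_Psi_pred_V: "predictable_HS_process M F J \<eta> e t (t + h) (\<lambda>s \<omega>. \<Psi> (pred_V s \<omega>))"
  unfolding predictable_HS_process_def
proof (intro conjI ballI HS_op_Psi)
  fix u assume "u \<in> U0 J \<eta> e"
  from Psi_measurable[OF pred_V_predictable this]
  show "(\<lambda>(s, \<omega>). \<Psi> (pred_V s \<omega>) u) \<in> borel_measurable (predictable_algebra M F t (t + h))"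
    by (simp add: case_prod_beta')
qed

text \<open>The accuracy per coordinate must outweigh the square of the number of coordinates, which
  enters through Cauchy-Schwarz and through the sum of the errors, and still leave 1 / (n +
  1).\<close>

definition \<delta> :: "nat \<Rightarrow> real" where
  "\<delta> n = 1 / ((real n + 1) * ((real (card (N n)))\<^sup>2 + 1))"

lemma delta_pos: "0 < \<delta> n"
  unfolding \<delta>_def by (intro divide_pos_pos mult_pos_pos add_nonneg_pos) auto

text \<open>Elementary processes take finitely many values, whereas \<open>\<beta>\<close> is
  Gaussian; hence the coefficients of \<open>\<Gamma> n\<close> are replaced by simple functions
  known at the same time.\<close>

definition simple_beta :: "nat \<Rightarrow> nat \<Rightarrow> 'j \<Rightarrow> 'w \<Rightarrow> real" where
  "simple_beta n m i = (SOME x. simple_function (F (\<tau> n m)) x \<and>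
     (\<integral>\<^sup>+\<omega>. ennreal ((\<beta> i t (\<tau> n m) \<omega> - x \<omega>)\<^sup>2) \<partial>M) \<le> ennreal (\<delta> n))"

lemma simple_beta:
  assumes "m < n" "i \<in> N n"
  shows "simple_function (F (\<tau> n m)) (simple_beta n m i)"
    and "(\<integral>\<^sup>+\<omega>. ennreal ((\<beta> i t (\<tau> n m) \<omega> - simple_beta n m i \<omega>)\<^sup>2) \<partial>M) \<le> ennreal (\<delta> n)"
    and "simple_beta n m i \<in> borel_measurable M"
proof -
  have "L2F (\<tau> n m) (\<beta> i t (\<tau> n m))"
    using assms N_subset t0 tau_ge tau_le(2)[of m n] by (intro L2F_beta) auto
  from simple_approximation[OF tau_ge(2) this delta_pos]
  have *: "simple_function (F (\<tau> n m)) (simple_beta n m i) \<and>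
     (\<integral>\<^sup>+\<omega>. ennreal ((\<beta> i t (\<tau> n m) \<omega> - simple_beta n m i \<omega>)\<^sup>2) \<partial>M) \<le> ennreal (\<delta> n)"
    unfolding simple_beta_def by (rule someI_ex)
  then show 1: "simple_function (F (\<tau> n m)) (simple_beta n m i)"
    and "(\<integral>\<^sup>+\<omega>. ennreal ((\<beta> i t (\<tau> n m) \<omega> - simple_beta n m i \<omega>)\<^sup>2) \<partial>M) \<le> ennreal (\<delta> n)" by auto
  show "simple_beta n m i \<in> borel_measurable M"
    by (rule measurable_F_M[OF tau_ge(2) borel_measurable_simple_function[OF 1]])
qed

text \<open>Maps \<open>f j\<close> to \<open>b i j\<close> and kills the other basis vectors. It is
  bounded on all of U although \<Psi> x is given on \<open>U0\<close> only, so combinations of such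
  operators are admissible values of an elementary process.\<close>

definition rank_one :: "'j \<Rightarrow> 'j \<Rightarrow> ('u \<Rightarrow>\<^sub>L 'h)" where
  "rank_one i j = Blinfun (\<lambda>u. ((u \<bullet> e j) / sqrt (\<eta> j)) *\<^sub>R b i j)"

lemma rank_one_apply: "blinfun_apply (rank_one i j) u = ((u \<bullet> e j) / sqrt (\<eta> j)) *\<^sub>R b i j"
proof -
  have "bounded_linear (\<lambda>u. ((u \<bullet> e j) / sqrt (\<eta> j)) *\<^sub>R b i j)"
    by (intro bounded_linear_scaleR_const bounded_linear_divide[THEN bounded_linear_compose] bounded_linear_inner_left)
  then show ?thesis unfolding rank_one_def by (simp add: bounded_linear_Blinfun_apply)
qed

lemma rank_one_f: "j \<in> Jp \<Longrightarrow> k \<in> Jp \<Longrightarrow> blinfun_apply (rank_one i j) (f k) = (if k = j then b i j else 0)"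
  using JpD[of j] JpD[of k] by (auto simp: rank_one_apply f_def inner_basis)

definition ES :: "nat \<Rightarrow> nat \<Rightarrow> 'w \<Rightarrow> ('u \<Rightarrow>\<^sub>L 'h)" where
  "ES n m \<omega> = (\<Sum>i\<in>N n. \<Sum>j\<in>N n. simple_beta n m i \<omega> *\<^sub>R rank_one i j)"

lemma elementary_ES: "0 < n \<Longrightarrow> elementary F t (t + h) (\<tau> n) n (ES n)"
  unfolding elementary_def
proof (intro conjI allI impI)
  fix m assume "m < n"
  then show "simple_function (F (\<tau> n m)) (ES n m)"
    unfolding ES_def using simple_beta(1) by (intro simple_function_sum simple_function_compose1[where g="\<lambda>x. x *\<^sub>R _"]) auto
qed (auto simp: tau_n tau_Suc)

text \<open>For each \<open>j\<close> the sum over \<open>i\<close> in \<open>N n\<close> is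
  estimated by Cauchy-Schwarz, which costs the cardinality of \<open>N n\<close> once; adding the
  mean squares of the differences costs it once more. The choice of \<open>\<delta> n\<close>
  absorbs both.\<close>

lemma elementary_error:
  assumes n: "0 < n" and s: "t < s" "s \<le> t + h"
  shows "(\<integral>\<^sup>+\<omega>. hs (\<lambda>j. elementary_process (\<tau> n) n (ES n) s \<omega> (f j) - \<Gamma> n s \<omega> j) \<partial>M) \<le> ennreal (Q2 * P2 / (real n + 1))"
proof -
  obtain m where m: "m < n" "\<And>m'. indicat_real {\<tau> n m'<..\<tau> n (Suc m')} s = (if m' = m then 1 else 0)"
    using grid_cell[OF n s] by metis
  let ?K = "real (card (N n))"
  have E: "elementary_process (\<tau> n) n (ES n) s \<omega> (f j) = (if j \<in> N n then (\<Sum>i\<in>N n. simple_beta n m i \<omega> *\<^sub>R b i j) else 0)"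
    if j: "j \<in> Jp" for \<omega> j
  proof -
    have "elementary_process (\<tau> n) n (ES n) s \<omega> (f j) = (\<Sum>m'<n. if m' = m then blinfun_apply (ES n m' \<omega>) (f j) else 0)"
      unfolding elementary_process_def m(2) by (intro sum.cong) auto
    also have "\<dots> = blinfun_apply (ES n m \<omega>) (f j)" using m(1) by simp
    also have "\<dots> = (\<Sum>i\<in>N n. \<Sum>k\<in>N n. simple_beta n m i \<omega> *\<^sub>R blinfun_apply (rank_one i k) (f j))"
      unfolding ES_def by (simp add: blinfun.sum_left blinfun.scaleR_left)
    also have "\<dots> = (\<Sum>i\<in>N n. \<Sum>k\<in>N n. if j = k then simple_beta n m i \<omega> *\<^sub>R b i j else 0)"
      using subsetD[OF N_subset] j by (intro sum.cong refl) (auto simp: rank_one_f)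
    also have "\<dots> = (if j \<in> N n then (\<Sum>i\<in>N n. simple_beta n m i \<omega> *\<^sub>R b i j) else 0)" using finite_N by simp
    finally show ?thesis .
  qed
  define d where "d i \<omega> = \<beta> i t (\<tau> n m) \<omega> - simple_beta n m i \<omega>" for i \<omega>
  have pt: "hs (\<lambda>j. elementary_process (\<tau> n) n (ES n) s \<omega> (f j) - \<Gamma> n s \<omega> j) \<le> ennreal (Q2 * P2 * ?K) * (\<Sum>i\<in>N n. ennreal ((d i \<omega>)\<^sup>2))" for \<omega>
  proof -
    have "hs (\<lambda>j. elementary_process (\<tau> n) n (ES n) s \<omega> (f j) - \<Gamma> n s \<omega> j) \<le> ennreal (Q2 * P2 * ?K * (\<Sum>i\<in>N n. (d i \<omega>)\<^sup>2))"
    proof (rule hs_le)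
      fix k
      have "(norm (elementary_process (\<tau> n) n (ES n) s \<omega> (f j) - \<Gamma> n s \<omega> j))\<^sup>2 \<le> (p j)\<^sup>2 * (Q2 * ?K * (\<Sum>i\<in>N n. (d i \<omega>)\<^sup>2))"
        if "j \<in> N k" for j
      proof -
        have j: "j \<in> Jp" using that N_subset by blast
        have sq0: "0 \<le> Q2 * ?K * (\<Sum>i\<in>N n. (d i \<omega>)\<^sup>2)" using q_total(2) by (intro mult_nonneg_nonneg sum_nonneg) auto
        show ?thesis
        proof (cases "j \<in> N n")
          case False
          then have "(norm (elementary_process (\<tau> n) n (ES n) s \<omega> (f j) - \<Gamma> n s \<omega> j))\<^sup>2 = 0"
            by (simp add: E[OF j] Gamma_cell[OF m])
          then show ?thesis using sq0 by (metis mult_nonneg_nonneg zero_le_power2)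
        next
          case True
          have "norm (elementary_process (\<tau> n) n (ES n) s \<omega> (f j) - \<Gamma> n s \<omega> j) = norm (\<Sum>i\<in>N n. d i \<omega> *\<^sub>R b i j)"
            using True by (simp add: E[OF j] Gamma_cell[OF m] d_def scaleR_diff_left sum_subtractf norm_minus_commute)
          also have "\<dots> \<le> (\<Sum>i\<in>N n. \<bar>d i \<omega>\<bar> * q i * p j)"
          proof (rule sum_norm_le)
            fix i
            have "norm (d i \<omega> *\<^sub>R b i j) \<le> \<bar>d i \<omega>\<bar> * (q i * p j)"
              using b_norm_le[OF j, of i] by (simp add: mult_left_mono)
            then show "norm (d i \<omega> *\<^sub>R b i j) \<le> \<bar>d i \<omega>\<bar> * q i * p j" by (simp add: mult.assoc)
          qed
          finally have "(norm (elementary_process (\<tau> n) n (ES n) s \<omega> (f j) - \<Gamma> n s \<omega> j))\<^sup>2 \<le> (\<Sum>i\<in>N n. \<bar>d i \<omega>\<bar> * q i * p j)\<^sup>2"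
            by (intro power_mono) auto
          also have "\<dots> \<le> (\<Sum>i\<in>N n. (\<bar>d i \<omega>\<bar> * q i * p j)\<^sup>2) * ?K"
            by (rule sum_squared_le_sum_of_squares)
          also have "\<dots> \<le> (\<Sum>i\<in>N n. (p j)\<^sup>2 * Q2 * (d i \<omega>)\<^sup>2) * ?K"
          proof (intro mult_right_mono sum_mono)
            fix i assume i: "i \<in> N n"
            have "(q i)\<^sup>2 \<le> Q2" using q_total(1)[of "{i}"] i N_subset by auto
            then have "(p j)\<^sup>2 * (d i \<omega>)\<^sup>2 * (q i)\<^sup>2 \<le> (p j)\<^sup>2 * (d i \<omega>)\<^sup>2 * Q2" by (intro mult_left_mono) auto
            then show "(\<bar>d i \<omega>\<bar> * q i * p j)\<^sup>2 \<le> (p j)\<^sup>2 * Q2 * (d i \<omega>)\<^sup>2"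
              by (simp add: power_mult_distrib mult_ac)
          qed simp
          also have "\<dots> = (p j)\<^sup>2 * (Q2 * ?K * (\<Sum>i\<in>N n. (d i \<omega>)\<^sup>2))"
            by (simp add: sum_distrib_left sum_distrib_right mult_ac)
          finally show ?thesis .
        qed
      qed
      then have "(\<Sum>j\<in>N k. (norm (elementary_process (\<tau> n) n (ES n) s \<omega> (f j) - \<Gamma> n s \<omega> j))\<^sup>2)
        \<le> (\<Sum>j\<in>N k. (p j)\<^sup>2 * (Q2 * ?K * (\<Sum>i\<in>N n. (d i \<omega>)\<^sup>2)))" by (rule sum_mono)
      also have "\<dots> = (\<Sum>j\<in>N k. (p j)\<^sup>2) * (Q2 * ?K * (\<Sum>i\<in>N n. (d i \<omega>)\<^sup>2))" by (simp add: sum_distrib_right)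
      also have "\<dots> \<le> P2 * (Q2 * ?K * (\<Sum>i\<in>N n. (d i \<omega>)\<^sup>2))"
        using q_total(2) by (intro mult_right_mono p_total(1) finite_N N_subset mult_nonneg_nonneg sum_nonneg) auto
      finally show "(\<Sum>j\<in>N k. (norm (elementary_process (\<tau> n) n (ES n) s \<omega> (f j) - \<Gamma> n s \<omega> j))\<^sup>2) \<le> Q2 * P2 * ?K * (\<Sum>i\<in>N n. (d i \<omega>)\<^sup>2)"
        by (simp add: mult_ac)
    qed
    also have "\<dots> = ennreal (Q2 * P2 * ?K) * (\<Sum>i\<in>N n. ennreal ((d i \<omega>)\<^sup>2))"
      using q_total(2) p_total(2) by (subst ennreal_mult) (auto intro!: sum_nonneg)
    finally show ?thesis .
  qed
  have dm: "d i \<in> borel_measurable M" if "i \<in> N n" for i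
    unfolding d_def using simple_beta(3)[OF m(1) that] beta_measurable[of t "\<tau> n m" i] t0 tau_ge tau_le(2)[of m n] m(1) by simp
  have "(\<integral>\<^sup>+\<omega>. hs (\<lambda>j. elementary_process (\<tau> n) n (ES n) s \<omega> (f j) - \<Gamma> n s \<omega> j) \<partial>M)
    \<le> (\<integral>\<^sup>+\<omega>. ennreal (Q2 * P2 * ?K) * (\<Sum>i\<in>N n. ennreal ((d i \<omega>)\<^sup>2)) \<partial>M)"
    by (intro nn_integral_mono pt)
  also have "\<dots> = ennreal (Q2 * P2 * ?K) * (\<Sum>i\<in>N n. \<integral>\<^sup>+\<omega>. ennreal ((d i \<omega>)\<^sup>2) \<partial>M)"
  proof -
    have dm': "(\<lambda>\<omega>. ennreal ((d i \<omega>)\<^sup>2)) \<in> borel_measurable M" if "i \<in> N n" for i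
      using dm[OF that] by measurable
    show ?thesis
      by (subst nn_integral_cmult, intro borel_measurable_sum dm', assumption)
        (subst nn_integral_sum[OF dm'], assumption, rule refl)
  qed
  also have "\<dots> \<le> ennreal (Q2 * P2 * ?K) * (\<Sum>i\<in>N n. ennreal (\<delta> n))"
    unfolding d_def by (intro mult_left_mono sum_mono simple_beta(2) m(1)) auto
  also have "\<dots> = ennreal (Q2 * P2 * ?K * (?K * \<delta> n))"
  proof -
    have "(\<Sum>i\<in>N n. ennreal (\<delta> n)) = ennreal (?K * \<delta> n)"
      using delta_pos[of n] by (simp add: ennreal_mult ennreal_of_nat_eq_real_of_nat)
    then show ?thesis using q_total(2) p_total(2) delta_pos[of n] by (simp add: ennreal_mult)
  qed
  also have "\<dots> \<le> ennreal (Q2 * P2 / (real n + 1))"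
  proof (rule ennreal_leI)
    have "?K * (?K * \<delta> n) \<le> 1 / (real n + 1)"
    proof -
      have "0 < ?K\<^sup>2 + 1" by (intro add_nonneg_pos) auto
      then have "?K\<^sup>2 / (?K\<^sup>2 + 1) \<le> 1" by (subst divide_le_eq_1_pos) auto
      then have "?K\<^sup>2 / (?K\<^sup>2 + 1) / (real n + 1) \<le> 1 / (real n + 1)" by (rule divide_right_mono) simp
      then show ?thesis by (simp add: \<delta>_def power2_eq_square mult.commute)
    qed
    then have "Q2 * P2 * (?K * (?K * \<delta> n)) \<le> Q2 * P2 * (1 / (real n + 1))"
      using q_total(2) p_total(2) by (intro mult_left_mono) auto
    then show "Q2 * P2 * ?K * (?K * \<delta> n) \<le> Q2 * P2 / (real n + 1)" by (simp add: mult_ac)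
  qed
  finally show ?thesis .
qed

lemma nn_integral_interval_bound:
  assumes "\<And>s. t < s \<Longrightarrow> s \<le> t + h \<Longrightarrow> g s \<le> ennreal C" and "0 \<le> C"
  shows "(\<integral>\<^sup>+s\<in>{t..t + h}. g s \<partial>lborel) \<le> ennreal (h * C)"
proof -
  have "(\<integral>\<^sup>+s\<in>{t..t + h}. g s \<partial>lborel) \<le> (\<integral>\<^sup>+s. ennreal C * indicator {t..t + h} s \<partial>lborel)"
  proof (rule nn_integral_mono_AE)
    have "AE s in lborel. s \<noteq> t" by (rule AE_lborel_singleton)
    then show "AE s in lborel. g s * indicator {t..t + h} s \<le> ennreal C * indicator {t..t + h} s"
      by eventually_elim (use assms in \<open>auto simp: indicator_def\<close>)
  qed
  also have "\<dots> = ennreal (h * C)" using h0 assms(2) by (simp add: nn_integral_cmult ennreal_mult mult.commute)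
  finally show ?thesis .
qed

lemma two_ennreal_add: "0 \<le> x \<Longrightarrow> 0 \<le> y \<Longrightarrow> 2 * ennreal x + 2 * ennreal y = ennreal (2 * x + 2 * y)"
proof -
  assume xy: "0 \<le> x" "0 \<le> y"
  have *: "2 * ennreal z = ennreal (2 * z)" if "0 \<le> z" for z using that by (simp add: ennreal_mult)
  show ?thesis using xy by (simp only: * ) (simp add: ennreal_plus[symmetric] del: ennreal_plus)
qed

lemma R_Cauchy:
  assumes nk: "0 < n" "0 < k"
  shows "mean_square M (\<lambda>\<omega>. R n \<omega> - R k \<omega>) \<le> ennreal (h * (2 * eps n + 2 * eps k))"
proof -
  have "mean_square M (\<lambda>\<omega>. R n \<omega> - R k \<omega>) = (\<integral>\<^sup>+s\<in>{t..t+h}. (\<integral>\<^sup>+\<omega>. hs (\<lambda>j. \<Gamma> n s \<omega> j - \<Gamma> k s \<omega> j) \<partial>M) \<partial>lborel)"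
    by (rule isometry[OF t0 thT rep_diff[OF rep_R rep_R]])
  also have "\<dots> \<le> ennreal (h * (2 * eps n + 2 * eps k))"
  proof (rule nn_integral_interval_bound)
    fix s assume s: "t < s" "s \<le> t + h"
    have Vm: "(\<lambda>\<omega>. \<Psi> (V t s \<omega>) (f j)) \<in> borel_measurable M" if "j \<in> Jp" for j
      using V_measurable[of t s] t0 s thT f_in_U0[OF that] by (intro Psi_measurable) auto
    have m: "(\<lambda>\<omega>. hs (\<lambda>j. \<Gamma> n s \<omega> j - \<Psi> (V t s \<omega>) (f j))) \<in> borel_measurable M"
      "(\<lambda>\<omega>. hs (\<lambda>j. \<Psi> (V t s \<omega>) (f j) - \<Gamma> k s \<omega> j)) \<in> borel_measurable M"
      by (intro hs_measurable borel_measurable_diff Vm Gamma_measurable, assumption)+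
    have "(\<integral>\<^sup>+\<omega>. hs (\<lambda>j. \<Gamma> n s \<omega> j - \<Gamma> k s \<omega> j) \<partial>M)
      \<le> (\<integral>\<^sup>+\<omega>. 2 * hs (\<lambda>j. \<Gamma> n s \<omega> j - \<Psi> (V t s \<omega>) (f j)) + 2 * hs (\<lambda>j. \<Psi> (V t s \<omega>) (f j) - \<Gamma> k s \<omega> j) \<partial>M)"
      by (intro nn_integral_mono hs_triangle)
    also have "\<dots> = 2 * (\<integral>\<^sup>+\<omega>. hs (\<lambda>j. \<Gamma> n s \<omega> j - \<Psi> (V t s \<omega>) (f j)) \<partial>M) + 2 * (\<integral>\<^sup>+\<omega>. hs (\<lambda>j. \<Psi> (V t s \<omega>) (f j) - \<Gamma> k s \<omega> j) \<partial>M)"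
      using m by (simp add: nn_integral_add nn_integral_cmult)
    also have "(\<integral>\<^sup>+\<omega>. hs (\<lambda>j. \<Gamma> n s \<omega> j - \<Psi> (V t s \<omega>) (f j)) \<partial>M) = (\<integral>\<^sup>+\<omega>. hs (\<lambda>j. \<Psi> (V t s \<omega>) (f j) - \<Gamma> n s \<omega> j) \<partial>M)"
      by (intro nn_integral_cong hs_cong) (simp add: norm_minus_commute)
    also have "2 * (\<integral>\<^sup>+\<omega>. hs (\<lambda>j. \<Psi> (V t s \<omega>) (f j) - \<Gamma> n s \<omega> j) \<partial>M) + 2 * (\<integral>\<^sup>+\<omega>. hs (\<lambda>j. \<Psi> (V t s \<omega>) (f j) - \<Gamma> k s \<omega> j) \<partial>M)
      \<le> 2 * ennreal (eps n) + 2 * ennreal (eps k)"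
      using nk s by (intro add_mono mult_left_mono Gamma_error) auto
    also have "\<dots> = ennreal (2 * eps n + 2 * eps k)" by (rule two_ennreal_add[OF eps_nonneg eps_nonneg])
    finally show "(\<integral>\<^sup>+\<omega>. hs (\<lambda>j. \<Gamma> n s \<omega> j - \<Gamma> k s \<omega> j) \<partial>M) \<le> ennreal (2 * eps n + 2 * eps k)" .
  qed (use eps_nonneg in auto)
  finally show ?thesis .
qed

text \<open>The sums \<open>R n\<close> are Cauchy in mean square, and their limit is the integral.
  The witnesses required by the definition are \<open>\<Psi>\<close> of \<open>pred_V\<close> as
  modification and the processes \<open>ES\<close>; \<Gamma> mediates between these two, and
  \<open>R\<close> between their integrals.\<close>

theorem outer_ito_exists:
  assumes X: "\<And>s. t \<le> s \<Longrightarrow> s \<le> t + h \<Longrightarrow> AE \<omega> in M. X s \<omega> = \<Psi> (V t s \<omega>)"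
  shows "\<exists>I. is_ito_integral M F J \<eta> e W t (t + h) X I"
proof -
  obtain I where Im: "I \<in> borel_measurable M" and I: "(\<lambda>n. mean_square M (\<lambda>\<omega>. I \<omega> - R n \<omega>)) \<longlonglongrightarrow> 0"
  proof (rule mean_square_Cauchy_limit[OF R_measurable])
    fix \<epsilon> :: real assume \<epsilon>: "0 < \<epsilon>"
    have "\<forall>\<^sub>F n in sequentially. eps n < \<epsilon> / (4 * h)"
      using \<epsilon> h0 by (intro order_tendstoD(2)[OF eps_tendsto]) auto
    then obtain K where K: "\<And>n. K \<le> n \<Longrightarrow> eps n < \<epsilon> / (4 * h)" by (auto simp: eventually_sequentially)
    show "\<exists>K. \<forall>m\<ge>K. \<forall>n\<ge>K. mean_square M (\<lambda>\<omega>. R m \<omega> - R n \<omega>) \<le> ennreal \<epsilon>"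
    proof (intro exI[of _ "Suc K"] allI impI)
      fix m n assume mn: "Suc K \<le> m" "Suc K \<le> n"
      have "2 * eps m + 2 * eps n \<le> \<epsilon> / h" using K[of m] K[of n] mn by (simp add: field_simps)
      then have "h * (2 * eps m + 2 * eps n) \<le> \<epsilon>" using h0 by (simp add: field_simps)
      then show "mean_square M (\<lambda>\<omega>. R m \<omega> - R n \<omega>) \<le> ennreal \<epsilon>"
        using R_Cauchy[of m n] mn by (auto intro: order_trans[OF _ ennreal_leI])
    qed
  qed blast
  let ?Y = "\<lambda>s \<omega>. \<Psi> (pred_V s \<omega>)"
  \<comment> \<open>The index is shifted because the grid with 0 cells is no partition ending at
    \<open>t + h\<close>.\<close>
  let ?ep = "\<lambda>n s \<omega>. elementary_process (\<tau> (Suc n)) (Suc n) (ES (Suc n)) s \<omega>"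
  let ?ei = "\<lambda>n. elementary_integral W (\<tau> (Suc n)) (Suc n) (ES (Suc n))"
  define d where "d n = Q2 * P2 / (real n + 1)" for n
  have d0: "0 \<le> d n" for n unfolding d_def using q_total(2) p_total(2) by auto
  have dlim: "d \<longlonglongrightarrow> 0"
    unfolding d_def using LIMSEQ_Suc[OF lim_const_over_n[of "Q2 * P2"]] by (simp add: add.commute)
  show ?thesis
    unfolding is_ito_integral_def
  proof (intro exI conjI allI ballI)
    show "I \<in> borel_measurable M" by (rule Im)
    show "predictable_HS_process M F J \<eta> e t (t + h) ?Y" by (rule predictable_Psi_pred_V)
    show "AE \<omega> in M. \<forall>u\<in>U0 J \<eta> e. X s \<omega> u = \<Psi> (pred_V s \<omega>) u" if "s \<in> {t..t + h}" for s
    proof -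
      have s: "t \<le> s" "s \<le> t + h" using that by auto
      show ?thesis using X[OF s] pred_V_modification[OF s] by eventually_elim simp
    qed
    show el: "elementary F t (t + h) ((\<lambda>n. \<tau> (Suc n)) n) (Suc n) ((\<lambda>n. ES (Suc n)) n)" for n
      using elementary_ES by simp
    show "(\<lambda>n. \<integral>\<^sup>+\<omega>. (\<integral>\<^sup>+s\<in>{t..t+h}. HS_norm_sq J \<eta> e (\<lambda>u. \<Psi> (pred_V s \<omega>) u - elementary_process ((\<lambda>n. \<tau> (Suc n)) n) (Suc n) ((\<lambda>n. ES (Suc n)) n) s \<omega> u) \<partial>lborel) \<partial>M) \<longlonglongrightarrow> 0"
    proof (rule tendsto_sandwich[OF _ _ tendsto_const])
      have "(\<integral>\<^sup>+\<omega>. (\<integral>\<^sup>+s\<in>{t..t+h}. HS_norm_sq J \<eta> e (\<lambda>u. \<Psi> (pred_V s \<omega>) u - ?ep n s \<omega> u) \<partial>lborel) \<partial>M)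
        \<le> ennreal (h * (2 * eps (Suc n) + 2 * d (Suc n)))" for n
        unfolding hs_difference_fubini[OF t0 predictable_Psi_pred_V elementary_ES[of "Suc n", OF zero_less_Suc]]
      proof (rule nn_integral_interval_bound)
        fix s assume s: "t < s" "s \<le> t + h"
        have Vm: "(\<lambda>\<omega>. \<Psi> (V t s \<omega>) (f j)) \<in> borel_measurable M" if "j \<in> Jp" for j
          using V_measurable[of t s] t0 s thT f_in_U0[OF that] by (intro Psi_measurable) auto
        have Em: "(\<lambda>\<omega>. ?ep n s \<omega> (f j)) \<in> borel_measurable M" for j
          unfolding elementary_process_def
          using elementary_value_measurable[OF t0 elementary_ES[of "Suc n"]]
          by (intro borel_measurable_sum borel_measurable_scaleR) auto
        have m: "(\<lambda>\<omega>. hs (\<lambda>j. \<Psi> (V t s \<omega>) (f j) - \<Gamma> (Suc n) s \<omega> j)) \<in> borel_measurable M"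
          "(\<lambda>\<omega>. hs (\<lambda>j. \<Gamma> (Suc n) s \<omega> j - ?ep n s \<omega> (f j))) \<in> borel_measurable M"
          by (intro hs_measurable borel_measurable_diff Vm Em Gamma_measurable, assumption?)+
        have s': "t \<le> s" using s by simp
        have "(\<integral>\<^sup>+\<omega>. hs (\<lambda>j. \<Psi> (pred_V s \<omega>) (f j) - ?ep n s \<omega> (f j)) \<partial>M)
          = (\<integral>\<^sup>+\<omega>. hs (\<lambda>j. \<Psi> (V t s \<omega>) (f j) - ?ep n s \<omega> (f j)) \<partial>M)"
          by (rule nn_integral_cong_AE, use pred_V_modification[OF s' s(2)] in eventually_elim) simp
        also have "\<dots> \<le> (\<integral>\<^sup>+\<omega>. 2 * hs (\<lambda>j. \<Psi> (V t s \<omega>) (f j) - \<Gamma> (Suc n) s \<omega> j) + 2 * hs (\<lambda>j. \<Gamma> (Suc n) s \<omega> j - ?ep n s \<omega> (f j)) \<partial>M)"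
          by (intro nn_integral_mono hs_triangle)
        also have "\<dots> = 2 * (\<integral>\<^sup>+\<omega>. hs (\<lambda>j. \<Psi> (V t s \<omega>) (f j) - \<Gamma> (Suc n) s \<omega> j) \<partial>M) + 2 * (\<integral>\<^sup>+\<omega>. hs (\<lambda>j. \<Gamma> (Suc n) s \<omega> j - ?ep n s \<omega> (f j)) \<partial>M)"
          using m by (simp add: nn_integral_add nn_integral_cmult)
        also have "(\<integral>\<^sup>+\<omega>. hs (\<lambda>j. \<Gamma> (Suc n) s \<omega> j - ?ep n s \<omega> (f j)) \<partial>M) = (\<integral>\<^sup>+\<omega>. hs (\<lambda>j. ?ep n s \<omega> (f j) - \<Gamma> (Suc n) s \<omega> j) \<partial>M)"
          by (intro nn_integral_cong hs_cong) (simp add: norm_minus_commute)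
        also have "2 * (\<integral>\<^sup>+\<omega>. hs (\<lambda>j. \<Psi> (V t s \<omega>) (f j) - \<Gamma> (Suc n) s \<omega> j) \<partial>M) + 2 * (\<integral>\<^sup>+\<omega>. hs (\<lambda>j. ?ep n s \<omega> (f j) - \<Gamma> (Suc n) s \<omega> j) \<partial>M)
          \<le> 2 * ennreal (eps (Suc n)) + 2 * ennreal (d (Suc n))"
          unfolding d_def using s by (intro add_mono mult_left_mono Gamma_error elementary_error) auto
        also have "\<dots> = ennreal (2 * eps (Suc n) + 2 * d (Suc n))" by (rule two_ennreal_add[OF eps_nonneg d0])
        finally show "(\<integral>\<^sup>+\<omega>. hs (\<lambda>j. \<Psi> (pred_V s \<omega>) (f j) - ?ep n s \<omega> (f j)) \<partial>M) \<le> ennreal (2 * eps (Suc n) + 2 * d (Suc n))" .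
      qed (use eps_nonneg d0 in auto)
      then show "\<forall>\<^sub>F n in sequentially. (\<integral>\<^sup>+\<omega>. (\<integral>\<^sup>+s\<in>{t..t+h}. HS_norm_sq J \<eta> e (\<lambda>u. \<Psi> (pred_V s \<omega>) u - elementary_process ((\<lambda>n. \<tau> (Suc n)) n) (Suc n) ((\<lambda>n. ES (Suc n)) n) s \<omega> u) \<partial>lborel) \<partial>M)
        \<le> ennreal (h * (2 * eps (Suc n) + 2 * d (Suc n)))" by simp
      have "(\<lambda>n. h * (2 * eps (Suc n) + 2 * d (Suc n))) \<longlonglongrightarrow> h * (2 * 0 + 2 * 0)"
        by (intro tendsto_mult tendsto_add tendsto_const LIMSEQ_Suc[OF eps_tendsto] LIMSEQ_Suc[OF dlim])
      from tendsto_ennrealI[OF this]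
      show "(\<lambda>n. ennreal (h * (2 * eps (Suc n) + 2 * d (Suc n)))) \<longlonglongrightarrow> 0" by simp
    qed simp
    show "(\<lambda>n. mean_square M (\<lambda>\<omega>. I \<omega> - elementary_integral W ((\<lambda>n. \<tau> (Suc n)) n) (Suc n) ((\<lambda>n. ES (Suc n)) n) \<omega>)) \<longlonglongrightarrow> 0"
    proof (rule tendsto_sandwich[OF _ _ tendsto_const])
      have "mean_square M (\<lambda>\<omega>. I \<omega> - ?ei n \<omega>) \<le> 2 * mean_square M (\<lambda>\<omega>. I \<omega> - R (Suc n) \<omega>) + 2 * ennreal (h * d (Suc n))" for n
      proof -
        have "mean_square M (\<lambda>\<omega>. ?ei n \<omega> - R (Suc n) \<omega>) \<le> (\<integral>\<^sup>+s\<in>{t..t+h}. (\<integral>\<^sup>+\<omega>. hs (\<lambda>j. ?ep n s \<omega> (f j) - \<Gamma> (Suc n) s \<omega> j) \<partial>M) \<partial>lborel)"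
          by (rule elementary_rep_bound[OF t0 thT elementary_ES[OF zero_less_Suc] rep_R])
        also have "\<dots> \<le> ennreal (h * d (Suc n))"
          using d0[of "Suc n"] elementary_error[of "Suc n", OF zero_less_Suc] unfolding d_def
          by (rule nn_integral_interval_bound[rotated])
        finally have 1: "mean_square M (\<lambda>\<omega>. R (Suc n) \<omega> - ?ei n \<omega>) \<le> ennreal (h * d (Suc n))"
          by (simp only: mean_square_commute[of M "R (Suc n)"])
        have "mean_square M (\<lambda>\<omega>. I \<omega> - ?ei n \<omega>) \<le> 2 * mean_square M (\<lambda>\<omega>. I \<omega> - R (Suc n) \<omega>) + 2 * mean_square M (\<lambda>\<omega>. R (Suc n) \<omega> - ?ei n \<omega>)"
          by (rule mean_square_triangle[OF Im R_measurable elementary_integral_measurable[OF t0 thT elementary_ES[OF zero_less_Suc]]])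
        also have "\<dots> \<le> 2 * mean_square M (\<lambda>\<omega>. I \<omega> - R (Suc n) \<omega>) + 2 * ennreal (h * d (Suc n))"
          by (intro add_left_mono mult_left_mono 1) simp
        finally show ?thesis .
      qed
      then show "\<forall>\<^sub>F n in sequentially. mean_square M (\<lambda>\<omega>. I \<omega> - elementary_integral W ((\<lambda>n. \<tau> (Suc n)) n) (Suc n) ((\<lambda>n. ES (Suc n)) n) \<omega>)
        \<le> 2 * mean_square M (\<lambda>\<omega>. I \<omega> - R (Suc n) \<omega>) + 2 * ennreal (h * d (Suc n))" by simp
      have "(\<lambda>n. ennreal (h * d (Suc n))) \<longlonglongrightarrow> ennreal (h * 0)"
        by (rule tendsto_ennrealI[OF tendsto_mult[OF tendsto_const LIMSEQ_Suc[OF dlim]]])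
      then have "(\<lambda>n. 2 * mean_square M (\<lambda>\<omega>. I \<omega> - R (Suc n) \<omega>) + 2 * ennreal (h * d (Suc n))) \<longlonglongrightarrow> 2 * 0 + 2 * ennreal (h * 0)"
        by (intro tendsto_add ennreal_tendsto_cmult LIMSEQ_Suc[OF I]) simp_all
      then show "(\<lambda>n. 2 * mean_square M (\<lambda>\<omega>. I \<omega> - R (Suc n) \<omega>) + 2 * ennreal (h * d (Suc n))) \<longlonglongrightarrow> 0" by simp
    qed simp
  qed
qed

end

section \<open>The truncated Fourier series of the sawtooth\<close>

definition saw :: "nat \<Rightarrow> real \<Rightarrow> real" where
  "saw D x = (1 / pi) * (\<Sum>r=1..D. sin (2 * real r * pi * x) / real r)"

definition rest :: "nat \<Rightarrow> real \<Rightarrow> real" where "rest D x = 1 / 2 - x - saw D x"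

lemma has_integral_real_derivative:
  fixes g G :: "real \<Rightarrow> real"
  assumes "a \<le> b" "\<And>x. (G has_real_derivative g x) (at x)"
  shows "(g has_integral (G b - G a)) {a..b}"
  using assms by (intro fundamental_theorem_of_calculus)
    (auto simp: has_real_derivative_iff_has_vector_derivative[symmetric] intro: has_field_derivative_at_within)

lemma sin_2pi_nat [simp]: "sin (2 * real r * pi) = 0" and cos_2pi_nat [simp]: "cos (2 * real r * pi) = 1"
  using sin_int_2pin[of "int r"] cos_int_2pin[of "int r"] by (simp_all add: mult_ac)

lemma integral_half_sq: "((\<lambda>x. (1 / 2 - x)\<^sup>2) has_integral (1 / 12 :: real)) {0..1}"
proof -
  have "((\<lambda>x. (1 / 2 - x)\<^sup>2) has_integral (- ((1 / 2 - 1) ^ 3) / 3 - (- ((1 / 2 - 0) ^ 3) / 3 :: real))) {0..1}"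
    by (rule has_integral_real_derivative) (auto intro!: derivative_eq_intros simp: power2_eq_square)
  then show ?thesis by (simp add: power3_eq_cube)
qed

lemma integral_half_sin:
  assumes "1 \<le> r"
  shows "((\<lambda>x. (1 / 2 - x) * sin (2 * real r * pi * x)) has_integral (1 / (2 * (pi * real r)))) {0..1}"
proof -
  define k where "k = 2 * real r * pi"
  have k: "k \<noteq> 0" using assms by (simp add: k_def)
  have "((\<lambda>x. (1 / 2 - x) * sin (k * x)) has_integral
     ((- (1 / 2 - 1) * cos (k * 1) / k - sin (k * 1) / k\<^sup>2) - (- (1 / 2 - 0) * cos (k * 0) / k - sin (k * 0) / k\<^sup>2))) {0..1}"
    by (rule has_integral_real_derivative) (use k in \<open>auto intro!: derivative_eq_intros simp: field_simps power2_eq_square\<close>)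
  then show ?thesis by (simp add: k_def)
qed

lemma integral_sin_sin:
  assumes "1 \<le> r" "1 \<le> r'"
  shows "((\<lambda>x. sin (2 * real r * pi * x) * sin (2 * real r' * pi * x)) has_integral (if r = r' then 1 / 2 else 0)) {0..1}"
proof (cases "r = r'")
  case True
  define k where "k = 2 * real r * pi"
  have k: "k \<noteq> 0" using assms by (simp add: k_def)
  have "((\<lambda>x. sin (k * x) * sin (k * x)) has_integral
     ((1 / 2 - sin (k * 1) * cos (k * 1) / (2 * k)) - (0 / 2 - sin (k * 0) * cos (k * 0) / (2 * k)))) {0..1}"
  proof (rule has_integral_real_derivative)
    fix x :: real
    have d: "((\<lambda>x. x / 2 - sin (k * x) * cos (k * x) / (2 * k)) has_real_derivative
       (1 / 2 - (cos (k * x) * k * cos (k * x) + sin (k * x) * (- sin (k * x) * k)) / (2 * k))) (at x)"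
      using k by (auto intro!: derivative_eq_intros simp: field_simps)
    have "1 / 2 - (cos (k * x) * k * cos (k * x) + sin (k * x) * (- sin (k * x) * k)) / (2 * k)
      = 1 / 2 - ((cos (k * x))\<^sup>2 - (sin (k * x))\<^sup>2) / 2"
      using k by (simp add: field_simps power2_eq_square)
    also have "\<dots> = sin (k * x) * sin (k * x)"
      by (simp add: cos_squared_eq power2_eq_square field_simps)
    finally show "((\<lambda>x. x / 2 - sin (k * x) * cos (k * x) / (2 * k)) has_real_derivative sin (k * x) * sin (k * x)) (at x)"
      using d by simp
  qed simp
  then show ?thesis using True by (simp add: k_def)
next
  case False
  define k where "k = 2 * real r * pi"
  define l where "l = 2 * real r' * pi"
  have "k \<noteq> l" using False by (auto simp: k_def l_def)
  moreover have "0 < k" "0 < l" using assms by (simp_all add: k_def l_def)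
  ultimately have k: "k - l \<noteq> 0" "k + l \<noteq> 0" by linarith+
  then have k'': "k \<noteq> l" "2 * k + 2 * l \<noteq> 0" by linarith+
  have sz: "sin (k - l) = 0" "sin (k + l) = 0" by (simp_all add: sin_diff sin_add k_def l_def)
  have "((\<lambda>x. sin (k * x) * sin (l * x)) has_integral
     ((sin ((k - l) * 1) / (2 * (k - l)) - sin ((k + l) * 1) / (2 * (k + l)))
     - (sin ((k - l) * 0) / (2 * (k - l)) - sin ((k + l) * 0) / (2 * (k + l))))) {0..1}"
  proof (rule has_integral_real_derivative)
    fix x :: real
    have d: "((\<lambda>x. sin ((k - l) * x) / (2 * (k - l)) - sin ((k + l) * x) / (2 * (k + l))) has_real_derivative
       (cos ((k - l) * x) * (k - l) / (2 * (k - l)) - cos ((k + l) * x) * (k + l) / (2 * (k + l)))) (at x)"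
      using k'' by (auto intro!: derivative_eq_intros)
    have "cos ((k - l) * x) * (k - l) / (2 * (k - l)) - cos ((k + l) * x) * (k + l) / (2 * (k + l))
      = cos (k * x - l * x) / 2 - cos (k * x + l * x) / 2"
    proof -
      have "y * z / (2 * z) = y / 2" if "z \<noteq> 0" for y z :: real using that by simp
      from this[OF k(1)] this[OF k(2)] show ?thesis by (simp only: left_diff_distrib distrib_right)
    qed
    also have "\<dots> = sin (k * x) * sin (l * x)" by (simp add: cos_diff cos_add field_simps)
    finally show "((\<lambda>x. sin ((k - l) * x) / (2 * (k - l)) - sin ((k + l) * x) / (2 * (k + l))) has_real_derivative sin (k * x) * sin (l * x)) (at x)"
      using d by simp
  qed simp
  then show ?thesis using False sz by (simp add: k_def l_def)
qed

text \<open>Since 1/(n+1)^2 \<le> 1/n - 1/(n+1), the partial sums increased by 1/n are decreasing.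
  They have the same limit pi^2/6, which is therefore at most the value at \<open>D\<close>.\<close>

lemma inverse_square_tail:
  assumes "1 \<le> D"
  shows "pi\<^sup>2 / 6 - (\<Sum>r=1..D. 1 / (real r)\<^sup>2) \<le> 1 / real D"
proof -
  define s where "s n = (\<Sum>r=1..n. 1 / (real r)\<^sup>2) + 1 / real n" for n
  have dec: "s (Suc n) \<le> s n" if "1 \<le> n" for n
  proof -
    have "1 / (real (Suc n))\<^sup>2 + 1 / real (Suc n) \<le> 1 / real n"
    proof -
      have "1 / (real (Suc n))\<^sup>2 \<le> 1 / (real n * real (Suc n))"
        unfolding power2_eq_square using that by (intro divide_left_mono mult_right_mono mult_pos_pos) auto
      also have "\<dots> = 1 / real n - 1 / real (Suc n)" using that by (simp add: field_simps)
      finally show ?thesis by simp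
    qed
    then show ?thesis by (simp add: s_def)
  qed
  have le: "s n \<le> s D" if "D \<le> n" for n
    using that
  proof (induction n rule: dec_induct)
    case (step n) then show ?case using dec[of n] assms by simp
  qed simp
  have "(\<lambda>n. \<Sum>r=1..n. 1 / (real r)\<^sup>2) \<longlonglongrightarrow> pi\<^sup>2 / 6"
  proof -
    have "(\<lambda>n. \<Sum>k<n. 1 / (real k + 1)\<^sup>2) \<longlonglongrightarrow> pi\<^sup>2 / 6"
      using inverse_squares_sums unfolding sums_def by (simp add: add.commute)
    moreover have "(\<Sum>k<n. 1 / (real k + 1)\<^sup>2) = (\<Sum>r=1..n. 1 / (real r)\<^sup>2)" for n
      by (induction n) (auto simp: add.commute)
    ultimately show ?thesis by simp
  qed
  from tendsto_add[OF this lim_const_over_n[of 1]]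
  have "s \<longlonglongrightarrow> pi\<^sup>2 / 6" by (simp add: s_def[abs_def])
  then have "pi\<^sup>2 / 6 \<le> s D"
    using le by (intro LIMSEQ_le_const2) auto
  then show ?thesis by (simp add: s_def)
qed

text \<open>The square is expanded and integrated with the orthogonality of the sines. With X the
  sum of 1/r^2 up to \<open>D\<close>, the result is 1/12 - X/pi^2 + X/(2 pi^2), that is 1/(2 pi^2)
  times the tail pi^2/6 - X.\<close>

lemma integral_rest_sq:
  assumes "1 \<le> D"
  shows "integral {0..1} (\<lambda>x. (rest D x)\<^sup>2) \<le> 1 / (2 * pi\<^sup>2 * real D)"
proof -
  let ?s = "\<lambda>r x. sin (2 * real r * pi * x)"
  have eq: "(rest D x)\<^sup>2 = (1 / 2 - x)\<^sup>2 - (\<Sum>r=1..D. 2 / (pi * real r) * ((1 / 2 - x) * ?s r x))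
     + (\<Sum>r=1..D. \<Sum>r'=1..D. 1 / (pi\<^sup>2 * real r * real r') * (?s r x * ?s r' x))" for x
  proof -
    have "(rest D x)\<^sup>2 = (1 / 2 - x)\<^sup>2 - 2 * (1 / 2 - x) * saw D x + saw D x * saw D x"
      by (simp add: rest_def power2_eq_square algebra_simps)
    moreover have "2 * (1 / 2 - x) * saw D x = (\<Sum>r=1..D. 2 / (pi * real r) * ((1 / 2 - x) * ?s r x))"
      unfolding saw_def sum_distrib_left by (intro sum.cong) auto
    moreover have "saw D x * saw D x = (\<Sum>r=1..D. \<Sum>r'=1..D. 1 / (pi\<^sup>2 * real r * real r') * (?s r x * ?s r' x))"
    proof -
      have "saw D x * saw D x = 1 / pi\<^sup>2 * ((\<Sum>r=1..D. ?s r x / real r) * (\<Sum>r=1..D. ?s r x / real r))"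
        by (simp add: saw_def power2_eq_square)
      also have "\<dots> = (\<Sum>r=1..D. \<Sum>r'=1..D. 1 / (pi\<^sup>2 * real r * real r') * (?s r x * ?s r' x))"
      proof -
        have "(\<Sum>r=1..D. ?s r x / real r) * (\<Sum>r=1..D. ?s r x / real r) = (\<Sum>r=1..D. \<Sum>r'=1..D. ?s r x / real r * (?s r' x / real r'))"
          by (rule sum_product)
        then show ?thesis by (simp only: sum_distrib_left) (intro sum.cong refl, simp)
      qed
      finally show ?thesis .
    qed
    ultimately show ?thesis by simp
  qed
  have "((\<lambda>x. (rest D x)\<^sup>2) has_integral (1 / 12 - (\<Sum>r=1..D. 2 / (pi * real r) * (1 / (2 * (pi * real r))))
     + (\<Sum>r=1..D. \<Sum>r'=1..D. 1 / (pi\<^sup>2 * real r * real r') * (if r = r' then 1 / 2 else 0)))) {0..1}"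
    unfolding eq
    by (intro has_integral_add has_integral_diff has_integral_sum finite_atLeastAtMost has_integral_mult_right
        integral_half_sq integral_half_sin integral_sin_sin) auto
  then have "integral {0..1} (\<lambda>x. (rest D x)\<^sup>2) = 1 / 12 - (\<Sum>r=1..D. 2 / (pi * real r) * (1 / (2 * (pi * real r))))
     + (\<Sum>r=1..D. \<Sum>r'=1..D. 1 / (pi\<^sup>2 * real r * real r') * (if r = r' then 1 / 2 else 0))"
    by (rule integral_unique)
  also have "(\<Sum>r=1..D. \<Sum>r'=1..D. 1 / (pi\<^sup>2 * real r * real r') * (if r = r' then 1 / 2 else 0))
    = (\<Sum>r=1..D. 1 / (2 * pi\<^sup>2) * (1 / (real r)\<^sup>2))"
  proof (intro sum.cong refl)
    fix r assume "r \<in> {1..D}"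
    have "(\<Sum>r'=1..D. 1 / (pi\<^sup>2 * real r * real r') * (if r = r' then 1 / 2 else 0)) = (\<Sum>r'=1..D. if r = r' then 1 / (2 * pi\<^sup>2) * (1 / (real r)\<^sup>2) else 0)"
      by (intro sum.cong) (auto simp: power2_eq_square)
    then show "(\<Sum>r'=1..D. 1 / (pi\<^sup>2 * real r * real r') * (if r = r' then 1 / 2 else 0)) = 1 / (2 * pi\<^sup>2) * (1 / (real r)\<^sup>2)"
      using \<open>r \<in> {1..D}\<close> by simp
  qed
  also have "(\<Sum>r=1..D. 2 / (pi * real r) * (1 / (2 * (pi * real r)))) = (\<Sum>r=1..D. 1 / pi\<^sup>2 * (1 / (real r)\<^sup>2))"
    by (intro sum.cong) (auto simp: power2_eq_square)
  finally have "integral {0..1} (\<lambda>x. (rest D x)\<^sup>2) = 1 / 12 - 1 / pi\<^sup>2 * (\<Sum>r=1..D. 1 / (real r)\<^sup>2) + 1 / (2 * pi\<^sup>2) * (\<Sum>r=1..D. 1 / (real r)\<^sup>2)"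
    by (simp only: sum_distrib_left)
  also have "1 / 12 - 1 / pi\<^sup>2 * X + 1 / (2 * pi\<^sup>2) * X = 1 / (2 * pi\<^sup>2) * (pi\<^sup>2 / 6 - X)" for X
    by (simp add: field_simps)
  note this[of "\<Sum>r=1..D. 1 / (real r)\<^sup>2"]
  also have "1 / (2 * pi\<^sup>2) * (pi\<^sup>2 / 6 - (\<Sum>r=1..D. 1 / (real r)\<^sup>2)) \<le> 1 / (2 * pi\<^sup>2) * (1 / real D)"
    by (intro mult_left_mono inverse_square_tail assms) auto
  finally show ?thesis by simp
qed

section \<open>Riemann sums\<close>

text \<open>The weight is integrated exactly over each cell and only \<open>w\<close> is frozen at
  the tag. Uniform continuity makes the error on a cell at most \<epsilon>' times its length, and an
  induction over the cells adds these up to h \<epsilon>' = \<epsilon>/2. Exact integrals of the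
  weight are what permits summation by parts for sines and cosines.\<close>

lemma tagged_sum_tendsto:
  fixes w \<phi> :: "real \<Rightarrow> real"
  assumes h: "0 < h" and w: "continuous_on {0..h} w" and \<phi>: "continuous_on {0..h} \<phi>"
    and bd: "\<And>u. u \<in> {0..h} \<Longrightarrow> \<bar>\<phi> u\<bar> \<le> 1"
    and tag: "\<And>n m. m < n \<Longrightarrow> real m * (h / real n) \<le> \<xi> n m \<and> \<xi> n m \<le> real (Suc m) * (h / real n)"
  shows "(\<lambda>n. \<Sum>m<n. w (\<xi> n m) * integral {real m * (h / real n)..real (Suc m) * (h / real n)} \<phi>) \<longlonglongrightarrow> integral {0..h} (\<lambda>u. w u * \<phi> u)"
  unfolding LIMSEQ_iff
proof (intro allI impI)
  fix \<epsilon> :: real assume \<epsilon>: "0 < \<epsilon>"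
  define \<epsilon>' where "\<epsilon>' = \<epsilon> / (2 * h)"
  have \<epsilon>': "0 < \<epsilon>'" using \<epsilon> h by (simp add: \<epsilon>'_def)
  have "uniformly_continuous_on {0..h} w" by (rule compact_uniformly_continuous[OF w]) simp
  then obtain d where d: "0 < d" "\<And>x y. x \<in> {0..h} \<Longrightarrow> y \<in> {0..h} \<Longrightarrow> dist y x < d \<Longrightarrow> dist (w y) (w x) < \<epsilon>'"
    using \<epsilon>' unfolding uniformly_continuous_on_def by metis
  obtain n0 :: nat where "h / d < real n0" using reals_Archimedean2 by blast
  moreover have "0 < h / d" using d(1) h by simp
  ultimately have n0: "0 < n0" "h / d < real n0"
    by (auto intro!: Nat.gr0I)
  then have n0: "0 < n0" "h / real n0 < d"
    using d(1) by (auto simp: pos_divide_less_eq mult.commute)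
  have "norm ((\<Sum>m<n. w (\<xi> n m) * integral {real m * (h / real n)..real (Suc m) * (h / real n)} \<phi>) - integral {0..h} (\<lambda>u. w u * \<phi> u)) < \<epsilon>"
    if n: "n0 \<le> n" for n
  proof -
    define \<Delta> where "\<Delta> = h / real n"
    have npos: "0 < n" using n n0 by simp
    have \<Delta>: "0 < \<Delta>" "\<Delta> < d" "real n * \<Delta> = h"
    proof -
      show "0 < \<Delta>" "real n * \<Delta> = h" using h npos by (auto simp: \<Delta>_def)
      have "\<Delta> \<le> h / real n0" unfolding \<Delta>_def using n n0 h by (intro divide_left_mono) auto
      then show "\<Delta> < d" using n0 by simp
    qed
    have sub: "{real m * \<Delta>..real (Suc m) * \<Delta>} \<subseteq> {0..h}" if "m < n" for m
    proof -
      have "real (Suc m) * \<Delta> \<le> real n * \<Delta>" using that \<Delta>(1) by (intro mult_right_mono) auto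
      then show ?thesis using \<Delta> by auto
    qed
    have sub0: "{0..real m * \<Delta>} \<subseteq> {0..h}" if "m \<le> n" for m
    proof -
      have "real m * \<Delta> \<le> real n * \<Delta>" using that \<Delta>(1) by (intro mult_right_mono) auto
      then show ?thesis using \<Delta> by auto
    qed
    have wp: "continuous_on {0..h} (\<lambda>u. w u * \<phi> u)" by (intro continuous_on_mult w \<phi>)
    have "\<bar>(\<Sum>m<k. w (\<xi> n m) * integral {real m * \<Delta>..real (Suc m) * \<Delta>} \<phi>) - integral {0..real k * \<Delta>} (\<lambda>u. w u * \<phi> u)\<bar> \<le> real k * \<Delta> * \<epsilon>'"
      if "k \<le> n" for k
      using that
    proof (induction k)
      case (Suc k)
      let ?a = "real k * \<Delta>" and ?b = "real (Suc k) * \<Delta>"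
      have ab: "0 \<le> ?a" "?a \<le> ?b" using \<Delta> by (auto intro: mult_right_mono)
      have kn: "k < n" using Suc by simp
      have "(\<lambda>u. w u * \<phi> u) integrable_on {0..?b}"
        using sub0[of "Suc k"] Suc by (intro integrable_continuous_interval continuous_on_subset[OF wp]) auto
      from Henstock_Kurzweil_Integration.integral_combine[OF ab this]
      have comb: "integral {0..?b} (\<lambda>u. w u * \<phi> u) = integral {0..?a} (\<lambda>u. w u * \<phi> u) + integral {?a..?b} (\<lambda>u. w u * \<phi> u)"
        by (rule sym)
      have i1: "\<phi> integrable_on {?a..?b}" "(\<lambda>u. w u * \<phi> u) integrable_on {?a..?b}"
        using sub[OF kn] by (auto intro!: integrable_continuous_interval intro: continuous_on_subset[OF \<phi>] continuous_on_subset[OF wp])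
      have "w (\<xi> n k) * integral {?a..?b} \<phi> - integral {?a..?b} (\<lambda>u. w u * \<phi> u)
        = integral {?a..?b} (\<lambda>u. w (\<xi> n k) * \<phi> u - w u * \<phi> u)"
        using i1 by (subst integral_diff) (auto intro: integrable_on_mult_right)
      also have "norm \<dots> \<le> \<epsilon>' * Henstock_Kurzweil_Integration.content {?a..?b}"
      proof (rule has_integral_bound_real[OF _ finite.emptyI])
        show "((\<lambda>u. w (\<xi> n k) * \<phi> u - w u * \<phi> u) has_integral integral {?a..?b} (\<lambda>u. w (\<xi> n k) * \<phi> u - w u * \<phi> u)) {?a..?b}"
          using i1 by (intro integrable_integral integrable_diff integrable_on_mult_right) auto
        fix u assume "u \<in> {?a..?b} - {}"
        then have u: "u \<in> {?a..?b}" by simp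
        then have u': "u \<in> {0..h}" using sub[OF kn] by blast
        have x: "\<xi> n k \<in> {?a..?b}" using tag[OF kn] by (simp add: \<Delta>_def)
        then have x': "\<xi> n k \<in> {0..h}" using sub[OF kn] by blast
        have "\<bar>\<xi> n k - u\<bar> \<le> ?b - ?a" using u x by auto
        then have "dist (\<xi> n k) u < d" using \<Delta> by (simp add: dist_real_def algebra_simps)
        then have "\<bar>w (\<xi> n k) - w u\<bar> < \<epsilon>'" using d(2)[OF u' x'] by (simp add: dist_real_def)
        then have "\<bar>w (\<xi> n k) - w u\<bar> * \<bar>\<phi> u\<bar> \<le> \<epsilon>' * 1" using bd[OF u'] \<epsilon>' by (intro mult_mono) auto
        then show "norm (w (\<xi> n k) * \<phi> u - w u * \<phi> u) \<le> \<epsilon>'" by (simp add: left_diff_distrib[symmetric] abs_mult)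
      qed (use \<epsilon>' in auto)
      finally have "\<bar>w (\<xi> n k) * integral {?a..?b} \<phi> - integral {?a..?b} (\<lambda>u. w u * \<phi> u)\<bar> \<le> \<epsilon>' * \<Delta>"
        using \<Delta> ab by (simp add: algebra_simps)
      then show ?case using Suc kn unfolding comb by (simp add: algebra_simps)
    qed simp
    from this[of n] have "\<bar>(\<Sum>m<n. w (\<xi> n m) * integral {real m * \<Delta>..real (Suc m) * \<Delta>} \<phi>) - integral {0..h} (\<lambda>u. w u * \<phi> u)\<bar> \<le> h * \<epsilon>'"
      using \<Delta>(3) by simp
    also have "\<dots> < \<epsilon>" using \<epsilon> h by (simp add: \<epsilon>'_def)
    finally show ?thesis by (simp add: \<Delta>_def)
  qed
  then show "\<exists>no. \<forall>n\<ge>no. norm ((\<Sum>m<n. w (\<xi> n m) * integral {real m * (h / real n)..real (Suc m) * (h / real n)} \<phi>) - integral {0..h} (\<lambda>u. w u * \<phi> u)) < \<epsilon>"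
    by blast
qed

lemma rest_sum_tendsto: "(\<lambda>n. (\<Sum>m<n. (rest D (real (Suc m) / real n))\<^sup>2) / real n) \<longlonglongrightarrow> integral {0..1} (\<lambda>x. (rest D x)\<^sup>2)"
proof -
  have cont: "continuous_on {0..1} (\<lambda>x. (rest D x)\<^sup>2)"
    unfolding rest_def saw_def by (intro continuous_intros) auto
  have "(\<lambda>n. \<Sum>m<n. (rest D (real (Suc m) * (1 / real n)))\<^sup>2 * integral {real m * (1 / real n)..real (Suc m) * (1 / real n)} (\<lambda>_. 1)) \<longlonglongrightarrow> integral {0..1} (\<lambda>u. (rest D u)\<^sup>2 * 1)"
  proof (rule tagged_sum_tendsto[where \<xi>="\<lambda>n m. real (Suc m) * (1 / real n)"])
    show "real m * (1 / real n) \<le> real (Suc m) * (1 / real n) \<and> real (Suc m) * (1 / real n) \<le> real (Suc m) * (1 / real n)" for m n :: nat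
      by (intro conjI mult_right_mono order_refl) auto
  qed (auto intro!: cont)
  moreover have "(\<Sum>m<n. (rest D (real (Suc m) * (1 / real n)))\<^sup>2 * integral {real m * (1 / real n)..real (Suc m) * (1 / real n)} (\<lambda>_. 1))
    = (\<Sum>m<n. (rest D (real (Suc m) / real n))\<^sup>2) / real n" for n
    unfolding sum_divide_distrib by (intro sum.cong refl) (auto simp: divide_right_mono diff_divide_distrib[symmetric])
  ultimately show ?thesis by simp
qed

text \<open>The square of a sum of three terms costs a factor 3, and each of the three double sums
  is at most n times one Riemann sum of the squared remainder; hence 9 = 3 * 3.\<close>

lemma rest_double_sum:
  assumes "1 \<le> D"
  shows "\<forall>\<^sub>F n in sequentially. (\<Sum>m<n. \<Sum>m'<m. (rest D ((real m - real m') / real n) + rest D (real (Suc m') / real n) - rest D (real (Suc m) / real n))\<^sup>2) / (real n)\<^sup>2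
    \<le> 9 / (pi\<^sup>2 * real D)"
proof -
  have pos: "0 < 1 / (2 * pi\<^sup>2 * real D)" using assms by simp
  \<comment> \<open>The bound for the integral is doubled to have a strict inequality, which the
    Riemann sums inherit eventually.\<close>
  have "integral {0..1} (\<lambda>x. (rest D x)\<^sup>2) < 1 / (pi\<^sup>2 * real D)"
    using integral_rest_sq[OF assms] pos by (auto simp: field_simps)
  from order_tendstoD(2)[OF rest_sum_tendsto this]
  show ?thesis
  proof (rule eventually_mp[rotated], intro eventually_mono[OF eventually_gt_at_top[of 0]] impI)
    fix n :: nat assume n: "0 < n"
    define X where "X = (\<Sum>m<n. (rest D (real (Suc m) / real n))\<^sup>2)"
    assume "(\<Sum>m<n. (rest D (real (Suc m) / real n))\<^sup>2) / real n < 1 / (pi\<^sup>2 * real D)"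
    then have X: "X / real n < 1 / (pi\<^sup>2 * real D)" by (simp add: X_def)
    have X0: "0 \<le> X" unfolding X_def by (intro sum_nonneg) auto
    \<comment> \<open>For fixed \<open>m\<close> the differences m - m' run through 1, ..., m, so
      this is a part of the sum \<open>X\<close> in reversed order.\<close>
    have 1: "(\<Sum>m'<m. (rest D ((real m - real m') / real n))\<^sup>2) \<le> X" if "m < n" for m
    proof -
      have "(\<Sum>m'<m. (rest D ((real m - real m') / real n))\<^sup>2) = (\<Sum>k<m. (rest D (real (Suc k) / real n))\<^sup>2)"
        by (rule sum.reindex_bij_witness[of _ "\<lambda>k. m - 1 - k" "\<lambda>k. m - 1 - k"]) (auto simp: of_nat_diff)
      also have "\<dots> \<le> X" unfolding X_def using that by (intro sum_mono2) auto
      finally show ?thesis .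
    qed
    have 2: "(\<Sum>m'<m. (rest D (real (Suc m') / real n))\<^sup>2) \<le> X" if "m < n" for m
      unfolding X_def using that by (intro sum_mono2) auto
    have 3: "(\<Sum>m<n. \<Sum>m'<m. (rest D (real (Suc m) / real n))\<^sup>2) \<le> real n * X"
    proof -
      have "(\<Sum>m<n. \<Sum>m'<m. (rest D (real (Suc m) / real n))\<^sup>2) \<le> (\<Sum>m<n. real n * (rest D (real (Suc m) / real n))\<^sup>2)"
        by (intro sum_mono) (auto intro!: mult_right_mono)
      then show ?thesis by (simp add: X_def sum_distrib_left)
    qed
    have sq: "(x + y - z)\<^sup>2 \<le> 3 * x\<^sup>2 + 3 * y\<^sup>2 + 3 * z\<^sup>2" for x y z :: real
    proof -
      have "0 \<le> (x - y)\<^sup>2 + (x + z)\<^sup>2 + (y + z)\<^sup>2" by simp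
      then show ?thesis by (simp add: power2_eq_square algebra_simps)
    qed
    have "(\<Sum>m<n. \<Sum>m'<m. (rest D ((real m - real m') / real n) + rest D (real (Suc m') / real n) - rest D (real (Suc m) / real n))\<^sup>2)
      \<le> (\<Sum>m<n. \<Sum>m'<m. 3 * (rest D ((real m - real m') / real n))\<^sup>2 + 3 * (rest D (real (Suc m') / real n))\<^sup>2 + 3 * (rest D (real (Suc m) / real n))\<^sup>2)"
      by (intro sum_mono sq)
    also have "\<dots> = 3 * (\<Sum>m<n. \<Sum>m'<m. (rest D ((real m - real m') / real n))\<^sup>2) + 3 * (\<Sum>m<n. \<Sum>m'<m. (rest D (real (Suc m') / real n))\<^sup>2) + 3 * (\<Sum>m<n. \<Sum>m'<m. (rest D (real (Suc m) / real n))\<^sup>2)"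
      by (simp only: sum.distrib sum_distrib_left)
    also have "\<dots> \<le> 3 * (\<Sum>m<n. X) + 3 * (\<Sum>m<n. X) + 3 * (real n * X)"
      using 1 2 3 by (intro add_mono mult_left_mono sum_mono) auto
    also have "\<dots> = 9 * (real n * X)" by simp
    finally have "(\<Sum>m<n. \<Sum>m'<m. (rest D ((real m - real m') / real n) + rest D (real (Suc m') / real n) - rest D (real (Suc m) / real n))\<^sup>2) / (real n)\<^sup>2
      \<le> 9 * (real n * X) / (real n)\<^sup>2" by (rule divide_right_mono) simp
    also have "\<dots> = 9 * (X / real n)" using n by (simp add: power2_eq_square)
    also have "\<dots> \<le> 9 * (1 / (pi\<^sup>2 * real D))" using X by (intro mult_left_mono) auto
    finally show "(\<Sum>m<n. \<Sum>m'<m. (rest D ((real m - real m') / real n) + rest D (real (Suc m') / real n) - rest D (real (Suc m) / real n))\<^sup>2) / (real n)\<^sup>2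
      \<le> 9 / (pi\<^sup>2 * real D)" by simp
  qed
qed

section \<open>The Fourier coefficients as limits of sums of increments\<close>

lemma abel_sum:
  fixes w s :: "nat \<Rightarrow> real"
  shows "(\<Sum>m<n. w m * (s (Suc m) - s m)) = w n * s n - w 0 * s 0 - (\<Sum>m<n. (w (Suc m) - w m) * s (Suc m))"
  by (induction n) (auto simp: algebra_simps)

lemma integral_cos_k: "a \<le> b \<Longrightarrow> k \<noteq> 0 \<Longrightarrow> integral {a..b} (\<lambda>u. cos (k * u)) = (sin (k * b) - sin (k * a)) / (k::real)"
proof -
  assume "a \<le> b" "k \<noteq> 0"
  then have "((\<lambda>u. cos (k * u)) has_integral (sin (k * b) / k - sin (k * a) / k)) {a..b}"
    by (intro has_integral_real_derivative) (auto intro!: derivative_eq_intros)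
  then show ?thesis by (simp add: integral_unique diff_divide_distrib)
qed

lemma integral_sin_k: "a \<le> b \<Longrightarrow> k \<noteq> 0 \<Longrightarrow> integral {a..b} (\<lambda>u. sin (k * u)) = (- cos (k * b) - - cos (k * a)) / (k::real)"
proof -
  assume "a \<le> b" "k \<noteq> 0"
  then have "((\<lambda>u. sin (k * u)) has_integral (- cos (k * b) / k - - cos (k * a) / k)) {a..b}"
    by (intro has_integral_real_derivative) (auto intro!: derivative_eq_intros)
  then show ?thesis by (simp add: integral_unique diff_divide_distrib add_divide_distrib)
qed

text \<open>The integral of a cosine over a cell is an increment of the sine, and summation by parts
  moves the increments to \<open>w\<close>; the boundary term vanishes for the sine since k h is a
  multiple of 2 pi. For the cosine it is \<open>- w h\<close>, which becomes the -1 next to the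
  cosine. The linear bridge u/h w(h) contributes nothing to the first coefficient, and for the
  second exactly the term 1/(pi r) w(h) that the Levy area subtracts.\<close>

lemma coefficient_limits:
  fixes w :: "real \<Rightarrow> real"
  assumes h: "0 < h" and w: "continuous_on {0..h} w" and w0: "w 0 = 0" and r: "1 \<le> r"
  shows "(\<lambda>n. - (1 / (pi * real r)) * (\<Sum>m<n. (w (real (Suc m) * (h / real n)) - w (real m * (h / real n))) * sin (2 * real r * pi * (real (Suc m) / real n))))
      \<longlonglongrightarrow> 2 / h * (LINT u:{0..h}|lborel. (w u - u / h * w h) * cos (2 * real r * pi * u / h))" (is ?a)
    and "(\<lambda>n. (1 / (pi * real r)) * (\<Sum>m<n. (w (real (Suc m) * (h / real n)) - w (real m * (h / real n))) * (cos (2 * real r * pi * (real (Suc m) / real n)) - 1)))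
      \<longlonglongrightarrow> 2 / h * (LINT u:{0..h}|lborel. (w u - u / h * w h) * sin (2 * real r * pi * u / h)) - 1 / (pi * real r) * w h" (is ?b)
proof -
  define k where "k = 2 * real r * pi / h"
  have k: "k \<noteq> 0" "k * h = 2 * real r * pi" using h r by (auto simp: k_def)
  have kn: "k * (real m * (h / real n)) = 2 * real r * pi * (real m / real n)" for m n :: nat
    using h by (simp add: k_def)
  have le: "real m * (h / real n) \<le> real (Suc m) * (h / real n)" for m n :: nat
    using h by (intro mult_right_mono) auto
  define W where "W n m = w (real m * (h / real n))" for n m :: nat
  have Wn: "W n n = w h" if "0 < n" for n using that by (simp add: W_def)
  have W0: "W n 0 = 0" for n by (simp add: W_def w0)
  have tel: "(\<Sum>m<n. W n (Suc m) - W n m) = W n n" for n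
    using sum_lessThan_telescope[of "W n" n] by (simp add: W0)
  have lint: "(LINT u:{0..h}|lborel. g u) = integral {0..h} g" if "continuous_on {0..h} g" for g :: "real \<Rightarrow> real"
    using that by (intro set_borel_integral_eq_integral borel_integrable_atLeastAtMost')
  have uc: "((\<lambda>u. u * cos (k * u)) has_integral 0) {0..h}"
  proof -
    have "((\<lambda>u. u * cos (k * u)) has_integral ((h * sin (k * h) / k + cos (k * h) / k\<^sup>2) - (0 * sin (k * 0) / k + cos (k * 0) / k\<^sup>2))) {0..h}"
      by (rule has_integral_real_derivative)
        (use h k in \<open>auto intro!: derivative_eq_intros simp: field_simps power2_eq_square\<close>)
    then show ?thesis by (simp add: k(2))
  qed
  have us: "((\<lambda>u. u * sin (k * u)) has_integral (- h / k)) {0..h}"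
  proof -
    have "((\<lambda>u. u * sin (k * u)) has_integral ((- h * cos (k * h) / k + sin (k * h) / k\<^sup>2) - (- 0 * cos (k * 0) / k + sin (k * 0) / k\<^sup>2))) {0..h}"
      by (rule has_integral_real_derivative)
        (use h k in \<open>auto intro!: derivative_eq_intros simp: field_simps power2_eq_square\<close>)
    then show ?thesis by (simp add: k(2))
  qed
  have cc: "continuous_on {0..h} (\<lambda>u. cos (k * u))" "continuous_on {0..h} (\<lambda>u. sin (k * u))"
    by (intro continuous_intros)+
  have split: "(LINT u:{0..h}|lborel. (w u - u / h * w h) * g u) = integral {0..h} (\<lambda>u. w u * g u) - w h / h * I"
    if g: "continuous_on {0..h} g" and I: "((\<lambda>u. u * g u) has_integral I) {0..h}" for g I
  proof -
    have "(LINT u:{0..h}|lborel. (w u - u / h * w h) * g u) = integral {0..h} (\<lambda>u. (w u - u / h * w h) * g u)"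
      by (intro lint continuous_intros w g) (use h in auto)
    also have "\<dots> = integral {0..h} (\<lambda>u. w u * g u - w h / h * (u * g u))"
      by (intro integral_cong) (simp add: algebra_simps)
    also have "\<dots> = integral {0..h} (\<lambda>u. w u * g u) - w h / h * I"
    proof (rule integral_unique, intro has_integral_diff has_integral_mult_right I integrable_integral)
      show "(\<lambda>u. w u * g u) integrable_on {0..h}" by (intro integrable_continuous_interval continuous_on_mult w g)
    qed
    finally show ?thesis .
  qed
  have "(\<lambda>n. \<Sum>m<n. W n m * integral {real m * (h / real n)..real (Suc m) * (h / real n)} (\<lambda>u. cos (k * u))) \<longlonglongrightarrow> integral {0..h} (\<lambda>u. w u * cos (k * u))"
    unfolding W_def using le by (intro tagged_sum_tendsto h w cc) auto
  then have A: "(\<lambda>n. 2 / h * (\<Sum>m<n. W n m * integral {real m * (h / real n)..real (Suc m) * (h / real n)} (\<lambda>u. cos (k * u)))) \<longlonglongrightarrow> 2 / h * integral {0..h} (\<lambda>u. w u * cos (k * u))"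
    by (rule tendsto_mult_left)
  have rh: "2 / (h * k) = 1 / (pi * real r)" using h r by (simp add: k_def)
  have rh': "2 / h * (1 / k * y) = 1 / (pi * real r) * y" for y
    unfolding rh[symmetric] by simp
  show ?a
  proof (rule Lim_transform_eventually)
    show "(\<lambda>n. 2 / h * (\<Sum>m<n. W n m * integral {real m * (h / real n)..real (Suc m) * (h / real n)} (\<lambda>u. cos (k * u))))
      \<longlonglongrightarrow> 2 / h * (LINT u:{0..h}|lborel. (w u - u / h * w h) * cos (2 * real r * pi * u / h))"
      using A split[OF cc(1) uc] by (simp add: k_def)
    show "\<forall>\<^sub>F n in sequentially. 2 / h * (\<Sum>m<n. W n m * integral {real m * (h / real n)..real (Suc m) * (h / real n)} (\<lambda>u. cos (k * u)))
      = - (1 / (pi * real r)) * (\<Sum>m<n. (w (real (Suc m) * (h / real n)) - w (real m * (h / real n))) * sin (2 * real r * pi * (real (Suc m) / real n)))"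
      using eventually_gt_at_top[of 0]
    proof eventually_elim
      case (elim n)
      have "(\<Sum>m<n. W n m * integral {real m * (h / real n)..real (Suc m) * (h / real n)} (\<lambda>u. cos (k * u)))
        = (1 / k) * (\<Sum>m<n. W n m * (sin (k * (real (Suc m) * (h / real n))) - sin (k * (real m * (h / real n)))))"
        unfolding integral_cos_k[OF le k(1)] sum_distrib_left by (intro sum.cong) auto
      also have "\<dots> = (1 / k) * (- (\<Sum>m<n. (W n (Suc m) - W n m) * sin (k * (real (Suc m) * (h / real n)))))"
        using elim by (subst abel_sum) (simp add: W0 k(2))
      finally have "2 / h * (\<Sum>m<n. W n m * integral {real m * (h / real n)..real (Suc m) * (h / real n)} (\<lambda>u. cos (k * u))) = 1 / (pi * real r) * (- (\<Sum>m<n. (W n (Suc m) - W n m) * sin (k * (real (Suc m) * (h / real n)))))"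
        by (simp only: rh')
      then show ?case unfolding kn W_def by simp
    qed
  qed
  have "(\<lambda>n. \<Sum>m<n. W n m * integral {real m * (h / real n)..real (Suc m) * (h / real n)} (\<lambda>u. sin (k * u))) \<longlonglongrightarrow> integral {0..h} (\<lambda>u. w u * sin (k * u))"
    unfolding W_def using le by (intro tagged_sum_tendsto h w cc) auto
  then have B: "(\<lambda>n. 2 / h * (\<Sum>m<n. W n m * integral {real m * (h / real n)..real (Suc m) * (h / real n)} (\<lambda>u. sin (k * u)))) \<longlonglongrightarrow> 2 / h * integral {0..h} (\<lambda>u. w u * sin (k * u))"
    by (rule tendsto_mult_left)
  show ?b
  proof (rule Lim_transform_eventually)
    have "2 / h * (LINT u:{0..h}|lborel. (w u - u / h * w h) * sin (2 * real r * pi * u / h)) - 1 / (pi * real r) * w h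
      = 2 / h * integral {0..h} (\<lambda>u. w u * sin (k * u))"
    proof -
      have "2 / h * (LINT u:{0..h}|lborel. (w u - u / h * w h) * sin (2 * real r * pi * u / h)) = 2 / h * (integral {0..h} (\<lambda>u. w u * sin (k * u)) - w h / h * (- h / k))"
        using split[OF cc(2) us] by (simp add: k_def)
      also have "\<dots> = 2 / h * integral {0..h} (\<lambda>u. w u * sin (k * u)) + 2 / (h * k) * w h"
        using h k(1) by (simp add: field_simps)
      finally show ?thesis unfolding rh by simp
    qed
    then show "(\<lambda>n. 2 / h * (\<Sum>m<n. W n m * integral {real m * (h / real n)..real (Suc m) * (h / real n)} (\<lambda>u. sin (k * u))))
      \<longlonglongrightarrow> 2 / h * (LINT u:{0..h}|lborel. (w u - u / h * w h) * sin (2 * real r * pi * u / h)) - 1 / (pi * real r) * w h"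
      using B by simp
    show "\<forall>\<^sub>F n in sequentially. 2 / h * (\<Sum>m<n. W n m * integral {real m * (h / real n)..real (Suc m) * (h / real n)} (\<lambda>u. sin (k * u)))
      = (1 / (pi * real r)) * (\<Sum>m<n. (w (real (Suc m) * (h / real n)) - w (real m * (h / real n))) * (cos (2 * real r * pi * (real (Suc m) / real n)) - 1))"
      using eventually_gt_at_top[of 0]
    proof eventually_elim
      case (elim n)
      have "(\<Sum>m<n. W n m * integral {real m * (h / real n)..real (Suc m) * (h / real n)} (\<lambda>u. sin (k * u)))
        = (1 / k) * (\<Sum>m<n. W n m * ((\<lambda>m. - cos (k * (real m * (h / real n)))) (Suc m) - (\<lambda>m. - cos (k * (real m * (h / real n)))) m))"
        unfolding integral_sin_k[OF le k(1)] sum_distrib_left by (intro sum.cong) auto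
      also have "\<dots> = (1 / k) * (- W n n + (\<Sum>m<n. (W n (Suc m) - W n m) * cos (k * (real (Suc m) * (h / real n)))))"
        using elim by (subst abel_sum) (simp add: W0 k(2) sum_negf)
      also have "\<dots> = (1 / k) * (\<Sum>m<n. (W n (Suc m) - W n m) * (cos (k * (real (Suc m) * (h / real n))) - 1))"
        by (simp add: tel[symmetric] right_diff_distrib sum_subtractf diff_divide_distrib add_divide_distrib)
      finally have "2 / h * (\<Sum>m<n. W n m * integral {real m * (h / real n)..real (Suc m) * (h / real n)} (\<lambda>u. sin (k * u))) = 1 / (pi * real r) * (\<Sum>m<n. (W n (Suc m) - W n m) * (cos (k * (real (Suc m) * (h / real n))) - 1))"
        by (simp only: rh')
      then show ?case unfolding kn W_def by simp
    qed
  qed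
qed

section \<open>Sums of products of increments\<close>

context q_wiener
begin

lemma orthogonal_sum_mean_square:
  fixes v :: "'p \<Rightarrow> 'h::{real_inner, second_countable_topology}" and x :: "'p \<Rightarrow> 'w \<Rightarrow> real"
  assumes P: "finite P" and int: "\<And>p q. p \<in> P \<Longrightarrow> q \<in> P \<Longrightarrow> integrable M (\<lambda>\<omega>. x p \<omega> * x q \<omega>)"
    and E: "\<And>p q. p \<in> P \<Longrightarrow> q \<in> P \<Longrightarrow> (\<integral>\<omega>. x p \<omega> * x q \<omega> \<partial>M) = (if p = q then w p else 0)"
  shows "mean_square M (\<lambda>\<omega>. \<Sum>p\<in>P. x p \<omega> *\<^sub>R v p) = ennreal (\<Sum>p\<in>P. w p * (norm (v p))\<^sup>2)"
proof -
  have sq: "(norm (\<Sum>p\<in>P. y p *\<^sub>R v p))\<^sup>2 = (\<Sum>p\<in>P. \<Sum>q\<in>P. y p * y q * (v p \<bullet> v q))" for y :: "'p \<Rightarrow> real"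
    unfolding power2_norm_eq_inner inner_sum_left inner_sum_right
    by (intro sum.cong refl) (simp add: inner_commute mult_ac)
  have i: "integrable M (\<lambda>\<omega>. \<Sum>p\<in>P. \<Sum>q\<in>P. x p \<omega> * x q \<omega> * (v p \<bullet> v q))"
    using int by (intro Bochner_Integration.integrable_sum integrable_mult_left) auto
  have "mean_square M (\<lambda>\<omega>. \<Sum>p\<in>P. x p \<omega> *\<^sub>R v p) = ennreal (\<integral>\<omega>. (\<Sum>p\<in>P. \<Sum>q\<in>P. x p \<omega> * x q \<omega> * (v p \<bullet> v q)) \<partial>M)"
    unfolding mean_square_def sq using i
    by (rule nn_integral_eq_integral) (simp add: sq[symmetric])
  also have "(\<integral>\<omega>. (\<Sum>p\<in>P. \<Sum>q\<in>P. x p \<omega> * x q \<omega> * (v p \<bullet> v q)) \<partial>M) = (\<Sum>p\<in>P. \<Sum>q\<in>P. (\<integral>\<omega>. x p \<omega> * x q \<omega> \<partial>M) * (v p \<bullet> v q))"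
  proof -
    have "(\<integral>\<omega>. (\<Sum>p\<in>P. \<Sum>q\<in>P. x p \<omega> * x q \<omega> * (v p \<bullet> v q)) \<partial>M) = (\<Sum>p\<in>P. \<integral>\<omega>. (\<Sum>q\<in>P. x p \<omega> * x q \<omega> * (v p \<bullet> v q)) \<partial>M)"
      using int by (intro Bochner_Integration.integral_sum Bochner_Integration.integrable_sum integrable_mult_left) auto
    also have "\<dots> = (\<Sum>p\<in>P. \<Sum>q\<in>P. (\<integral>\<omega>. x p \<omega> * x q \<omega> * (v p \<bullet> v q) \<partial>M))"
      using int by (intro sum.cong refl Bochner_Integration.integral_sum integrable_mult_left) auto
    finally show ?thesis by simp
  qed
  also have "\<dots> = (\<Sum>p\<in>P. \<Sum>q\<in>P. if p = q then w p * (norm (v p))\<^sup>2 else 0)"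
    using E by (intro sum.cong refl) (auto simp: power2_norm_eq_inner)
  also have "\<dots> = (\<Sum>p\<in>P. w p * (norm (v p))\<^sup>2)" using P by simp
  finally show ?thesis .
qed

end

lemma quadruple_sum:
  assumes "finite L"
  shows "(\<Sum>m<n. \<Sum>m'<m. \<Sum>i\<in>L. \<Sum>j\<in>L. g m m' i j)
    = (\<Sum>(m, m', i, j)\<in>(SIGMA m:{..<n::nat}. {..<m} \<times> (L \<times> L)). g m m' i j)"
proof -
  have "(\<Sum>(m, m', i, j)\<in>(SIGMA m:{..<n::nat}. {..<m} \<times> (L \<times> L)). g m m' i j)
    = (\<Sum>m<n. \<Sum>(m', i, j)\<in>{..<m} \<times> (L \<times> L). g m m' i j)"
    using assms by (subst sum.Sigma[symmetric]) auto
  also have "\<dots> = (\<Sum>m<n. \<Sum>m'<m. \<Sum>i\<in>L. \<Sum>j\<in>L. g m m' i j)"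
    by (simp add: sum.cartesian_product')
  finally show ?thesis by simp
qed

lemma square_sum_split:
  fixes g :: "nat \<Rightarrow> nat \<Rightarrow> 'a::comm_monoid_add"
  shows "(\<Sum>m'<n. \<Sum>m<n. g m' m) = (\<Sum>m<n. \<Sum>m'<m. g m' m + g m m') + (\<Sum>m<n. g m m)"
proof (induction n)
  case (Suc n)
  have "(\<Sum>m'<Suc n. \<Sum>m<Suc n. g m' m) = (\<Sum>m'<n. \<Sum>m<n. g m' m) + (\<Sum>m'<n. g m' n) + (\<Sum>m<n. g n m) + g n n"
    by (simp add: sum.distrib ac_simps)
  then show ?case by (simp add: Suc sum.distrib ac_simps)
qed simp

text \<open>Expanding (k m' - 1) s m - s m' (k m - 1) yields the addition formula for the sine of a
  difference and the two boundary terms s m' - s m. These are the origin of the three sawtooth terms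
  in the kernel.\<close>

lemma levy_sum_identity:
  fixes x y s k :: "nat \<Rightarrow> real"
  assumes r: "r \<noteq> (0::real)"
  shows "pi * (r * ((- (1 / (pi * r)) * (\<Sum>m<n. x m * s m)) * (1 / (pi * r) * (\<Sum>m<n. y m * (k m - 1)))
      - (1 / (pi * r) * (\<Sum>m<n. x m * (k m - 1))) * (- (1 / (pi * r)) * (\<Sum>m<n. y m * s m))))
    = (\<Sum>m'<n. \<Sum>m<n. (1 / pi * ((s m * k m' - k m * s m' + s m' - s m) / r)) * (x m' * y m))"
proof -
  have "pi * (r * ((- (1 / (pi * r)) * (\<Sum>m<n. x m * s m)) * (1 / (pi * r) * (\<Sum>m<n. y m * (k m - 1)))
      - (1 / (pi * r) * (\<Sum>m<n. x m * (k m - 1))) * (- (1 / (pi * r)) * (\<Sum>m<n. y m * s m))))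
    = (1 / (pi * r)) * ((\<Sum>m<n. x m * (k m - 1)) * (\<Sum>m<n. y m * s m) - (\<Sum>m<n. x m * s m) * (\<Sum>m<n. y m * (k m - 1)))"
    using r by (simp add: field_simps)
  also have "\<dots> = (1 / (pi * r)) * (\<Sum>m'<n. \<Sum>m<n. x m' * (k m' - 1) * (y m * s m) - x m' * s m' * (y m * (k m - 1)))"
    by (simp only: sum_product sum_subtractf)
  also have "\<dots> = (\<Sum>m'<n. \<Sum>m<n. (1 / pi * ((s m * k m' - k m * s m' + s m' - s m) / r)) * (x m' * y m))"
    unfolding sum_distrib_left using r by (intro sum.cong refl) (simp add: field_simps)
  finally show ?thesis .
qed

context grid
begin

section \<open>Orthogonality of products of increments on the grid\<close>

definition inc :: "nat \<Rightarrow> nat \<Rightarrow> 'j \<Rightarrow> 'w \<Rightarrow> real" where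
  "inc n m i = \<beta> i (\<tau> n m) (\<tau> n (Suc m))"

lemma inc_bounds: "m < n \<Longrightarrow> 0 \<le> \<tau> n m" "m < n \<Longrightarrow> \<tau> n m \<le> \<tau> n (Suc m)" "m < n \<Longrightarrow> \<tau> n (Suc m) \<le> T"
  using tau_ge tau_Suc tau_le(2)[of "Suc m" n] by auto

lemma L2F_inc: "m < n \<Longrightarrow> i \<in> Jp \<Longrightarrow> L2F (\<tau> n (Suc m)) (inc n m i)"
  unfolding inc_def using inc_bounds by (intro L2F_beta) auto

lemma inc_measurable: "m < n \<Longrightarrow> inc n m i \<in> borel_measurable M"
  unfolding inc_def using inc_bounds by (intro beta_measurable) auto

lemma cell_overlap:
  "max 0 (min (\<tau> n (Suc m)) (\<tau> n (Suc l)) - max (\<tau> n m) (\<tau> n l)) = (if m = l then h / real n else 0)"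
proof (cases m l rule: linorder_cases)
  case equal
  then show ?thesis using tau_diff[of n m] h0 by simp
next
  case less
  then have "\<tau> n (Suc m) \<le> \<tau> n l" by (intro tau_mono) simp
  then show ?thesis using less by (simp add: max_def min_def)
next
  case greater
  then have "\<tau> n (Suc l) \<le> \<tau> n m" by (intro tau_mono) simp
  then show ?thesis using greater by (simp add: max_def min_def)
qed

lemma inc_mean_product:
  assumes "m < n" "l < n" "i \<in> Jp" "k \<in> Jp"
  shows "(\<integral>\<omega>. inc n m i \<omega> * inc n l k \<omega> \<partial>M) = (if m = l \<and> i = k then h / real n else 0)"
  unfolding inc_def
  using covariance[OF inc_bounds[OF assms(1)] inc_bounds[OF assms(2)] L2F_const[of _ 1] L2F_const[of _ 1] assms(3,4)]
    inc_bounds(1)[OF assms(1)] inc_bounds(1)[OF assms(2)]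
  unfolding cell_overlap by (auto simp: prob_space)

text \<open>For m' < m the earlier increment is known at the start of the later cell. The covariance
  formula is thus applied twice, to the later cells and then to the earlier ones, and gives zero
  unless all four indices agree; each of the two cells contributes a factor h / n.\<close>

lemma chaos_mean_square:
  fixes v :: "nat \<Rightarrow> nat \<Rightarrow> 'j \<Rightarrow> 'j \<Rightarrow> 'k::{real_inner, second_countable_topology}"
  assumes L: "finite L" "L \<subseteq> Jp"
  shows "mean_square M (\<lambda>\<omega>. \<Sum>m<n. \<Sum>m'<m. \<Sum>i\<in>L. \<Sum>j\<in>L. (inc n m' i \<omega> * inc n m j \<omega>) *\<^sub>R v m m' i j)
    = ennreal (\<Sum>m<n. \<Sum>m'<m. \<Sum>i\<in>L. \<Sum>j\<in>L. (h / real n)\<^sup>2 * (norm (v m m' i j))\<^sup>2)"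
proof -
  define P where "P = (SIGMA m:{..<n}. {..<m} \<times> (L \<times> L))"
  define x where "x p \<omega> = (case p of (m, m', i, j) \<Rightarrow> inc n m' i \<omega> * inc n m j \<omega>)" for p \<omega>
  define u where "u p = (case p of (m, m', i, j) \<Rightarrow> v m m' i j)" for p
  have P: "finite P" using L by (auto simp: P_def)
  have pre: "L2F (\<tau> n m) (inc n m' i)" if "m' < m" "m < n" "i \<in> L" for m m' i
    using L2F_mono[OF _ tau_mono[of "Suc m'" m n] L2F_inc[of m' n i]] that L tau_ge by auto
  have xL: "L2F (\<tau> n (Suc m)) (x (m, m', i, j))" if "m' < m" "m < n" "i \<in> L" "j \<in> L" for m m' i j
    using L2F_beta_mult[OF inc_bounds[OF that(2)] pre[OF that(1-3)], of j] that L by (auto simp: x_def[abs_def] inc_def)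
  have int: "integrable M (\<lambda>\<omega>. x p \<omega> * x q \<omega>)" if "p \<in> P" "q \<in> P" for p q
  proof -
    obtain m m' i j l l' k j2 where pq: "p = (m, m', i, j)" "q = (l, l', k, j2)" by (cases p, cases q) auto
    then show ?thesis using that by (auto simp: P_def intro!: L2F_mult[OF tau_ge(2) tau_ge(2) xL xL])
  qed
  have E: "(\<integral>\<omega>. x p \<omega> * x q \<omega> \<partial>M) = (if p = q then (h / real n)\<^sup>2 else 0)" if "p \<in> P" "q \<in> P" for p q
  proof -
    obtain m m' i j l l' k j2 where pq: "p = (m, m', i, j)" "q = (l, l', k, j2)" by (cases p, cases q) auto
    then have b: "m < n" "m' < m" "i \<in> L" "j \<in> L" "l < n" "l' < l" "k \<in> L" "j2 \<in> L" using that by (auto simp: P_def)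
    have "(\<integral>\<omega>. x p \<omega> * x q \<omega> \<partial>M) = (if j = j2 then (\<integral>\<omega>. inc n m' i \<omega> * inc n l' k \<omega> \<partial>M) * (if m = l then h / real n else 0) else 0)"
      using covariance[OF inc_bounds[OF b(1)] inc_bounds[OF b(5)] pre[OF b(2,1,3)] pre[OF b(6,5,7)] subsetD[OF L(2) b(4)] subsetD[OF L(2) b(8)]]
      unfolding cell_overlap by (auto simp: pq x_def inc_def)
    also have "\<dots> = (if p = q then (h / real n)\<^sup>2 else 0)"
      using inc_mean_product[of m' n l' i k] subsetD[OF L(2) b(3)] subsetD[OF L(2) b(7)] b by (auto simp: pq power2_eq_square)
    finally show ?thesis .
  qed
  have "mean_square M (\<lambda>\<omega>. \<Sum>m<n. \<Sum>m'<m. \<Sum>i\<in>L. \<Sum>j\<in>L. (inc n m' i \<omega> * inc n m j \<omega>) *\<^sub>R v m m' i j)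
    = mean_square M (\<lambda>\<omega>. \<Sum>p\<in>P. x p \<omega> *\<^sub>R u p)"
    unfolding quadruple_sum[OF L(1)] P_def[symmetric] by (simp add: x_def u_def split_def)
  also have "\<dots> = ennreal (\<Sum>p\<in>P. (h / real n)\<^sup>2 * (norm (u p))\<^sup>2)"
    by (rule orthogonal_sum_mean_square[OF P int E])
  also have "(\<Sum>p\<in>P. (h / real n)\<^sup>2 * (norm (u p))\<^sup>2) = (\<Sum>m<n. \<Sum>m'<m. \<Sum>i\<in>L. \<Sum>j\<in>L. (h / real n)\<^sup>2 * (norm (v m m' i j))\<^sup>2)"
    unfolding quadruple_sum[OF L(1)] P_def[symmetric] by (simp add: u_def split_def)
  finally show ?thesis .
qed

text \<open>The deviation of the quadratic covariation of two coordinates on the grid from its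
  limit, which is \<open>h\<close> for equal and 0 for distinct coordinates.\<close>

definition qvar :: "nat \<Rightarrow> 'j \<Rightarrow> 'j \<Rightarrow> 'w \<Rightarrow> real" where
  "qvar n i j \<omega> = (\<Sum>m<n. inc n m i \<omega> * inc n m j \<omega> - (if i = j then h / real n else 0))"

lemma qvar_measurable: "qvar n i j \<in> borel_measurable M"
  unfolding qvar_def using inc_measurable by (intro borel_measurable_sum borel_measurable_diff borel_measurable_times) auto

text \<open>The summands are centred given the past and hence orthogonal. Each has mean square at
  most 8 (h/n)^2, where 8 = 3 + 3 + 2 consists of two Gaussian fourth moments and the subtracted
  constant; there are n of them.\<close>

lemma qvar_mean_square:
  assumes ij: "i \<in> Jp" "j \<in> Jp" and n: "0 < n"
  shows "mean_square M (qvar n i j) \<le> ennreal (8 * h\<^sup>2 / real n)"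
proof -
  define \<kappa> where "\<kappa> = (if i = j then h / real n else 0)"
  define x where "x m \<omega> = inc n m i \<omega> * inc n m j \<omega> - \<kappa>" for m \<omega>
  have \<kappa>: "0 \<le> \<kappa>" "\<kappa> \<le> h / real n" using h0 by (auto simp: \<kappa>_def)
  have m4: "integrable M (\<lambda>\<omega>. inc n m k \<omega> ^ 4)" "(\<integral>\<omega>. inc n m k \<omega> ^ 4 \<partial>M) = 3 * (h / real n)\<^sup>2" if "m < n" "k \<in> Jp" for m k
    unfolding inc_def using beta_moments(1,4)[OF inc_bounds[OF that(1)] that(2)] by (simp_all add: tau_diff)
  have xm: "x m \<in> borel_measurable (F (\<tau> n (Suc m)))" if "m < n" for m
    unfolding x_def using L2F_D(1)[OF L2F_inc[OF that ij(1)]] L2F_D(1)[OF L2F_inc[OF that ij(2)]] by simp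
  have bd: "(x m \<omega>)\<^sup>2 \<le> inc n m i \<omega> ^ 4 + inc n m j \<omega> ^ 4 + 2 * (h / real n)\<^sup>2" for m \<omega>
  proof -
    have "(x m \<omega>)\<^sup>2 \<le> 2 * (inc n m i \<omega> * inc n m j \<omega>)\<^sup>2 + 2 * \<kappa>\<^sup>2"
      using sum_squares_bound[of "inc n m i \<omega> * inc n m j \<omega>" "- \<kappa>"] by (simp add: x_def power2_diff)
    also have "2 * (inc n m i \<omega> * inc n m j \<omega>)\<^sup>2 \<le> inc n m i \<omega> ^ 4 + inc n m j \<omega> ^ 4"
      using sum_squares_bound[of "(inc n m i \<omega>)\<^sup>2" "(inc n m j \<omega>)\<^sup>2"] by (simp add: power_mult_distrib power_mult[symmetric])
    also have "\<kappa>\<^sup>2 \<le> (h / real n)\<^sup>2" using \<kappa> by (intro power_mono)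
    finally show ?thesis by simp
  qed
  have i4: "integrable M (\<lambda>\<omega>. inc n m i \<omega> ^ 4 + inc n m j \<omega> ^ 4 + 2 * (h / real n)\<^sup>2)" if "m < n" for m
    using m4[OF that] ij by simp
  have x2: "integrable M (\<lambda>\<omega>. (x m \<omega>)\<^sup>2)" if "m < n" for m
  proof (rule Bochner_Integration.integrable_bound[OF i4[OF that]])
    show "(\<lambda>\<omega>. (x m \<omega>)\<^sup>2) \<in> borel_measurable M"
      using measurable_F_M[OF tau_ge(2) xm[OF that]] by simp
    show "AE \<omega> in M. norm ((x m \<omega>)\<^sup>2) \<le> norm (inc n m i \<omega> ^ 4 + inc n m j \<omega> ^ 4 + 2 * (h / real n)\<^sup>2)"
    proof (rule AE_I2)
      fix \<omega>
      have "norm ((x m \<omega>)\<^sup>2) = (x m \<omega>)\<^sup>2" by simp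
      also have "\<dots> \<le> inc n m i \<omega> ^ 4 + inc n m j \<omega> ^ 4 + 2 * (h / real n)\<^sup>2" by (rule bd)
      also have "\<dots> \<le> norm (inc n m i \<omega> ^ 4 + inc n m j \<omega> ^ 4 + 2 * (h / real n)\<^sup>2)" by simp
      finally show "norm ((x m \<omega>)\<^sup>2) \<le> norm (inc n m i \<omega> ^ 4 + inc n m j \<omega> ^ 4 + 2 * (h / real n)\<^sup>2)" .
    qed
  qed
  have xL: "L2F (\<tau> n (Suc m)) (x m)" if "m < n" for m using xm[OF that] x2[OF that] by (simp add: L2F_def)
  have w: "(\<integral>\<omega>. (x m \<omega>)\<^sup>2 \<partial>M) \<le> 8 * (h / real n)\<^sup>2" if "m < n" for m
  proof -
    have "(\<integral>\<omega>. (x m \<omega>)\<^sup>2 \<partial>M) \<le> (\<integral>\<omega>. inc n m i \<omega> ^ 4 + inc n m j \<omega> ^ 4 + 2 * (h / real n)\<^sup>2 \<partial>M)"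
      by (rule integral_mono[OF x2[OF that] i4[OF that] bd])
    also have "\<dots> = 8 * (h / real n)\<^sup>2" using m4[OF that] ij by (simp add: prob_space)
    finally show ?thesis .
  qed
  have int: "integrable M (\<lambda>\<omega>. x m \<omega> * x l \<omega>)" if "m < n" "l < n" for m l
    by (rule L2F_mult[OF tau_ge(2) tau_ge(2) xL[OF that(1)] xL[OF that(2)]])
  have ort: "(\<integral>\<omega>. x m \<omega> * x l \<omega> \<partial>M) = 0" if "m < l" "l < n" for m l
  proof -
    have ml: "m < n" using that by simp
    have Xl: "L2F (\<tau> n l) (x m)" using L2F_mono[OF tau_ge(2) tau_mono xL[OF ml], of l] that by simp
    have xi: "integrable M (x m)"
      using L2F_mult[OF tau_ge(2) tau_ge(2) xL[OF ml] L2F_const[OF tau_ge(2), of _ _ 1]] by simp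
    note a = adapted_times_beta_beta[OF inc_bounds[OF that(2)] L2F_D(1)[OF Xl] xi ij, folded inc_def]
    have "(\<integral>\<omega>. x m \<omega> * x l \<omega> \<partial>M) = (\<integral>\<omega>. x m \<omega> * (inc n l i \<omega> * inc n l j \<omega>) - \<kappa> * x m \<omega> \<partial>M)"
      by (intro Bochner_Integration.integral_cong refl) (simp add: x_def[of l] algebra_simps)
    also have "\<dots> = (if i = j then (\<integral>\<omega>. x m \<omega> \<partial>M) * (h / real n) else 0) - \<kappa> * (\<integral>\<omega>. x m \<omega> \<partial>M)"
      using a xi by (simp add: tau_diff)
    also have "\<dots> = 0" by (simp add: \<kappa>_def)
    finally show ?thesis .
  qed
  have "mean_square M (\<lambda>\<omega>. \<Sum>m\<in>{..<n}. x m \<omega> *\<^sub>R (1::real)) = ennreal (\<Sum>m\<in>{..<n}. (\<integral>\<omega>. (x m \<omega>)\<^sup>2 \<partial>M) * (norm (1::real))\<^sup>2)"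
  proof (rule orthogonal_sum_mean_square)
    fix p q assume pq: "p \<in> {..<n}" "q \<in> {..<n}"
    then show "integrable M (\<lambda>\<omega>. x p \<omega> * x q \<omega>)" using int by simp
    show "(\<integral>\<omega>. x p \<omega> * x q \<omega> \<partial>M) = (if p = q then (\<integral>\<omega>. (x p \<omega>)\<^sup>2 \<partial>M) else 0)"
      using ort[of p q] ort[of q p] pq by (cases p q rule: linorder_cases) (auto simp: power2_eq_square mult.commute)
  qed simp
  then have "mean_square M (qvar n i j) = ennreal (\<Sum>m<n. \<integral>\<omega>. (x m \<omega>)\<^sup>2 \<partial>M)"
    by (simp add: qvar_def[abs_def] x_def \<kappa>_def)
  also have "\<dots> \<le> ennreal (\<Sum>m<n. 8 * (h / real n)\<^sup>2)" using w by (intro ennreal_leI sum_mono) auto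
  also have "(\<Sum>m<n. 8 * (h / real n)\<^sup>2) = 8 * h\<^sup>2 / real n" using n by (simp add: power2_eq_square)
  finally show ?thesis .
qed

section \<open>Discretisation of the approximation\<close>

text \<open>The truncated Levy area is the limit of the quadratic forms with kernel \<open>levy_kernel\<close>, which follows from
  \<open>sin (x - y) = sin x * cos y - cos x * sin y\<close>. For \<open>m' < m\<close> and \<open>D \<longlonglongrightarrow> \<infinity>\<close> the kernel tends to \<open>1/2\<close>, since the
  Fourier series of the sawtooth \<open>1/2 - x\<close> on \<open>(0,1)\<close> is \<open>saw\<close>.\<close>

definition levy_kernel :: "nat \<Rightarrow> nat \<Rightarrow> nat \<Rightarrow> nat \<Rightarrow> real" where
  "levy_kernel D n m' m = saw D ((real m - real m') / real n) + saw D (real (Suc m') / real n) - saw D (real (Suc m) / real n)"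

lemma saw_minus: "saw D (- x) = - saw D x"
  by (simp add: saw_def sum_negf)

lemma levy_kernel_antisym: "levy_kernel D n m m' = - levy_kernel D n m' m"
  using saw_minus[of D "(real m - real m') / real n"] by (simp add: levy_kernel_def minus_divide_left)

lemma levy_kernel_self [simp]: "levy_kernel D n m m = 0"
  using levy_kernel_antisym[of D n m m] by simp

text \<open>The linear parts of the three remainders cancel, as m - m' + (m' + 1) - (m + 1) = 0, and
  their constants leave 1/2 + 1/2 - 1/2.\<close>

lemma half_minus_levy_kernel:
  "0 < n \<Longrightarrow> 1 / 2 - levy_kernel D n m' m = rest D ((real m - real m') / real n) + rest D (real (Suc m') / real n) - rest D (real (Suc m) / real n)"
  unfolding levy_kernel_def rest_def by (simp add: field_simps)

definition Idisc :: "nat \<Rightarrow> nat \<Rightarrow> 'j \<Rightarrow> 'j \<Rightarrow> 'w \<Rightarrow> real" where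
  "Idisc D n i j \<omega> = (\<beta> i t (t + h) \<omega> * \<beta> j t (t + h) \<omega> - (if i = j then h else 0)) / 2
     + (\<Sum>m'<n. \<Sum>m<n. levy_kernel D n m' m * (inc n m' i \<omega> * inc n m j \<omega>))"

text \<open>Divided by the two standard deviations, which \<open>b i j\<close> contains as factors
  because it is formed with \<open>f\<close> in place of \<open>e\<close>.\<close>

definition Ibar :: "nat \<Rightarrow> 'j \<Rightarrow> 'j \<Rightarrow> 'w \<Rightarrow> real" where
  "Ibar D i j \<omega> = iter_int_approx W \<eta> e t h D i j \<omega> / (sqrt (\<eta> i) * sqrt (\<eta> j))"

lemma Idisc_measurable: "Idisc D n i j \<in> borel_measurable M"
proof -
  have [measurable]: "\<beta> k t (t + h) \<in> borel_measurable M" for k using beta_measurable t0 h0 thT by simp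
  have [measurable]: "m < n \<Longrightarrow> inc n m k \<in> borel_measurable M" for m k by (rule inc_measurable)
  show ?thesis unfolding Idisc_def
    by (intro borel_measurable_add borel_measurable_divide borel_measurable_diff borel_measurable_times borel_measurable_sum
        borel_measurable_const) auto
qed

text \<open>A statement about single continuous paths: each of the finitely many coefficients is a
  limit of weighted sums of increments, and for fixed \<open>n\<close> the products of these sums
  combine exactly to the quadratic form with \<open>levy_kernel\<close>.\<close>

lemma Idisc_tendsto:
  assumes ij: "i \<in> Jp" "j \<in> Jp"
  shows "AE \<omega> in M. (\<lambda>n. Idisc D n i j \<omega>) \<longlonglongrightarrow> Ibar D i j \<omega>"
  using W_continuous
proof eventually_elim
  case (elim \<omega>)
  define w where "w k u = wincr W e t k u \<omega>" for k u
  have cont: "continuous_on {0..h} (w k)" for k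
  proof -
    have "continuous_on {0..h} (\<lambda>u. W (t + u) \<omega>)"
      by (rule continuous_on_compose2[OF elim]) (use t0 h0 thT in \<open>auto intro!: continuous_intros\<close>)
    then show ?thesis unfolding w_def wincr_def by (intro continuous_intros)
  qed
  have w0: "w k 0 = 0" for k by (simp add: w_def wincr_def)
  define d where "d n k m = w k (real (Suc m) * (h / real n)) - w k (real m * (h / real n))" for n k m
  have dinc: "d n k m = sqrt (\<eta> k) * inc n m k \<omega>" if "k \<in> Jp" for n k m
    using JpD(2)[OF that] by (simp add: d_def w_def wincr_def inc_def \<beta>_def \<tau>_def inner_diff_left)
  define A where "A n k r = - (1 / (pi * real r)) * (\<Sum>m<n. d n k m * sin (2 * real r * pi * (real (Suc m) / real n)))" for n k and r :: nat
  define C where "C n k r = 1 / (pi * real r) * (\<Sum>m<n. d n k m * (cos (2 * real r * pi * (real (Suc m) / real n)) - 1))" for n k and r :: nat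
  have A: "(\<lambda>n. A n k r) \<longlonglongrightarrow> coeff_a W e t h k r \<omega>" if "1 \<le> r" for k r
    using coefficient_limits(1)[OF h0 cont[of k] w0 that] by (simp add: A_def d_def coeff_a_def w_def)
  have C: "(\<lambda>n. C n k r) \<longlonglongrightarrow> coeff_b W e t h k r \<omega> - 1 / (pi * real r) * wincr W e t k h \<omega>" if "1 \<le> r" for k r
    using coefficient_limits(2)[OF h0 cont[of k] w0 that] by (simp add: C_def d_def coeff_b_def w_def)
  have lim: "(\<lambda>n. pi * (\<Sum>r=1..D. real r * (A n i r * C n j r - C n i r * A n j r))) \<longlonglongrightarrow> levy_area W e t h D i j \<omega>"
    unfolding levy_area_def
    by (intro tendsto_mult tendsto_const tendsto_sum tendsto_diff A C) auto
  have eq: "pi * (\<Sum>r=1..D. real r * (A n i r * C n j r - C n i r * A n j r)) = (\<Sum>m'<n. \<Sum>m<n. levy_kernel D n m' m * (d n i m' * d n j m))" for n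
  proof -
    have "pi * (\<Sum>r=1..D. real r * (A n i r * C n j r - C n i r * A n j r))
      = (\<Sum>r=1..D. pi * (real r * (A n i r * C n j r - C n i r * A n j r)))" by (rule sum_distrib_left)
    also have "\<dots> = (\<Sum>r=1..D. \<Sum>m'<n. \<Sum>m<n. (1 / pi * ((sin (2 * real r * pi * ((real m - real m') / real n))
        + sin (2 * real r * pi * (real (Suc m') / real n)) - sin (2 * real r * pi * (real (Suc m) / real n))) / real r)) * (d n i m' * d n j m))"
    proof (rule sum.cong[OF refl])
      fix r assume "r \<in> {1..D}"
      then have r: "real r \<noteq> 0" by simp
      \<comment> \<open>The sines and cosines are taken at right ends of cells; the two shifts by
        one cancel in the difference.\<close>
      have sd: "sin (2 * real r * pi * (real (Suc m) / real n)) * cos (2 * real r * pi * (real (Suc m') / real n))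
          - cos (2 * real r * pi * (real (Suc m) / real n)) * sin (2 * real r * pi * (real (Suc m') / real n))
        = sin (2 * real r * pi * ((real m - real m') / real n))" for m m'
        unfolding sin_diff[symmetric] by (rule arg_cong[of _ _ sin]) (simp add: diff_divide_distrib[symmetric] right_diff_distrib[symmetric])
      show "pi * (real r * (A n i r * C n j r - C n i r * A n j r))
        = (\<Sum>m'<n. \<Sum>m<n. (1 / pi * ((sin (2 * real r * pi * ((real m - real m') / real n))
        + sin (2 * real r * pi * (real (Suc m') / real n)) - sin (2 * real r * pi * (real (Suc m) / real n))) / real r)) * (d n i m' * d n j m))"
        unfolding A_def C_def levy_sum_identity[OF r] sd ..
    qed
    also have "\<dots> = (\<Sum>m'<n. \<Sum>m<n. \<Sum>r=1..D. (1 / pi * ((sin (2 * real r * pi * ((real m - real m') / real n))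
        + sin (2 * real r * pi * (real (Suc m') / real n)) - sin (2 * real r * pi * (real (Suc m) / real n))) / real r)) * (d n i m' * d n j m))"
      by (rule trans[OF sum.swap], rule sum.cong[OF refl], rule sum.swap)
    also have "\<dots> = (\<Sum>m'<n. \<Sum>m<n. levy_kernel D n m' m * (d n i m' * d n j m))"
      unfolding levy_kernel_def saw_def
      by (intro sum.cong refl) (simp only: sum_distrib_right[symmetric] sum_distrib_left[symmetric] add_divide_distrib diff_divide_distrib
          sum.distrib sum_subtractf distrib_left right_diff_distrib)
    finally show ?thesis .
  qed
  have pos: "0 < sqrt (\<eta> i)" "0 < sqrt (\<eta> j)" using JpD ij by auto
  have "(\<lambda>n. (wincr W e t i h \<omega> * wincr W e t j h \<omega> - h * \<eta> i * (if i = j then 1 else 0)) / 2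
     + pi * (\<Sum>r=1..D. real r * (A n i r * C n j r - C n i r * A n j r))) \<longlonglongrightarrow> iter_int_approx W \<eta> e t h D i j \<omega>"
    unfolding iter_int_approx_def by (intro tendsto_add tendsto_const lim)
  then have "(\<lambda>n. ((wincr W e t i h \<omega> * wincr W e t j h \<omega> - h * \<eta> i * (if i = j then 1 else 0)) / 2
     + pi * (\<Sum>r=1..D. real r * (A n i r * C n j r - C n i r * A n j r))) / (sqrt (\<eta> i) * sqrt (\<eta> j))) \<longlonglongrightarrow> Ibar D i j \<omega>"
    unfolding Ibar_def by (intro tendsto_divide tendsto_const) (use pos in auto)
  moreover have "((wincr W e t i h \<omega> * wincr W e t j h \<omega> - h * \<eta> i * (if i = j then 1 else 0)) / 2
     + pi * (\<Sum>r=1..D. real r * (A n i r * C n j r - C n i r * A n j r))) / (sqrt (\<eta> i) * sqrt (\<eta> j)) = Idisc D n i j \<omega>" for n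
  proof -
    have 1: "wincr W e t k h \<omega> = sqrt (\<eta> k) * \<beta> k t (t + h) \<omega>" if "k \<in> Jp" for k
      using JpD(2)[OF that] by (simp add: wincr_def \<beta>_def)
    have 2: "(wincr W e t i h \<omega> * wincr W e t j h \<omega> - h * \<eta> i * (if i = j then 1 else 0)) / 2
      = sqrt (\<eta> i) * sqrt (\<eta> j) * ((\<beta> i t (t + h) \<omega> * \<beta> j t (t + h) \<omega> - (if i = j then h else 0)) / 2)"
    proof -
      have "\<eta> i = sqrt (\<eta> i) * sqrt (\<eta> i)" using JpD(2)[OF ij(1)] by simp
      then show ?thesis unfolding 1[OF ij(1)] 1[OF ij(2)] by (auto simp: field_simps)
    qed
    have 3: "(\<Sum>m'<n. \<Sum>m<n. levy_kernel D n m' m * (d n i m' * d n j m))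
      = sqrt (\<eta> i) * sqrt (\<eta> j) * (\<Sum>m'<n. \<Sum>m<n. levy_kernel D n m' m * (inc n m' i \<omega> * inc n m j \<omega>))"
      unfolding sum_distrib_left dinc[OF ij(1)] dinc[OF ij(2)] by (intro sum.cong refl) simp
    show ?thesis unfolding eq 2 3 distrib_left[symmetric] Idisc_def using pos by simp
  qed
  ultimately show ?case by simp
qed

lemma beta_sum_inc: "\<beta> i t (\<tau> n m) \<omega> = (\<Sum>m'<m. inc n m' i \<omega>)"
proof (induction m)
  case (Suc m)
  then show ?case using beta_add[of i t "\<tau> n m" \<omega> "\<tau> n (Suc m)"] by (simp add: inc_def)
qed simp

text \<open>The product of the total increments is a double sum over cells; half of it and the
  kernel are folded onto m' < m by antisymmetry. On the diagonal the kernel vanishes, and what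
  remains together with the subtracted \<open>h / 2\<close> is half of \<open>qvar\<close>.\<close>

lemma Idisc_eq:
  assumes n: "0 < n"
  shows "Idisc D n i j \<omega> = (\<Sum>m<n. \<Sum>m'<m. (1 / 2 + levy_kernel D n m' m) * (inc n m' i \<omega> * inc n m j \<omega>) + (1 / 2 - levy_kernel D n m' m) * (inc n m i \<omega> * inc n m' j \<omega>))
    + qvar n i j \<omega> / 2"
proof -
  have "\<beta> i t (t + h) \<omega> * \<beta> j t (t + h) \<omega> = (\<Sum>m'<n. \<Sum>m<n. inc n m' i \<omega> * inc n m j \<omega>)"
    using beta_sum_inc[of _ n n \<omega>] tau_n[OF n] by (simp add: sum_product)
  then have "Idisc D n i j \<omega> = (\<Sum>m'<n. \<Sum>m<n. (1 / 2 + levy_kernel D n m' m) * (inc n m' i \<omega> * inc n m j \<omega>)) - (if i = j then h else 0) / 2"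
    by (simp add: Idisc_def diff_divide_distrib sum_divide_distrib distrib_right sum.distrib)
  also have "(\<Sum>m'<n. \<Sum>m<n. (1 / 2 + levy_kernel D n m' m) * (inc n m' i \<omega> * inc n m j \<omega>))
    = (\<Sum>m<n. \<Sum>m'<m. (1 / 2 + levy_kernel D n m' m) * (inc n m' i \<omega> * inc n m j \<omega>) + (1 / 2 - levy_kernel D n m' m) * (inc n m i \<omega> * inc n m' j \<omega>))
      + (\<Sum>m<n. 1 / 2 * (inc n m i \<omega> * inc n m j \<omega>))"
    unfolding square_sum_split
  proof (intro arg_cong2[where f="(+)"] sum.cong refl)
    fix m m'
    show "(1 / 2 + levy_kernel D n m m') * (inc n m i \<omega> * inc n m' j \<omega>) = (1 / 2 - levy_kernel D n m' m) * (inc n m i \<omega> * inc n m' j \<omega>)"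
      unfolding levy_kernel_antisym[of D n m m'] by simp
  qed simp
  finally have 1: "Idisc D n i j \<omega> = (\<Sum>m<n. \<Sum>m'<m. (1 / 2 + levy_kernel D n m' m) * (inc n m' i \<omega> * inc n m j \<omega>) + (1 / 2 - levy_kernel D n m' m) * (inc n m i \<omega> * inc n m' j \<omega>))
      + (\<Sum>m<n. 1 / 2 * (inc n m i \<omega> * inc n m j \<omega>)) - (if i = j then h else 0) / 2" .
  have "(\<Sum>m<n. 1 / 2 * (inc n m i \<omega> * inc n m j \<omega>)) - (if i = j then h else 0) / 2 = qvar n i j \<omega> / 2"
    using n by (auto simp: qvar_def sum_subtractf sum_divide_distrib[symmetric] diff_divide_distrib)
  with 1 show ?thesis by simp
qed

end

section \<open>The error of the approximation\<close>

text \<open>Applies the known result for convergence in mean to the squared norms. The sequence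
  starts at \<open>K\<close>, since its first members may have infinite mean square.\<close>

lemma (in prob_space) mean_square_AE_subseq:
  fixes g :: "nat \<Rightarrow> 'a \<Rightarrow> 'h::{real_normed_vector, second_countable_topology}"
  assumes [measurable]: "\<And>n. g n \<in> borel_measurable M" and lim: "(\<lambda>n. mean_square M (g n)) \<longlonglongrightarrow> 0"
  obtains r where "strict_mono r" "AE \<omega> in M. (\<lambda>k. g (r k) \<omega>) \<longlonglongrightarrow> 0"
proof -
  obtain K where K: "\<And>n. K \<le> n \<Longrightarrow> mean_square M (g n) \<le> ennreal 1"
    using ennreal_tendsto_0_small[OF lim, of 1] by auto
  define u where "u n \<omega> = (norm (g (n + K) \<omega>))\<^sup>2" for n \<omega>
  have [measurable]: "u n \<in> borel_measurable M" for n unfolding u_def by measurable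
  have ms: "(\<integral>\<^sup>+\<omega>. ennreal (norm (u n \<omega>)) \<partial>M) = mean_square M (g (n + K))" for n
    by (simp add: u_def mean_square_def)
  have i: "integrable M (u n)" for n
    unfolding integrable_iff_bounded ms
    using order_le_less_trans[OF K[of "n + K"], of \<infinity>] by simp
  have "(\<lambda>n. ennreal (\<integral>\<omega>. norm (u n \<omega>) \<partial>M)) \<longlonglongrightarrow> 0"
  proof -
    have "ennreal (\<integral>\<omega>. norm (u n \<omega>) \<partial>M) = mean_square M (g (n + K))" for n
      using nn_integral_eq_integral[OF integrable_norm[OF i[of n]]] ms[of n] by simp
    then show ?thesis using LIMSEQ_ignore_initial_segment[OF lim, of K] by simp
  qed
  then have "(\<lambda>n. \<integral>\<omega>. norm (u n \<omega>) \<partial>M) \<longlonglongrightarrow> 0"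
    by (subst (asm) ennreal_tendsto_0_iff) auto
  from tendsto_L1_AE_subseq[OF i this]
  obtain r where r: "strict_mono r" "AE \<omega> in M. (\<lambda>n. u (r n) \<omega>) \<longlonglongrightarrow> 0" by blast
  show ?thesis
  proof (rule that[of "\<lambda>k. r k + K"])
    show "strict_mono (\<lambda>k. r k + K)" using r(1) by (simp add: strict_mono_def)
    show "AE \<omega> in M. (\<lambda>k. g (r k + K) \<omega>) \<longlonglongrightarrow> 0"
      using r(2)
    proof eventually_elim
      case (elim \<omega>)
      then have "(\<lambda>k. sqrt ((norm (g (r k + K) \<omega>))\<^sup>2)) \<longlonglongrightarrow> sqrt 0"
        unfolding u_def by (rule tendsto_real_sqrt)
      then have "(\<lambda>k. norm (g (r k + K) \<omega>)) \<longlonglongrightarrow> 0" by simp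
      then show ?case by (rule tendsto_norm_zero_cancel)
    qed
  qed
qed

context grid
begin

text \<open>For \<open>i, j \<in> L\<close> the coefficient is \<open>(1/2 - levy_kernel) *\<^sub>R (b i j - b j i)\<close>; it is written as below because the
  approximation has the terms \<open>(1/2 + K) *\<^sub>R b i j\<close> and, after exchanging \<open>i\<close> and \<open>j\<close>, \<open>(1/2 - K) *\<^sub>R b j i\<close>.\<close>

definition residual :: "nat \<Rightarrow> nat \<Rightarrow> 'j set \<Rightarrow> nat \<Rightarrow> nat \<Rightarrow> 'j \<Rightarrow> 'j \<Rightarrow> 'h" where
  "residual D n L m m' i j = b i j - (if i \<in> L \<and> j \<in> L then (1 / 2 + levy_kernel D n m' m) *\<^sub>R b i j + (1 / 2 - levy_kernel D n m' m) *\<^sub>R b j i else 0)"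

text \<open>Both sides are brought to sums over cells m' < m and coordinates in \<open>N n\<close>:
  \<open>R n\<close> by expanding the inner increment into cells, the approximation by giving the
  pairs outside of \<open>L\<close> the coefficient zero.\<close>

lemma error_decomposition:
  assumes n: "0 < n" and L: "finite L" "L \<subseteq> N n"
  shows "R n \<omega> - (\<Sum>i\<in>L. \<Sum>j\<in>L. Idisc D n i j \<omega> *\<^sub>R b i j)
    = (\<Sum>m<n. \<Sum>m'<m. \<Sum>i\<in>N n. \<Sum>j\<in>N n. (inc n m' i \<omega> * inc n m j \<omega>) *\<^sub>R residual D n L m m' i j)
      - (\<Sum>i\<in>L. \<Sum>j\<in>L. (qvar n i j \<omega> / 2) *\<^sub>R b i j)"
proof -
  define y where "y m m' i j = inc n m' i \<omega> * inc n m j \<omega>" for m m' i j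
  define u where "u m m' i j = (1 / 2 + levy_kernel D n m' m) *\<^sub>R b i j + (1 / 2 - levy_kernel D n m' m) *\<^sub>R b j i" for m m' i j
  have "R n \<omega> = (\<Sum>m<n. \<Sum>i\<in>N n. \<Sum>j\<in>N n. \<Sum>m'<m. y m m' i j *\<^sub>R b i j)"
    unfolding R_def beta_sum_inc inc_def[symmetric] y_def
    by (simp add: sum_distrib_right scaleR_sum_left)
  also have "\<dots> = (\<Sum>m<n. \<Sum>m'<m. \<Sum>i\<in>N n. \<Sum>j\<in>N n. y m m' i j *\<^sub>R b i j)"
  proof (rule sum.cong[OF refl])
    fix m
    have "(\<Sum>i\<in>N n. \<Sum>j\<in>N n. \<Sum>m'<m. y m m' i j *\<^sub>R b i j) = (\<Sum>i\<in>N n. \<Sum>m'<m. \<Sum>j\<in>N n. y m m' i j *\<^sub>R b i j)"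
      by (rule sum.cong[OF refl], rule sum.swap)
    also have "\<dots> = (\<Sum>m'<m. \<Sum>i\<in>N n. \<Sum>j\<in>N n. y m m' i j *\<^sub>R b i j)" by (rule sum.swap)
    finally show "(\<Sum>i\<in>N n. \<Sum>j\<in>N n. \<Sum>m'<m. y m m' i j *\<^sub>R b i j) = (\<Sum>m'<m. \<Sum>i\<in>N n. \<Sum>j\<in>N n. y m m' i j *\<^sub>R b i j)" .
  qed
  finally have R: "R n \<omega> = (\<Sum>m<n. \<Sum>m'<m. \<Sum>i\<in>N n. \<Sum>j\<in>N n. y m m' i j *\<^sub>R b i j)" .
  have "(\<Sum>i\<in>L. \<Sum>j\<in>L. Idisc D n i j \<omega> *\<^sub>R b i j)
    = (\<Sum>i\<in>L. \<Sum>j\<in>L. (\<Sum>m<n. \<Sum>m'<m. ((1 / 2 + levy_kernel D n m' m) * y m m' i j + (1 / 2 - levy_kernel D n m' m) * y m m' j i) *\<^sub>R b i j) + (qvar n i j \<omega> / 2) *\<^sub>R b i j)"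
    unfolding Idisc_eq[OF n] y_def by (simp add: scaleR_add_left scaleR_sum_left mult.commute[of "inc n _ _ \<omega>" "inc n _ _ \<omega>"])
  also have "\<dots> = (\<Sum>i\<in>L. \<Sum>j\<in>L. \<Sum>m<n. \<Sum>m'<m. ((1 / 2 + levy_kernel D n m' m) * y m m' i j + (1 / 2 - levy_kernel D n m' m) * y m m' j i) *\<^sub>R b i j)
      + (\<Sum>i\<in>L. \<Sum>j\<in>L. (qvar n i j \<omega> / 2) *\<^sub>R b i j)"
    by (simp only: sum.distrib)
  also have "(\<Sum>i\<in>L. \<Sum>j\<in>L. \<Sum>m<n. \<Sum>m'<m. ((1 / 2 + levy_kernel D n m' m) * y m m' i j + (1 / 2 - levy_kernel D n m' m) * y m m' j i) *\<^sub>R b i j)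
    = (\<Sum>m<n. \<Sum>m'<m. \<Sum>i\<in>L. \<Sum>j\<in>L. ((1 / 2 + levy_kernel D n m' m) * y m m' i j + (1 / 2 - levy_kernel D n m' m) * y m m' j i) *\<^sub>R b i j)"
  proof -
    have sw: "(\<Sum>i\<in>L. \<Sum>j\<in>L. \<Sum>m\<in>A. g m i j) = (\<Sum>m\<in>A. \<Sum>i\<in>L. \<Sum>j\<in>L. g m i j)" for A and g :: "nat \<Rightarrow> 'j \<Rightarrow> 'j \<Rightarrow> 'h"
    proof -
      have "(\<Sum>i\<in>L. \<Sum>j\<in>L. \<Sum>m\<in>A. g m i j) = (\<Sum>i\<in>L. \<Sum>m\<in>A. \<Sum>j\<in>L. g m i j)" by (rule sum.cong[OF refl], rule sum.swap)
      also have "\<dots> = (\<Sum>m\<in>A. \<Sum>i\<in>L. \<Sum>j\<in>L. g m i j)" by (rule sum.swap)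
      finally show ?thesis .
    qed
    show ?thesis by (simp only: sw)
  qed
  also have "\<dots> = (\<Sum>m<n. \<Sum>m'<m. \<Sum>i\<in>L. \<Sum>j\<in>L. y m m' i j *\<^sub>R u m m' i j)"
  proof (rule sum.cong[OF refl], rule sum.cong[OF refl])
    fix m m'
    let ?K = "levy_kernel D n m' m"
    have "(\<Sum>i\<in>L. \<Sum>j\<in>L. ((1 / 2 + ?K) * y m m' i j + (1 / 2 - ?K) * y m m' j i) *\<^sub>R b i j)
      = (\<Sum>i\<in>L. \<Sum>j\<in>L. ((1 / 2 + ?K) * y m m' i j) *\<^sub>R b i j) + (\<Sum>i\<in>L. \<Sum>j\<in>L. ((1 / 2 - ?K) * y m m' j i) *\<^sub>R b i j)"
      by (simp only: scaleR_add_left sum.distrib)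
    also have "(\<Sum>i\<in>L. \<Sum>j\<in>L. ((1 / 2 - ?K) * y m m' j i) *\<^sub>R b i j) = (\<Sum>i\<in>L. \<Sum>j\<in>L. ((1 / 2 - ?K) * y m m' i j) *\<^sub>R b j i)"
      by (rule sum.swap)
    also have "(\<Sum>i\<in>L. \<Sum>j\<in>L. ((1 / 2 + ?K) * y m m' i j) *\<^sub>R b i j) + (\<Sum>i\<in>L. \<Sum>j\<in>L. ((1 / 2 - ?K) * y m m' i j) *\<^sub>R b j i)
      = (\<Sum>i\<in>L. \<Sum>j\<in>L. y m m' i j *\<^sub>R u m m' i j)"
      unfolding u_def scaleR_add_right sum.distrib by (simp add: mult.commute)
    finally show "(\<Sum>i\<in>L. \<Sum>j\<in>L. ((1 / 2 + ?K) * y m m' i j + (1 / 2 - ?K) * y m m' j i) *\<^sub>R b i j)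
      = (\<Sum>i\<in>L. \<Sum>j\<in>L. y m m' i j *\<^sub>R u m m' i j)" .
  qed
  finally have Ib: "(\<Sum>i\<in>L. \<Sum>j\<in>L. Idisc D n i j \<omega> *\<^sub>R b i j)
    = (\<Sum>m<n. \<Sum>m'<m. \<Sum>i\<in>L. \<Sum>j\<in>L. y m m' i j *\<^sub>R u m m' i j) + (\<Sum>i\<in>L. \<Sum>j\<in>L. (qvar n i j \<omega> / 2) *\<^sub>R b i j)" .
  have ext: "(\<Sum>i\<in>N n. \<Sum>j\<in>N n. if i \<in> L \<and> j \<in> L then g i j else 0) = (\<Sum>i\<in>L. \<Sum>j\<in>L. g i j)" for g :: "'j \<Rightarrow> 'j \<Rightarrow> 'h"
  proof -
    have "(\<Sum>i\<in>N n. \<Sum>j\<in>N n. if i \<in> L \<and> j \<in> L then g i j else 0) = (\<Sum>i\<in>L. \<Sum>j\<in>N n. if j \<in> L then g i j else 0)"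
      using L finite_N by (intro sum.mono_neutral_cong_right) (auto intro!: sum.neutral)
    also have "\<dots> = (\<Sum>i\<in>L. \<Sum>j\<in>L. g i j)"
      using L finite_N by (intro sum.cong refl sum.mono_neutral_cong_right) auto
    finally show ?thesis .
  qed
  have "(\<Sum>m<n. \<Sum>m'<m. \<Sum>i\<in>N n. \<Sum>j\<in>N n. y m m' i j *\<^sub>R residual D n L m m' i j)
    = (\<Sum>m<n. \<Sum>m'<m. (\<Sum>i\<in>N n. \<Sum>j\<in>N n. y m m' i j *\<^sub>R b i j) - (\<Sum>i\<in>L. \<Sum>j\<in>L. y m m' i j *\<^sub>R u m m' i j))"
  proof (intro sum.cong refl)
    fix m m'
    have "(\<Sum>i\<in>N n. \<Sum>j\<in>N n. y m m' i j *\<^sub>R residual D n L m m' i j)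
      = (\<Sum>i\<in>N n. \<Sum>j\<in>N n. y m m' i j *\<^sub>R b i j - (if i \<in> L \<and> j \<in> L then y m m' i j *\<^sub>R u m m' i j else 0))"
      by (intro sum.cong refl) (auto simp: residual_def u_def scaleR_diff_right)
    then show "(\<Sum>i\<in>N n. \<Sum>j\<in>N n. y m m' i j *\<^sub>R residual D n L m m' i j)
      = (\<Sum>i\<in>N n. \<Sum>j\<in>N n. y m m' i j *\<^sub>R b i j) - (\<Sum>i\<in>L. \<Sum>j\<in>L. y m m' i j *\<^sub>R u m m' i j)"
      by (simp only: sum_subtractf ext)
  qed
  then show ?thesis unfolding R Ib by (simp only: y_def sum_subtractf) simp
qed

lemma b_sq_sum:
  assumes "finite K" "K \<subseteq> Jp" "finite K'" "K' \<subseteq> Jp"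
  shows "(\<Sum>i\<in>K. \<Sum>j\<in>K'. (norm (b i j))\<^sup>2) \<le> (\<Sum>i\<in>K. (q i)\<^sup>2) * (\<Sum>j\<in>K'. (p j)\<^sup>2)"
  unfolding sum_product
proof (intro sum_mono)
  fix i j assume "i \<in> K" "j \<in> K'"
  then have "norm (b i j) \<le> q i * p j" using assms b_norm_le by blast
  then have "(norm (b i j))\<^sup>2 \<le> (q i * p j)\<^sup>2" by (intro power_mono) auto
  then show "(norm (b i j))\<^sup>2 \<le> (q i)\<^sup>2 * (p j)\<^sup>2" by (simp add: power_mult_distrib)
qed

text \<open>\<open>L\<close> does not depend on \<open>n\<close>, so crude Cauchy-Schwarz over the
  pairs is enough: every term is of order 1 / n.\<close>

lemma qvar_sum_mean_square:
  fixes \<epsilon> :: real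
  assumes L: "finite L" "L \<subseteq> Jp" and \<epsilon>: "0 < \<epsilon>"
  shows "\<forall>\<^sub>F n in sequentially. mean_square M (\<lambda>\<omega>. \<Sum>i\<in>L. \<Sum>j\<in>L. (qvar n i j \<omega> / 2) *\<^sub>R b i j) \<le> ennreal \<epsilon>"
proof -
  let ?P = "L \<times> L"
  define C where "C = real (card ?P) * (\<Sum>(i, j)\<in>?P. (norm (b i j))\<^sup>2)"
  have P: "finite ?P" using L by simp
  have C: "0 \<le> C" unfolding C_def by (intro mult_nonneg_nonneg sum_nonneg) auto
  have bd: "mean_square M (\<lambda>\<omega>. \<Sum>i\<in>L. \<Sum>j\<in>L. (qvar n i j \<omega> / 2) *\<^sub>R b i j) \<le> ennreal (C * (2 * h\<^sup>2 / real n))" if n: "0 < n" for n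
  proof -
    define z where "z p \<omega> = (case p of (i, j) \<Rightarrow> qvar n i j \<omega>)" for p :: "'j \<times> 'j" and \<omega>
    define w where "w p = (case p of (i, j) \<Rightarrow> real (card ?P) / 4 * (norm (b i j))\<^sup>2)" for p :: "'j \<times> 'j"
    have w: "0 \<le> w p" for p by (auto simp: w_def split: prod.split)
    have zm: "z p \<in> borel_measurable M" for p
      by (cases p) (simp add: z_def[abs_def] qvar_measurable)
    have pt: "ennreal ((norm (\<Sum>i\<in>L. \<Sum>j\<in>L. (qvar n i j \<omega> / 2) *\<^sub>R b i j))\<^sup>2) \<le> (\<Sum>p\<in>?P. ennreal (w p) * ennreal ((norm (z p \<omega>))\<^sup>2))" for \<omega>
    proof -
      have "norm (\<Sum>i\<in>L. \<Sum>j\<in>L. (qvar n i j \<omega> / 2) *\<^sub>R b i j) = norm (\<Sum>(i, j)\<in>?P. (qvar n i j \<omega> / 2) *\<^sub>R b i j)"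
        by (simp add: sum.cartesian_product')
      also have "\<dots> \<le> (\<Sum>(i, j)\<in>?P. \<bar>qvar n i j \<omega> / 2\<bar> * norm (b i j))"
        by (rule sum_norm_le) (auto simp: split_def)
      finally have "(norm (\<Sum>i\<in>L. \<Sum>j\<in>L. (qvar n i j \<omega> / 2) *\<^sub>R b i j))\<^sup>2 \<le> (\<Sum>(i, j)\<in>?P. \<bar>qvar n i j \<omega> / 2\<bar> * norm (b i j))\<^sup>2"
        by (intro power_mono) auto
      also have "\<dots> \<le> (\<Sum>p\<in>?P. (case p of (i, j) \<Rightarrow> \<bar>qvar n i j \<omega> / 2\<bar> * norm (b i j))\<^sup>2) * real (card ?P)"
        by (rule sum_squared_le_sum_of_squares)
      also have "\<dots> = (\<Sum>p\<in>?P. w p * (norm (z p \<omega>))\<^sup>2)"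
        unfolding sum_distrib_right by (intro sum.cong refl) (auto simp: w_def z_def power_mult_distrib power_divide)
      finally have "ennreal ((norm (\<Sum>i\<in>L. \<Sum>j\<in>L. (qvar n i j \<omega> / 2) *\<^sub>R b i j))\<^sup>2) \<le> ennreal (\<Sum>p\<in>?P. w p * (norm (z p \<omega>))\<^sup>2)"
        by (rule ennreal_leI)
      also have "\<dots> = (\<Sum>p\<in>?P. ennreal (w p) * ennreal ((norm (z p \<omega>))\<^sup>2))"
        using w by (simp add: ennreal_mult sum_ennreal[symmetric] del: sum_ennreal)
      finally show ?thesis .
    qed
    have "mean_square M (\<lambda>\<omega>. \<Sum>i\<in>L. \<Sum>j\<in>L. (qvar n i j \<omega> / 2) *\<^sub>R b i j) \<le> (\<integral>\<^sup>+\<omega>. (\<Sum>p\<in>?P. ennreal (w p) * ennreal ((norm (z p \<omega>))\<^sup>2)) \<partial>M)"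
      unfolding mean_square_def by (intro nn_integral_mono pt)
    also have "\<dots> = (\<Sum>p\<in>?P. ennreal (w p) * mean_square M (z p))"
      unfolding mean_square_def using zm by (subst nn_integral_sum) (auto intro!: sum.cong nn_integral_cmult)
    also have "\<dots> \<le> (\<Sum>p\<in>?P. ennreal (w p) * ennreal (8 * h\<^sup>2 / real n))"
    proof (intro sum_mono mult_left_mono)
      fix p assume "p \<in> ?P"
      then obtain i j where p: "p = (i, j)" "i \<in> Jp" "j \<in> Jp" using L by auto
      then have "z p = qvar n i j" by (auto simp: z_def[abs_def])
      then show "mean_square M (z p) \<le> ennreal (8 * h\<^sup>2 / real n)" using qvar_mean_square[OF p(2,3) n] by simp
    qed simp
    also have "\<dots> = ennreal (\<Sum>p\<in>?P. w p * (8 * h\<^sup>2 / real n))"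
    proof -
      have "(\<Sum>p\<in>?P. ennreal (w p) * ennreal (8 * h\<^sup>2 / real n)) = (\<Sum>p\<in>?P. ennreal (w p * (8 * h\<^sup>2 / real n)))"
        using w by (intro sum.cong refl ennreal_mult[symmetric]) auto
      also have "\<dots> = ennreal (\<Sum>p\<in>?P. w p * (8 * h\<^sup>2 / real n))"
        using w by (intro sum_ennreal mult_nonneg_nonneg) auto
      finally show ?thesis .
    qed
    also have "(\<Sum>p\<in>?P. w p * (8 * h\<^sup>2 / real n)) = C * (2 * h\<^sup>2 / real n)"
      unfolding C_def w_def sum_distrib_left sum_distrib_right by (intro sum.cong refl) (auto simp: split_def)
    finally show ?thesis .
  qed
  have "(\<lambda>n. C * (2 * h\<^sup>2 / real n)) \<longlonglongrightarrow> C * 0" by (intro tendsto_mult tendsto_const lim_const_over_n)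
  then have "\<forall>\<^sub>F n in sequentially. C * (2 * h\<^sup>2 / real n) < \<epsilon>"
    using \<epsilon> by (intro order_tendstoD(2)) auto
  then show ?thesis using eventually_gt_at_top[of 0]
    by eventually_elim (rule order_trans[OF bd ennreal_leI], auto)
qed

text \<open>Pairs outside of \<open>L\<close> contribute at most \<open>OD\<close> per pair of
  cells, and there are at most n^2 of the latter. Inside, the norm of \<open>b i j - b j i\<close>
  squared sums to at most 4 \<open>Q2 * P2\<close>; with the 9 of \<open>rest_double_sum\<close>
  this gives 36.\<close>

lemma chaos_bound:
  assumes D: "1 \<le> D" and L: "finite L" "L \<subseteq> Jp" and OD: "\<And>n. L \<subseteq> N n \<Longrightarrow>
      (\<Sum>i\<in>N n. \<Sum>j\<in>N n. if i \<in> L \<and> j \<in> L then 0 else (norm (b i j))\<^sup>2) \<le> OD"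
  shows "\<forall>\<^sub>F n in sequentially. mean_square M (\<lambda>\<omega>. \<Sum>m<n. \<Sum>m'<m. \<Sum>i\<in>N n. \<Sum>j\<in>N n. (inc n m' i \<omega> * inc n m j \<omega>) *\<^sub>R residual D n L m m' i j)
    \<le> ennreal (h\<^sup>2 * OD + 36 * Q2 * P2 * (h\<^sup>2 / (pi\<^sup>2 * real D)))"
proof -
  obtain n0 where n0: "L \<subseteq> N n0" using finite_subset_N[OF L] by blast
  have OD0: "0 \<le> OD"
    by (rule order_trans[OF _ OD[OF n0]]) (intro sum_nonneg, auto)
  let ?c = "\<lambda>n m m'. rest D ((real m - real m') / real n) + rest D (real (Suc m') / real n) - rest D (real (Suc m) / real n)"
  show ?thesis
    using rest_double_sum[OF D] eventually_ge_at_top[of n0] eventually_gt_at_top[of 0]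
  proof eventually_elim
    case (elim n)
    then have n: "0 < n" and Ln: "L \<subseteq> N n" using n0 N_mono by blast+
    have in1: "(\<Sum>i\<in>N n. \<Sum>j\<in>N n. (norm (residual D n L m m' i j))\<^sup>2) \<le> OD + (?c n m m')\<^sup>2 * (4 * (Q2 * P2))" for m m'
    proof -
      have "(norm (residual D n L m m' i j))\<^sup>2 = (if i \<in> L \<and> j \<in> L then 0 else (norm (b i j))\<^sup>2)
          + (if i \<in> L \<and> j \<in> L then (?c n m m')\<^sup>2 * (norm (b i j - b j i))\<^sup>2 else 0)" for i j
      proof (cases "i \<in> L \<and> j \<in> L")
        case True
        then have "residual D n L m m' i j = (1 / 2 - levy_kernel D n m' m) *\<^sub>R (b i j - b j i)"
          by (simp add: residual_def algebra_simps scaleR_half_double[symmetric]) (simp add: scaleR_add_left[symmetric])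
        then show ?thesis using True by (simp add: half_minus_levy_kernel[OF n] power_mult_distrib)
      qed (auto simp: residual_def)
      then have "(\<Sum>i\<in>N n. \<Sum>j\<in>N n. (norm (residual D n L m m' i j))\<^sup>2)
        = (\<Sum>i\<in>N n. \<Sum>j\<in>N n. if i \<in> L \<and> j \<in> L then 0 else (norm (b i j))\<^sup>2)
          + (\<Sum>i\<in>N n. \<Sum>j\<in>N n. if i \<in> L \<and> j \<in> L then (?c n m m')\<^sup>2 * (norm (b i j - b j i))\<^sup>2 else 0)"
        by (simp only: sum.distrib)
      also have "\<dots> \<le> OD + (\<Sum>i\<in>N n. \<Sum>j\<in>N n. (?c n m m')\<^sup>2 * (2 * (norm (b i j))\<^sup>2 + 2 * (norm (b j i))\<^sup>2))"
      proof (intro add_mono OD Ln sum_mono)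
        fix i j
        have "(norm (b i j - b j i))\<^sup>2 \<le> 2 * (norm (b i j))\<^sup>2 + 2 * (norm (b j i))\<^sup>2"
        proof -
          have "(norm (b i j - b j i))\<^sup>2 \<le> (norm (b i j) + norm (b j i))\<^sup>2"
            by (intro power_mono norm_triangle_ineq4) auto
          then show ?thesis using sum_squares_bound[of "norm (b i j)" "norm (b j i)"] by (simp add: power2_sum)
        qed
        then show "(if i \<in> L \<and> j \<in> L then (?c n m m')\<^sup>2 * (norm (b i j - b j i))\<^sup>2 else 0)
          \<le> (?c n m m')\<^sup>2 * (2 * (norm (b i j))\<^sup>2 + 2 * (norm (b j i))\<^sup>2)"
          by (auto intro!: mult_left_mono mult_nonneg_nonneg add_nonneg_nonneg)
      qed
      also have "(\<Sum>i\<in>N n. \<Sum>j\<in>N n. (?c n m m')\<^sup>2 * (2 * (norm (b i j))\<^sup>2 + 2 * (norm (b j i))\<^sup>2))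
        = (?c n m m')\<^sup>2 * (2 * (\<Sum>i\<in>N n. \<Sum>j\<in>N n. (norm (b i j))\<^sup>2) + 2 * (\<Sum>i\<in>N n. \<Sum>j\<in>N n. (norm (b j i))\<^sup>2))"
        by (simp only: sum_distrib_left[symmetric] sum.distrib)
      also have "(\<Sum>i\<in>N n. \<Sum>j\<in>N n. (norm (b j i))\<^sup>2) = (\<Sum>i\<in>N n. \<Sum>j\<in>N n. (norm (b i j))\<^sup>2)" by (rule sum.swap)
      also have "OD + (?c n m m')\<^sup>2 * (2 * (\<Sum>i\<in>N n. \<Sum>j\<in>N n. (norm (b i j))\<^sup>2) + 2 * (\<Sum>i\<in>N n. \<Sum>j\<in>N n. (norm (b i j))\<^sup>2))
        \<le> OD + (?c n m m')\<^sup>2 * (4 * (Q2 * P2))"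
      proof -
        have "(\<Sum>i\<in>N n. \<Sum>j\<in>N n. (norm (b i j))\<^sup>2) \<le> (\<Sum>i\<in>N n. (q i)\<^sup>2) * (\<Sum>j\<in>N n. (p j)\<^sup>2)"
          by (intro b_sq_sum finite_N N_subset)
        also have "\<dots> \<le> Q2 * P2"
          using q_total(2) by (intro mult_mono q_total(1) p_total(1) finite_N N_subset sum_nonneg) auto
        finally show ?thesis by (intro add_left_mono mult_left_mono) auto
      qed
      finally show ?thesis .
    qed
    have "(\<Sum>m<n. \<Sum>m'<m. \<Sum>i\<in>N n. \<Sum>j\<in>N n. (h / real n)\<^sup>2 * (norm (residual D n L m m' i j))\<^sup>2)
      = (h / real n)\<^sup>2 * (\<Sum>m<n. \<Sum>m'<m. \<Sum>i\<in>N n. \<Sum>j\<in>N n. (norm (residual D n L m m' i j))\<^sup>2)"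
      by (simp only: sum_distrib_left)
    also have "\<dots> \<le> (h / real n)\<^sup>2 * (\<Sum>m<n. \<Sum>m'<m. OD + (?c n m m')\<^sup>2 * (4 * (Q2 * P2)))"
      by (intro mult_left_mono sum_mono in1) auto
    also have "(\<Sum>m<n. \<Sum>m'<m. OD + (?c n m m')\<^sup>2 * (4 * (Q2 * P2))) = (\<Sum>m<n. \<Sum>m'<m. OD) + (\<Sum>m<n. \<Sum>m'<m. (?c n m m')\<^sup>2) * (4 * (Q2 * P2))"
      by (simp only: sum.distrib sum_distrib_right)
    also have "(h / real n)\<^sup>2 * \<dots> \<le> (h / real n)\<^sup>2 * ((real n)\<^sup>2 * OD + (\<Sum>m<n. \<Sum>m'<m. (?c n m m')\<^sup>2) * (4 * (Q2 * P2)))"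
    proof (intro mult_left_mono add_right_mono)
      have "(\<Sum>m<n. \<Sum>m'<m. OD) \<le> (\<Sum>m<n. \<Sum>m'<n. OD)"
        using OD0 by (intro sum_mono sum_mono2) auto
      then show "(\<Sum>m<n. \<Sum>m'<m. OD) \<le> (real n)\<^sup>2 * OD" by (simp add: power2_eq_square)
    qed simp
    also have "\<dots> = h\<^sup>2 * OD + (h\<^sup>2 * (4 * (Q2 * P2))) * ((\<Sum>m<n. \<Sum>m'<m. (?c n m m')\<^sup>2) / (real n)\<^sup>2)"
      using n by (simp add: distrib_left power_divide)
    also have "\<dots> \<le> h\<^sup>2 * OD + (h\<^sup>2 * (4 * (Q2 * P2))) * (9 / (pi\<^sup>2 * real D))"
      using q_total(2) p_total(2) by (intro add_left_mono mult_left_mono elim(1)) auto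
    also have "\<dots> = h\<^sup>2 * OD + 36 * Q2 * P2 * (h\<^sup>2 / (pi\<^sup>2 * real D))" by simp
    finally show ?case
      unfolding chaos_mean_square[OF finite_N N_subset] by (rule ennreal_leI)
  qed
qed

text \<open>The Riemann sums converge in mean square, the quadratic forms for almost every path.
  Along a subsequence both converge almost surely, so that Fatou's lemma yields the bound for the
  limit.\<close>

theorem discretisation_error:
  assumes I: "is_ito_integral M F J \<eta> e W t (t + h) X I"
    and X: "\<And>s. t < s \<Longrightarrow> s \<le> t + h \<Longrightarrow> AE \<omega> in M. \<forall>j\<in>Jp. X s \<omega> (f j) = \<Psi> (V t s \<omega>) (f j)"
    and D: "1 \<le> D" and L: "finite L" "L \<subseteq> Jp" and OD: "\<And>n. L \<subseteq> N n \<Longrightarrow>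
      (\<Sum>i\<in>N n. \<Sum>j\<in>N n. if i \<in> L \<and> j \<in> L then 0 else (norm (b i j))\<^sup>2) \<le> OD"
  shows "mean_square M (\<lambda>\<omega>. I \<omega> - (\<Sum>i\<in>L. \<Sum>j\<in>L. Ibar D i j \<omega> *\<^sub>R b i j))
    \<le> ennreal (2 * (h\<^sup>2 * OD + 36 * Q2 * P2 * (h\<^sup>2 / (pi\<^sup>2 * real D))) + 2 * (h\<^sup>2 / (pi\<^sup>2 * real D)))"
proof -
  have Im: "I \<in> borel_measurable M" using I by (simp add: is_ito_integral_def)
  have "(\<lambda>n. mean_square M (\<lambda>\<omega>. I \<omega> - R n \<omega>)) \<longlonglongrightarrow> 0"
  proof (rule tendsto_sandwich[OF _ _ tendsto_const])
    show "\<forall>\<^sub>F n in sequentially. mean_square M (\<lambda>\<omega>. I \<omega> - R n \<omega>) \<le> ennreal (4 * h * eps n)"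
      using eventually_gt_at_top[of 0] by eventually_elim (rule R_approx[OF I _ X])
    have "(\<lambda>n. 4 * h * eps n) \<longlonglongrightarrow> 4 * h * 0" by (intro tendsto_mult tendsto_const eps_tendsto)
    from tendsto_ennrealI[OF this] show "(\<lambda>n. ennreal (4 * h * eps n)) \<longlonglongrightarrow> 0" by simp
  qed simp
  then obtain r where r: "strict_mono r" "AE \<omega> in M. (\<lambda>k. I \<omega> - R (r k) \<omega>) \<longlonglongrightarrow> 0"
    by (rule mean_square_AE_subseq[OF borel_measurable_diff[OF Im R_measurable]])
  obtain n0 where n0: "L \<subseteq> N n0" using finite_subset_N[OF L] by blast
  have OD0: "0 \<le> OD"
    by (rule order_trans[OF _ OD[OF n0]]) (intro sum_nonneg, auto)
  \<comment> \<open>\<open>?y\<close> serves as the bound for the vanishing quadratic variation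
    part. Any positive number would do eventually; this one has the form of the second error
    term.\<close>
  let ?x = "h\<^sup>2 * OD + 36 * Q2 * P2 * (h\<^sup>2 / (pi\<^sup>2 * real D))" and ?y = "h\<^sup>2 / (pi\<^sup>2 * real D)"
  have xy: "0 \<le> ?x" "0 < ?y"
    using OD0 q_total(2) p_total(2) h0 D by (auto intro!: add_nonneg_nonneg mult_nonneg_nonneg divide_pos_pos)
  let ?E = "\<lambda>n \<omega>. R n \<omega> - (\<Sum>i\<in>L. \<Sum>j\<in>L. Idisc D n i j \<omega> *\<^sub>R b i j)"
  have Em: "?E n \<in> borel_measurable M" for n
    by (intro borel_measurable_diff R_measurable borel_measurable_sum borel_measurable_scaleR Idisc_measurable borel_measurable_const)
  have cb: "\<forall>\<^sub>F n in sequentially. mean_square M (\<lambda>\<omega>. \<Sum>m<n. \<Sum>m'<m. \<Sum>i\<in>N n. \<Sum>j\<in>N n. (inc n m' i \<omega> * inc n m j \<omega>) *\<^sub>R residual D n L m m' i j) \<le> ennreal ?x"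
    using OD by (rule chaos_bound[OF D L])
  have ev: "\<forall>\<^sub>F n in sequentially. mean_square M (?E n) \<le> ennreal (2 * ?x + 2 * ?y)"
    using cb qvar_sum_mean_square[OF L xy(2)] eventually_ge_at_top[of n0] eventually_gt_at_top[of 0]
  proof eventually_elim
    case (elim n)
    let ?A = "\<lambda>\<omega>. \<Sum>m<n. \<Sum>m'<m. \<Sum>i\<in>N n. \<Sum>j\<in>N n. (inc n m' i \<omega> * inc n m j \<omega>) *\<^sub>R residual D n L m m' i j"
    let ?B = "\<lambda>\<omega>. \<Sum>i\<in>L. \<Sum>j\<in>L. (qvar n i j \<omega> / 2) *\<^sub>R b i j"
    have Ln: "L \<subseteq> N n" using n0 N_mono[OF elim(3)] by blast
    have Am: "?A \<in> borel_measurable M"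
      by (intro borel_measurable_sum borel_measurable_scaleR borel_measurable_times borel_measurable_const inc_measurable) auto
    have Bm: "?B \<in> borel_measurable M"
      by (intro borel_measurable_sum borel_measurable_scaleR borel_measurable_divide borel_measurable_const qvar_measurable)
    have "mean_square M (?E n) = mean_square M (\<lambda>\<omega>. ?A \<omega> - ?B \<omega>)"
      by (simp only: error_decomposition[OF elim(4) L(1) Ln])
    also have "\<dots> \<le> 2 * mean_square M ?A + 2 * mean_square M ?B"
      using mean_square_triangle[OF Am _ Bm, of "\<lambda>_. 0"] by (simp add: mean_square_def)
    also have "\<dots> \<le> 2 * ennreal ?x + 2 * ennreal ?y"
      by (intro add_mono mult_left_mono elim) auto
    also have "\<dots> = ennreal (2 * ?x + 2 * ?y)" using xy by (intro two_ennreal_add) auto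
    finally show ?case .
  qed
  show ?thesis
  proof (rule mean_square_fatou_le[where f="\<lambda>k. ?E (r k)"])
    show "?E (r k) \<in> borel_measurable M" for k by (rule Em)
    show "\<forall>\<^sub>F k in sequentially. mean_square M (?E (r k)) \<le> ennreal (2 * ?x + 2 * ?y)"
      by (rule eventually_subseq[OF r(1) ev])
    have "AE \<omega> in M. \<forall>p\<in>L \<times> L. (\<lambda>n. Idisc D n (fst p) (snd p) \<omega>) \<longlonglongrightarrow> Ibar D (fst p) (snd p) \<omega>"
    proof (rule AE_finite_allI)
      fix p assume "p \<in> L \<times> L"
      then show "AE \<omega> in M. (\<lambda>n. Idisc D n (fst p) (snd p) \<omega>) \<longlonglongrightarrow> Ibar D (fst p) (snd p) \<omega>"
        using L by (intro Idisc_tendsto) auto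
    qed (use L in simp)
    then show "AE \<omega> in M. (\<lambda>k. ?E (r k) \<omega>) \<longlonglongrightarrow> I \<omega> - (\<Sum>i\<in>L. \<Sum>j\<in>L. Ibar D i j \<omega> *\<^sub>R b i j)"
      using r(2)
    proof eventually_elim
      case (elim \<omega>)
      have "(\<lambda>k. I \<omega> - (I \<omega> - R (r k) \<omega>)) \<longlonglongrightarrow> I \<omega> - 0" by (intro tendsto_diff tendsto_const elim(2))
      then have R: "(\<lambda>k. R (r k) \<omega>) \<longlonglongrightarrow> I \<omega>" by simp
      have "(\<lambda>k. Idisc D (r k) i j \<omega>) \<longlonglongrightarrow> Ibar D i j \<omega>" if "i \<in> L" "j \<in> L" for i j
        using LIMSEQ_subseq_LIMSEQ[OF _ r(1), of "\<lambda>n. Idisc D n i j \<omega>"] bspec[OF elim(1), of "(i, j)"] that by (simp add: o_def)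
      then show ?case by (intro tendsto_diff R tendsto_sum tendsto_scaleR tendsto_const) auto
    qed
  qed
qed

end

section \<open>The main estimate\<close>

text \<open>In the nuclear representation the sum of the eigenvalues over \<open>K\<close> is the
  series of \<open>a n \<bullet> proj K (b n)\<close>, and projections do not increase norms. The 1
  added to \<open>B\<close> makes it positive.\<close>

lemma (in onb) trace_bound:
  assumes eig: "\<And>j. j \<in> J \<Longrightarrow> blinfun_apply Q (e j) = \<eta> j *\<^sub>R e j" and tr: "trace_class_op Q"
  obtains B :: real where "0 < B" "\<And>K. finite K \<Longrightarrow> K \<subseteq> J \<Longrightarrow> sum \<eta> K \<le> B"
proof -
  obtain a b :: "nat \<Rightarrow> 'u" where ab: "summable (\<lambda>n. norm (a n) * norm (b n))"
    "\<And>x. (\<lambda>n. (b n \<bullet> x) *\<^sub>R a n) sums blinfun_apply Q x"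
    using tr unfolding trace_class_op_def by blast
  define B where "B = (\<Sum>n. norm (a n) * norm (b n)) + 1"
  have "0 \<le> (\<Sum>n. norm (a n) * norm (b n))" using ab(1) by (intro suminf_nonneg) auto
  then have B: "0 < B" by (simp add: B_def)
  have "sum \<eta> K \<le> B" if K: "finite K" "K \<subseteq> J" for K
  proof -
    have "(\<lambda>n. ((b n \<bullet> e j) *\<^sub>R a n) \<bullet> e j) sums (blinfun_apply Q (e j) \<bullet> e j)" for j
      using bounded_linear.sums[OF bounded_linear_inner_left ab(2)] .
    then have "(\<lambda>n. \<Sum>j\<in>K. ((b n \<bullet> e j) *\<^sub>R a n) \<bullet> e j) sums (\<Sum>j\<in>K. blinfun_apply Q (e j) \<bullet> e j)"
      by (rule sums_sum)
    moreover have "(\<Sum>j\<in>K. blinfun_apply Q (e j) \<bullet> e j) = sum \<eta> K"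
      using K by (intro sum.cong refl) (auto simp: eig inner_basis subset_eq)
    ultimately have s: "(\<lambda>n. \<Sum>j\<in>K. ((b n \<bullet> e j) *\<^sub>R a n) \<bullet> e j) sums sum \<eta> K" by simp
    have le: "(\<Sum>j\<in>K. ((b n \<bullet> e j) *\<^sub>R a n) \<bullet> e j) \<le> norm (a n) * norm (b n)" for n
    proof -
      have "(\<Sum>j\<in>K. ((b n \<bullet> e j) *\<^sub>R a n) \<bullet> e j) = a n \<bullet> proj K (b n)"
        by (simp add: proj_def inner_sum_right)
      also have "\<dots> \<le> norm (a n) * norm (proj K (b n))" by (rule norm_cauchy_schwarz)
      also have "norm (proj K (b n)) \<le> norm (b n)"
        using bessel[OF K, of "b n"] norm_sum_basis[OF K, of "\<lambda>j. b n \<bullet> e j"]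
        by - (rule power2_le_imp_le, simp_all add: proj_def)
      finally show ?thesis by (simp add: mult_left_mono)
    qed
    have "sum \<eta> K \<le> (\<Sum>n. norm (a n) * norm (b n))"
      by (rule sums_le[OF le s summable_sums[OF ab(1)]])
    then show ?thesis by (simp add: B_def)
  qed
  with B show ?thesis using that by blast
qed

context operators
begin

text \<open>On \<open>f j\<close> the pseudo-inverse acts as multiplication by \<eta> j powr
  -\<alpha>, so the Hilbert-Schmidt assumption is the weighted square summability of
  \<open>q\<close>.\<close>

lemma Phi_Qneg_HS:
  assumes HS: "HS_norm_sq J \<eta> e (\<Phi> \<circ> Qneg J \<eta> e \<alpha>) < ennreal C" and C: "0 \<le> C" and K: "finite K" "K \<subseteq> Jp"
  shows "(\<Sum>j\<in>K. (\<eta> j powr - \<alpha> * q j)\<^sup>2) \<le> C"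
proof -
  have val: "norm ((\<Phi> \<circ> Qneg J \<eta> e \<alpha>) (f j)) = \<eta> j powr - \<alpha> * q j" if j: "j \<in> Jp" for j
  proof -
    have "Qneg J \<eta> e \<alpha> (f j) = (sqrt (\<eta> j) * \<eta> j powr - \<alpha>) *\<^sub>R e j"
      unfolding f_def by (rule Qneg_basis[OF alpha j])
    also have "\<dots> = \<eta> j powr - \<alpha> *\<^sub>R f j" by (simp add: f_def mult.commute)
    finally have "\<Phi> (Qneg J \<eta> e \<alpha> (f j)) = \<eta> j powr - \<alpha> *\<^sub>R blinfun_apply S (f j)"
      using Phi_eq[OF U0_scale[OF f_in_U0[OF j]]] by (simp add: blinfun.scaleR_right)
    then show ?thesis by (simp add: q_def)
  qed
  obtain n where n: "K \<subseteq> N n" using finite_subset_N[OF K] by blast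
  have "ennreal (\<Sum>j\<in>K. (\<eta> j powr - \<alpha> * q j)\<^sup>2) = (\<Sum>j\<in>K. ennreal ((norm ((\<Phi> \<circ> Qneg J \<eta> e \<alpha>) (f j)))\<^sup>2))"
  proof -
    have "(\<Sum>j\<in>K. (\<eta> j powr - \<alpha> * q j)\<^sup>2) = (\<Sum>j\<in>K. (norm ((\<Phi> \<circ> Qneg J \<eta> e \<alpha>) (f j)))\<^sup>2)"
      using K val by (intro sum.cong refl) (simp add: subset_eq)
    then show ?thesis by simp
  qed
  also have "\<dots> \<le> (\<Sum>j\<in>N n. ennreal ((norm ((\<Phi> \<circ> Qneg J \<eta> e \<alpha>) (f j)))\<^sup>2))"
    using n by (intro sum_mono2 finite_N) auto
  also have "\<dots> \<le> hs (\<lambda>j. (\<Phi> \<circ> Qneg J \<eta> e \<alpha>) (f j))" unfolding hs_SUP by (rule SUP_upper) simp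
  also have "\<dots> \<le> ennreal C" using HS unfolding HS_norm_sq_eq_hs by (rule less_imp_le)
  finally show ?thesis using C by (simp add: ennreal_le_iff)
qed

text \<open>A pair outside of \<open>L\<close> times \<open>L\<close> has its first or its second
  index outside, so the sum is at most two products of sums, each with one factor restricted to the
  complement of \<open>L\<close>. That factor yields \<open>s\<^sup>2\<close>: \<open>q i\<close> is
  \<eta> i powr \<alpha> times the summable weight, and \<open>p j\<close> contains \<eta> j powr
  \<alpha>.\<close>

lemma off_diagonal_bound:
  assumes HS: "\<And>K. finite K \<Longrightarrow> K \<subseteq> Jp \<Longrightarrow> (\<Sum>j\<in>K. (\<eta> j powr - \<alpha> * q j)\<^sup>2) \<le> C"
    and s: "0 \<le> s" "\<And>j. j \<in> Jp \<Longrightarrow> j \<notin> L \<Longrightarrow> \<eta> j powr \<alpha> \<le> s"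
  shows "(\<Sum>i\<in>N n. \<Sum>j\<in>N n. if i \<in> L \<and> j \<in> L then 0 else (norm (b i j))\<^sup>2) \<le> s\<^sup>2 * (C * P2 + Q2 * (c\<^sup>2 * B))"
proof -
  have bb: "(norm (b i j))\<^sup>2 \<le> (q i)\<^sup>2 * (p j)\<^sup>2" if "j \<in> N n" for i j
  proof -
    have "norm (b i j) \<le> q i * p j" using that N_subset b_norm_le by blast
    then have "(norm (b i j))\<^sup>2 \<le> (q i * p j)\<^sup>2" by (intro power_mono) auto
    then show ?thesis by (simp add: power_mult_distrib)
  qed
  have fin: "finite (N n - L)" "N n - L \<subseteq> Jp" using finite_N N_subset by auto
  have qs: "(\<Sum>i\<in>N n - L. (q i)\<^sup>2) \<le> s\<^sup>2 * C"
  proof -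
    have "(\<Sum>i\<in>N n - L. (q i)\<^sup>2) \<le> (\<Sum>i\<in>N n - L. s\<^sup>2 * (\<eta> i powr - \<alpha> * q i)\<^sup>2)"
    proof (rule sum_mono)
      fix i assume i: "i \<in> N n - L"
      then have \<eta>: "0 < \<eta> i" "\<eta> i powr \<alpha> \<le> s" using fin JpD s(2) by auto
      have "\<eta> i powr \<alpha> * \<eta> i powr - \<alpha> = 1" using \<eta>(1) by (simp add: powr_add[symmetric])
      then have "q i = \<eta> i powr \<alpha> * (\<eta> i powr - \<alpha> * q i)" by (simp add: mult.assoc[symmetric])
      also have "\<dots> \<le> s * (\<eta> i powr - \<alpha> * q i)" using \<eta> by (intro mult_right_mono) (auto simp: q_def)
      finally have "(q i)\<^sup>2 \<le> (s * (\<eta> i powr - \<alpha> * q i))\<^sup>2" by (intro power_mono) (auto simp: q_def)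
      then show "(q i)\<^sup>2 \<le> s\<^sup>2 * (\<eta> i powr - \<alpha> * q i)\<^sup>2" by (simp add: power_mult_distrib)
    qed
    also have "\<dots> \<le> s\<^sup>2 * C" unfolding sum_distrib_left[symmetric] by (intro mult_left_mono HS fin) auto
    finally show ?thesis .
  qed
  have ps: "(\<Sum>j\<in>N n - L. (p j)\<^sup>2) \<le> s\<^sup>2 * (c\<^sup>2 * B)"
  proof -
    have "(\<Sum>j\<in>N n - L. (p j)\<^sup>2) \<le> (\<Sum>j\<in>N n - L. s\<^sup>2 * (c\<^sup>2 * \<eta> j))"
    proof (rule sum_mono)
      fix j assume j: "j \<in> N n - L"
      then have \<eta>: "0 < \<eta> j" "\<eta> j powr \<alpha> \<le> s" using fin JpD s(2) by auto
      have "(\<eta> j powr \<alpha>)\<^sup>2 \<le> s\<^sup>2" using \<eta> by (intro power_mono) auto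
      then have "(\<eta> j powr \<alpha>)\<^sup>2 * (c\<^sup>2 * \<eta> j) \<le> s\<^sup>2 * (c\<^sup>2 * \<eta> j)" using \<eta> by (intro mult_right_mono) auto
      then show "(p j)\<^sup>2 \<le> s\<^sup>2 * (c\<^sup>2 * \<eta> j)" using \<eta> by (simp add: p_def power_mult_distrib mult_ac)
    qed
    also have "\<dots> = s\<^sup>2 * (c\<^sup>2 * sum \<eta> (N n - L))" by (simp only: sum_distrib_left)
    also have "\<dots> \<le> s\<^sup>2 * (c\<^sup>2 * B)" using fin Jp_subset by (intro mult_left_mono trace_le) auto
    finally show ?thesis .
  qed
  have "(\<Sum>i\<in>N n. \<Sum>j\<in>N n. if i \<in> L \<and> j \<in> L then 0 else (norm (b i j))\<^sup>2)
    \<le> (\<Sum>i\<in>N n. \<Sum>j\<in>N n. (if i \<in> L then 0 else (q i)\<^sup>2) * (p j)\<^sup>2 + (q i)\<^sup>2 * (if j \<in> L then 0 else (p j)\<^sup>2))"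
    using bb by (intro sum_mono) (auto intro: order_trans[OF bb])
  also have "\<dots> = (\<Sum>i\<in>N n. if i \<in> L then 0 else (q i)\<^sup>2) * (\<Sum>j\<in>N n. (p j)\<^sup>2) + (\<Sum>i\<in>N n. (q i)\<^sup>2) * (\<Sum>j\<in>N n. if j \<in> L then 0 else (p j)\<^sup>2)"
    by (simp only: sum_product sum.distrib)
  also have "(\<Sum>i\<in>N n. if i \<in> L then 0 else (q i)\<^sup>2) = (\<Sum>i\<in>N n - L. (q i)\<^sup>2)"
    using finite_N by (intro sum.mono_neutral_cong_right) auto
  also have "(\<Sum>j\<in>N n. if j \<in> L then 0 else (p j)\<^sup>2) = (\<Sum>j\<in>N n - L. (p j)\<^sup>2)"
    using finite_N by (intro sum.mono_neutral_cong_right) auto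
  also have "(\<Sum>i\<in>N n - L. (q i)\<^sup>2) * (\<Sum>j\<in>N n. (p j)\<^sup>2) + (\<Sum>i\<in>N n. (q i)\<^sup>2) * (\<Sum>j\<in>N n - L. (p j)\<^sup>2)
    \<le> (s\<^sup>2 * C) * P2 + Q2 * (s\<^sup>2 * (c\<^sup>2 * B))"
    using q_total(2) order_trans[OF sum_nonneg qs]
    by (intro add_mono mult_mono qs ps q_total(1) p_total(1) finite_N N_subset sum_nonneg) auto
  also have "\<dots> = s\<^sup>2 * (C * P2 + Q2 * (c\<^sup>2 * B))" by (simp add: algebra_simps)
  finally show ?thesis .
qed

lemma b_eq:
  assumes ij: "i \<in> Jp" "j \<in> Jp"
  shows "b i j = (sqrt (\<eta> i) * sqrt (\<eta> j)) *\<^sub>R \<Psi> (\<Phi> (e i)) (e j)"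
proof -
  have eU: "e k \<in> U0 J \<eta> e" if "k \<in> Jp" for k using basis_in_U0[OF that, of 1] by simp
  have "\<Psi> x (sqrt (\<eta> j) *\<^sub>R e j) = sqrt (\<eta> j) *\<^sub>R \<Psi> x (e j)" for x
    using HS_op_Psi[of x] eU[OF ij(2)] unfolding HS_op_def linear_on_subspace_def by blast
  then have "b i j = sqrt (\<eta> j) *\<^sub>R \<Psi> (blinfun_apply S (f i)) (e j)" by (simp add: b_def f_def)
  also have "blinfun_apply S (f i) = sqrt (\<eta> i) *\<^sub>R \<Phi> (e i)"
    by (simp add: f_def blinfun.scaleR_right Phi_eq[OF eU[OF ij(1)]])
  also have "\<Psi> (sqrt (\<eta> i) *\<^sub>R \<Phi> (e i)) (e j) = sqrt (\<eta> i) *\<^sub>R \<Psi> (\<Phi> (e i)) (e j)"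
    using Psi_linear[OF eU[OF ij(2)]] by (rule linear_scale)
  finally show ?thesis by (simp add: mult.commute)
qed

end

context grid
begin

theorem approximation_error:
  assumes HS: "\<And>K. finite K \<Longrightarrow> K \<subseteq> Jp \<Longrightarrow> (\<Sum>j\<in>K. (\<eta> j powr - \<alpha> * q j)\<^sup>2) \<le> C"
    and s: "0 \<le> s" "\<And>j. j \<in> Jp \<Longrightarrow> j \<notin> L \<Longrightarrow> \<eta> j powr \<alpha> \<le> s"
    and D: "1 \<le> D" and L: "finite L" "L \<subseteq> Jp"
  shows "mean_square M (\<lambda>\<omega>. ito_integral M F J \<eta> e W t (t + h) (\<lambda>s \<omega>'. \<Psi> (ito_integral M F J \<eta> e W t s (\<lambda>_ _. \<Phi>) \<omega>')) \<omega>
      - (\<Sum>i\<in>L. \<Sum>j\<in>L. iter_int_approx W \<eta> e t h D i j \<omega> *\<^sub>R \<Psi> (\<Phi> (e i)) (e j)))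
    \<le> ennreal (2 * (C * P2 + Q2 * (c\<^sup>2 * B)) * (h * s)\<^sup>2 + (72 * Q2 * P2 + 2) * (h / (pi * sqrt (real D)))\<^sup>2)"
proof -
  let ?X = "\<lambda>s \<omega>'. \<Psi> (ito_integral M F J \<eta> e W t s (\<lambda>_ _. \<Phi>) \<omega>')"
  have X: "AE \<omega> in M. ?X s \<omega> = \<Psi> (V t s \<omega>)" if "t \<le> s" "s \<le> t + h" for s
  proof -
    have "s \<le> T" using that thT by simp
    from inner_ito_integral[OF t0 that(1) this] show ?thesis by eventually_elim simp
  qed
  have I: "is_ito_integral M F J \<eta> e W t (t + h) ?X (ito_integral M F J \<eta> e W t (t + h) ?X)"
    \<comment> \<open>With these arguments only the outer integral is unfolded; the inner one stays
      inside the integrand.\<close>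
    unfolding ito_integral_def[of M F J \<eta> e W t "t + h"] using outer_ito_exists[OF X] by (rule someI_ex)
  have "(\<Sum>i\<in>L. \<Sum>j\<in>L. iter_int_approx W \<eta> e t h D i j \<omega> *\<^sub>R \<Psi> (\<Phi> (e i)) (e j)) = (\<Sum>i\<in>L. \<Sum>j\<in>L. Ibar D i j \<omega> *\<^sub>R b i j)" for \<omega>
  proof (intro sum.cong refl)
    fix i j assume "i \<in> L" "j \<in> L"
    then have ij: "i \<in> Jp" "j \<in> Jp" using L by auto
    then show "iter_int_approx W \<eta> e t h D i j \<omega> *\<^sub>R \<Psi> (\<Phi> (e i)) (e j) = Ibar D i j \<omega> *\<^sub>R b i j"
      using JpD(2)[OF ij(1)] JpD(2)[OF ij(2)] by (simp add: b_eq[OF ij] Ibar_def)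
  qed
  note sums = this
  let ?K = "C * P2 + Q2 * (c\<^sup>2 * B)"
  have "mean_square M (\<lambda>\<omega>. ito_integral M F J \<eta> e W t (t + h) ?X \<omega> - (\<Sum>i\<in>L. \<Sum>j\<in>L. Ibar D i j \<omega> *\<^sub>R b i j))
    \<le> ennreal (2 * (h\<^sup>2 * (s\<^sup>2 * ?K) + 36 * Q2 * P2 * (h\<^sup>2 / (pi\<^sup>2 * real D))) + 2 * (h\<^sup>2 / (pi\<^sup>2 * real D)))"
  proof (rule discretisation_error[OF I _ D L])
    show "AE \<omega> in M. \<forall>j\<in>Jp. ?X r \<omega> (f j) = \<Psi> (V t r \<omega>) (f j)" if "t < r" "r \<le> t + h" for r
      using X[OF less_imp_le[OF that(1)] that(2)] by eventually_elim simp
    show "(\<Sum>i\<in>N n. \<Sum>j\<in>N n. if i \<in> L \<and> j \<in> L then 0 else (norm (b i j))\<^sup>2) \<le> s\<^sup>2 * ?K" for n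
      by (rule off_diagonal_bound[OF HS s])
  qed
  \<comment> \<open>Here 72 = 2 * 36, and the summand 2 comes from the quadratic variation
    part.\<close>
  also have "2 * (h\<^sup>2 * (s\<^sup>2 * ?K) + 36 * Q2 * P2 * (h\<^sup>2 / (pi\<^sup>2 * real D))) + 2 * (h\<^sup>2 / (pi\<^sup>2 * real D))
    = 2 * ?K * (h * s)\<^sup>2 + (72 * Q2 * P2 + 2) * (h / (pi * sqrt (real D)))\<^sup>2"
  proof -
    have "(h / (pi * sqrt (real D)))\<^sup>2 = h\<^sup>2 / (pi\<^sup>2 * real D)" by (simp add: power_divide power_mult_distrib)
    then show ?thesis by (simp only: power_mult_distrib) (simp add: algebra_simps)
  qed
  finally show ?thesis unfolding sums .
qed

end

theorem theorem2p1:
  fixes M :: "'w measure" and F :: "real \<Rightarrow> 'w measure"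
    and Q :: "'u::{real_inner, banach, second_countable_topology} \<Rightarrow>\<^sub>L 'u"
    and J :: "'j set" and \<eta> :: "'j \<Rightarrow> real" and e :: "'j \<Rightarrow> 'u"
    and W :: "real \<Rightarrow> 'w \<Rightarrow> 'u"
    and \<Phi> :: "'u \<Rightarrow> 'h::{real_inner, banach, second_countable_topology}"
    and \<Psi> :: "'h \<Rightarrow> 'u \<Rightarrow> 'h"
    and T \<alpha> C :: real
  assumes "0 < T"
    and "prob_space M" and "filtered M F"
    and "nonneg_op Q" and "symmetric_op Q" and "trace_class_op Q"
    and "eigenbasis Q J \<eta> e"
    and "Q_Wiener_process M F T Q W"
    and "0 < \<alpha>"
    and "L_UH_U0 J \<eta> e \<Phi>"
    and "0 < C" and "HS_norm_sq J \<eta> e (\<Phi> \<circ> Qneg J \<eta> e \<alpha>) < ennreal (C\<^sup>2)"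
    and "L_H_L_Qneg_U0 J \<eta> e \<alpha> \<Psi>"
  shows "\<exists>C\<^sub>Q>0. \<forall>h t. \<forall>D K :: nat. \<forall>J\<^sub>K.
    0 < h \<longrightarrow> t \<in> {0..T} \<longrightarrow> t + h \<in> {0..T} \<longrightarrow> 1 \<le> D \<longrightarrow> 1 \<le> K \<longrightarrow>
    J\<^sub>K \<subseteq> J \<longrightarrow> finite J\<^sub>K \<longrightarrow> card J\<^sub>K = K \<longrightarrow> (\<forall>j\<in>J\<^sub>K. \<eta> j \<noteq> 0) \<longrightarrow>
    (let err = mean_square M (\<lambda>\<omega>.
           ito_integral M F J \<eta> e W t (t + h)
             (\<lambda>s \<omega>'. \<Psi> (ito_integral M F J \<eta> e W t s (\<lambda>_ _. \<Phi>) \<omega>')) \<omega>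
           - (\<Sum>i\<in>J\<^sub>K. \<Sum>j\<in>J\<^sub>K. iter_int_approx W \<eta> e t h D i j \<omega> *\<^sub>R \<Psi> (\<Phi> (e i)) (e j)))
     in err < \<infinity> \<and>
        sqrt (enn2real err) \<le> C\<^sub>Q * h * sup0 \<eta> (J - J\<^sub>K) powr \<alpha> + C\<^sub>Q * (h / (pi * sqrt (real D))))"
proof -
  have onb: "orthonormal_basis J e" and cJ: "countable J" and eig: "\<And>j. j \<in> J \<Longrightarrow> blinfun_apply Q (e j) = \<eta> j *\<^sub>R e j"
    using \<open>eigenbasis Q J \<eta> e\<close> by (auto simp: eigenbasis_def)
  interpret onb J e by (rule onb.intro[OF onb])
  obtain B :: real where B: "0 < B" "\<And>K. finite K \<Longrightarrow> K \<subseteq> J \<Longrightarrow> sum \<eta> K \<le> B"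
    using trace_bound[OF eig \<open>trace_class_op Q\<close>] by metis
  have eta0: "0 \<le> \<eta> j" if "j \<in> J" for j
  proof -
    have "0 \<le> blinfun_apply Q (e j) \<bullet> e j" using \<open>nonneg_op Q\<close> by (simp add: nonneg_op_def)
    then show ?thesis using that by (simp add: eig inner_basis)
  qed
  have etaB: "\<eta> j \<le> B" if "j \<in> J" for j using B(2)[of "{j}"] that by simp
  obtain S :: "'u \<Rightarrow>\<^sub>L 'h" where S: "\<And>u. u \<in> U0 J \<eta> e \<Longrightarrow> \<Phi> u = blinfun_apply S u"
    using \<open>L_UH_U0 J \<eta> e \<Phi>\<close> unfolding L_UH_U0_def by blast
  obtain c0 where c0: "\<And>x. \<exists>A. bounded_op_Qneg_space J \<eta> e \<alpha> (c0 * norm x) A \<and> (\<forall>u\<in>U0 J \<eta> e. \<Psi> x u = A u)"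
    and lin: "\<And>u. u \<in> U0 J \<eta> e \<Longrightarrow> linear (\<lambda>x. \<Psi> x u)"
    using \<open>L_H_L_Qneg_U0 J \<eta> e \<alpha> \<Psi>\<close> unfolding L_H_L_Qneg_U0_def by blast
  \<comment> \<open>The constant provided by the assumption on \<Psi> is not known to be
    nonnegative.\<close>
  define c where "c = max c0 0"
  have c_nonneg: "0 \<le> c" by (simp add: c_def)
  have c: "\<exists>A. bounded_op_Qneg_space J \<eta> e \<alpha> (c * norm x) A \<and> (\<forall>u\<in>U0 J \<eta> e. \<Psi> x u = A u)" for x
  proof -
    obtain A where A: "bounded_op_Qneg_space J \<eta> e \<alpha> (c0 * norm x) A" "\<forall>u\<in>U0 J \<eta> e. \<Psi> x u = A u"
      using c0 by blast
    have "c0 * norm x * y \<le> c * norm x * y" if "0 \<le> y" for y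
      using that by (intro mult_right_mono) (auto simp: c_def)
    then have "bounded_op_Qneg_space J \<eta> e \<alpha> (c * norm x) A"
      using A(1) unfolding bounded_op_Qneg_space_def by (meson norm_ge_zero order_trans)
    with A(2) show ?thesis by blast
  qed
  interpret prob_space M by fact
  interpret operators M J e \<eta> B F T Q W S \<Phi> \<Psi> \<alpha> c
    by unfold_locales
      (fact eta0 etaB B cJ eig S c_nonneg assms | rule c | rule linear_add[OF lin], assumption | rule linear_scale[OF lin], assumption)+
  \<comment> \<open>\<open>k1\<close> and \<open>k2\<close> are the roots of the two coefficients in
    \<open>approximation_error\<close>; the summand 2 makes \<open>k2\<close>, and with it the final
    constant, positive.\<close>
  define k1 where "k1 = sqrt (2 * (C\<^sup>2 * P2 + Q2 * (c\<^sup>2 * B)))"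
  define k2 where "k2 = sqrt (72 * Q2 * P2 + 2)"
  have nn: "0 \<le> C\<^sup>2 * P2 + Q2 * (c\<^sup>2 * B)" "0 < 72 * Q2 * P2 + 2"
    using p_total(2) q_total(2) B(1) by (auto intro!: add_nonneg_nonneg mult_nonneg_nonneg add_nonneg_pos)
  have k: "0 \<le> k1" "0 < k2" using nn by (auto simp: k1_def k2_def)
  have HS: "(\<Sum>j\<in>K. (\<eta> j powr - \<alpha> * q j)\<^sup>2) \<le> C\<^sup>2" if "finite K" "K \<subseteq> Jp" for K
    using \<open>HS_norm_sq J \<eta> e (\<Phi> \<circ> Qneg J \<eta> e \<alpha>) < ennreal (C\<^sup>2)\<close> that by (intro Phi_Qneg_HS) auto
  show ?thesis
  proof (intro exI[of _ "k1 + k2"] conjI allI impI)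
    show "0 < k1 + k2" using k by simp
    fix h t and D K :: nat and L
    assume h: "0 < h" and t: "t \<in> {0..T}" "t + h \<in> {0..T}" and D: "1 \<le> D" and "1 \<le> K"
      and L: "L \<subseteq> J" "finite L" "card L = K" "\<forall>j\<in>L. \<eta> j \<noteq> 0"
    interpret grid M J e \<eta> B F T Q W S \<Phi> \<Psi> \<alpha> c t h
      using h t by unfold_locales auto
    have LJp: "L \<subseteq> Jp" using L eta0 by (force simp: Jp_def)
    define s where "s = sup0 \<eta> (J - L) powr \<alpha>"
    have s: "\<eta> j powr \<alpha> \<le> s" if "j \<in> Jp" "j \<notin> L" for j
    proof -
      have "bdd_above (\<eta> ` (J - L))" using etaB by (auto intro!: bdd_aboveI[of _ B])
      then have "\<eta> j \<le> sup0 \<eta> (J - L)"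
        using that JpD(1)[OF that(1)] unfolding sup0_def by (auto intro: cSUP_upper)
      then show ?thesis unfolding s_def using JpD(2)[OF that(1)] \<open>0 < \<alpha>\<close> by (intro powr_mono2) auto
    qed
    have s0: "0 \<le> s" by (simp add: s_def)
    define err where "err = mean_square M (\<lambda>\<omega>.
           ito_integral M F J \<eta> e W t (t + h)
             (\<lambda>s \<omega>'. \<Psi> (ito_integral M F J \<eta> e W t s (\<lambda>_ _. \<Phi>) \<omega>')) \<omega>
           - (\<Sum>i\<in>L. \<Sum>j\<in>L. iter_int_approx W \<eta> e t h D i j \<omega> *\<^sub>R \<Psi> (\<Phi> (e i)) (e j)))"
    let ?r = "h / (pi * sqrt (real D))"
    have "err \<le> ennreal (2 * (C\<^sup>2 * P2 + Q2 * (c\<^sup>2 * B)) * (h * s)\<^sup>2 + (72 * Q2 * P2 + 2) * ?r\<^sup>2)"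
      unfolding err_def by (rule approximation_error[OF HS s0 s D L(2) LJp])
    also have "2 * (C\<^sup>2 * P2 + Q2 * (c\<^sup>2 * B)) * (h * s)\<^sup>2 + (72 * Q2 * P2 + 2) * ?r\<^sup>2 = (k1 * (h * s))\<^sup>2 + (k2 * ?r)\<^sup>2"
    proof -
      have "k1\<^sup>2 = 2 * (C\<^sup>2 * P2 + Q2 * (c\<^sup>2 * B))" "k2\<^sup>2 = 72 * Q2 * P2 + 2"
        using nn by (auto simp: k1_def k2_def)
      then show ?thesis by (simp only: power_mult_distrib)
    qed
    finally have err: "err \<le> ennreal ((k1 * (h * s))\<^sup>2 + (k2 * ?r)\<^sup>2)" .
    have "err < \<infinity>" using err by (metis ennreal_less_top infinity_ennreal_def order_le_less_trans)
    moreover have "sqrt (enn2real err) \<le> (k1 + k2) * h * s + (k1 + k2) * ?r"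
    proof -
      have x: "0 \<le> k1 * (h * s)" "0 \<le> k2 * ?r" using k h s0 by auto
      have "enn2real err \<le> (k1 * (h * s))\<^sup>2 + (k2 * ?r)\<^sup>2"
        using err by (intro enn2real_leI) auto
      \<comment> \<open>For nonnegative numbers the root of a sum of squares is at most the sum of
        the numbers.\<close>
      also have "\<dots> \<le> (k1 * (h * s) + k2 * ?r)\<^sup>2"
        using mult_nonneg_nonneg[OF x] by (simp add: power2_sum)
      finally have "sqrt (enn2real err) \<le> k1 * (h * s) + k2 * ?r"
        using x by (intro real_le_lsqrt) auto
      also have "\<dots> \<le> (k1 + k2) * (h * s) + (k1 + k2) * ?r"
        using k h s0 by (intro add_mono mult_right_mono) auto
      finally show ?thesis by (simp add: mult.assoc)
    qed
    ultimately show "let err = mean_square M (\<lambda>\<omega>.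
           ito_integral M F J \<eta> e W t (t + h)
             (\<lambda>s \<omega>'. \<Psi> (ito_integral M F J \<eta> e W t s (\<lambda>_ _. \<Phi>) \<omega>')) \<omega>
           - (\<Sum>i\<in>L. \<Sum>j\<in>L. iter_int_approx W \<eta> e t h D i j \<omega> *\<^sub>R \<Psi> (\<Phi> (e i)) (e j)))
     in err < \<infinity> \<and> sqrt (enn2real err) \<le> (k1 + k2) * h * sup0 \<eta> (J - L) powr \<alpha> + (k1 + k2) * (h / (pi * sqrt (real D)))"
      unfolding Let_def err_def s_def by blast
  qed
qed

end
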